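(* Let $\delta>0$ and $M<\infty$. (a) Let $d\ge2$ and $\nu>0$. The convergence in distribution of $\sqrt n\,(A_\nu(Q_n)-A_\nu(Q))$ to its normal limit $N(0,S_Q)$ on $\mathcal{S}_d$, as $n\to\infty$, is uniform over the set of all $Q\in\mathcal{U}_{d,\nu+d}$ such that $A_\nu(Q)\in\mathcal{W}_{\delta,d}$ and $$Q(\{y:|y|>M\})\le(1-\delta)/(\nu+d).$$ (b) Let $d\ge1$ and $1<\nu<\infty$. The convergence in distribution of $\sqrt n\,[(\mu_\nu,\Sigma_\nu)(P_n)-(\mu_\nu,\Sigma_\nu)(P)]$ to its mean-zero normal limit, as $n\to\infty$, is uniform over all $P\in\mathcal{V}_{d,\nu+d}$ such that $\Sigma_\nu(P)\in\mathcal{W}_{\delta,d}$ and $P(\{y:|y|>M\})\le(1-\delta)/(\nu+d)$.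
   Context: A law is a Borel probability measure. $\mathcal{S}_d$: symmetric real $d\times d$ matrices; $\mathcal{P}_d$: strictly positive definite ones; $\|\cdot\|$ operator norm; $\mathcal{W}_{\delta,d}=\{A\in\mathcal{P}_d:\max(\|A\|,\|A^{-1}\|)<1/\delta\}$. $Q_n$, $P_n$ are the empirical measures $\frac1n\sum_{j\le n}\delta_{X_j}$ of i.i.d. observations with law $Q$, $P$ respectively. $\mathcal{U}_{d,a}$ (resp. $\mathcal{V}_{d,a}$): laws $Q$ on $\mathbb{R}^d$ with $Q(H)<1-(d-q)/a$ for every linear (resp. affine) subspace $H$ of dimension $q$, $0\le q\le d-1$. With $\rho_{\nu,d}(s)=\frac{\nu+d}{2}\log\frac{\nu+s}{\nu}$: for $Q\in\mathcal{U}_{d,\nu+d}$, $A_\nu(Q)$ is the unique minimizer over $A\in\mathcal{P}_d$ of $\frac12\log\det A+\int(\rho_{\nu,d}(y'A^{-1}y)-\rho_{\nu,d}(y'y))\,dQ(y)$; for $\nu>1$, $P\in\mathcal{V}_{d,\nu+d}$, $(\mu_\nu,\Sigma_\nu)(P)$ is the unique minimizer over $\mathbb{R}^d\times\mathcal{P}_d$ of $\frac12\log\det\Sigma+\int\big(\rho_{\nu,d}((y-\mu)'\Sigma^{-1}(y-\mu))-\rho_{\nu,d}(y'y)\big)\,dP(y)$. For each fixed such $Q$ (resp. $P$), the empirical measure lies in $\mathcal{U}_{d,\nu+d}$ (resp. $\mathcal{V}_{d,\nu+d}$) with probability tending to $1$, and the stated sequence converges in distribution to a normal law with mean $0$ (depending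 on $Q$, resp. $P$). Uniform convergence over a class of laws means that the probability that the empirical measure lies in $\mathcal{U}_{d,\nu+d}$ (resp. $\mathcal{V}_{d,\nu+d}$) converges to $1$ uniformly over the class, and that, with arbitrary values assigned to the functionals where undefined, the distance between the law of the normalized difference and its normal limit tends to $0$ uniformly over the class, for the dual-bounded-Lipschitz metric $\beta(\lambda_1,\lambda_2)=\sup\{|\int f\,d(\lambda_1-\lambda_2)|:\|f\|_{\sup}+\mathrm{Lip}(f)\le1\}$. *)

theory Defs
  imports "HOL-Probability.Probability"
begin

section \<open>Matrices\<close>

definition sym_mats :: "(real^'d^'d) set" where
  "sym_mats = {A. transpose A = A}"

definition pd_mats :: "(real^'d^'d) set" where
  "pd_mats = {A \<in> sym_mats. \<forall>x. x \<noteq> 0 \<longrightarrow> x \<bullet> (A *v x) > 0}"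

definition W_set :: "real \<Rightarrow> (real^'d^'d) set" where
  "W_set \<delta> = {A \<in> pd_mats.
     max (onorm (\<lambda>x. A *v x)) (onorm (\<lambda>x. matrix_inv A *v x)) < 1 / \<delta>}"


section \<open>Classes of laws\<close>

definition laws :: "'a::topological_space measure set" where
  "laws = {Q. prob_space Q \<and> sets Q = sets borel}"

definition U_laws :: "real \<Rightarrow> (real^'d) measure set" where
  "U_laws a = {Q \<in> laws. \<forall>H. subspace H \<and> dim H < CARD('d) \<longrightarrow>
     measure Q H < 1 - (real CARD('d) - real (dim H)) / a}"

text \<open>The empty set is affine with \<open>aff_dim\<close> equal to \<open>-1\<close>; the lower bound on the dimension excludes it.\<close>

definition V_laws :: "real \<Rightarrow> (real^'d) measure set" where
  "V_laws a = {P \<in> laws. \<forall>H. affine H \<and> 0 \<le> aff_dim H \<and> aff_dim H < int CARD('d) \<longrightarrow>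
     measure P H < 1 - (real CARD('d) - real_of_int (aff_dim H)) / a}"


section \<open>The scatter and location-scatter functionals\<close>

definition rho :: "real \<Rightarrow> nat \<Rightarrow> real \<Rightarrow> real" where
  "rho \<nu> d s = (\<nu> + real d) / 2 * ln ((\<nu> + s) / \<nu>)"

definition scatter_obj :: "real \<Rightarrow> (real^'d) measure \<Rightarrow> real^'d^'d \<Rightarrow> real" where
  "scatter_obj \<nu> Q A = ln (det A) / 2 +
     (\<integral>y. (rho \<nu> CARD('d) (y \<bullet> (matrix_inv A *v y)) - rho \<nu> CARD('d) (y \<bullet> y)) \<partial>Q)"

definition A_fun :: "real \<Rightarrow> (real^'d) measure \<Rightarrow> real^'d^'d" where
  "A_fun \<nu> Q = (THE A. is_arg_min (scatter_obj \<nu> Q) (\<lambda>A. A \<in> pd_mats) A)"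

definition loc_scatter_obj :: "real \<Rightarrow> (real^'d) measure \<Rightarrow> (real^'d) \<times> (real^'d^'d) \<Rightarrow> real" where
  "loc_scatter_obj \<nu> P = (\<lambda>(\<mu>, \<Sigma>). ln (det \<Sigma>) / 2 +
     (\<integral>y. (rho \<nu> CARD('d) ((y - \<mu>) \<bullet> (matrix_inv \<Sigma> *v (y - \<mu>))) - rho \<nu> CARD('d) (y \<bullet> y)) \<partial>P))"

definition mu_Sigma_fun :: "real \<Rightarrow> (real^'d) measure \<Rightarrow> (real^'d) \<times> (real^'d^'d)" where
  "mu_Sigma_fun \<nu> P =
     (THE p. is_arg_min (loc_scatter_obj \<nu> P) (\<lambda>p. p \<in> UNIV \<times> pd_mats) p)"


section \<open>Samples and empirical measures\<close>

text \<open>I.i.d. observations with law \<open>Q\<close> are the coordinates on the infinite product space.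
  The observations entering the \<open>n\<close>-th empirical measure are those with index \<open>0, \<dots>, n - 1\<close>.\<close>

definition iid :: "'a measure \<Rightarrow> (nat \<Rightarrow> 'a) measure" where
  "iid Q = PiM UNIV (\<lambda>_. Q)"

definition empirical :: "nat \<Rightarrow> (nat \<Rightarrow> 'a::topological_space) \<Rightarrow> 'a measure" where
  "empirical n X = distr (uniform_count_measure {..<n}) borel X"

lemma sets_empirical [simp]: "sets (empirical n X) = sets borel"
  by (simp add: empirical_def)

lemma measure_empirical:
  assumes "n > 0" "B \<in> sets borel"
  shows "measure (empirical n X) B = (1 / real n) * (\<Sum>j<n. measure (return borel (X j)) B)"
proof -
  have meas: "X \<in> measurable (uniform_count_measure {..<n}) borel"
    by (auto simp: measurable_def sets_uniform_count_measure space_uniform_count_measure)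
  have "measure (empirical n X) B = real (card (X -` B \<inter> {..<n})) / real n"
    unfolding empirical_def using assms meas
    by (subst measure_distr) (auto simp: space_uniform_count_measure measure_uniform_count_measure)
  also have "real (card (X -` B \<inter> {..<n})) = (\<Sum>j<n. indicator B (X j))"
    by (simp add: indicator_def sum.If_cases Int_commute vimage_def)
  finally show ?thesis
    using assms by (simp add: measure_return)
qed


section \<open>Dual-bounded-Lipschitz metric and normal laws\<close>

definition sup_norm :: "('a \<Rightarrow> real) \<Rightarrow> ennreal" where
  "sup_norm f = (SUP x. ennreal \<bar>f x\<bar>)"

definition lip_seminorm :: "('a::metric_space \<Rightarrow> real) \<Rightarrow> ennreal" where
  "lip_seminorm f = (SUP (x, y) \<in> {(x, y). x \<noteq> y}. ennreal (\<bar>f x - f y\<bar> / dist x y))"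

definition beta_dist :: "'a::metric_space measure \<Rightarrow> 'a measure \<Rightarrow> real" where
  "beta_dist L1 L2 =
     (SUP f \<in> {f. sup_norm f + lip_seminorm f \<le> 1}. \<bar>(\<integral>x. f x \<partial>L1) - (\<integral>x. f x \<partial>L2)\<bar>)"

text \<open>A law is normal with mean zero if all its one-dimensional images under linear functionals are,
  where degenerate normal laws are allowed. A law on a linear subspace \<open>S\<close> is
  represented as a law on the ambient space that gives \<open>S\<close> probability one.\<close>

definition normal_law_0 :: "real \<Rightarrow> real measure" where
  "normal_law_0 \<sigma> =
     (if \<sigma> = 0 then return borel 0 else density lborel (\<lambda>x. ennreal (normal_density 0 \<sigma> x)))"

definition mean_zero_normal_on :: "'b::euclidean_space set \<Rightarrow> 'b measure \<Rightarrow> bool" where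
  "mean_zero_normal_on S N \<longleftrightarrow> N \<in> laws \<and> (AE x in N. x \<in> S) \<and>
     (\<forall>t. \<exists>\<sigma>\<ge>0. distr N borel (\<lambda>x. t \<bullet> x) = normal_law_0 \<sigma>)"


section \<open>Uniform convergence in distribution\<close>

text \<open>\<open>T\<close> is a functional with values in a linear subspace \<open>S\<close>, defined on the laws in \<open>D\<close>; \<open>g\<close>
  supplies arbitrary values outside \<open>D\<close>, subject only to the measurability needed for the
  normalized difference to have a law. That the extended functional is then measurable is part of
  the assertion. The limit \<open>N Q\<close> does not depend on \<open>g\<close>.

  Distances between laws on \<open>S\<close> are computed in the ambient Euclidean space; since a bounded Lipschitz
  function on \<open>S\<close> extends with the same supremum norm and Lipschitz constant, this is
  the metric on \<open>S\<close> itself.\<close>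

definition extend_by ::
  "'a measure set \<Rightarrow> ('a measure \<Rightarrow> 'b) \<Rightarrow> ('a measure \<Rightarrow> 'b) \<Rightarrow> 'a measure \<Rightarrow> 'b" where
  "extend_by D T g Q = (if Q \<in> D then T Q else g Q)"

definition uniform_convergence_to_normal ::
  "'b set \<Rightarrow> 'a::topological_space measure set \<Rightarrow> ('a measure \<Rightarrow> 'b::euclidean_space) \<Rightarrow>
   'a measure set \<Rightarrow> bool" where
  "uniform_convergence_to_normal S D T C \<longleftrightarrow>
     uniform_limit C
       (\<lambda>n Q. measure (iid Q) {X \<in> space (iid Q). empirical n X \<in> D}) (\<lambda>_. 1) sequentially \<and>
     (\<exists>N. (\<forall>Q\<in>C. mean_zero_normal_on S (N Q)) \<and>
        (\<forall>g. range g \<subseteq> S \<and> (\<forall>n. (\<lambda>X. g (empirical n X)) \<in> borel_measurable (iid borel)) \<longrightarrow>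
           (\<forall>n. (\<lambda>X. extend_by D T g (empirical n X)) \<in> borel_measurable (iid borel)) \<and>
           uniform_limit C
             (\<lambda>n Q. beta_dist
                (distr (iid Q) borel
                   (\<lambda>X. sqrt (real n) *\<^sub>R (extend_by D T g (empirical n X) - T Q)))
                (N Q))
             (\<lambda>_. 0) sequentially))"

end

theory Submission
  imports Defs
begin

text \<open>
  The scatter matrix of a law solves an equation that involves the law only through integrals of bounded
  continuous functions, and over the classes considered here the linearization of this equation has an inverse
  of bounded norm. Near every law of the class the functional is therefore linear in the law up to a quadratic
  error, with constants common to the whole class, and a central limit theorem for bounded random vectors with
  explicit rates transfers this to the functional.

  \<^bold>\<open>The equation.\<close> A matrix \<open>A\<close> minimizes the scatter objective of \<open>Q\<close> if
  \<open>A = (\<nu> + d) \<integral> y y' / (\<nu> + y' A\<^sup>-\<^sup>1 y) dQ(y)\<close> (\<open>solves_scatter\<close>), and then it is the only minimizer: after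
  diagonalizing \<open>A\<close> and a competitor simultaneously, the difference of their objectives is the integral of a
  gap in Jensen's inequality (\<open>solves_scatter_unique_minimizer\<close>). For laws of the class \<open>\<U>\<close> a solution
  exists as the limit of a decreasing fixed point iteration (\<open>U_laws_imp_solves_scatter\<close>). Conversely a law
  for which the equation is solvable belongs to \<open>\<U>\<close> (\<open>solves_scatter_imp_U_laws\<close>); so once a solution has been
  constructed for a perturbed law, the class membership of that law comes for free.

  \<^bold>\<open>The expansion.\<close> A linear change of coordinates reduces to \<open>A = I\<close>. With the score
  \<open>m(z) = z z' / (\<nu> + z' z)\<close> the linearized equation there is \<open>e - J e = \<Delta>\<close>, where \<open>J\<close> is the integral of
  \<open>(\<nu> + d) m \<otimes> m\<close>. The tail condition makes \<open>I - J\<close> coercive, with a constant that depends on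
  \<open>\<nu>\<close>, \<open>\<delta>\<close> and \<open>M\<close> only (\<open>derivative_coercive\<close>). If the integrals of the bounded functions \<open>m\<close> and
  \<open>m \<otimes> m\<close> under a law \<open>R\<close> are close to those under \<open>Q\<close>, Brouwer's fixed point theorem yields a solution for
  \<open>R\<close>, located up to a quadratic error (\<open>local_solution_at_identity\<close>). The outcome is the property
  \<open>local_expansion\<close>, established in \<open>scatter_local_expansion\<close>.

  \<^bold>\<open>The limit theorem.\<close> Uniform asymptotic normality holds for every functional with a common local expansion
  (\<open>uniform_convergence_to_normal_if_local_expansion\<close>). The mean square deviation of the empirical integral of a
  bounded function is of order \<open>1/n\<close>; this bounds both the probability that the expansion is not applicable and,
  after multiplication by \<open>\<surd>n\<close>, the quadratic remainder. The linear term is a normalized sum of bounded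
  centred vectors. Its characteristic function converges at an explicit rate, and because second moments are
  bounded, finitely many frequencies control all bounded Lipschitz functions
  (\<open>BL_integrals_close_if_char_close\<close>), so that the convergence is uniform (\<open>uniform_clt\<close>). The local expansion
  at the empirical measures themselves makes the functional continuous in the sample, hence measurable.

  \<^bold>\<open>Location.\<close> Adjoining a coordinate that is constantly \<open>1\<close> turns the location-scatter objective with
  parameter \<open>\<nu>\<close> into the scatter objective with parameter \<open>\<nu> - 1\<close> in dimension \<open>d + 1\<close>, restricted to matrices
  whose corner entry is \<open>1\<close>. A trace identity shows that the unrestricted minimizer satisfies this restriction
  (\<open>augmented_scatter_corner\<close>), so location and scatter are smooth functions of a scatter matrix
  (\<open>mu_Sigma_fun_eq\<close>) and part (b) follows by a delta method. The bound on the location that makes the constants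
  uniform comes from the tail condition (\<open>location_bound\<close>).
\<close>


section \<open>Symmetric and positive definite matrices\<close>

lemma matrix_inv_unique:
  fixes A B :: "real^'n^'n"
  assumes "A ** B = mat 1"
  shows "matrix_inv A = B"
proof -
  have "B ** A = mat 1" using assms by (simp add: matrix_left_right_inverse)
  then have "A ** matrix_inv A = mat 1 \<and> matrix_inv A ** A = mat 1"
    unfolding matrix_inv_def using assms by (metis (mono_tags, lifting) someI)
  then show ?thesis
    by (metis assms matrix_mul_assoc matrix_mul_lid matrix_mul_rid)
qed

lemma matrix_inv_cancel:
  fixes A :: "real^'n^'n"
  assumes "invertible A"
  shows "A ** matrix_inv A = mat 1" "matrix_inv A ** A = mat 1"
proof -
  obtain B where "A ** B = mat 1" "B ** A = mat 1" using assms by (auto simp: invertible_def)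
  then show "A ** matrix_inv A = mat 1" "matrix_inv A ** A = mat 1"
    using matrix_inv_unique by metis+
qed

lemma transpose_adjoint:
  fixes A :: "real^'n^'m"
  shows "x \<bullet> (A *v y) = (transpose A *v x) \<bullet> y"
  by (simp add: dot_lmul_matrix)

lemma pd_mats_symD: "A \<in> pd_mats \<Longrightarrow> transpose A = A"
  by (simp add: pd_mats_def sym_mats_def)

lemma sym_mats_bilinear_commute:
  assumes "A \<in> sym_mats"
  shows "x \<bullet> (A *v y) = y \<bullet> (A *v x)"
  using assms transpose_adjoint[of x A y] by (simp add: sym_mats_def inner_commute del: transpose_matrix_vector)

lemma pd_mats_posD: "A \<in> pd_mats \<Longrightarrow> x \<noteq> 0 \<Longrightarrow> 0 < x \<bullet> (A *v x)"
  by (simp add: pd_mats_def)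

lemma pd_mats_nonneg: "A \<in> pd_mats \<Longrightarrow> 0 \<le> x \<bullet> (A *v x)"
  by (cases "x = 0") (auto dest: pd_mats_posD less_imp_le)

lemma pd_mats_sym_mats: "A \<in> pd_mats \<Longrightarrow> A \<in> sym_mats"
  by (simp add: pd_mats_def)

lemma pd_mats_invertible:
  fixes A :: "real^'n^'n"
  assumes "A \<in> pd_mats"
  shows "invertible A"
proof -
  have "\<forall>x. A *v x = 0 \<longrightarrow> x = 0"
    using pd_mats_posD[OF assms] by (metis inner_zero_right less_irrefl)
  then show ?thesis
    by (simp add: invertible_left_inverse matrix_left_invertible_ker)
qed

lemma symmetric_eq_if_quadratic_eq:
  fixes A B :: "real^'n^'n"
  assumes "A \<in> sym_mats" "B \<in> sym_mats" "\<And>x. x \<bullet> (A *v x) = x \<bullet> (B *v x)"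
  shows "A = B"
proof -
  have "x \<bullet> (A *v y) = x \<bullet> (B *v y)" for x y
  proof -
    have "(x+y) \<bullet> (A *v (x+y)) = (x+y) \<bullet> (B *v (x+y))" by (rule assms)
    then show ?thesis
      using assms(3)[of x] assms(3)[of y] sym_mats_bilinear_commute[OF assms(1), of x y]
       sym_mats_bilinear_commute[OF assms(2), of x y]
      by (simp add: matrix_vector_right_distrib inner_add_left inner_add_right)
  qed
  then have "A *v y = B *v y" for y
    by (metis vector_eq_rdot inner_commute)
  then show ?thesis by (simp add: matrix_eq)
qed

text \<open>The quadratic form attains its infimum on the compact unit sphere.\<close>

lemma pd_mats_coercive:
  fixes A :: "real^'n^'n"
  assumes "A \<in> pd_mats"
  obtains c where "c > 0" "\<forall>x. c * (x \<bullet> x) \<le> x \<bullet> (A *v x)"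
proof -
  have "\<exists>x\<in>sphere (0::real^'n) 1. \<forall>y\<in>sphere 0 1. x \<bullet> (A *v x) \<le> y \<bullet> (A *v y)"
    by (intro continuous_attains_inf continuous_intros) (auto simp: sphere_eq_empty)
  then obtain x where x: "norm x = 1" "\<And>y. norm y = 1 \<Longrightarrow> x \<bullet> (A *v x) \<le> y \<bullet> (A *v y)" by auto
  show ?thesis
  proof
    have "x \<noteq> 0" using x(1) by auto
    then show "x \<bullet> (A *v x) > 0" by (rule pd_mats_posD[OF assms])
    show "\<forall>y. x \<bullet> (A *v x) * (y \<bullet> y) \<le> y \<bullet> (A *v y)"
    proof
    fix y :: "real^'n"
    show "x \<bullet> (A *v x) * (y \<bullet> y) \<le> y \<bullet> (A *v y)"
    proof (cases "y = 0")
      case False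
      have "x \<bullet> (A *v x) \<le> (y /\<^sub>R norm y) \<bullet> (A *v (y /\<^sub>R norm y))"
        by (rule x(2)) (use False in simp)
      also have "\<dots> = (y \<bullet> (A *v y)) / (norm y)^2"
        by (simp add: matrix_vector_mult_scaleR power2_eq_square field_simps)
      finally show ?thesis using False by (simp add: field_simps power2_norm_eq_inner)
    qed simp
    qed
  qed
qed

lemma forms_equivalent:
  fixes A :: "real^'n^'n"
  assumes A: "A \<in> pd_mats"
  obtains c where "c \<ge> 1" "\<forall>x. x \<bullet> (A *v x) \<le> c * (x \<bullet> x) \<and> x \<bullet> x \<le> c * (x \<bullet> (A *v x))"
proof -
  obtain a where a: "a > 0" "\<forall>x. a * (x \<bullet> x) \<le> x \<bullet> (A *v x)" by (rule pd_mats_coercive[OF A])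
  define c where "c = max 1 (max (1/a) (onorm ((*v) A)))"
  have "x \<bullet> (A *v x) \<le> c * (x \<bullet> x)" for x
  proof -
    have "x \<bullet> (A *v x) \<le> norm x * norm (A *v x)" by (rule norm_cauchy_schwarz)
    also have "\<dots> \<le> norm x * (onorm ((*v) A) * norm x)"
      by (intro mult_left_mono onorm matrix_vector_mul_bounded_linear) auto
    also have "\<dots> \<le> norm x * (c * norm x)" by (intro mult_left_mono mult_right_mono) (auto simp: c_def)
    finally show ?thesis by (simp add: power2_norm_eq_inner[symmetric] power2_eq_square mult_ac)
  qed
  moreover have "x \<bullet> x \<le> c * (x \<bullet> (A *v x))" for x
  proof -
    have "x \<bullet> x \<le> (1/a) * (x \<bullet> (A *v x))" using a by (simp add: field_simps)
    also have "\<dots> \<le> c * (x \<bullet> (A *v x))" using pd_mats_nonneg[OF A, of x] by (intro mult_right_mono) (auto simp: c_def)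
    finally show ?thesis .
  qed
  ultimately show ?thesis by (intro that[of c]) (auto simp: c_def)
qed

lemma form_bound_entries:
  fixes A :: "real^'n^'n"
  assumes "\<forall>x. x \<bullet> (A *v x) \<le> \<kappa> * (x \<bullet> x)"
  shows "A $ i $ i \<le> \<kappa>"
  using spec[OF assms, of "axis i 1"]
  by (simp add: inner_axis' matrix_vector_mul_component inner_axis)

lemma sym_mats_subspace: "subspace (sym_mats :: (real^'n^'n) set)"
  by (auto simp: subspace_def sym_mats_def transpose_def vec_eq_iff)

lemma matrix_inv_mat_1 [simp]: "matrix_inv (mat 1) = (mat 1 :: real^'n^'n)"
  by (rule matrix_inv_unique) simp

lemma scaled_mat_pd:
  assumes "t > 0"
  shows "t *\<^sub>R (mat 1 :: real^'n^'n) \<in> pd_mats" "matrix_inv (t *\<^sub>R (mat 1 :: real^'n^'n)) = (1/t) *\<^sub>R mat 1"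
proof -
  have "transpose (t *\<^sub>R (mat 1 :: real^'n^'n)) = t *\<^sub>R mat 1"
    by (simp add: transpose_def vec_eq_iff mat_def)
  moreover have "x \<bullet> ((t *\<^sub>R (mat 1 :: real^'n^'n)) *v x) = t * (x \<bullet> x)" for x
    by (simp flip: scaleR_matrix_vector_assoc)
  ultimately show "t *\<^sub>R (mat 1 :: real^'n^'n) \<in> pd_mats"
    using assms by (auto simp: pd_mats_def sym_mats_def)
  show "matrix_inv (t *\<^sub>R (mat 1 :: real^'n^'n)) = (1/t) *\<^sub>R mat 1"
    using assms by (intro matrix_inv_unique) (simp add: matrix_scalar_ac scalar_matrix_assoc)
qed

lemma mat_1_pd: "(mat 1 :: real^'n^'n) \<in> pd_mats"
  using scaled_mat_pd(1)[of 1] by simp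

lemma matrix_mult_add_right: "(A + B) ** C = A ** C + B ** (C :: real^'p^'n)" for A B :: "real^'n^'m"
  by (simp add: matrix_matrix_mult_def vec_eq_iff distrib_right sum.distrib)


section \<open>Simultaneous diagonalization\<close>

text \<open>First order condition at a minimum: a quadratic in \<open>t\<close> that is nonnegative everywhere and vanishes at \<open>0\<close>
  has no linear term.\<close>

lemma quadratic_nonneg_linear_zero:
  fixes p q :: real
  assumes "\<And>t. 0 \<le> 2 * t * p + t^2 * q"
  shows "p = 0"
proof (rule ccontr)
  assume p: "p \<noteq> 0"
  \<comment> \<open>Inserting \<open>t = - p / r\<close> makes the linear term dominate, whatever the sign of \<open>q\<close>.\<close>
  define r where "r = \<bar>q\<bar> + 1"
  have r: "r > 0" "q \<le> r" by (auto simp: r_def)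
  have "0 \<le> 2 * (-p/r) * p + (-p/r)^2 * q" by (rule assms)
  also have "\<dots> \<le> 2 * (-p/r) * p + (-p/r)^2 * r"
    using r by (intro add_left_mono mult_left_mono) auto
  also have "\<dots> = - (p^2 / r)"
    using r by (simp add: field_simps power2_eq_square)
  finally show False using p r by (simp add: field_simps)
qed

text \<open>Vectors are produced one at a time: on the \<open>A\<close>-orthogonal complement of the previous ones, the form of \<open>B\<close> is
  maximized over the compact \<open>A\<close>-unit ellipsoid, and the first order condition at a maximizer says that it is an
  eigenvector of \<open>B\<close> relative to \<open>A\<close>.\<close>

lemma relative_eigenvectors:
  fixes A B :: "real^'n^'n" and I :: "'n set"
  assumes A: "A \<in> pd_mats" and B: "B \<in> sym_mats"
  shows "\<exists>w c. (\<forall>i\<in>I. \<forall>j\<in>I. w i \<bullet> (A *v w j) = (if i = j then 1 else 0)) \<and>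
               (\<forall>i\<in>I. B *v w i = c i *\<^sub>R (A *v w i))"
proof -
  have "finite I" by simp
  then show ?thesis
  proof (induction I rule: finite_induct)
    case empty
    then show ?case by auto
  next
    case (insert k I)
    then obtain w c where w: "\<And>i j. i\<in>I \<Longrightarrow> j\<in>I \<Longrightarrow> w i \<bullet> (A *v w j) = (if i = j then 1 else 0)"
       and c: "\<And>i. i\<in>I \<Longrightarrow> B *v w i = c i *\<^sub>R (A *v w i)" by blast
    define V where "V = {x. \<forall>i\<in>I. x \<bullet> (A *v w i) = 0}"
    have card: "card I < CARD('n)"
      using insert.hyps by (metis card_seteq finite_class.finite_UNIV subset_UNIV UNIV_I not_le)
    have "dim ((\<lambda>i. A *v w i) ` I) \<le> card ((\<lambda>i. A *v w i) ` I)"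
      by (intro dim_le_card') simp
    also have "\<dots> \<le> card I" by (intro card_image_le) simp
    finally have "dim ((\<lambda>i. A *v w i) ` I) < DIM(real^'n)" using card by simp
    then obtain x1 where x1: "x1 \<noteq> 0" "\<And>y. y \<in> span ((\<lambda>i. A *v w i) ` I) \<Longrightarrow> orthogonal x1 y"
      using orthogonal_to_subspace_exists by blast
    have x1V: "x1 \<in> V" using x1(2) by (auto simp: V_def orthogonal_def span_base)
    have V_sub: "subspace V"
      by (auto simp: V_def subspace_def inner_add_left)
    have V_closed: "closed V" using V_sub by (rule closed_subspace)
    obtain a where a: "a > 0" "\<forall>x. a * (x \<bullet> x) \<le> x \<bullet> (A *v x)" by (rule pd_mats_coercive[OF A])
    define K where "K = V \<inter> {x. x \<bullet> (A *v x) = 1}"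
    have "bounded K"
      unfolding bounded_iff
    proof (intro exI ballI)
      fix x assume "x \<in> K"
      then have "x \<bullet> (A *v x) = 1" by (simp add: K_def)
      moreover have "a * (x \<bullet> x) \<le> x \<bullet> (A *v x)" using a(2) by (rule spec)
      ultimately have "(norm x)^2 \<le> 1 / a" using a(1) by (simp add: power2_norm_eq_inner field_simps)
      then show "norm x \<le> sqrt (1/a)" by (rule real_le_rsqrt)
    qed
    moreover have "closed {x. x \<bullet> (A *v x) = 1}"
      by (intro closed_Collect_eq continuous_intros)
    ultimately have "compact K" using V_closed by (auto simp: K_def compact_eq_bounded_closed)
    moreover have "K \<noteq> {}"
    proof -
      have p: "x1 \<bullet> (A *v x1) > 0" using pd_mats_posD[OF A x1(1)] .
      have "x1 /\<^sub>R sqrt (x1 \<bullet> (A *v x1)) \<in> K"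
        using p x1V V_sub by (auto simp: K_def subspace_scale matrix_vector_mult_scaleR simp flip: power2_eq_square)
           (simp add: field_simps flip: power2_eq_square)
      then show ?thesis by auto
    qed
    ultimately have "\<exists>x\<in>K. \<forall>y\<in>K. y \<bullet> (B *v y) \<le> x \<bullet> (B *v x)"
      by (intro continuous_attains_sup continuous_intros)
    then obtain x where xK: "x \<in> K" and xmax: "\<And>y. y \<in> K \<Longrightarrow> y \<bullet> (B *v y) \<le> x \<bullet> (B *v x)" by blast
    define l where "l = x \<bullet> (B *v x)"
    have xV: "x \<in> V" and xA: "x \<bullet> (A *v x) = 1" using xK by (auto simp: K_def)
    have le: "y \<bullet> (B *v y) \<le> l * (y \<bullet> (A *v y))" if "y \<in> V" for y
    proof (cases "y = 0")
      case False
      let ?s = "y \<bullet> (A *v y)"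
      have p: "?s > 0" using pd_mats_posD[OF A False] .
      have "y /\<^sub>R sqrt ?s \<in> K"
        using p that V_sub by (auto simp: K_def subspace_scale matrix_vector_mult_scaleR simp flip: power2_eq_square)
           (simp add: field_simps flip: power2_eq_square)
      from xmax[OF this] have "(y \<bullet> (B *v y)) / ?s \<le> l"
        using p by (simp add: l_def matrix_vector_mult_scaleR field_simps)
      then show ?thesis using p by (simp add: field_simps)
    qed simp
    \<comment> \<open>First order condition at the maximizer \<open>x\<close>, for directions inside \<open>V\<close>.\<close>
    have orth: "v \<bullet> (l *\<^sub>R (A *v x) - B *v x) = 0" if "v \<in> V" for v
    proof (rule quadratic_nonneg_linear_zero)
      fix t :: real
      let ?y = "x + t *\<^sub>R v"
      have "?y \<in> V" using xV that V_sub by (simp add: subspace_add subspace_scale)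
      from le[OF this] have "0 \<le> l * (?y \<bullet> (A *v ?y)) - ?y \<bullet> (B *v ?y)" by simp
      also have "\<dots> = 2 * t * (v \<bullet> (l *\<^sub>R (A *v x) - B *v x)) + t^2 * (l * (v \<bullet> (A *v v)) - v \<bullet> (B *v v))
            + (l * (x \<bullet> (A *v x)) - x \<bullet> (B *v x))"
        using sym_mats_bilinear_commute[OF pd_mats_sym_mats[OF A], of x v]
          sym_mats_bilinear_commute[OF B, of x v]
        by (simp add: matrix_vector_right_distrib matrix_vector_mult_scaleR inner_add_left inner_add_right
            inner_diff_right algebra_simps power2_eq_square)
      finally show "0 \<le> 2 * t * (v \<bullet> (l *\<^sub>R (A *v x) - B *v x)) + t^2 * (l * (v \<bullet> (A *v v)) - v \<bullet> (B *v v))"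
        using xA by (simp add: l_def)
    qed
    have orthW: "w i \<bullet> (l *\<^sub>R (A *v x) - B *v x) = 0" if i: "i \<in> I" for i
    proof -
      have "w i \<bullet> (A *v x) = 0" using xV i sym_mats_bilinear_commute[OF pd_mats_sym_mats[OF A], of x "w i"]
        by (auto simp: V_def)
      moreover have "w i \<bullet> (B *v x) = c i * (x \<bullet> (A *v w i))"
        using sym_mats_bilinear_commute[OF B, of x "w i"] c[OF i] by simp
      ultimately show ?thesis using xV i by (auto simp: V_def inner_diff_right)
    qed
    have eig: "B *v x = l *\<^sub>R (A *v x)"
    proof -
      define r where "r = l *\<^sub>R (A *v x) - B *v x"
      \<comment> \<open>The residual \<open>r\<close> is orthogonal to \<open>V\<close> and to the earlier vectors, hence to itself.\<close>
      define v where "v = r - (\<Sum>i\<in>I. (r \<bullet> (A *v w i)) *\<^sub>R w i)"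
      have "v \<in> V"
      proof -
        have "v \<bullet> (A *v w i) = 0" if i: "i \<in> I" for i
        proof -
          have "(\<Sum>j\<in>I. (r \<bullet> (A *v w j)) *\<^sub>R w j) \<bullet> (A *v w i) = (\<Sum>j\<in>I. if j = i then r \<bullet> (A *v w j) else 0)"
            unfolding inner_sum_left by (intro sum.cong) (auto simp: w i)
          also have "\<dots> = r \<bullet> (A *v w i)" using i by (simp add: sum.delta')
          finally show ?thesis by (simp add: v_def inner_diff_left)
        qed
        then show ?thesis by (simp add: V_def)
      qed
      then have "v \<bullet> r = 0" using orth r_def by blast
      moreover have "(\<Sum>i\<in>I. (r \<bullet> (A *v w i)) *\<^sub>R w i) \<bullet> r = 0"
        unfolding inner_sum_left using orthW by (intro sum.neutral) (auto simp: r_def)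
      ultimately have "r \<bullet> r = 0" by (simp add: v_def inner_diff_left)
      then show ?thesis by (simp add: r_def)
    qed
    have xw: "x \<bullet> (A *v w i) = 0" "w i \<bullet> (A *v x) = 0" if "i \<in> I" for i
      using xV that sym_mats_bilinear_commute[OF pd_mats_sym_mats[OF A], of x "w i"] by (auto simp: V_def)
    have "(w(k:=x)) i \<bullet> (A *v (w(k:=x)) j) = (if i = j then 1 else 0)"
      if "i \<in> insert k I" "j \<in> insert k I" for i j
      using that insert.hyps(2) by (cases "i = k"; cases "j = k") (simp_all add: xA xw w)
    moreover have "B *v (w(k:=x)) i = (c(k:=l)) i *\<^sub>R (A *v (w(k:=x)) i)" if "i \<in> insert k I" for i
      using that insert.hyps(2) by (cases "i = k") (simp_all add: eig c)
    ultimately have "(\<forall>i\<in>insert k I. \<forall>j\<in>insert k I. (w(k:=x)) i \<bullet> (A *v (w(k:=x)) j) = (if i = j then 1 else 0)) \<and>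
               (\<forall>i\<in>insert k I. B *v (w(k:=x)) i = (c(k:=l)) i *\<^sub>R (A *v (w(k:=x)) i))"
      by blast
    then show ?case by blast
  qed
qed

definition diag_mat :: "('n \<Rightarrow> real) \<Rightarrow> real^'n^'n" where
  "diag_mat c = (\<chi> i j. if i = j then c i else 0)"

lemma diag_mat_mult: "diag_mat c *v x = (\<chi> i. c i * x $ i)"
  by (simp add: diag_mat_def matrix_vector_mult_def vec_eq_iff if_distrib if_distribR cong: if_cong)

lemma transpose_diag_mat [simp]: "transpose (diag_mat c) = diag_mat c"
  by (simp add: diag_mat_def transpose_def vec_eq_iff)

lemma matrix_inv_diag_mat:
  assumes "\<And>i. c i \<noteq> 0"
  shows "matrix_inv (diag_mat c) = diag_mat (\<lambda>i. 1 / c i)"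
  by (rule matrix_inv_unique)
     (auto simp: matrix_eq matrix_vector_mul_assoc[symmetric] diag_mat_mult vec_eq_iff assms)

lemma det_diag_mat: "det (diag_mat c :: real^'n^'n) = (\<Prod>i\<in>UNIV. c i)"
  by (subst det_diagonal) (auto simp: diag_mat_def)

lemma diag_mat_pd_entries:
  assumes "diag_mat c \<in> pd_mats"
  shows "c i > 0"
proof -
  have "axis i 1 \<bullet> (diag_mat c *v axis i 1) > 0"
    using assms by (rule pd_mats_posD) (simp add: axis_eq_0_iff)
  then show ?thesis by (simp add: diag_mat_mult inner_axis' )
qed

lemma quadratic_diag_mat: "x \<bullet> (diag_mat c *v x) = (\<Sum>i\<in>UNIV. c i * (x $ i)\<^sup>2)"
  by (simp add: diag_mat_mult inner_vec_def power2_eq_square mult_ac)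

lemma diag_mat_pd:
  assumes "\<And>i. c i > 0"
  shows "diag_mat c \<in> pd_mats"
proof -
  have "0 < (\<Sum>i\<in>UNIV. c i * (x $ i)\<^sup>2)" if x: "x \<noteq> 0" for x
  proof -
    obtain i where "x $ i \<noteq> 0" using x by (auto simp: vec_eq_iff)
    then show ?thesis
      by (intro sum_pos2[of _ i]) (auto simp: assms less_imp_le)
  qed
  then show ?thesis by (simp add: pd_mats_def sym_mats_def quadratic_diag_mat)
qed

lemma congruence_row_entry:
  fixes A :: "real^'n^'n"
  shows "((\<chi> i. w i) ** A ** transpose (\<chi> i. w i)) $ i $ j = w i \<bullet> (A *v w j)"
  unfolding matrix_matrix_mult_def matrix_vector_mult_def transpose_def inner_vec_def
  by (simp add: sum_distrib_left sum_distrib_right mult.assoc) (rule sum.swap)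

text \<open>The relative eigenvectors are the rows of the transformation.\<close>

proposition simultaneous_diagonalization:
  fixes A B :: "real^'n^'n"
  assumes A: "A \<in> pd_mats" and B: "B \<in> sym_mats"
  obtains W :: "real^'n^'n" and c where "invertible W" "W ** A ** transpose W = mat 1" "W ** B ** transpose W = diag_mat c"
proof -
  obtain w :: "'n \<Rightarrow> real^'n" and c where w: "\<And>i j. w i \<bullet> (A *v w j) = (if i = j then 1 else 0)"
    and c: "\<And>i. B *v w i = c i *\<^sub>R (A *v w i)"
    using relative_eigenvectors[OF A B, of UNIV] by blast
  define W where "W = (\<chi> i. w i)"
  have 1: "W ** A ** transpose W = mat 1"
    unfolding W_def by (simp add: vec_eq_iff congruence_row_entry w mat_def)
  have 2: "W ** B ** transpose W = diag_mat c"
    unfolding W_def by (auto simp add: vec_eq_iff congruence_row_entry w c diag_mat_def)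
  have "invertible W" using 1 by (metis invertible_right_inverse matrix_mul_assoc)
  then show ?thesis using 1 2 by (rule that)
qed


section \<open>Congruence and the inverse quadratic form\<close>

lemma congruence_quadratic:
  fixes A W :: "real^'n^'n"
  shows "x \<bullet> ((W ** A ** transpose W) *v y) = (transpose W *v x) \<bullet> (A *v (transpose W *v y))"
  by (metis matrix_vector_mul_assoc transpose_adjoint)

lemma congruence_sym_mats: "A \<in> sym_mats \<Longrightarrow> W ** A ** transpose W \<in> sym_mats"
  by (simp add: sym_mats_def matrix_transpose_mul matrix_mul_assoc)

lemma invertible_transpose_cancel:
  fixes W :: "real^'n^'n"
  assumes "invertible W"
  shows "transpose W ** transpose (matrix_inv W) = mat 1" "transpose (matrix_inv W) ** transpose W = mat 1"
  using matrix_inv_cancel[OF assms] by (metis matrix_transpose_mul transpose_mat)+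

lemma congruence_pd_mats:
  fixes A W :: "real^'n^'n"
  assumes "A \<in> pd_mats" "invertible W"
  shows "W ** A ** transpose W \<in> pd_mats"
proof -
  have "transpose W *v x \<noteq> 0" if "x \<noteq> 0" for x
    using invertible_transpose_cancel(2)[OF assms(2)] that
    by (metis matrix_vector_mul_assoc matrix_vector_mul_lid matrix_vector_mult_0_right)
  then show ?thesis
    using assms congruence_sym_mats[of A W]
    by (auto simp: pd_mats_def congruence_quadratic simp del: transpose_matrix_vector)
qed

text \<open>Under \<open>y \<mapsto> W y\<close> a scatter matrix \<open>A\<close> becomes \<open>W A W'\<close>, and \<open>y' A\<^sup>-\<^sup>1 y\<close> is invariant.\<close>

lemma matrix_inv_congruence:
  fixes A W :: "real^'n^'n"
  assumes "invertible A" "invertible W"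
  shows "matrix_inv A = transpose W ** matrix_inv (W ** A ** transpose W) ** W"
proof (rule matrix_inv_unique)
  let ?C = "W ** A ** transpose W"
  have C: "invertible ?C" using assms by (intro invertible_mult transpose_invertible)
  have "A ** (transpose W ** matrix_inv ?C ** W) = matrix_inv W ** (?C ** matrix_inv ?C) ** W"
    using matrix_inv_cancel[OF assms(2)] by (simp add: matrix_mul_assoc)
  then show "A ** (transpose W ** matrix_inv ?C ** W) = mat 1"
    using matrix_inv_cancel[OF assms(2)] matrix_inv_cancel[OF C] by simp
qed

lemma inverse_form_congruence:
  fixes A W :: "real^'n^'n"
  assumes "invertible A" "invertible W"
  shows "y \<bullet> (matrix_inv A *v y) = (W *v y) \<bullet> (matrix_inv (W ** A ** transpose W) *v (W *v y))"
  unfolding matrix_inv_congruence[OF assms]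
  by (metis matrix_vector_mul_assoc transpose_adjoint transpose_transpose)

lemma congruence_inverse:
  fixes A W :: "real^'n^'n"
  assumes "invertible W"
  shows "matrix_inv W ** (W ** A ** transpose W) ** transpose (matrix_inv W) = A"
proof -
  have "matrix_inv W ** (W ** A ** transpose W) ** transpose (matrix_inv W)
     = (matrix_inv W ** W) ** A ** (transpose W ** transpose (matrix_inv W))"
    by (simp add: matrix_mul_assoc)
  then show ?thesis using matrix_inv_cancel[OF assms] invertible_transpose_cancel[OF assms] by simp
qed

lemma invertible_matrix_inv:
  fixes W :: "real^'n^'n"
  assumes "invertible W"
  shows "invertible (matrix_inv W)"
  using matrix_inv_cancel[OF assms] invertible_def by blast

lemma matrix_inv_pd_mats:
  fixes A :: "real^'n^'n"
  assumes "A \<in> pd_mats"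
  shows "matrix_inv A \<in> pd_mats"
proof -
  have i: "invertible A" using pd_mats_invertible[OF assms] .
  have "matrix_inv A ** A ** transpose (matrix_inv A) = transpose (matrix_inv A)"
    using matrix_inv_cancel[OF i] by simp
  then have "transpose (matrix_inv A) \<in> pd_mats"
    using congruence_pd_mats[OF assms invertible_matrix_inv[OF i]] by simp
  then show ?thesis using pd_mats_symD by fastforce
qed

text \<open>The inverse form is the convex conjugate of the form: \<open>y' A\<^sup>-\<^sup>1 y\<close> is the supremum over \<open>v\<close> of
  \<open>2 v' y - v' A v\<close>. This turns inequalities between forms into inequalities between their inverses without
  manipulating inverse matrices.\<close>

lemma inverse_form_ge:
  fixes A :: "real^'n^'n"
  assumes A: "A \<in> pd_mats"
  shows "2 * (v \<bullet> y) - v \<bullet> (A *v v) \<le> y \<bullet> (matrix_inv A *v y)"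
proof -
  let ?u = "matrix_inv A *v y"
  have Au: "A *v ?u = y"
    using matrix_inv_cancel[OF pd_mats_invertible[OF A]] by (simp add: matrix_vector_mul_assoc)
  have "0 \<le> (v - ?u) \<bullet> (A *v (v - ?u))" by (rule pd_mats_nonneg[OF A])
  also have "\<dots> = v \<bullet> (A *v v) - 2 * (v \<bullet> y) + y \<bullet> ?u"
    using sym_mats_bilinear_commute[OF pd_mats_sym_mats[OF A], of v ?u]
    by (simp add: matrix_vector_mult_diff_distrib inner_diff_left inner_diff_right Au inner_commute)
  finally show ?thesis by simp
qed

text \<open>The supremum in this conjugacy is attained at \<open>v = A\<^sup>-\<^sup>1 y\<close>.\<close>

lemma inverse_form_attained:
  fixes A :: "real^'n^'n"
  assumes A: "A \<in> pd_mats"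
  shows "2 * ((matrix_inv A *v y) \<bullet> y) - (matrix_inv A *v y) \<bullet> (A *v (matrix_inv A *v y)) = y \<bullet> (matrix_inv A *v y)"
  using matrix_inv_cancel[OF pd_mats_invertible[OF A]] by (simp add: matrix_vector_mul_assoc inner_commute)

lemma inverse_form_antimono:
  fixes A B :: "real^'n^'n"
  assumes "A \<in> pd_mats" "B \<in> pd_mats" "\<And>x. x \<bullet> (A *v x) \<le> x \<bullet> (B *v x)"
  shows "y \<bullet> (matrix_inv B *v y) \<le> y \<bullet> (matrix_inv A *v y)"
  using inverse_form_attained[OF assms(2), of y] inverse_form_ge[OF assms(1), of "matrix_inv B *v y" y]
    assms(3)[of "matrix_inv B *v y"] by linarith

lemma inverse_form_le:
  fixes A :: "real^'n^'n"
  assumes A: "A \<in> pd_mats" and lo: "\<forall>x. x \<bullet> x \<le> \<kappa> * (x \<bullet> (A *v x))" and \<kappa>: "\<kappa> \<ge> 0"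
  shows "y \<bullet> (matrix_inv A *v y) \<le> \<kappa> * (y \<bullet> y)"
proof -
  define u where "u = matrix_inv A *v y"
  have Au: "A *v u = y"
    unfolding u_def using matrix_inv_cancel[OF pd_mats_invertible[OF A]] by (simp add: matrix_vector_mul_assoc)
  have yu: "y \<bullet> u \<le> norm y * norm u" by (rule norm_cauchy_schwarz)
  have "(norm u)\<^sup>2 \<le> \<kappa> * (u \<bullet> y)" using spec[OF lo, of u] by (simp add: Au power2_norm_eq_inner)
  also have "\<dots> \<le> \<kappa> * (norm y * norm u)" using yu \<kappa> by (intro mult_left_mono) (simp_all add: inner_commute)
  finally have "norm u * norm u \<le> (\<kappa> * norm y) * norm u" by (simp add: power2_eq_square mult_ac)
  then have "norm u \<le> \<kappa> * norm y"
    using \<kappa> by (cases "norm u = 0") (auto intro: mult_nonneg_nonneg)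
  then have "norm y * norm u \<le> norm y * (\<kappa> * norm y)" by (intro mult_left_mono) auto
  with yu have "y \<bullet> u \<le> norm y * (\<kappa> * norm y)" by linarith
  then show ?thesis by (simp add: u_def power2_norm_eq_inner[symmetric] power2_eq_square mult_ac)
qed

text \<open>Take \<open>v = y / \<kappa>\<close> in the conjugacy.\<close>

lemma inverse_form_lower:
  fixes A :: "real^'n^'n"
  assumes A: "A \<in> pd_mats" and hi: "\<forall>x. x \<bullet> (A *v x) \<le> \<kappa> * (x \<bullet> x)" and \<kappa>: "\<kappa> > 0"
  shows "y \<bullet> y \<le> \<kappa> * (y \<bullet> (matrix_inv A *v y))"
proof -
  let ?v = "(1 / \<kappa>) *\<^sub>R y"
  have "2 * (?v \<bullet> y) - ?v \<bullet> (A *v ?v) \<le> y \<bullet> (matrix_inv A *v y)" by (rule inverse_form_ge[OF A])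
  moreover have "?v \<bullet> (A *v ?v) \<le> \<kappa> * (?v \<bullet> ?v)" using hi by (rule spec)
  moreover have "\<kappa> * (?v \<bullet> ?v) = (y \<bullet> y) / \<kappa>" "?v \<bullet> y = (y \<bullet> y) / \<kappa>"
    using \<kappa> by (simp_all add: divide_simps)
  ultimately have "(y \<bullet> y) / \<kappa> \<le> y \<bullet> (matrix_inv A *v y)" by linarith
  then show ?thesis using \<kappa> by (simp add: divide_le_eq mult.commute)
qed


section \<open>Laws\<close>

lemma laws_prob_space: "Q \<in> laws \<Longrightarrow> prob_space Q" by (simp add: laws_def)

lemma laws_sets: "Q \<in> laws \<Longrightarrow> sets Q = sets borel" by (simp add: laws_def)

lemma laws_space: "Q \<in> laws \<Longrightarrow> space Q = UNIV"
  using sets_eq_imp_space_eq[OF laws_sets] by force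

lemma laws_measurable: "Q \<in> laws \<Longrightarrow> measurable Q N = measurable borel N"
  by (simp add: laws_sets cong: measurable_cong_sets)

lemma laws_integrable_bounded:
  fixes f :: "'a::topological_space \<Rightarrow> 'b::{banach,second_countable_topology}"
  assumes "Q \<in> laws" "f \<in> borel_measurable borel" "\<And>x. norm (f x) \<le> K"
  shows "integrable Q f"
proof -
  interpret prob_space Q using assms(1) by (rule laws_prob_space)
  show ?thesis
    by (rule integrable_const_bound[of _ K]) (use assms in \<open>auto simp: laws_measurable\<close>)
qed

lemma laws_distr:
  assumes "Q \<in> laws" "f \<in> measurable borel borel"
  shows "distr Q borel f \<in> laws"
  using assms prob_space.prob_space_distr[of Q f borel]
  by (simp add: laws_def cong: measurable_cong_sets)

lemma law_integral_bounded:
  fixes f :: "'a::topological_space \<Rightarrow> real"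
  assumes "N \<in> laws" "f \<in> borel_measurable borel" "\<And>x. \<bar>f x\<bar> \<le> K"
  shows "\<bar>\<integral>x. f x \<partial>N\<bar> \<le> K"
proof -
  interpret prob_space N using assms(1) by (rule laws_prob_space)
  have "\<bar>\<integral>x. f x \<partial>N\<bar> \<le> (\<integral>x. \<bar>f x\<bar> \<partial>N)" by (rule integral_abs_bound)
  also have "\<dots> \<le> (\<integral>x. K \<partial>N)"
    using assms by (intro integral_mono integrable_abs laws_integrable_bounded[OF assms(1,2), of K]) auto
  also have "\<dots> = K" by (simp add: prob_space)
  finally show ?thesis .
qed

lemma law_mean_le:
  fixes f :: "'a::topological_space \<Rightarrow> real"
  assumes "N \<in> laws" "f \<in> borel_measurable borel" "\<And>x. 0 \<le> f x" "\<And>x. f x \<le> K"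
  shows "(\<integral>x. f x \<partial>N) \<le> K"
proof -
  have "\<bar>f x\<bar> \<le> K" for x using assms(3,4)[of x] by simp
  from law_integral_bounded[OF assms(1,2) this] show ?thesis by linarith
qed

text \<open>A subspace is the orthogonal complement of its orthogonal complement, and orthogonality to a fixed vector
  passes to the integral; without integrability the integral is \<open>0\<close> by convention.\<close>

lemma integral_in_subspace:
  fixes f :: "'a \<Rightarrow> 'b::euclidean_space"
  assumes S: "subspace S" and f: "\<And>x. f x \<in> S"
  shows "(\<integral>x. f x \<partial>M) \<in> S"
proof (cases "integrable M f")
  case True
  have "(\<integral>x. f x \<partial>M) \<in> (S\<^sup>\<bottom>)\<^sup>\<bottom>"
    unfolding orthogonal_comp_def
  proof (intro CollectI ballI)
    fix s assume s: "s \<in> {x. \<forall>y\<in>S. orthogonal y x}"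
    have "s \<bullet> (\<integral>x. f x \<partial>M) = (\<integral>x. s \<bullet> f x \<partial>M)" using True by simp
    also have "\<dots> = 0"
    proof -
      have "s \<bullet> f x = 0" for x using s f[of x] by (auto simp: orthogonal_def inner_commute)
      then show ?thesis by simp
    qed
    finally show "orthogonal s (\<integral>x. f x \<partial>M)" by (simp add: orthogonal_def)
  qed
  then show ?thesis using orthogonal_comp_self[OF S] by simp
next
  case False
  then show ?thesis using subspace_0[OF S] by (simp add: not_integrable_integral_eq)
qed

lemma matrix_vector_borel [measurable]: "(\<lambda>y::real^'n. (A::real^'n^'m) *v y) \<in> borel_measurable borel"
  by (intro borel_measurable_continuous_onI continuous_intros)


section \<open>The estimating equation of scatter\<close>

text \<open>The estimating equation \<open>A = (\<nu> + d) \<integral> y y' / (\<nu> + y' A\<^sup>-\<^sup>1 y) dQ(y)\<close>, expressed by the quadratic forms of both sides.\<close>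

definition solves_scatter :: "real \<Rightarrow> (real^'d) measure \<Rightarrow> real^'d^'d \<Rightarrow> bool" where
  "solves_scatter \<nu> Q A \<longleftrightarrow> A \<in> pd_mats \<and>
     (\<forall>x. x \<bullet> (A *v x) = (\<nu> + real CARD('d)) * (\<integral>y. (x \<bullet> y)\<^sup>2 / (\<nu> + y \<bullet> (matrix_inv A *v y)) \<partial>Q))"

lemma solves_scatter_pd: "solves_scatter \<nu> Q A \<Longrightarrow> A \<in> pd_mats"
  unfolding solves_scatter_def by (rule conjunct1)

lemma solves_scatter_eq:
  fixes A :: "real^'d^'d"
  shows "solves_scatter \<nu> Q A \<Longrightarrow>
   x \<bullet> (A *v x) = (\<nu> + real CARD('d)) * (\<integral>y. (x \<bullet> y)\<^sup>2 / (\<nu> + y \<bullet> (matrix_inv A *v y)) \<partial>Q)"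
  unfolding solves_scatter_def by blast

lemma weight_pos:
  fixes A :: "real^'d^'d"
  assumes "A \<in> pd_mats" "\<nu> > 0"
  shows "\<nu> + y \<bullet> (matrix_inv A *v y) > 0" "\<nu> + y \<bullet> (matrix_inv A *v y) \<ge> \<nu>"
  using pd_mats_nonneg[OF matrix_inv_pd_mats[OF assms(1)], of y] assms(2) by auto

text \<open>Cauchy-Schwarz between the form of \<open>A\<close> and its inverse; it makes every integrand of the estimating equation
  bounded, hence integrable under every law.\<close>

lemma weighted_square_le:
  fixes A :: "real^'d^'d"
  assumes A: "A \<in> pd_mats" and "\<nu> > 0"
  shows "(x \<bullet> y)\<^sup>2 / (\<nu> + y \<bullet> (matrix_inv A *v y)) \<le> x \<bullet> (A *v x)"
proof (cases "x = 0")
  case False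
  let ?a = "x \<bullet> (A *v x)" and ?s = "y \<bullet> (matrix_inv A *v y)"
  have a: "?a > 0" using pd_mats_posD[OF A False] .
  define t where "t = (x \<bullet> y) / ?a"
  have "2 * ((t *\<^sub>R x) \<bullet> y) - (t *\<^sub>R x) \<bullet> (A *v (t *\<^sub>R x)) \<le> ?s" by (rule inverse_form_ge[OF A])
  then have "2 * t * (x \<bullet> y) - t^2 * ?a \<le> ?s"
    by (simp add: matrix_vector_mult_scaleR power2_eq_square algebra_simps)
  also have "2 * t * (x \<bullet> y) - t^2 * ?a = (x \<bullet> y)^2 / ?a"
    using a by (simp add: t_def field_simps power2_eq_square)
  finally have "(x \<bullet> y)^2 \<le> ?a * ?s" using a by (simp add: field_simps)
  also have "\<dots> \<le> ?a * (\<nu> + ?s)" using a assms(2) by (intro mult_left_mono) auto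
  finally show ?thesis using weight_pos[OF A assms(2), of y] by (simp add: field_simps)
qed simp

lemma weighted_square_nonneg:
  fixes A :: "real^'d^'d"
  assumes "A \<in> pd_mats" "\<nu> > 0"
  shows "0 \<le> (x \<bullet> y)\<^sup>2 / (\<nu> + y \<bullet> (matrix_inv A *v y))"
  using weight_pos[OF assms, of y] by simp

lemma integrable_weighted_square:
  fixes A :: "real^'d^'d"
  assumes "A \<in> pd_mats" "\<nu> > 0" "Q \<in> laws"
  shows "integrable Q (\<lambda>y. (x \<bullet> y)\<^sup>2 / (\<nu> + y \<bullet> (matrix_inv A *v y)))"
proof (rule laws_integrable_bounded[OF assms(3)])
  show "norm ((x \<bullet> y)\<^sup>2 / (\<nu> + y \<bullet> (matrix_inv A *v y))) \<le> x \<bullet> (A *v x)" for y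
    unfolding real_norm_def abs_of_nonneg[OF weighted_square_nonneg[OF assms(1,2)]]
    by (rule weighted_square_le[OF assms(1,2)])
qed measurable

text \<open>The functional is equivariant under linear maps, which reduces most questions to \<open>A = I\<close>.\<close>

lemma solves_scatter_congruence:
  fixes A W :: "real^'d^'d"
  assumes "Q \<in> laws" and W: "invertible W" and A: "solves_scatter \<nu> Q A"
  shows "solves_scatter \<nu> (distr Q borel ((*v) W)) (W ** A ** transpose W)"
  unfolding solves_scatter_def
proof (intro conjI allI)
  have pd: "A \<in> pd_mats" using A by (simp add: solves_scatter_def)
  show "W ** A ** transpose W \<in> pd_mats" by (rule congruence_pd_mats[OF pd W])
  fix x
  let ?C = "W ** A ** transpose W"
  have "(\<integral>y. (x \<bullet> y)\<^sup>2 / (\<nu> + y \<bullet> (matrix_inv ?C *v y)) \<partial>distr Q borel ((*v) W))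
     = (\<integral>y. (x \<bullet> (W *v y))\<^sup>2 / (\<nu> + (W *v y) \<bullet> (matrix_inv ?C *v (W *v y))) \<partial>Q)"
    by (intro integral_distr) (simp_all add: laws_measurable[OF assms(1)] matrix_vector_borel)
  also have "\<dots> = (\<integral>y. ((transpose W *v x) \<bullet> y)\<^sup>2 / (\<nu> + y \<bullet> (matrix_inv A *v y)) \<partial>Q)"
    by (simp only: inverse_form_congruence[OF pd_mats_invertible[OF pd] W] transpose_adjoint[of x W])
  finally show "x \<bullet> (?C *v x) = (\<nu> + real CARD('d)) *
      (\<integral>y. (x \<bullet> y)\<^sup>2 / (\<nu> + y \<bullet> (matrix_inv ?C *v y)) \<partial>distr Q borel ((*v) W))"
    using A unfolding solves_scatter_def congruence_quadratic by metis
qed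

lemma solves_scatter_identity:
  assumes "solves_scatter \<nu> Q (mat 1 :: real^'d^'d)"
  shows "x \<bullet> x = (\<nu> + real CARD('d)) * (\<integral>y. (x \<bullet> y)\<^sup>2 / (\<nu> + y \<bullet> y) \<partial>Q)"
proof -
  have "x \<bullet> (mat 1 *v x) = (\<nu> + real CARD('d)) * (\<integral>y. (x \<bullet> y)\<^sup>2 / (\<nu> + y \<bullet> (matrix_inv (mat 1 :: real^'d^'d) *v y)) \<partial>Q)"
    using assms unfolding solves_scatter_def by blast
  then show ?thesis by (simp only: matrix_inv_mat_1 matrix_vector_mul_lid)
qed

text \<open>Trace of the equation: at \<open>A = I\<close> the left side has trace \<open>d\<close>, the integrand on the right has trace
  \<open>1 - \<nu> / (\<nu> + |z|\<^sup>2)\<close>.\<close>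

lemma solves_scatter_mean_weight:
  fixes A :: "real^'d^'d"
  assumes Q: "Q \<in> laws" and nu: "\<nu> > 0" and sol: "solves_scatter \<nu> Q A"
  shows "(\<nu> + real CARD('d)) * (\<integral>y. 1 / (\<nu> + y \<bullet> (matrix_inv A *v y)) \<partial>Q) = 1"
proof -
  have A: "A \<in> pd_mats" by (rule solves_scatter_pd[OF sol])
  obtain W :: "real^'d^'d" and cc where W: "invertible W" "W ** A ** transpose W = mat 1"
    by (rule simultaneous_diagonalization[OF A pd_mats_sym_mats[OF A]])
  define R where "R = distr Q borel ((*v) W)"
  have R: "R \<in> laws" unfolding R_def by (rule laws_distr[OF Q matrix_vector_borel])
  interpret R: prob_space R using R by (rule laws_prob_space)
  have solR: "solves_scatter \<nu> R (mat 1)"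
    using solves_scatter_congruence[OF Q W(1) sol] by (simp only: R_def W(2))
  have pos: "0 < \<nu> + z \<bullet> z" for z :: "real^'d" using nu inner_ge_zero[of z] by linarith
  have bm: "(\<lambda>z. f z / (\<nu> + z \<bullet> z)) \<in> borel_measurable borel" if "continuous_on UNIV f" for f :: "real^'d \<Rightarrow> real"
    by (intro borel_measurable_continuous_onI continuous_intros that) (metis pos less_irrefl)
  have i1: "integrable R (\<lambda>z. 1 / (\<nu> + z \<bullet> z))"
    by (rule laws_integrable_bounded[OF R bm, of _ "1 / \<nu>"]) (use pos nu in \<open>auto intro!: continuous_intros frac_le simp: abs_of_pos\<close>)
  have i2: "integrable R (\<lambda>z. (z $ i)\<^sup>2 / (\<nu> + z \<bullet> z))" for i
  proof (rule laws_integrable_bounded[OF R bm, of _ 1])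
    show "continuous_on UNIV (\<lambda>z :: real^'d. (z $ i)\<^sup>2)" by (intro continuous_intros)
    show "norm ((z $ i)\<^sup>2 / (\<nu> + z \<bullet> z)) \<le> 1" for z :: "real^'d"
    proof -
      have "(z $ i)\<^sup>2 \<le> z \<bullet> z"
        unfolding inner_vec_def power2_eq_square inner_real_def by (rule member_le_sum) auto
      then show ?thesis using pos[of z] nu by (simp add: divide_le_eq)
    qed
  qed
  have "real CARD('d) = (\<Sum>i\<in>(UNIV :: 'd set). (\<nu> + real CARD('d)) * (\<integral>z. (z $ i)\<^sup>2 / (\<nu> + z \<bullet> z) \<partial>R))"
  proof -
    have "(\<nu> + real CARD('d)) * (\<integral>z. (z $ i)\<^sup>2 / (\<nu> + z \<bullet> z) \<partial>R) = 1" for i :: 'd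
      using solves_scatter_identity[OF solR, of "axis i 1"] by (simp add: inner_axis')
    then show ?thesis by simp
  qed
  also have "\<dots> = (\<nu> + real CARD('d)) * (\<integral>z. (\<Sum>i\<in>UNIV. (z $ i)\<^sup>2 / (\<nu> + z \<bullet> z)) \<partial>R)"
    by (subst Bochner_Integration.integral_sum[OF i2]) (simp add: sum_distrib_left)
  also have "(\<lambda>z. \<Sum>i\<in>UNIV. (z $ i)\<^sup>2 / (\<nu> + z \<bullet> z)) = (\<lambda>z :: real^'d. 1 - \<nu> * (1 / (\<nu> + z \<bullet> z)))"
  proof
    fix z :: "real^'d"
    have "(\<Sum>i\<in>UNIV. (z $ i)\<^sup>2 / (\<nu> + z \<bullet> z)) = (z \<bullet> z) / (\<nu> + z \<bullet> z)"
      by (simp add: inner_vec_def power2_eq_square sum_divide_distrib)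
    then show "(\<Sum>i\<in>UNIV. (z $ i)\<^sup>2 / (\<nu> + z \<bullet> z)) = 1 - \<nu> * (1 / (\<nu> + z \<bullet> z))"
      using pos[of z] by (simp add: field_simps)
  qed
  also have "(\<integral>z. 1 - \<nu> * (1 / (\<nu> + z \<bullet> z)) \<partial>R) = 1 - \<nu> * (\<integral>z. 1 / (\<nu> + z \<bullet> z) \<partial>R)"
    unfolding Bochner_Integration.integral_diff[OF R.integrable_const integrable_mult_right[OF i1, of \<nu>]] integral_mult_right_zero
    using R.prob_space by simp
  finally have "\<nu> * ((\<nu> + real CARD('d)) * (\<integral>z. 1 / (\<nu> + z \<bullet> z) \<partial>R)) = \<nu> * 1"
    by (simp add: algebra_simps)
  then have "(\<nu> + real CARD('d)) * (\<integral>z. 1 / (\<nu> + z \<bullet> z) \<partial>R) = 1" using nu by (simp only: mult_cancel_left) simp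
  moreover have "(\<integral>z. 1 / (\<nu> + z \<bullet> z) \<partial>R) = (\<integral>y. 1 / (\<nu> + (W *v y) \<bullet> (W *v y)) \<partial>Q)"
    unfolding R_def
    by (rule integral_distr) (simp_all add: laws_measurable[OF Q] matrix_vector_borel bm continuous_on_const)
  moreover have "(W *v y) \<bullet> (W *v y) = y \<bullet> (matrix_inv A *v y)" for y
    using inverse_form_congruence[OF pd_mats_invertible[OF A] W(1), of y] by (simp add: W(2))
  ultimately show ?thesis by simp
qed


section \<open>Solutions of the estimating equation minimize the objective\<close>

text \<open>Jensen's inequality for the exponential with weights \<open>\<nu> / S\<close> at the point \<open>0\<close> and \<open>a i / S\<close> at
  \<open>- ln (c i)\<close>. Writing \<open>exp x = 1 + x + r x\<close> with \<open>r \<ge> 0\<close> exhibits the gap explicitly and so identifies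
  the case of equality.\<close>

lemma weighted_ln_jensen:
  fixes a c :: "'i::finite \<Rightarrow> real"
  assumes "\<nu> > 0" "\<And>i. a i \<ge> 0" "\<And>i. c i > 0"
  defines "S \<equiv> \<nu> + (\<Sum>i\<in>UNIV. a i)"
  defines "g \<equiv> ln ((\<nu> + (\<Sum>i\<in>UNIV. a i / c i)) / S) + (\<Sum>i\<in>UNIV. ln (c i) * (a i / S))"
  shows "g \<ge> 0" and "g = 0 \<Longrightarrow> a i = 0 \<or> c i = 1"
proof -
  \<comment> \<open>\<open>- m\<close> is the weighted mean of the exponents; multiplying by \<open>exp m\<close> centres them.\<close>
  define m where "m = (\<Sum>i\<in>UNIV. ln (c i) * (a i / S))"
  have S: "S > 0" using assms(1,2) by (auto simp: S_def intro!: add_pos_nonneg sum_nonneg)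
  define T where "T = \<nu> + (\<Sum>i\<in>UNIV. a i / c i)"
  have T: "T > 0" unfolding T_def
    by (rule add_pos_nonneg[OF assms(1) sum_nonneg]) (rule divide_nonneg_pos[OF assms(2,3)])
  define r where "r x = exp x - (1 + x)" for x :: real
  have r0: "r x \<ge> 0" for x using exp_ge_add_one_self[of x] by (simp add: r_def)
  have r_eq: "x = 0" if "r x = 0" for x
  proof -
    have "x = exp x - 1" using that unfolding r_def by linarith
    then have "exp x = 1" by (intro ln_eq_minus_one) (simp_all only: exp_gt_zero ln_exp)
    then show ?thesis by simp
  qed
  have mS: "m * S = (\<Sum>i\<in>UNIV. ln (c i) * a i)"
    using S by (simp add: m_def sum_distrib_right)
  have e: "exp (m - ln (c i)) = exp m / c i" for i using assms(3)[of i] by (simp add: exp_diff)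
  have "exp m * T = \<nu> * exp m + (\<Sum>i\<in>UNIV. a i * exp (m - ln (c i)))"
    by (simp add: T_def e algebra_simps sum_distrib_left)
  also have "\<dots> = \<nu> * (1 + m + r m) + (\<Sum>i\<in>UNIV. a i * (1 + (m - ln (c i)) + r (m - ln (c i))))"
    by (simp add: r_def)
  also have "\<dots> = S + m * S - (\<Sum>i\<in>UNIV. ln (c i) * a i) + (\<nu> * r m + (\<Sum>i\<in>UNIV. a i * r (m - ln (c i))))"
    by (simp add: S_def algebra_simps sum.distrib sum_subtractf sum_distrib_left)
  finally have key: "exp m * T = S + (\<nu> * r m + (\<Sum>i\<in>UNIV. a i * r (m - ln (c i))))" by (simp add: mS)
  have g: "g = m + ln (T / S)" by (simp add: g_def m_def T_def)
  then have eg: "exp g = exp m * T / S" using S T by (simp add: exp_add)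
  have sn: "0 \<le> (\<Sum>i\<in>UNIV. a i * r (m - ln (c i)))" by (intro sum_nonneg mult_nonneg_nonneg assms r0)
  have "1 \<le> exp g" unfolding eg key using S assms(1) r0[of m] sn by simp
  then show "g \<ge> 0" by simp
  show "a i = 0 \<or> c i = 1" if "g = 0"
  proof -
    have "\<nu> * r m + (\<Sum>i\<in>UNIV. a i * r (m - ln (c i))) = 0"
      using eg key S that by (simp add: field_simps)
    moreover have "\<nu> * r m \<ge> 0" using assms(1) r0[of m] by simp
    ultimately have "\<nu> * r m = 0" and sum0: "(\<Sum>i\<in>UNIV. a i * r (m - ln (c i))) = 0"
      using sn by linarith+
    then have "r m = 0" using assms(1) by simp
    then have m: "m = 0" by (rule r_eq)
    have "\<forall>i\<in>UNIV. a i * r (m - ln (c i)) = 0"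
      using sum0 by (subst (asm) sum_nonneg_eq_0_iff) (simp_all add: assms(2) r0)
    then have "a i = 0 \<or> r (- ln (c i)) = 0" by (simp add: m)
    then show ?thesis
    proof
      assume "r (- ln (c i)) = 0"
      then have "- ln (c i) = 0" by (rule r_eq)
      then show ?thesis using assms(3)[of i] by simp
    qed simp
  qed
qed

lemma rho_diff:
  assumes "\<nu> > 0" "s \<ge> 0" "t \<ge> 0"
  shows "rho \<nu> d s - rho \<nu> d t = (\<nu> + real d) / 2 * ln ((\<nu> + s) / (\<nu> + t))"
  using assms by (simp add: rho_def ln_divide_pos right_diff_distrib[symmetric])

lemma ln_ratio_bounded:
  fixes \<nu> s t c :: real
  assumes "\<nu> > 0" "s \<ge> 0" "t \<ge> 0" "c \<ge> 1" "s \<le> c * t" "t \<le> c * s"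
  shows "\<bar>ln ((\<nu> + s) / (\<nu> + t))\<bar> \<le> ln c"
proof -
  have "\<nu> \<le> c * \<nu>" using assms by (simp add: mult_le_cancel_right1)
  then have "\<nu> + s \<le> c * (\<nu> + t)" "\<nu> + t \<le> c * (\<nu> + s)" unfolding distrib_left using assms by linarith+
  then have "ln (\<nu> + s) \<le> ln (c * (\<nu> + t))" "ln (\<nu> + t) \<le> ln (c * (\<nu> + s))"
    using assms by (subst ln_le_cancel_iff; simp add: add_pos_nonneg)+
  then show ?thesis using assms by (simp add: ln_mult ln_divide_pos add_pos_nonneg abs_le_iff)
qed

text \<open>Since the two forms are comparable, the difference stays bounded as \<open>y\<close> tends to infinity, although
  each of the two terms is unbounded.\<close>

lemma rho_diff_bounded:
  fixes A :: "real^'d^'d"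
  assumes "A \<in> pd_mats" "\<nu> > 0"
  obtains K where "\<forall>y. \<bar>rho \<nu> n (y \<bullet> (matrix_inv A *v y)) - rho \<nu> n (y \<bullet> y)\<bar> \<le> K"
proof -
  obtain c where c: "c \<ge> 1" "\<forall>x. x \<bullet> (matrix_inv A *v x) \<le> c * (x \<bullet> x) \<and> x \<bullet> x \<le> c * (x \<bullet> (matrix_inv A *v x))"
    by (rule forms_equivalent[OF matrix_inv_pd_mats[OF assms(1)]])
  have "\<bar>rho \<nu> n (y \<bullet> (matrix_inv A *v y)) - rho \<nu> n (y \<bullet> y)\<bar> \<le> (\<nu> + real n) / 2 * ln c" for y
    using assms c pd_mats_nonneg[OF matrix_inv_pd_mats[OF assms(1)], of y]
    by (simp add: rho_diff abs_mult) (intro mult_left_mono ln_ratio_bounded, auto)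
  then show ?thesis using that by blast
qed

lemma rho_borel [measurable (raw)]:
  "f \<in> borel_measurable M \<Longrightarrow> (\<lambda>x. rho \<nu> n (f x)) \<in> borel_measurable M"
  unfolding rho_def
  by (intro borel_measurable_times borel_measurable_ln borel_measurable_divide borel_measurable_add) simp_all

lemma integrable_rho_diff:
  fixes A :: "real^'d^'d"
  assumes "A \<in> pd_mats" "\<nu> > 0" "Q \<in> laws"
  shows "integrable Q (\<lambda>y. rho \<nu> n (y \<bullet> (matrix_inv A *v y)) - rho \<nu> n (y \<bullet> y))"
proof -
  obtain K where "\<forall>y. \<bar>rho \<nu> n (y \<bullet> (matrix_inv A *v y)) - rho \<nu> n (y \<bullet> y)\<bar> \<le> K"
    by (rule rho_diff_bounded[OF assms(1,2)])
  then show ?thesis by (intro laws_integrable_bounded[OF assms(3), of _ K]) auto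
qed

text \<open>After simultaneous diagonalization \<open>A = I\<close> and \<open>B\<close> is diagonal with entries \<open>c i\<close>. The log-determinant term
  equals \<open>\<Sum>i. ln (c i)\<close>, which by the equation at \<open>A\<close> is an integral of \<open>\<Sum>i. ln (c i) z\<^sub>i\<^sup>2 / (\<nu> + |z|\<^sup>2)\<close> as well.
  Putting both parts under one integral, the difference of the objectives becomes the integral of the Jensen gap.\<close>

proposition solves_scatter_unique_minimizer:
  fixes A B :: "real^'d^'d"
  assumes Q: "Q \<in> laws" and nu: "\<nu> > 0" and sol: "solves_scatter \<nu> Q A" and B: "B \<in> pd_mats"
  shows "scatter_obj \<nu> Q A \<le> scatter_obj \<nu> Q B"
    and "scatter_obj \<nu> Q B \<le> scatter_obj \<nu> Q A \<Longrightarrow> B = A"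
proof -
  have A: "A \<in> pd_mats" using sol by (simp add: solves_scatter_def)
  obtain W :: "real^'d^'d" and c where W: "invertible W" "W ** A ** transpose W = mat 1" "W ** B ** transpose W = diag_mat c"
    by (rule simultaneous_diagonalization[OF A pd_mats_sym_mats[OF B]])
  have c: "c i > 0" for i
    using diag_mat_pd_entries congruence_pd_mats[OF B W(1)] W(3) by metis
  define n where "n = CARD('d)"
  define Q' where "Q' = distr Q borel ((*v) W)"
  have Q': "Q' \<in> laws" unfolding Q'_def by (intro laws_distr Q matrix_vector_borel)
  have sol': "solves_scatter \<nu> Q' (mat 1)"
    using solves_scatter_congruence[OF Q W(1) sol] by (simp add: Q'_def W(2))
  have sA: "y \<bullet> (matrix_inv A *v y) = (W *v y) \<bullet> (W *v y)" for y
    using inverse_form_congruence[OF pd_mats_invertible[OF A] W(1)] by (simp add: W(2))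
  have sB: "y \<bullet> (matrix_inv B *v y) = (\<Sum>i\<in>UNIV. ((W *v y) $ i)\<^sup>2 / c i)" for y
    using inverse_form_congruence[OF pd_mats_invertible[OF B] W(1)] c
    by (simp add: W(3) matrix_inv_diag_mat less_imp_neq[THEN not_sym] diag_mat_mult inner_vec_def power2_eq_square)
  have dets: "ln (det B) / 2 - ln (det A) / 2 = (\<Sum>i\<in>UNIV. ln (c i)) / 2"
  proof -
    have "det W * det A * det W = 1" "det W * det B * det W = (\<Prod>i\<in>UNIV. c i)"
      using arg_cong[OF W(2), of det] arg_cong[OF W(3), of det]
      by (simp_all add: det_mul det_diag_mat)
    moreover have "(\<Prod>i\<in>UNIV. c i) > 0" by (simp add: c prod_pos)
    ultimately have a: "(det W)^2 * det A = 1" "(det W)^2 * det B = (\<Prod>i\<in>UNIV. c i)" "(\<Prod>i\<in>UNIV. c i) > 0"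
      by (simp_all add: power2_eq_square algebra_simps)
    have w: "(det W)^2 > 0" using W(1) by (simp add: invertible_det_nz)
    have dA: "det A > 0" using a(1) w by (metis zero_less_mult_pos zero_less_one)
    have "det B = det A * (\<Prod>i\<in>UNIV. c i)"
    proof -
      have "(det W)^2 * det B = (det W)^2 * (det A * (\<Prod>i\<in>UNIV. c i))" using a by (simp add: mult.assoc[symmetric])
      then show ?thesis using w by simp
    qed
    moreover have "ln (\<Prod>i\<in>UNIV. c i) = (\<Sum>i\<in>UNIV. ln (c i))"
      by (rule ln_prod) (use c in \<open>auto simp: less_le\<close>)
    moreover have "ln (det A * (\<Prod>i\<in>UNIV. c i)) = ln (det A) + ln (\<Prod>i\<in>UNIV. c i)"
      by (rule ln_mult_pos[OF dA a(3)])
    ultimately show ?thesis by (simp add: field_simps)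
  qed
  define a where "a z i = (z $ i)\<^sup>2" for z :: "real^'d" and i
  define S where "S z = \<nu> + (\<Sum>i\<in>UNIV. a z i)" for z
  have zz: "z \<bullet> z = (\<Sum>i\<in>UNIV. a z i)" for z by (simp add: a_def inner_vec_def power2_eq_square)
  \<comment> \<open>\<open>g1\<close> comes from the difference of the two \<open>rho\<close> terms, \<open>g2\<close> from the log-determinant.\<close>
  define g1 where "g1 z = ln ((\<nu> + (\<Sum>i\<in>UNIV. a z i / c i)) / S z)" for z
  define g2 where "g2 z = (\<Sum>i\<in>UNIV. ln (c i) * (a z i / S z))" for z
  have g_nonneg: "g1 z + g2 z \<ge> 0" and g_zero: "g1 z + g2 z = 0 \<Longrightarrow> a z i = 0 \<or> c i = 1" for z i
  proof -
    have a0: "\<And>i. a z i \<ge> 0" by (simp add: a_def)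
    show "g1 z + g2 z \<ge> 0" unfolding g1_def g2_def S_def by (rule weighted_ln_jensen(1)[OF nu a0 c])
    show "a z i = 0 \<or> c i = 1" if "g1 z + g2 z = 0"
      using that unfolding g1_def g2_def S_def by (rule weighted_ln_jensen(2)[OF nu a0 c])
  qed
  have meas: "g1 \<in> borel_measurable borel" "g2 \<in> borel_measurable borel"
    unfolding g1_def g2_def S_def a_def by measurable
  have Sp: "S z > 0" "a z i / S z \<le> 1" "0 \<le> a z i / S z" for z i
  proof -
    have "a z i \<le> (\<Sum>i\<in>UNIV. a z i)" by (rule member_le_sum) (auto simp: a_def)
    moreover have "0 \<le> a z i" "0 \<le> (\<Sum>i\<in>UNIV. a z i)" by (auto simp: a_def intro: sum_nonneg)
    ultimately show "S z > 0" "a z i / S z \<le> 1" "0 \<le> a z i / S z"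
      using nu by (auto simp: S_def)
  qed
  have int_a: "integrable Q' (\<lambda>z. a z i / S z)" for i
  proof (rule laws_integrable_bounded[OF Q'])
    show "norm (a z i / S z) \<le> 1" for z
      unfolding real_norm_def abs_of_nonneg[OF Sp(3)] by (rule Sp(2))
    show "(\<lambda>z. a z i / S z) \<in> borel_measurable borel" unfolding a_def S_def by measurable
  qed
  have int_g2: "integrable Q' g2" unfolding g2_def by (intro Bochner_Integration.integrable_sum integrable_mult_right int_a)
  \<comment> \<open>The estimating equation at \<open>A\<close>, tested with the coordinate vectors.\<close>
  have moment: "(\<nu> + real n) * (\<integral>z. a z i / S z \<partial>Q') = 1" for i
  proof -
    have "(axis i 1 \<bullet> y)\<^sup>2 / (\<nu> + y \<bullet> y) = a y i / S y" for y :: "real^'d"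
      by (simp add: inner_axis' S_def zz) (simp add: a_def)
    then show ?thesis
      using solves_scatter_identity[OF sol', of "axis i 1"] by (simp add: n_def inner_axis_axis)
  qed
  have obj: "scatter_obj \<nu> Q B - scatter_obj \<nu> Q A
      = (\<Sum>i\<in>UNIV. ln (c i)) / 2 + (\<nu> + real n) / 2 * (\<integral>z. g1 z \<partial>Q')" and int_g1: "integrable Q' g1"
  proof -
    have eq: "rho \<nu> n (y \<bullet> (matrix_inv B *v y)) - rho \<nu> n (y \<bullet> (matrix_inv A *v y)) = (\<nu> + real n) / 2 * g1 (W *v y)" for y
    proof -
      have "rho \<nu> n (y \<bullet> (matrix_inv B *v y)) - rho \<nu> n (y \<bullet> (matrix_inv A *v y))
         = (\<nu> + real n) / 2 * ln ((\<nu> + y \<bullet> (matrix_inv B *v y)) / (\<nu> + y \<bullet> (matrix_inv A *v y)))"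
        by (rule rho_diff[OF nu pd_mats_nonneg pd_mats_nonneg]) (intro matrix_inv_pd_mats A B)+
      then show ?thesis unfolding sA sB g1_def S_def zz a_def .
    qed
    have i: "integrable Q (\<lambda>y. (rho \<nu> n (y \<bullet> (matrix_inv B *v y)) - rho \<nu> n (y \<bullet> y)) -
       (rho \<nu> n (y \<bullet> (matrix_inv A *v y)) - rho \<nu> n (y \<bullet> y)))"
      by (intro Bochner_Integration.integrable_diff integrable_rho_diff A B nu Q)
    then have i2: "integrable Q (\<lambda>y. (\<nu> + real n) / 2 * g1 (W *v y))" by (simp add: eq)
    moreover have "(\<nu> + real n) / 2 \<noteq> 0" using nu by simp
    ultimately have i3: "integrable Q (\<lambda>y. g1 (W *v y))"
      using integrable_mult_right[OF i2, of "inverse ((\<nu> + real n) / 2)"]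
      by (simp only: mult.assoc[symmetric] left_inverse mult_1 simp_thms)
    then show "integrable Q' g1"
      unfolding Q'_def by (subst integrable_distr_eq) (auto simp: laws_measurable[OF Q] meas)
    have "scatter_obj \<nu> Q B - scatter_obj \<nu> Q A = (\<Sum>i\<in>UNIV. ln (c i)) / 2 +
       (\<integral>y. (rho \<nu> n (y \<bullet> (matrix_inv B *v y)) - rho \<nu> n (y \<bullet> y)) -
       (rho \<nu> n (y \<bullet> (matrix_inv A *v y)) - rho \<nu> n (y \<bullet> y)) \<partial>Q)"
      unfolding scatter_obj_def n_def[symmetric] using dets
      by (subst Bochner_Integration.integral_diff) (auto intro!: integrable_rho_diff A B nu Q)
    also have "\<dots> = (\<Sum>i\<in>UNIV. ln (c i)) / 2 + (\<integral>y. (\<nu> + real n) / 2 * g1 (W *v y) \<partial>Q)"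
      by (simp add: eq)
    also have "\<dots> = (\<Sum>i\<in>UNIV. ln (c i)) / 2 + (\<nu> + real n) / 2 * (\<integral>z. g1 z \<partial>Q')"
      unfolding Q'_def by (subst integral_distr) (auto simp: laws_measurable[OF Q] meas)
    finally show "scatter_obj \<nu> Q B - scatter_obj \<nu> Q A
      = (\<Sum>i\<in>UNIV. ln (c i)) / 2 + (\<nu> + real n) / 2 * (\<integral>z. g1 z \<partial>Q')" .
  qed
  have "(\<nu> + real n) * (\<integral>z. g2 z \<partial>Q') = (\<Sum>i\<in>UNIV. ln (c i))"
  proof -
    have "(\<integral>z. g2 z \<partial>Q') = (\<Sum>i\<in>UNIV. \<integral>z. ln (c i) * (a z i / S z) \<partial>Q')"
      unfolding g2_def by (rule Bochner_Integration.integral_sum) (intro integrable_mult_right int_a)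
    also have "\<dots> = (\<Sum>i\<in>UNIV. ln (c i) * (\<integral>z. a z i / S z \<partial>Q'))"
      by (simp only: integral_mult_right_zero)
    finally have "(\<nu> + real n) * (\<integral>z. g2 z \<partial>Q') = (\<Sum>i\<in>UNIV. ln (c i) * ((\<nu> + real n) * (\<integral>z. a z i / S z \<partial>Q')))"
      by (simp add: sum_distrib_left mult_ac)
    then show ?thesis by (simp only: moment) simp
  qed
  then have main: "scatter_obj \<nu> Q B - scatter_obj \<nu> Q A = (\<nu> + real n) / 2 * (\<integral>z. g1 z + g2 z \<partial>Q')"
    using obj by (simp add: Bochner_Integration.integral_add int_g1 int_g2 distrib_left)
  have nn: "0 \<le> (\<integral>z. g1 z + g2 z \<partial>Q')" by (intro integral_nonneg_AE AE_I2 g_nonneg)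
  then have "0 \<le> (\<nu> + real n) / 2 * (\<integral>z. g1 z + g2 z \<partial>Q')" using nu by (intro mult_nonneg_nonneg) auto
  then show "scatter_obj \<nu> Q A \<le> scatter_obj \<nu> Q B" using main by simp
  show "B = A" if "scatter_obj \<nu> Q B \<le> scatter_obj \<nu> Q A"
  proof -
    have "(\<nu> + real n) / 2 * (\<integral>z. g1 z + g2 z \<partial>Q') \<le> 0" using that main by simp
    then have "(\<integral>z. g1 z + g2 z \<partial>Q') = 0" using nn nu by (simp add: mult_le_0_iff)
    then have "AE z in Q'. g1 z + g2 z = 0"
      using int_g1 int_g2 g_nonneg by (subst (asm) integral_nonneg_eq_0_iff_AE) auto
    \<comment> \<open>Equality forces \<open>c i = 1\<close>, because the equation does not allow the coordinate \<open>z\<^sub>i\<close> to vanish almost surely.\<close>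
    then have ae: "AE z in Q'. a z i = 0 \<or> c i = 1" for i by eventually_elim (rule g_zero)
    have "c i = 1" for i
    proof (rule ccontr)
      assume "c i \<noteq> 1"
      then have "AE z in Q'. a z i / S z = 0" using ae[of i] by auto
      then have "(\<integral>z. a z i / S z \<partial>Q') = 0" by (rule integral_eq_zero_AE)
      then show False using moment[of i] by simp
    qed
    then have "diag_mat c = mat 1" by (simp add: diag_mat_def mat_def vec_eq_iff)
    then have eq: "W ** B ** transpose W = W ** A ** transpose W" by (simp only: W(2,3))
    have "B = matrix_inv W ** (W ** B ** transpose W) ** transpose (matrix_inv W)"
      by (rule congruence_inverse[OF W(1), symmetric])
    also have "\<dots> = A" unfolding eq by (rule congruence_inverse[OF W(1)])
    finally show ?thesis .
  qed
qed

lemma solves_scatter_imp_A_fun: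
  assumes Q: "Q \<in> laws" and nu: "\<nu> > 0" and sol: "solves_scatter \<nu> Q A"
  shows "A_fun \<nu> Q = A"
  unfolding A_fun_def
proof (rule the_equality)
  have A: "A \<in> pd_mats" using sol by (simp add: solves_scatter_def)
  have "\<not> scatter_obj \<nu> Q B < scatter_obj \<nu> Q A" if "B \<in> pd_mats" for B
    using solves_scatter_unique_minimizer(1)[OF Q nu sol that] by simp
  with A show "is_arg_min (scatter_obj \<nu> Q) (\<lambda>A. A \<in> pd_mats) A"
    unfolding is_arg_min_def by blast
  fix B assume "is_arg_min (scatter_obj \<nu> Q) (\<lambda>A. A \<in> pd_mats) B"
  then have B: "B \<in> pd_mats" and "\<not> (\<exists>y. y \<in> pd_mats \<and> scatter_obj \<nu> Q y < scatter_obj \<nu> Q B)"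
    by (simp_all add: is_arg_min_def)
  then have "\<not> scatter_obj \<nu> Q A < scatter_obj \<nu> Q B" using A by auto
  then show "B = A"
    by (intro solves_scatter_unique_minimizer(2)[OF Q nu sol B]) simp
qed


section \<open>Existence of solutions\<close>

lemma bessel_finite:
  fixes z :: "'a::real_inner"
  assumes "finite B" "pairwise orthogonal B" "\<And>u. u \<in> B \<Longrightarrow> norm u = 1"
  shows "(\<Sum>u\<in>B. (u \<bullet> z)\<^sup>2) \<le> z \<bullet> z"
proof -
  define p where "p = (\<Sum>u\<in>B. (u \<bullet> z) *\<^sub>R u)"
  have pz: "p \<bullet> z = (\<Sum>u\<in>B. (u \<bullet> z)\<^sup>2)"
    by (simp add: p_def inner_sum_left power2_eq_square)
  have up: "p \<bullet> u = u \<bullet> z" if "u \<in> B" for u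
  proof -
    have "p \<bullet> u = (\<Sum>v\<in>B. (v \<bullet> z) * (v \<bullet> u))" by (simp add: p_def inner_sum_left)
    also have "\<dots> = (\<Sum>v\<in>B. if v = u then u \<bullet> z else 0)"
    proof (intro sum.cong refl)
      fix v assume "v \<in> B"
      have "v \<bullet> u = 0" if "v \<noteq> u"
        using assms(2) \<open>u \<in> B\<close> \<open>v \<in> B\<close> that by (simp add: pairwise_def orthogonal_def)
      moreover have "u \<bullet> u = 1" using assms(3)[OF \<open>u \<in> B\<close>] by (simp add: norm_eq_1)
      ultimately show "(v \<bullet> z) * (v \<bullet> u) = (if v = u then u \<bullet> z else 0)" by simp
    qed
    also have "\<dots> = u \<bullet> z" using assms(1) that by simp
    finally show ?thesis .
  qed
  have "p \<bullet> p = (\<Sum>u\<in>B. (u \<bullet> z) * (p \<bullet> u))" by (subst (2) p_def) (simp add: inner_sum_right)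
  also have "\<dots> = (\<Sum>u\<in>B. (u \<bullet> z)\<^sup>2)" by (intro sum.cong) (simp_all add: up power2_eq_square)
  finally have pp: "p \<bullet> p = p \<bullet> z" by (simp add: pz)
  have "0 \<le> (z - p) \<bullet> (z - p)" by simp
  also have "\<dots> = z \<bullet> z - p \<bullet> z" by (simp add: inner_diff_left inner_diff_right pp inner_commute)
  finally show ?thesis by (simp add: pz)
qed

text \<open>With \<open>A = I\<close>, sum the equation over an orthonormal basis of the complement of the subspace \<open>G\<close>. The left side
  is the codimension; on the right the integrand vanishes on \<open>G\<close> and is strictly below \<open>1\<close> off \<open>G\<close>, so the codimension
  is strictly less than \<open>(\<nu> + d) Q(-G)\<close>.\<close>

lemma solves_scatter_imp_U_laws:
  fixes A :: "real^'d^'d"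
  assumes Q: "Q \<in> laws" and nu: "\<nu> > 0" and sol: "solves_scatter \<nu> Q A"
  shows "Q \<in> U_laws (\<nu> + real CARD('d))"
  unfolding U_laws_def
proof (intro CollectI conjI allI impI Q)
  fix H :: "(real^'d) set" assume H: "subspace H \<and> dim H < CARD('d)"
  define n where "n = CARD('d)"
  have A: "A \<in> pd_mats" using sol by (simp add: solves_scatter_def)
  obtain W :: "real^'d^'d" and c where W: "invertible W" "W ** A ** transpose W = mat 1"
    by (rule simultaneous_diagonalization[OF A pd_mats_sym_mats[OF A]])
  define R where "R = distr Q borel ((*v) W)"
  have R: "R \<in> laws" unfolding R_def by (intro laws_distr Q matrix_vector_borel)
  interpret R: prob_space R using R by (rule laws_prob_space)
  have sol': "solves_scatter \<nu> R (mat 1)"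
    using solves_scatter_congruence[OF Q W(1) sol] by (simp add: R_def W(2))
  define G where "G = (*v) W ` H"
  have G: "subspace G" unfolding G_def using H by (intro linear_subspace_image) auto
  have "closed G" using G by (rule closed_subspace)
  then have Gm: "G \<in> sets R" by (simp add: laws_sets[OF R])
  have dimG: "dim G \<le> dim H" unfolding G_def by (intro dim_image_le) auto
  have inj: "inj ((*v) W)" by (rule inj_matrix_vector_mult[OF W(1)])
  have "measure R G = measure Q ((*v) W -` G \<inter> space Q)"
    unfolding R_def using \<open>closed G\<close>
    by (intro measure_distr) (simp_all add: laws_measurable[OF Q] matrix_vector_borel)
  also have "(*v) W -` G \<inter> space Q = H"
    using inj by (auto simp: G_def laws_space[OF Q] inj_def)
  finally have mG: "measure R G = measure Q H" .
  obtain B where B: "B \<subseteq> G\<^sup>\<bottom>" "pairwise orthogonal B" "\<And>u. u \<in> B \<Longrightarrow> norm u = 1"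
      "independent B" "card B = dim (G\<^sup>\<bottom>)"
    using orthonormal_basis_subspace[OF subspace_orthogonal_comp[of G]] by metis
  have finB: "finite B" using B(4) by (rule independent_imp_finite)
  have "dim {y \<in> UNIV. \<forall>x\<in>G. orthogonal x y} + dim G = dim (UNIV :: (real^'d) set)"
    by (rule dim_subspace_orthogonal_to_vectors) (auto simp: G)
  moreover have "{y \<in> UNIV. \<forall>x\<in>G. orthogonal x y} = G\<^sup>\<bottom>"
    by (auto simp: orthogonal_comp_def)
  ultimately have cardB: "real (card B) \<ge> real n - real (dim H)"
    using dimG B(5) by (simp add: n_def)
  then have cpos: "real (card B) > 0" using H by (simp add: n_def)
  define f where "f z = (\<Sum>u\<in>B. (u \<bullet> z)\<^sup>2 / (\<nu> + z \<bullet> z))" for z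
  \<comment> \<open>\<open>h\<close> is the amount by which Bessel's inequality for the weighted squares falls short of \<open>1\<close> off \<open>G\<close>;
    its integral being positive gives the strict inequality.\<close>
  define h where "h z = indicator (-G) z * (\<nu> / (\<nu> + z \<bullet> z))" for z :: "real^'d"
  have hm: "h \<in> borel_measurable borel"
    unfolding h_def using \<open>closed G\<close> by (intro borel_measurable_times borel_measurable_indicator) auto
  have h01: "0 \<le> h z" "h z \<le> 1" for z
  proof -
    have "0 < \<nu> + z \<bullet> z" using nu by (intro add_pos_nonneg) auto
    then have "0 \<le> \<nu> / (\<nu> + z \<bullet> z)" "\<nu> / (\<nu> + z \<bullet> z) \<le> 1" using nu by simp_all
    then show "0 \<le> h z" "h z \<le> 1" by (simp_all add: h_def indicator_def)
  qed
  have "f z \<le> indicator (-G) z - h z" for z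
  proof (cases "z \<in> G")
    case True
    have "u \<bullet> z = 0" if "u \<in> B" for u
      using B(1) that True by (auto simp: orthogonal_comp_def orthogonal_def inner_commute)
    then show ?thesis using True by (simp add: f_def h_def)
  next
    case False
    have "f z = (\<Sum>u\<in>B. (u \<bullet> z)\<^sup>2) / (\<nu> + z \<bullet> z)" by (simp add: f_def sum_divide_distrib)
    also have "\<dots> \<le> (z \<bullet> z) / (\<nu> + z \<bullet> z)"
      using nu bessel_finite[OF finB B(2,3)] by (intro divide_right_mono) auto
    also have "\<dots> = 1 - \<nu> / (\<nu> + z \<bullet> z)"
      using nu inner_ge_zero[of z] by (simp add: field_simps add_nonneg_eq_0_iff)
    finally show ?thesis using False by (simp add: h_def)
  qed
  note fle = this
  have int_u: "integrable R (\<lambda>z. (u \<bullet> z)\<^sup>2 / (\<nu> + z \<bullet> z))" for u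
    using integrable_weighted_square[OF solves_scatter_pd[OF sol'] nu R, of u] by simp
  have int_h: "integrable R h" using h01 by (intro laws_integrable_bounded[OF R hm, of 1]) auto
  have int_i: "integrable R (indicator (-G) :: _ \<Rightarrow> real)"
    using \<open>closed G\<close> by (intro integrable_real_indicator) (auto simp: R.emeasure_eq_measure laws_sets[OF R] open_Compl)
  have "(\<nu> + real n) * (\<integral>z. f z \<partial>R) = (\<Sum>u\<in>B. (\<nu> + real n) * (\<integral>z. (u \<bullet> z)\<^sup>2 / (\<nu> + z \<bullet> z) \<partial>R))"
    unfolding f_def by (subst Bochner_Integration.integral_sum) (auto simp: int_u sum_distrib_left)
  also have "\<dots> = (\<Sum>u\<in>B. 1)"
  proof (intro sum.cong refl)
    fix u assume "u \<in> B"
    then have "u \<bullet> u = 1" using B(3) by (simp add: norm_eq_1)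
    then show "(\<nu> + real n) * (\<integral>z. (u \<bullet> z)\<^sup>2 / (\<nu> + z \<bullet> z) \<partial>R) = 1"
      using solves_scatter_identity[OF sol', of u] by (simp add: n_def)
  qed
  finally have "real (card B) = (\<nu> + real n) * (\<integral>z. f z \<partial>R)" by simp
  also have "\<dots> \<le> (\<nu> + real n) * (\<integral>z. indicator (-G) z - h z \<partial>R)"
    using nu fle int_h int_i int_u unfolding f_def
    by (intro mult_left_mono integral_mono Bochner_Integration.integrable_sum Bochner_Integration.integrable_diff) auto
  also have "(\<integral>z. indicator (-G) z - h z \<partial>R) = measure R (-G) - (\<integral>z. h z \<partial>R)"
    using int_h int_i by (subst Bochner_Integration.integral_diff) (auto simp: laws_space[OF R])
  finally have key: "real (card B) \<le> (\<nu> + real n) * (measure R (-G) - (\<integral>z. h z \<partial>R))" .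
  have hint: "(\<integral>z. h z \<partial>R) > 0"
  proof (rule ccontr)
    assume "\<not> (\<integral>z. h z \<partial>R) > 0"
    moreover have "(\<integral>z. h z \<partial>R) \<ge> 0" by (intro integral_nonneg_AE AE_I2 h01)
    ultimately have "(\<integral>z. h z \<partial>R) = 0" by simp
    then have "AE z in R. h z = 0"
      using int_h h01 by (subst (asm) integral_nonneg_eq_0_iff_AE) auto
    moreover have "z \<in> G" if "h z = 0" for z
    proof (rule ccontr)
      assume "z \<notin> G"
      then have "h z = \<nu> / (\<nu> + z \<bullet> z)" by (simp add: h_def)
      moreover have "\<nu> / (\<nu> + z \<bullet> z) > 0" using nu by (intro divide_pos_pos add_pos_nonneg) auto
      ultimately show False using that by linarith
    qed
    ultimately have "AE z in R. z \<in> G" by auto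
    then have "measure R (-G) = 0"
      using Gm R.prob_compl[OF Gm] R.prob_eq_1[OF Gm] by (simp add: laws_space[OF R] Compl_eq_Diff_UNIV)
    then show False using key cpos \<open>(\<integral>z. h z \<partial>R) = 0\<close> by simp
  qed
  have "measure R (-G) = 1 - measure Q H"
    using R.prob_compl[OF Gm] by (simp add: laws_space[OF R] Compl_eq_Diff_UNIV mG)
  then have "real n - real (dim H) < (\<nu> + real n) * (1 - measure Q H)"
  proof -
    have "(\<nu> + real n) * (measure R (-G) - (\<integral>z. h z \<partial>R)) < (\<nu> + real n) * measure R (-G)"
      using hint nu by (intro mult_strict_left_mono) auto
    then show ?thesis using key cardB \<open>measure R (-G) = 1 - measure Q H\<close> by simp
  qed
  then show "measure Q H < 1 - (real CARD('d) - real (dim H)) / (\<nu> + real CARD('d))"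
    using nu by (simp add: n_def[symmetric] field_simps add_pos_nonneg)
qed

text \<open>The right side of the estimating equation, whose fixed points are its solutions.\<close>

definition scatter_map :: "real \<Rightarrow> (real^'d) measure \<Rightarrow> real^'d^'d \<Rightarrow> real^'d^'d" where
  "scatter_map \<nu> Q A =
     (\<chi> i j. (\<nu> + real CARD('d)) * (\<integral>y. y $ i * y $ j / (\<nu> + y \<bullet> (matrix_inv A *v y)) \<partial>Q))"

lemma scatter_map_sym: "scatter_map \<nu> Q A \<in> sym_mats"
  by (simp add: scatter_map_def sym_mats_def transpose_def mult.commute)

lemma scatter_map_quadratic:
  fixes A :: "real^'d^'d"
  assumes A: "A \<in> pd_mats" and nu: "\<nu> > 0" and Q: "Q \<in> laws"
  shows "x \<bullet> (scatter_map \<nu> Q A *v x) =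
    (\<nu> + real CARD('d)) * (\<integral>y. (x \<bullet> y)\<^sup>2 / (\<nu> + y \<bullet> (matrix_inv A *v y)) \<partial>Q)"
proof -
  define w where "w y = \<nu> + y \<bullet> (matrix_inv A *v y)" for y
  have wp: "w y > 0" for y using weight_pos[OF A nu] by (simp add: w_def)
  have wm: "w \<in> borel_measurable borel" unfolding w_def by measurable
  define K where "K i = axis i 1 \<bullet> (A *v axis i (1::real))" for i
  have sq: "(y $ i)\<^sup>2 / w y \<le> K i" for y i
    using weighted_square_le[OF A nu, of "axis i 1" y] by (simp add: w_def K_def inner_axis')
  have int: "integrable Q (\<lambda>y. y $ i * y $ j / w y)" for i j
  proof (rule laws_integrable_bounded[OF Q])
    show "(\<lambda>y. y $ i * y $ j / w y) \<in> borel_measurable borel" using wm by measurable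
    fix y :: "real^'d"
    have "\<bar>y $ i * y $ j\<bar> \<le> (y $ i)\<^sup>2 + (y $ j)\<^sup>2"
    proof -
      have "2 * \<bar>y $ i\<bar> * \<bar>y $ j\<bar> \<le> (y $ i)\<^sup>2 + (y $ j)\<^sup>2"
        using sum_squares_bound[of "\<bar>y $ i\<bar>" "\<bar>y $ j\<bar>"] by simp
      moreover have "0 \<le> \<bar>y $ i\<bar> * \<bar>y $ j\<bar>" by simp
      ultimately show ?thesis unfolding abs_mult by linarith
    qed
    then have "\<bar>y $ i * y $ j\<bar> / w y \<le> ((y $ i)\<^sup>2 + (y $ j)\<^sup>2) / w y"
      using wp[of y] by (intro divide_right_mono) auto
    also have "\<dots> \<le> K i + K j" using sq[of y i] sq[of y j] by (simp add: add_divide_distrib)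
    finally show "norm (y $ i * y $ j / w y) \<le> K i + K j" using wp[of y] by (simp add: abs_mult)
  qed
  have pt: "(x \<bullet> y)\<^sup>2 / w y = (\<Sum>i\<in>UNIV. \<Sum>j\<in>UNIV. x $ i * x $ j * (y $ i * y $ j / w y))" for y
    by (simp add: inner_vec_def power2_eq_square sum_product sum_divide_distrib mult_ac)
  have "(\<integral>y. (x \<bullet> y)\<^sup>2 / w y \<partial>Q) = (\<Sum>i\<in>UNIV. \<Sum>j\<in>UNIV. x $ i * x $ j * (\<integral>y. y $ i * y $ j / w y \<partial>Q))"
    unfolding pt using int
    by (subst Bochner_Integration.integral_sum; (intro Bochner_Integration.integrable_sum integrable_mult_right int)?)
       (intro sum.cong refl, subst Bochner_Integration.integral_sum, simp_all only: integral_mult_right_zero integrable_mult_right)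
  then have "(\<nu> + real CARD('d)) * (\<integral>y. (x \<bullet> y)\<^sup>2 / w y \<partial>Q)
     = (\<Sum>i\<in>UNIV. \<Sum>j\<in>UNIV. x $ i * x $ j * scatter_map \<nu> Q A $ i $ j)"
    by (simp add: scatter_map_def w_def[symmetric] sum_distrib_left mult_ac)
  also have "\<dots> = x \<bullet> (scatter_map \<nu> Q A *v x)"
    by (simp add: inner_vec_def matrix_vector_mult_def sum_distrib_left mult_ac)
  finally show ?thesis by (simp add: w_def)
qed

lemma tendsto_quadratic_form:
  fixes A :: "nat \<Rightarrow> real^'n^'n"
  assumes "\<And>i j. (\<lambda>k. A k $ i $ j) \<longlonglongrightarrow> B $ i $ j"
  shows "(\<lambda>k. x \<bullet> (A k *v x)) \<longlonglongrightarrow> x \<bullet> (B *v x)"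
  unfolding inner_vec_def matrix_vector_mult_def by (auto intro!: tendsto_intros assms)

text \<open>The right side \<open>T\<close> of the equation is monotone in \<open>A\<close>. A large multiple \<open>t I\<close> satisfies \<open>T(t I) \<le> t I\<close>,
  so the iterates of \<open>T\<close> from there decrease to a positive semidefinite limit \<open>B\<close>. If \<open>B\<close> is positive definite
  it solves the equation. If \<open>B\<close> is degenerate, the limiting weights vanish off a proper subspace \<open>H\<close>; comparing
  the trace of the equation on \<open>H\<close> with the trace bound for the iterates shows that \<open>H\<close> carries at least the mass
  \<open>1 - (d - dim H) / (\<nu> + d)\<close>, which the class \<open>\<U>\<close> excludes.\<close>

proposition U_laws_imp_solves_scatter:
  assumes QU: "Q \<in> U_laws (\<nu> + real CARD('d))" and nu: "\<nu> > 0"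
  shows "\<exists>A :: real^'d^'d. solves_scatter \<nu> Q A"
proof -
  define n where "n = CARD('d)"
  define a where "a = \<nu> + real n"
  have a: "a > 0" using nu by (simp add: a_def)
  have Q: "Q \<in> laws" using QU by (simp add: U_laws_def)
  interpret Q: prob_space Q using Q by (rule laws_prob_space)
  have U: "measure Q H < 1 - (real n - real (dim H)) / a" if "subspace H" "dim H < n" for H :: "(real^'d) set"
    using QU that by (simp add: U_laws_def n_def a_def)
  let ?T = "scatter_map \<nu> Q :: real^'d^'d \<Rightarrow> real^'d^'d"
  have T_pd: "?T A \<in> pd_mats" if A: "A \<in> pd_mats" for A
  proof -
    have "0 < x \<bullet> (?T A *v x)" if x: "x \<noteq> 0" for x
    proof -
      let ?f = "\<lambda>y. (x \<bullet> y)\<^sup>2 / (\<nu> + y \<bullet> (matrix_inv A *v y))"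
      have "0 \<le> (\<integral>y. ?f y \<partial>Q)" by (intro integral_nonneg_AE AE_I2 weighted_square_nonneg A nu)
      moreover have "(\<integral>y. ?f y \<partial>Q) \<noteq> 0"
      proof
        assume "(\<integral>y. ?f y \<partial>Q) = 0"
        then have "AE y in Q. ?f y = 0"
          using integrable_weighted_square[OF A nu Q, of x] weighted_square_nonneg[OF A nu, of x]
          by (subst (asm) integral_nonneg_eq_0_iff_AE) auto
        then have ae: "AE y in Q. y \<in> {y. x \<bullet> y = 0}"
        proof eventually_elim
          case (elim y)
          then show ?case using weight_pos(1)[OF A nu, of y] by simp
        qed
        have cl: "closed {y. x \<bullet> y = 0}" by (rule closed_hyperplane)
        then have "measure Q {y. x \<bullet> y = 0} = 1"
          using ae by (subst Q.prob_eq_1) (auto simp: laws_sets[OF Q])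
        moreover have "measure Q {y. x \<bullet> y = 0} < 1"
        proof -
          have d: "dim {y. x \<bullet> y = 0} = n - 1" using dim_hyperplane[OF x] by (simp add: n_def)
          have "n > 0" by (simp add: n_def)
          then have "measure Q {y. x \<bullet> y = 0} < 1 - (real n - real (n - 1)) / a"
            using U[OF subspace_hyperplane, of x] d by simp
          also have "\<dots> \<le> 1" using a by simp
          finally show ?thesis .
        qed
        ultimately show False by simp
      qed
      ultimately show ?thesis unfolding scatter_map_quadratic[OF A nu Q] using nu by (simp add: add_pos_nonneg)
    qed
    then show ?thesis using scatter_map_sym[of \<nu> Q A] by (simp add: pd_mats_def)
  qed
  have T_mono: "x \<bullet> (?T A *v x) \<le> x \<bullet> (?T B *v x)"
    if A: "A \<in> pd_mats" and B: "B \<in> pd_mats" and le: "\<And>x. x \<bullet> (A *v x) \<le> x \<bullet> (B *v x)" for A B x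
    unfolding scatter_map_quadratic[OF A nu Q] scatter_map_quadratic[OF B nu Q]
  proof (intro mult_left_mono integral_mono integrable_weighted_square A B nu Q)
    fix y
    show "(x \<bullet> y)\<^sup>2 / (\<nu> + y \<bullet> (matrix_inv A *v y)) \<le> (x \<bullet> y)\<^sup>2 / (\<nu> + y \<bullet> (matrix_inv B *v y))"
      using inverse_form_antimono[OF A B le, of y] weight_pos(1)[OF B nu, of y]
      by (intro divide_left_mono) (auto intro: mult_pos_pos weight_pos[OF A nu])
  qed (use nu in auto)
  obtain t where t: "t > 0" "\<And>x. x \<bullet> (?T (t *\<^sub>R mat 1) *v x) \<le> t * (x \<bullet> x)"
  proof -
    \<comment> \<open>Up to the factor \<open>t |x|\<^sup>2\<close>, \<open>\<phi> m\<close> bounds the integrand of \<open>x' T(t I) x\<close> for \<open>t = m + 1\<close>; it tends to \<open>0\<close> with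
      growing \<open>t\<close>, and dominated convergence makes its integral smaller than \<open>1 / a\<close>.\<close>
    define \<phi> where "\<phi> m y = (y \<bullet> y) / (\<nu> * real (Suc m) + y \<bullet> y)" for m and y :: "real^'d"
    have den: "0 < \<nu> * real (Suc m) + y \<bullet> y" for m and y :: "real^'d"
      using nu by (intro add_pos_nonneg) auto
    have \<phi>01: "0 \<le> \<phi> m y" "\<phi> m y \<le> 1" for m y
    proof -
      have "0 < \<nu> * real (Suc m) + y \<bullet> y" by (rule den)
      moreover have "0 \<le> \<nu> * real (Suc m)" using nu by simp
      ultimately show "\<phi> m y \<le> 1" unfolding \<phi>_def by (subst divide_le_eq_1_pos) simp_all
      show "0 \<le> \<phi> m y" unfolding \<phi>_def
        using \<open>0 < \<nu> * real (Suc m) + y \<bullet> y\<close> by (intro divide_nonneg_nonneg inner_ge_zero less_imp_le)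
    qed
    have \<phi>m: "\<phi> m \<in> borel_measurable borel" for m unfolding \<phi>_def by measurable
    have \<phi>0: "(\<lambda>m. \<phi> m y) \<longlonglongrightarrow> 0" for y
    proof (rule real_tendsto_sandwich[OF _ _ tendsto_const])
      show "\<forall>\<^sub>F m in sequentially. \<phi> m y \<le> (y \<bullet> y / \<nu>) * inverse (real (Suc m))"
      proof (intro always_eventually allI)
        fix m
        have "\<phi> m y \<le> (y \<bullet> y) / (\<nu> * real (Suc m))"
          unfolding \<phi>_def using nu den by (intro divide_left_mono mult_pos_pos) auto
        then show "\<phi> m y \<le> (y \<bullet> y / \<nu>) * inverse (real (Suc m))" by (simp add: field_simps)
      qed
      show "(\<lambda>m. y \<bullet> y / \<nu> * inverse (real (Suc m))) \<longlonglongrightarrow> 0"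
        using tendsto_mult_right_zero[OF LIMSEQ_inverse_real_of_nat] .
    qed (simp add: \<phi>01)
    have "(\<lambda>m. \<integral>y. \<phi> m y \<partial>Q) \<longlonglongrightarrow> (\<integral>y. 0 \<partial>Q)"
      by (rule integral_dominated_convergence[where w = "\<lambda>_. 1"])
         (use \<phi>0 \<phi>01 \<phi>m in \<open>auto simp: laws_measurable[OF Q]\<close>)
    then have "\<forall>\<^sub>F m in sequentially. (\<integral>y. \<phi> m y \<partial>Q) < 1 / a" using a by (intro order_tendstoD) auto
    then obtain m where m: "(\<integral>y. \<phi> m y \<partial>Q) < 1 / a" by (auto dest: eventually_happens)
    define t where "t = real (Suc m)"
    have t: "t > 0" by (simp add: t_def)
    have "x \<bullet> (?T (t *\<^sub>R mat 1) *v x) \<le> t * (x \<bullet> x)" for x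
    proof -
      have "(\<integral>y. (x \<bullet> y)\<^sup>2 / (\<nu> + y \<bullet> (matrix_inv (t *\<^sub>R mat 1) *v y)) \<partial>Q) \<le> (\<integral>y. t * (x \<bullet> x) * \<phi> m y \<partial>Q)"
      proof (intro integral_mono integrable_weighted_square scaled_mat_pd t nu Q)
        show "integrable Q (\<lambda>y. t * (x \<bullet> x) * \<phi> m y)"
          using \<phi>01 \<phi>m by (intro integrable_mult_right laws_integrable_bounded[OF Q, of _ 1]) auto
        fix y
        have "(x \<bullet> y)\<^sup>2 / (\<nu> + y \<bullet> (matrix_inv (t *\<^sub>R mat 1) *v y)) = t * (x \<bullet> y)\<^sup>2 / (\<nu> * t + y \<bullet> y)"
          using t nu den[of m y] by (simp add: scaled_mat_pd(2) scaleR_matrix_vector_assoc[symmetric] field_simps)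
        also have "\<dots> \<le> t * ((x \<bullet> x) * (y \<bullet> y)) / (\<nu> * t + y \<bullet> y)"
          using t den[of m y] Cauchy_Schwarz_ineq[of x y] by (intro divide_right_mono mult_left_mono) (auto simp: t_def)
        finally show "(x \<bullet> y)\<^sup>2 / (\<nu> + y \<bullet> (matrix_inv (t *\<^sub>R mat 1) *v y)) \<le> t * (x \<bullet> x) * \<phi> m y"
          by (simp add: \<phi>_def t_def)
      qed
      also have "\<dots> = t * (x \<bullet> x) * (\<integral>y. \<phi> m y \<partial>Q)" by simp
      also have "\<dots> \<le> t * (x \<bullet> x) * (1 / a)" using m t by (intro mult_left_mono) auto
      finally have "a * (\<integral>y. (x \<bullet> y)\<^sup>2 / (\<nu> + y \<bullet> (matrix_inv (t *\<^sub>R mat 1) *v y)) \<partial>Q) \<le> a * (t * (x \<bullet> x) * (1 / a))"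
        using a by (intro mult_left_mono) auto
      then show ?thesis
        unfolding scatter_map_quadratic[OF scaled_mat_pd(1)[OF t] nu Q] using a by (simp add: a_def n_def)
    qed
    with t show ?thesis by (rule that)
  qed
  define A where "A k = (?T ^^ k) (t *\<^sub>R mat 1)" for k
  have A_Suc: "A (Suc k) = ?T (A k)" for k by (simp add: A_def)
  have pd: "A k \<in> pd_mats" for k
    by (induction k) (simp_all add: A_Suc T_pd, simp add: A_def scaled_mat_pd(1)[OF t(1)])
  have dec: "x \<bullet> (A (Suc k) *v x) \<le> x \<bullet> (A k *v x)" for k x
  proof (induction k arbitrary: x)
    case 0
    have "t * (x \<bullet> x) = x \<bullet> ((t *\<^sub>R mat 1) *v x)" by (simp flip: scaleR_matrix_vector_assoc)
    then show ?case using t(2)[of x] by (simp add: A_def)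
  next
    case (Suc k)
    show ?case unfolding A_Suc[of "Suc k"] A_Suc[of k]
      using T_mono[OF pd[of "Suc k"] pd[of k] Suc.IH] by (simp add: A_Suc)
  qed
  have decs: "decseq (\<lambda>k. x \<bullet> (A k *v x))" for x by (rule decseq_SucI) (rule dec)
  have conv: "convergent (\<lambda>k. x \<bullet> (A k *v x))" for x
  proof -
    have "bdd_below (range (\<lambda>k. x \<bullet> (A k *v x)))"
      by (rule bdd_belowI[of _ 0]) (auto intro: pd_mats_nonneg[OF pd])
    then show ?thesis using LIMSEQ_decseq_INF[OF _ decs[of x]] by (auto simp: convergent_def)
  qed
  \<comment> \<open>Polarization turns convergence of the quadratic forms into convergence of the entries.\<close>
  have entry: "A k $ i $ j = ((axis i 1 + axis j 1) \<bullet> (A k *v (axis i 1 + axis j 1))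
      - axis i 1 \<bullet> (A k *v axis i 1) - axis j 1 \<bullet> (A k *v axis j 1)) / 2" for k i j
  proof -
    have "A k $ i $ j = axis i 1 \<bullet> (A k *v axis j 1)"
      by (simp add: inner_axis' matrix_vector_mul_component inner_axis)
    then show ?thesis
      using sym_mats_bilinear_commute[OF pd_mats_sym_mats[OF pd[of k]], of "axis i 1" "axis j 1"]
      by (simp add: matrix_vector_right_distrib inner_add_left inner_add_right)
  qed
  have conv_entry: "convergent (\<lambda>k. A k $ i $ j)" for i j
  proof -
    obtain l where l: "\<And>x. (\<lambda>k. x \<bullet> (A k *v x)) \<longlonglongrightarrow> l x" using conv unfolding convergent_def by metis
    have "(\<lambda>k. A k $ i $ j) \<longlonglongrightarrow> (l (axis i 1 + axis j 1) - l (axis i 1) - l (axis j 1)) / 2"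
      unfolding entry by (intro tendsto_divide tendsto_diff l tendsto_const) simp
    then show ?thesis by (auto simp: convergent_def)
  qed
  define B where "B = (\<chi> i j. lim (\<lambda>k. A k $ i $ j))"
  have AB: "(\<lambda>k. A k $ i $ j) \<longlonglongrightarrow> B $ i $ j" for i j
    using conv_entry[of i j] by (simp add: B_def convergent_LIMSEQ_iff)
  have ABq: "(\<lambda>k. x \<bullet> (A k *v x)) \<longlonglongrightarrow> x \<bullet> (B *v x)" for x
    using AB by (rule tendsto_quadratic_form)
  have B_le: "x \<bullet> (B *v x) \<le> x \<bullet> (A k *v x)" for x k using decseq_ge[OF decs ABq] .
  have B_nn: "0 \<le> x \<bullet> (B *v x)" for x
    by (rule LIMSEQ_le_const[OF ABq]) (auto intro: pd_mats_nonneg[OF pd])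
  have B_sym: "B \<in> sym_mats"
  proof -
    have "A k $ i $ j = A k $ j $ i" for i j k
      using pd_mats_symD[OF pd[of k]] by (metis (no_types) transpose_def vec_lambda_beta)
    then show ?thesis by (simp add: sym_mats_def transpose_def B_def)
  qed
  define s where "s k y = y \<bullet> (matrix_inv (A k) *v y)" for k y
  \<comment> \<open>The weights of the equation. They decrease along the iteration because the forms do, and their limit \<open>h\<close> exists
    even where the matrices degenerate.\<close>
  define r where "r k y = 1 / (\<nu> + s k y)" for k y
  have s_nn: "0 \<le> s k y" for k y unfolding s_def by (intro pd_mats_nonneg matrix_inv_pd_mats pd)
  have den: "\<nu> + s k y > 0" for k y using s_nn[of k y] nu by simp
  have r_pos: "r k y > 0" for k y using den[of k y] by (simp add: r_def)
  have r_dec: "decseq (\<lambda>k. r k y)" for y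
  proof (rule decseq_SucI)
    fix k
    have "s k y \<le> s (Suc k) y" unfolding s_def by (intro inverse_form_antimono pd dec)
    then show "r (Suc k) y \<le> r k y" unfolding r_def using den by (intro divide_left_mono mult_pos_pos) auto
  qed
  have rm: "r k \<in> borel_measurable borel" for k unfolding r_def s_def by measurable
  define h where "h y = lim (\<lambda>k. r k y)" for y
  have rh: "(\<lambda>k. r k y) \<longlonglongrightarrow> h y" for y
  proof -
    have "bdd_below (range (\<lambda>k. r k y))"
      by (rule bdd_belowI[of _ 0]) (use r_pos in \<open>auto simp: less_imp_le\<close>)
    then show ?thesis using LIMSEQ_decseq_INF[OF _ r_dec[of y]]
      by (auto simp: h_def convergent_LIMSEQ_iff[symmetric] convergent_def)
  qed
  have hm: "h \<in> borel_measurable borel" by (rule borel_measurable_LIMSEQ_real[OF rh rm])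
  have h_nn: "0 \<le> h y" for y by (rule LIMSEQ_le_const[OF rh]) (use r_pos in \<open>auto simp: less_imp_le\<close>)
  have h_le: "h y \<le> r k y" for y k using decseq_ge[OF r_dec rh] .
  have \<nu>r: "0 \<le> 1 - \<nu> * r k y" "1 - \<nu> * r k y \<le> 1" for k y
    using den[of k y] s_nn[of k y] nu r_pos[of k y] by (auto simp: r_def)
  have \<nu>h: "0 \<le> 1 - \<nu> * h y" "1 - \<nu> * h y \<le> 1" for y
  proof -
    have "\<nu> * h y \<le> \<nu> * r 0 y" using nu h_le by simp
    then show "0 \<le> 1 - \<nu> * h y" using \<nu>r(1)[of 0 y] by simp
    show "1 - \<nu> * h y \<le> 1" using nu h_nn[of y] by simp
  qed
  have Aform: "x \<bullet> (A (Suc k) *v x) = a * (\<integral>y. (x \<bullet> y)\<^sup>2 * r k y \<partial>Q)" for k x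
    unfolding A_Suc scatter_map_quadratic[OF pd nu Q] by (simp add: r_def s_def a_def n_def)
  have xr: "0 \<le> (x \<bullet> y)\<^sup>2 * r k y" "(x \<bullet> y)\<^sup>2 * r k y \<le> x \<bullet> (A 0 *v x)" for x y k
  proof -
    show "0 \<le> (x \<bullet> y)\<^sup>2 * r k y" using r_pos[of k y] by simp
    have "(x \<bullet> y)\<^sup>2 * r k y \<le> x \<bullet> (A k *v x)"
      using weighted_square_le[OF pd nu, of x y k] by (simp add: r_def s_def)
    also have "\<dots> \<le> x \<bullet> (A 0 *v x)" using decseqD[OF decs, of 0 k] by simp
    finally show "(x \<bullet> y)\<^sup>2 * r k y \<le> x \<bullet> (A 0 *v x)" .
  qed
  have xh: "0 \<le> (x \<bullet> y)\<^sup>2 * h y" "(x \<bullet> y)\<^sup>2 * h y \<le> x \<bullet> (A 0 *v x)" for x y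
  proof -
    show "0 \<le> (x \<bullet> y)\<^sup>2 * h y" using h_nn[of y] by simp
    have "(x \<bullet> y)\<^sup>2 * h y \<le> (x \<bullet> y)\<^sup>2 * r 0 y" using h_le by (intro mult_left_mono) auto
    then show "(x \<bullet> y)\<^sup>2 * h y \<le> x \<bullet> (A 0 *v x)" using xr(2)[of x y 0] by linarith
  qed
  have int_xr: "integrable Q (\<lambda>y. (x \<bullet> y)\<^sup>2 * r k y)" for x k
  proof (rule laws_integrable_bounded[OF Q])
    show "norm ((x \<bullet> y)\<^sup>2 * r k y) \<le> x \<bullet> (A 0 *v x)" for y
      unfolding real_norm_def abs_of_nonneg[OF xr(1)] by (rule xr(2))
    show "(\<lambda>y. (x \<bullet> y)\<^sup>2 * r k y) \<in> borel_measurable borel" using rm by measurable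
  qed
  have int_xh: "integrable Q (\<lambda>y. (x \<bullet> y)\<^sup>2 * h y)" for x
  proof (rule laws_integrable_bounded[OF Q])
    show "norm ((x \<bullet> y)\<^sup>2 * h y) \<le> x \<bullet> (A 0 *v x)" for y
      unfolding real_norm_def abs_of_nonneg[OF xh(1)] by (rule xh(2))
    show "(\<lambda>y. (x \<bullet> y)\<^sup>2 * h y) \<in> borel_measurable borel" using hm by measurable
  qed
  \<comment> \<open>The three properties of the limit: the equation itself, with limiting weights \<open>h\<close> (\<open>F1\<close>); the limit of the trace
    inequality for the iterates (\<open>F2\<close>); and the bound on \<open>h\<close> by the dual form (\<open>F3\<close>), in which no inverse of
    \<open>B\<close> occurs.\<close>
  have F1: "x \<bullet> (B *v x) = a * (\<integral>y. (x \<bullet> y)\<^sup>2 * h y \<partial>Q)" for x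
  proof -
    have "(\<lambda>k. \<integral>y. (x \<bullet> y)\<^sup>2 * r k y \<partial>Q) \<longlonglongrightarrow> (\<integral>y. (x \<bullet> y)\<^sup>2 * h y \<partial>Q)"
    proof (rule integral_dominated_convergence[where w = "\<lambda>_. x \<bullet> (A 0 *v x)"])
      show "AE y in Q. (\<lambda>k. (x \<bullet> y)\<^sup>2 * r k y) \<longlonglongrightarrow> (x \<bullet> y)\<^sup>2 * h y"
        by (intro AE_I2 tendsto_mult tendsto_const rh)
      show "AE y in Q. norm ((x \<bullet> y)\<^sup>2 * r k y) \<le> x \<bullet> (A 0 *v x)" for k
        by (intro AE_I2) (simp only: real_norm_def abs_of_nonneg[OF xr(1)] xr(2))
    qed (use int_xr[of x] int_xh[of x] in auto)
    then have "(\<lambda>k. x \<bullet> (A (Suc k) *v x)) \<longlonglongrightarrow> a * (\<integral>y. (x \<bullet> y)\<^sup>2 * h y \<partial>Q)"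
      unfolding Aform by (intro tendsto_mult tendsto_const)
    then show ?thesis using LIMSEQ_Suc[OF ABq[of x]] by (rule LIMSEQ_unique[rotated])
  qed
  have F2: "a * (\<integral>y. 1 - \<nu> * h y \<partial>Q) \<le> real n"
  proof -
    have "a * (\<integral>y. 1 - \<nu> * r k y \<partial>Q) \<le> real n" for k
    proof -
      obtain W :: "real^'d^'d" and c where W: "invertible W" "W ** A k ** transpose W = mat 1"
        by (rule simultaneous_diagonalization[OF pd pd_mats_sym_mats[OF pd], of k k])
      have sk: "s k y = (\<Sum>i\<in>UNIV. (W $ i \<bullet> y)\<^sup>2)" for y
        using inverse_form_congruence[OF pd_mats_invertible[OF pd] W(1), of y k]
        by (simp add: W(2) s_def inner_vec_def[of "W *v y"] matrix_vector_mul_component power2_eq_square)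
      have wi: "W $ i \<bullet> (A k *v (W $ i)) = 1" for i
        using congruence_row_entry[of "($) W" "A k" i i] by (simp add: W(2) mat_def)
      have pt: "1 - \<nu> * r k y = (\<Sum>i\<in>UNIV. (W $ i \<bullet> y)\<^sup>2 * r k y)" for y
        unfolding sum_distrib_right[symmetric] sk[symmetric] r_def using den[of k y] by (simp add: field_simps)
      have "a * (\<integral>y. 1 - \<nu> * r k y \<partial>Q) = (\<Sum>i\<in>UNIV. a * (\<integral>y. (W $ i \<bullet> y)\<^sup>2 * r k y \<partial>Q))"
        unfolding pt by (subst Bochner_Integration.integral_sum) (auto simp: int_xr sum_distrib_left)
      also have "\<dots> = (\<Sum>i\<in>UNIV. W $ i \<bullet> (A (Suc k) *v (W $ i)))" by (simp only: Aform)
      also have "\<dots> \<le> (\<Sum>i\<in>(UNIV::'d set). 1)" by (intro sum_mono) (metis dec wi)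
      finally show ?thesis by (simp add: n_def)
    qed
    moreover have "(\<lambda>k. \<integral>y. 1 - \<nu> * r k y \<partial>Q) \<longlonglongrightarrow> (\<integral>y. 1 - \<nu> * h y \<partial>Q)"
    proof (rule integral_dominated_convergence[where w = "\<lambda>_. 1"])
      show "AE y in Q. (\<lambda>k. 1 - \<nu> * r k y) \<longlonglongrightarrow> 1 - \<nu> * h y"
        by (intro AE_I2 tendsto_intros rh)
      show "AE y in Q. norm (1 - \<nu> * r k y) \<le> 1" for k
        by (intro AE_I2) (simp only: real_norm_def abs_of_nonneg[OF \<nu>r(1)] \<nu>r(2))
      show "(\<lambda>y. 1 - \<nu> * h y) \<in> borel_measurable Q" unfolding laws_measurable[OF Q] using hm by measurable
      show "(\<lambda>y. 1 - \<nu> * r k y) \<in> borel_measurable Q" for k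
        unfolding laws_measurable[OF Q] using rm[of k] by measurable
    qed simp
    then have "(\<lambda>k. a * (\<integral>y. 1 - \<nu> * r k y \<partial>Q)) \<longlonglongrightarrow> a * (\<integral>y. 1 - \<nu> * h y \<partial>Q)"
      by (intro tendsto_mult tendsto_const)
    ultimately show ?thesis by (intro LIMSEQ_le_const2) auto
  qed
  have F3: "h y * (\<nu> + 2 * (v \<bullet> y) - v \<bullet> (B *v v)) \<le> 1" for v y
  proof (rule LIMSEQ_le_const2)
    show "(\<lambda>k. r k y * (\<nu> + 2 * (v \<bullet> y) - v \<bullet> (A k *v v))) \<longlonglongrightarrow> h y * (\<nu> + 2 * (v \<bullet> y) - v \<bullet> (B *v v))"
      by (intro tendsto_mult tendsto_diff tendsto_const rh ABq)
    have "r k y * (\<nu> + 2 * (v \<bullet> y) - v \<bullet> (A k *v v)) \<le> r k y * (\<nu> + s k y)" for k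
      using inverse_form_ge[OF pd, of v y k] r_pos[of k y] by (intro mult_left_mono) (auto simp: s_def)
    moreover have "r k y * (\<nu> + s k y) = 1" for k using den[of k y] by (simp add: r_def)
    ultimately show "\<exists>N. \<forall>k\<ge>N. r k y * (\<nu> + 2 * (v \<bullet> y) - v \<bullet> (A k *v v)) \<le> 1" by metis
  qed
  obtain W :: "real^'d^'d" and c where W: "invertible W" "W ** mat 1 ** transpose W = mat 1"
      "W ** B ** transpose W = diag_mat c"
    using simultaneous_diagonalization[OF _ B_sym, of "mat 1"] scaled_mat_pd(1)[of 1] by auto
  define w where "w i = W $ i" for i
  have ww: "w i \<bullet> w j = (if i = j then 1 else 0)" for i j
  proof -
    have "W $ i \<bullet> (mat 1 *v W $ j) = (mat 1 :: real^'d^'d) $ i $ j"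
      using congruence_row_entry[of "($) W" "mat 1" i j] W(2) by simp
    then show ?thesis by (simp only: matrix_vector_mul_lid w_def) (simp add: mat_def)
  qed
  have wB: "w i \<bullet> (B *v w j) = (if i = j then c i else 0)" for i j
    using congruence_row_entry[of "($) W" B i j] W(3) by (simp add: diag_mat_def w_def)
  have c_nn: "c i \<ge> 0" for i using wB[of i i] B_nn[of "w i"] by simp
  \<comment> \<open>In an orthonormal eigenbasis of \<open>B\<close>, \<open>I\<close> indexes the directions in which \<open>B\<close> does not degenerate.\<close>
  define I where "I = {i. c i > 0}"
  show ?thesis
  proof (cases "I = UNIV")
    case True
    then have "diag_mat c \<in> pd_mats" by (intro diag_mat_pd) (auto simp: I_def)
    then have Bpd: "B \<in> pd_mats"
      using congruence_pd_mats[OF _ invertible_matrix_inv[OF W(1)], of "diag_mat c"]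
        congruence_inverse[OF W(1), of B] by (simp add: W(3))
    have "h y = 1 / (\<nu> + y \<bullet> (matrix_inv B *v y))" for y
    proof (rule antisym)
      have p: "\<nu> + y \<bullet> (matrix_inv B *v y) > 0" using weight_pos[OF Bpd nu] by simp
      show "1 / (\<nu> + y \<bullet> (matrix_inv B *v y)) \<le> h y"
      proof (rule LIMSEQ_le_const[OF rh])
        have "1 / (\<nu> + y \<bullet> (matrix_inv B *v y)) \<le> r k y" for k
          using inverse_form_antimono[OF Bpd pd B_le, of y] den[of k y] p
          unfolding r_def s_def by (intro divide_left_mono mult_pos_pos) auto
        then show "\<exists>N. \<forall>k\<ge>N. 1 / (\<nu> + y \<bullet> (matrix_inv B *v y)) \<le> r k y" by blast
      qed
      have "h y * (\<nu> + y \<bullet> (matrix_inv B *v y)) \<le> 1"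
        using F3[of y "matrix_inv B *v y"] inverse_form_attained[OF Bpd, of y] by (simp add: algebra_simps)
      then show "h y \<le> 1 / (\<nu> + y \<bullet> (matrix_inv B *v y))" using p by (simp add: field_simps)
    qed
    then have "solves_scatter \<nu> Q B"
      unfolding solves_scatter_def using Bpd F1 by (simp add: a_def n_def)
    then show ?thesis by blast
  next
    case False
    \<comment> \<open>\<open>H\<close> is the range of \<open>B\<close>.\<close>
    define H where "H = {y. \<forall>i\<in>-I. w i \<bullet> y = 0}"
    have H: "subspace H" by (auto simp: H_def subspace_def inner_add_right)
    have "closed H" using H by (rule closed_subspace)
    then have Hm: "H \<in> sets Q" "-H \<in> sets Q" by (auto simp: laws_sets[OF Q] open_Compl)
    have expand: "y = (\<Sum>i\<in>UNIV. (w i \<bullet> y) *\<^sub>R w i)" for y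
    proof -
      have "transpose W ** W = mat 1" using W(2) by (simp add: matrix_left_right_inverse)
      then have "y = transpose W *v (W *v y)" by (metis matrix_vector_mul_assoc matrix_vector_mul_lid)
      then have "y $ k = (transpose W *v (W *v y)) $ k" for k by simp
      moreover have "(transpose W *v z) $ k = (\<Sum>i\<in>UNIV. W $ i $ k * z $ i)" for z k
        by (simp add: matrix_vector_mult_def transpose_def del: transpose_matrix_vector)
      ultimately have "y $ k = (\<Sum>i\<in>UNIV. W $ i $ k * (W $ i \<bullet> y))" for k
        by (simp only: matrix_vector_mul_component)
      then show ?thesis by (simp add: vec_eq_iff w_def sum_component mult.commute)
    qed
    have "H \<subseteq> span (w ` I)"
    proof
      fix y assume y: "y \<in> H"
      have "y = (\<Sum>i\<in>I. (w i \<bullet> y) *\<^sub>R w i)"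
        using y by (subst expand) (intro sum.mono_neutral_right, auto simp: H_def)
      also have "\<dots> \<in> span (w ` I)" by (intro span_sum span_scale span_base) auto
      finally show "y \<in> span (w ` I)" .
    qed
    then have "dim H \<le> card (w ` I)" by (intro dim_le_card) auto
    also have "\<dots> \<le> card I" by (intro card_image_le) auto
    finally have dimH: "dim H \<le> card I" .
    also have "card I < n" unfolding n_def using False by (intro psubset_card_mono) auto
    finally have mH: "measure Q H < 1 - (real n - real (dim H)) / a" by (intro U H)
    \<comment> \<open>\<open>\<sigma>\<close> is the inverse form of \<open>B\<close> on its range.\<close>
    define \<sigma> where "\<sigma> y = (\<Sum>i\<in>I. (w i \<bullet> y)\<^sup>2 / c i)" for y
    have F5: "h y * (\<nu> + \<sigma> y) \<le> 1" for y
    proof -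
      define v where "v = (\<Sum>i\<in>I. ((w i \<bullet> y) / c i) *\<^sub>R w i)"
      have vy: "v \<bullet> y = \<sigma> y" by (simp add: v_def \<sigma>_def inner_sum_left power2_eq_square)
      have wBv: "w i \<bullet> (B *v v) = w i \<bullet> y" if "i \<in> I" for i
      proof -
        have "w i \<bullet> (B *v v) = (\<Sum>j\<in>I. (w j \<bullet> y) / c j * (w i \<bullet> (B *v w j)))"
          by (simp add: v_def matrix_vector_mult_scaleR inner_sum_right linear_sum[OF matrix_vector_mul_linear])
        also have "\<dots> = (\<Sum>j\<in>I. if j = i then w i \<bullet> y else 0)"
          using that by (intro sum.cong) (auto simp: wB I_def)
        finally show ?thesis using that by simp
      qed
      have "v \<bullet> (B *v v) = (\<Sum>i\<in>I. (w i \<bullet> y) / c i * (w i \<bullet> (B *v v)))"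
        by (subst (1) v_def) (simp add: inner_sum_left)
      also have "\<dots> = \<sigma> y" by (simp add: \<sigma>_def wBv power2_eq_square)
      finally have "v \<bullet> (B *v v) = \<sigma> y" .
      with F3[of y v] vy show ?thesis by (simp add: add.commute)
    qed
    have F6: "h y = 0" if y: "y \<notin> H" for y
    proof (rule ccontr)
      assume "h y \<noteq> 0"
      then have hp: "h y > 0" using h_nn[of y] by simp
      obtain i where i: "i \<notin> I" "w i \<bullet> y \<noteq> 0" using y by (auto simp: H_def)
      have ci: "c i = 0" using i(1) c_nn[of i] by (simp add: I_def)
      \<comment> \<open>In a degenerate direction the dual bound can be violated at will if \<open>h y > 0\<close>.\<close>
      define t where "t = (1 / h y) / (w i \<bullet> y)"
      have "h y * (\<nu> + 2 * ((t *\<^sub>R w i) \<bullet> y) - (t *\<^sub>R w i) \<bullet> (B *v (t *\<^sub>R w i))) \<le> 1" by (rule F3)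
      moreover have "(t *\<^sub>R w i) \<bullet> (B *v (t *\<^sub>R w i)) = 0" by (simp add: matrix_vector_mult_scaleR wB ci)
      moreover have "(t *\<^sub>R w i) \<bullet> y = 1 / h y" using i(2) by (simp add: t_def)
      ultimately have "h y * (\<nu> + 2 * (1 / h y)) \<le> 1" by (simp only: diff_0_right)
      then show False using hp nu mult_pos_pos[OF hp nu] by (simp add: distrib_left)
    qed
    have int_\<sigma>h: "integrable Q (\<lambda>y. \<sigma> y * h y)"
    proof -
      have "integrable Q (\<lambda>y. \<Sum>i\<in>I. (1 / c i) * ((w i \<bullet> y)\<^sup>2 * h y))"
        by (intro Bochner_Integration.integrable_sum integrable_mult_right int_xh)
      then show ?thesis by (simp add: \<sigma>_def sum_distrib_right)
    qed
    have "a * (\<integral>y. \<sigma> y * h y \<partial>Q) = (\<Sum>i\<in>I. (1 / c i) * (a * (\<integral>y. (w i \<bullet> y)\<^sup>2 * h y \<partial>Q)))"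
    proof -
      have "(\<integral>y. \<sigma> y * h y \<partial>Q) = (\<integral>y. (\<Sum>i\<in>I. (1 / c i) * ((w i \<bullet> y)\<^sup>2 * h y)) \<partial>Q)"
        by (simp add: \<sigma>_def sum_distrib_right)
      also have "\<dots> = (\<Sum>i\<in>I. (1 / c i) * (\<integral>y. (w i \<bullet> y)\<^sup>2 * h y \<partial>Q))"
        by (subst Bochner_Integration.integral_sum)
          (intro integrable_mult_right int_xh, simp only: integral_mult_right_zero)
      finally show ?thesis by (simp add: sum_distrib_left)
    qed
    also have "\<dots> = (\<Sum>i\<in>I. 1)"
      by (intro sum.cong) (auto simp: F1[symmetric] wB I_def)
    finally have a\<sigma>: "a * (\<integral>y. \<sigma> y * h y \<partial>Q) = real (card I)" by simp
    have ind: "integrable Q (indicator (-H) :: _ \<Rightarrow> real)"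
      using Hm by (intro integrable_real_indicator) (auto simp: Q.emeasure_eq_measure)
    have "(\<integral>y. indicator (-H) y + \<sigma> y * h y \<partial>Q) \<le> (\<integral>y. 1 - \<nu> * h y \<partial>Q)"
    proof (intro integral_mono Bochner_Integration.integrable_add ind int_\<sigma>h)
      show "integrable Q (\<lambda>y. 1 - \<nu> * h y)"
      proof (rule laws_integrable_bounded[OF Q])
        show "norm (1 - \<nu> * h y) \<le> 1" for y
          unfolding real_norm_def abs_of_nonneg[OF \<nu>h(1)] by (rule \<nu>h(2))
        show "(\<lambda>y. 1 - \<nu> * h y) \<in> borel_measurable borel" using hm by measurable
      qed
      fix y show "indicator (-H) y + \<sigma> y * h y \<le> 1 - \<nu> * h y"
        using F5[of y] F6[of y] by (cases "y \<in> H") (auto simp: algebra_simps)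
    qed
    also have "(\<integral>y. indicator (-H) y + \<sigma> y * h y \<partial>Q) = measure Q (-H) + (\<integral>y. \<sigma> y * h y \<partial>Q)"
      using ind int_\<sigma>h by (simp add: Bochner_Integration.integral_add laws_space[OF Q])
    finally have "a * (measure Q (-H) + (\<integral>y. \<sigma> y * h y \<partial>Q)) \<le> a * (\<integral>y. 1 - \<nu> * h y \<partial>Q)"
      using a by (intro mult_left_mono) auto
    then have "a * measure Q (-H) + real (card I) \<le> real n" using F2 a\<sigma> by (simp add: distrib_left)
    moreover have "measure Q (-H) = 1 - measure Q H"
      using Q.prob_compl[OF Hm(1)] by (simp add: laws_space[OF Q] Compl_eq_Diff_UNIV)
    ultimately have "a * (1 - measure Q H) \<le> real n - real (dim H)" using dimH by simp
    then have False using mH a by (simp add: field_simps)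
    then show ?thesis ..
  qed
qed


section \<open>Rank one matrices and the Euclidean norm of matrices\<close>

definition outer :: "real^'n \<Rightarrow> real^'n^'n" where
  "outer z = (\<chi> i j. z $ i * z $ j)"

lemma outer_nth [simp]: "outer z $ i $ j = z $ i * z $ j"
  by (simp add: outer_def)

lemma inner_outer: "e \<bullet> outer z = z \<bullet> (e *v z)"
  by (simp add: inner_vec_def matrix_vector_mult_def sum_distrib_left mult_ac)

lemma outer_mult_vector: "outer z *v x = (z \<bullet> x) *\<^sub>R z"
  by (simp add: vec_eq_iff matrix_vector_mult_def inner_vec_def sum_distrib_left mult_ac)

lemma norm_outer: "norm (outer z) = z \<bullet> z"
proof -
  have "outer z \<bullet> outer z = (z \<bullet> z) * (z \<bullet> z)"
    by (simp add: inner_outer outer_mult_vector)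
  then show ?thesis by (simp add: norm_eq_sqrt_inner)
qed

lemma outer_sym: "outer z \<in> sym_mats"
  by (simp add: sym_mats_def transpose_def vec_eq_iff mult.commute)

lemma continuous_outer [continuous_intros]: "continuous_on S outer"
  unfolding outer_def by (intro continuous_intros)

lemma power2_norm_vec: "(norm (v :: real^'n))\<^sup>2 = (\<Sum>i\<in>UNIV. (v $ i)\<^sup>2)"
  unfolding power2_norm_eq_inner inner_vec_def by (simp add: power2_eq_square)

lemma power2_norm_matrix: "(norm (e :: real^'n^'m))\<^sup>2 = (\<Sum>i\<in>UNIV. (norm (e $ i))\<^sup>2)"
  by (simp add: power2_norm_eq_inner inner_vec_def)

lemma norm_matrix_vector_le:
  fixes e :: "real^'n^'m"
  shows "norm (e *v z) \<le> norm e * norm z"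
proof -
  have "(norm (e *v z))\<^sup>2 = (\<Sum>i\<in>UNIV. (e $ i \<bullet> z)\<^sup>2)"
    by (simp add: power2_norm_vec matrix_vector_mul_component)
  also have "\<dots> \<le> (\<Sum>i\<in>UNIV. (norm (e $ i))\<^sup>2 * (norm z)\<^sup>2)"
    by (intro sum_mono) (metis Cauchy_Schwarz_ineq power2_norm_eq_inner)
  also have "\<dots> = (norm e * norm z)\<^sup>2" by (simp add: power2_norm_matrix sum_distrib_right power_mult_distrib)
  finally show ?thesis by (rule power2_le_imp_le) simp
qed

lemma quadratic_le_norm:
  fixes e :: "real^'n^'n"
  shows "\<bar>z \<bullet> (e *v z)\<bar> \<le> norm e * (z \<bullet> z)"
proof -
  have "\<bar>z \<bullet> (e *v z)\<bar> \<le> norm z * norm (e *v z)" by (rule Cauchy_Schwarz_ineq2)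
  also have "\<dots> \<le> norm z * (norm e * norm z)" by (intro mult_left_mono norm_matrix_vector_le) auto
  finally show ?thesis by (simp add: power2_norm_eq_inner[symmetric] power2_eq_square mult_ac)
qed

text \<open>The radius \<open>1/2\<close> is a convenient value below \<open>1\<close>; the numerical constants below stem from it.\<close>

lemma near_identity_pd:
  fixes e :: "real^'n^'n"
  assumes e: "e \<in> sym_mats" "norm e \<le> 1/2"
  shows "mat 1 + e \<in> pd_mats"
proof -
  have "0 < x \<bullet> ((mat 1 + e) *v x)" if x: "x \<noteq> 0" for x
  proof -
    have "norm e * (x \<bullet> x) \<le> (1/2) * (x \<bullet> x)" using e(2) by (intro mult_right_mono) auto
    then have "\<bar>x \<bullet> (e *v x)\<bar> \<le> (1/2) * (x \<bullet> x)" using quadratic_le_norm[of x e] by linarith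
    moreover have "x \<bullet> x > 0" using x by simp
    moreover have "x \<bullet> ((mat 1 + e) *v x) = x \<bullet> x + x \<bullet> (e *v x)"
      by (simp add: matrix_vector_mult_add_rdistrib inner_add_right)
    ultimately show ?thesis by linarith
  qed
  moreover have "mat 1 + e \<in> sym_mats"
    using e(1) subspace_add[OF sym_mats_subspace pd_mats_sym_mats[OF mat_1_pd]] by blast
  ultimately show ?thesis by (simp add: pd_mats_def)
qed

text \<open>Entries of \<open>V e V'\<close> are forms of \<open>e\<close> in the rows of \<open>V\<close>, whose squared lengths are the diagonal entries of
  \<open>V V' = A\<close>.\<close>

lemma norm_congruence_le:
  fixes A V e :: "real^'n^'n"
  assumes VA: "V ** transpose V = A" and A: "\<forall>x. x \<bullet> (A *v x) \<le> \<kappa> * (x \<bullet> x)" and \<kappa>: "\<kappa> \<ge> 0"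
  shows "norm (V ** e ** transpose V) \<le> (real CARD('n))\<^sup>2 * \<kappa> * norm e"
proof -
  have row: "(norm (V $ i))\<^sup>2 \<le> \<kappa>" for i
  proof -
    have "(V ** transpose V) $ i $ i = V $ i \<bullet> V $ i"
      by (simp add: matrix_matrix_mult_def transpose_def inner_vec_def)
    then show ?thesis using form_bound_entries[OF A, of i] by (simp add: VA power2_norm_eq_inner)
  qed
  have entry: "norm ((V ** e ** transpose V) $ i $ j) \<le> \<kappa> * norm e" for i j
  proof -
    have "(V ** e ** transpose V) $ i $ j = V $ i \<bullet> (e *v V $ j)"
      using congruence_row_entry[of "($) V" e i j] by simp
    then have "norm ((V ** e ** transpose V) $ i $ j) \<le> norm (V $ i) * norm (e *v V $ j)"
      using Cauchy_Schwarz_ineq2 by simp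
    also have "\<dots> \<le> norm (V $ i) * (norm e * norm (V $ j))"
      by (intro mult_left_mono norm_matrix_vector_le) simp
    also have "\<dots> = (norm (V $ i) * norm (V $ j)) * norm e" by simp
    also have "\<dots> \<le> \<kappa> * norm e"
    proof (rule mult_right_mono)
      have "norm (V $ i) \<le> sqrt \<kappa>" "norm (V $ j) \<le> sqrt \<kappa>" using row by (simp_all add: real_le_rsqrt)
      then have "norm (V $ i) * norm (V $ j) \<le> sqrt \<kappa> * sqrt \<kappa>" using \<kappa> by (intro mult_mono) auto
      then show "norm (V $ i) * norm (V $ j) \<le> \<kappa>" using \<kappa> by simp
    qed simp
    finally show ?thesis .
  qed
  have l1: "norm x \<le> (\<Sum>i\<in>UNIV. norm (x $ i))" for x :: "'a::real_normed_vector^'n"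
    unfolding norm_vec_def by (rule L2_set_le_sum) simp
  have "norm (V ** e ** transpose V) \<le> (\<Sum>i\<in>UNIV. norm ((V ** e ** transpose V) $ i))" by (rule l1)
  also have "\<dots> \<le> (\<Sum>i\<in>(UNIV::'n set). \<Sum>j\<in>(UNIV::'n set). \<kappa> * norm e)"
    by (intro sum_mono order_trans[OF l1] entry)
  also have "\<dots> = (real CARD('n))\<^sup>2 * \<kappa> * norm e" by (simp add: power2_eq_square)
  finally show ?thesis .
qed


section \<open>The score and its second order expansion\<close>

text \<open>The integrand of the estimating equation as a matrix.\<close>

definition score :: "real \<Rightarrow> real^'n^'n \<Rightarrow> real^'n \<Rightarrow> real^'n^'n" where
  "score \<nu> C z = (1 / (\<nu> + z \<bullet> (matrix_inv C *v z))) *\<^sub>R outer z"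

lemma score_identity: "score \<nu> (mat 1) z = (1 / (\<nu> + z \<bullet> z)) *\<^sub>R outer z"
  by (simp add: score_def)

lemma score_quadratic:
  "x \<bullet> (score \<nu> C z *v x) = (x \<bullet> z)\<^sup>2 / (\<nu> + z \<bullet> (matrix_inv C *v z))"
  by (simp add: score_def outer_mult_vector scaleR_matrix_vector_assoc[symmetric] inner_commute power2_eq_square)

lemma continuous_score:
  fixes C :: "real^'n^'n"
  assumes "C \<in> pd_mats" "\<nu> > 0"
  shows "continuous_on S (score \<nu> C)"
  unfolding score_def using weight_pos(1)[OF assms]
  by (intro continuous_intros) (auto simp: less_imp_neq[THEN not_sym])

lemma score_sym: "score \<nu> C z \<in> sym_mats"
  unfolding score_def by (intro subspace_scale[OF sym_mats_subspace] outer_sym)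

lemma norm_score_le:
  fixes C :: "real^'n^'n"
  assumes C: "C \<in> pd_mats" and nu: "\<nu> > 0" and c: "c > 0" "z \<bullet> z \<le> c * (z \<bullet> (matrix_inv C *v z))"
  shows "norm (score \<nu> C z) \<le> c"
proof -
  have "norm (score \<nu> C z) = (z \<bullet> z) / (\<nu> + z \<bullet> (matrix_inv C *v z))"
    using weight_pos(1)[OF C nu, of z] by (simp add: score_def norm_outer)
  also have "\<dots> \<le> c"
  proof -
    have "c * (z \<bullet> (matrix_inv C *v z)) \<le> c * (\<nu> + z \<bullet> (matrix_inv C *v z))"
      using c nu by (intro mult_left_mono) auto
    with c(2) have "z \<bullet> z \<le> c * (\<nu> + z \<bullet> (matrix_inv C *v z))" by linarith
    then show ?thesis using weight_pos(1)[OF C nu, of z] by (simp add: pos_divide_le_eq)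
  qed
  finally show ?thesis .
qed

lemma norm_score_identity: "\<nu> > 0 \<Longrightarrow> norm (score \<nu> (mat 1) z) \<le> 1"
  by (rule norm_score_le[OF mat_1_pd]) auto

lemma integrable_score:
  fixes C :: "real^'n^'n"
  assumes C: "C \<in> pd_mats" and nu: "\<nu> > 0" and R: "R \<in> laws"
  shows "integrable R (score \<nu> C)"
proof -
  obtain c where c: "c \<ge> 1" "\<forall>x. x \<bullet> (matrix_inv C *v x) \<le> c * (x \<bullet> x) \<and> x \<bullet> x \<le> c * (x \<bullet> (matrix_inv C *v x))"
    by (rule forms_equivalent[OF matrix_inv_pd_mats[OF C]])
  show ?thesis
    by (rule laws_integrable_bounded[OF R borel_measurable_continuous_onI[OF continuous_score[OF C nu]]
          norm_score_le[OF C nu]]) (use c in auto)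
qed

lemma bounded_linear_quadratic: "bounded_linear (\<lambda>A :: real^'n^'n. x \<bullet> (A *v y))"
  by (intro linear_conv_bounded_linear[THEN iffD1] linearI)
     (simp_all add: matrix_vector_mult_add_rdistrib inner_add_right scaleR_matrix_vector_assoc[symmetric])

lemma solves_scatter_iff_score:
  fixes C :: "real^'n^'n"
  assumes C: "C \<in> pd_mats" and nu: "\<nu> > 0" and R: "R \<in> laws"
  shows "solves_scatter \<nu> R C \<longleftrightarrow> C = (\<nu> + real CARD('n)) *\<^sub>R (\<integral>z. score \<nu> C z \<partial>R)"
proof -
  let ?I = "(\<nu> + real CARD('n)) *\<^sub>R (\<integral>z. score \<nu> C z \<partial>R)"
  have I: "?I \<in> sym_mats"
    by (intro subspace_scale[OF sym_mats_subspace] integral_in_subspace[OF sym_mats_subspace] score_sym)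
  have q: "x \<bullet> (?I *v x) = (\<nu> + real CARD('n)) * (\<integral>y. (x \<bullet> y)\<^sup>2 / (\<nu> + y \<bullet> (matrix_inv C *v y)) \<partial>R)" for x
    using integral_bounded_linear[OF bounded_linear_quadratic[of x x] integrable_score[OF C nu R]]
    by (simp add: scaleR_matrix_vector_assoc[symmetric] score_quadratic)
  show ?thesis
  proof
    assume "solves_scatter \<nu> R C"
    then show "C = ?I"
      by (intro symmetric_eq_if_quadratic_eq[OF pd_mats_sym_mats[OF C] I]) (simp only: q solves_scatter_eq)
  next
    assume "C = ?I"
    then have "x \<bullet> (C *v x) = x \<bullet> (?I *v x)" for x by (rule arg_cong)
    then show "solves_scatter \<nu> R C" unfolding solves_scatter_def q using C by blast
  qed
qed

text \<open>For \<open>u = (I + e)\<^sup>-\<^sup>1 z\<close> one has \<open>z = u + e u\<close>; the bound on the form uses the conjugacy at \<open>v = 2/3 z\<close>, which is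
  optimal for \<open>I + e = 3/2 I\<close>.\<close>

lemma inverse_near_identity:
  fixes e :: "real^'n^'n"
  assumes e: "e \<in> sym_mats" "norm e \<le> 1/2"
  defines "u \<equiv> \<lambda>z. matrix_inv (mat 1 + e) *v z"
  shows "z = u z + e *v u z" "norm (u z) \<le> 2 * norm z" "z \<bullet> z \<le> (3/2) * (z \<bullet> u z)"
proof -
  have pd: "mat 1 + e \<in> pd_mats" by (rule near_identity_pd[OF e])
  have "(mat 1 + e) *v u z = z"
    unfolding u_def by (simp add: matrix_vector_mul_assoc matrix_inv_cancel(1)[OF pd_mats_invertible[OF pd]])
  moreover have "(mat 1 + e) *v u z = u z + e *v u z" by (simp add: matrix_vector_mult_add_rdistrib)
  ultimately show eq: "z = u z + e *v u z" by (rule trans[OF sym])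
  have uz: "u z = z - e *v u z" by (subst eq_diff_eq) (rule eq[symmetric])
  have "norm (e *v u z) \<le> (1/2) * norm (u z)"
    using norm_matrix_vector_le[of e "u z"] mult_right_mono[OF e(2), of "norm (u z)"] by simp
  moreover have "norm (u z) \<le> norm z + norm (e *v u z)"
    using norm_triangle_ineq4[of z "e *v u z"] arg_cong[OF uz, of norm] by linarith
  ultimately show "norm (u z) \<le> 2 * norm z" by linarith
  have "2 * (((2/3) *\<^sub>R z) \<bullet> z) - ((2/3) *\<^sub>R z) \<bullet> ((mat 1 + e) *v ((2/3) *\<^sub>R z)) \<le> z \<bullet> u z"
    unfolding u_def by (rule inverse_form_ge[OF pd])
  moreover have "z \<bullet> (e *v z) \<le> (1/2) * (z \<bullet> z)"
    using quadratic_le_norm[of z e] mult_right_mono[OF e(2), of "z \<bullet> z"] by (simp add: abs_le_iff)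
  moreover have "((2/3) *\<^sub>R z) \<bullet> ((mat 1 + e) *v ((2/3) *\<^sub>R z)) = 4/9 * (z \<bullet> z) + 4/9 * (z \<bullet> (e *v z))"
    by (simp add: matrix_vector_mult_scaleR matrix_vector_mult_add_rdistrib inner_add_right field_simps)
  moreover have "((2/3) *\<^sub>R z) \<bullet> z = 2/3 * (z \<bullet> z)" by simp
  ultimately show "z \<bullet> z \<le> (3/2) * (z \<bullet> u z)" by linarith
qed

text \<open>Both factors \<open>|z|\<^sup>2 / (\<nu> + z' u)\<close> arising from the difference of the two weights are at most \<open>3/2\<close>, uniformly in
  \<open>z\<close>.\<close>

lemma score_lipschitz:
  fixes e f :: "real^'n^'n"
  assumes e: "e \<in> sym_mats" "norm e \<le> 1/2" and f: "f \<in> sym_mats" "norm f \<le> 1/2" and nu: "\<nu> > 0"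
  shows "norm (score \<nu> (mat 1 + e) z - score \<nu> (mat 1 + f) z) \<le> 9 * norm (e - f)"
proof -
  define u where "u = matrix_inv (mat 1 + e) *v z"
  define w where "w = matrix_inv (mat 1 + f) *v z"
  note E = inverse_near_identity[OF e, of z, folded u_def] and F = inverse_near_identity[OF f, of z, folded w_def]
  define s where "s = z \<bullet> z"
  have s0: "s \<ge> 0" by (simp add: s_def)
  have "norm ((u - w) + e *v (u - w)) = norm ((f - e) *v w)"
  proof -
    have "e *v u + u = w + f *v w" using trans[OF E(1)[symmetric] F(1)] by (simp only: add.commute)
    then have "e *v u = w + f *v w - u" by (simp only: eq_diff_eq)
    then have "(u - w) + e *v (u - w) = (f - e) *v w"
      by (simp add: matrix_vector_mult_diff_distrib matrix_vector_mult_diff_rdistrib)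
    then show ?thesis by simp
  qed
  also have "\<dots> \<le> norm (e - f) * (2 * norm z)"
    using norm_matrix_vector_le[of "f - e" w] mult_left_mono[OF F(2), of "norm (e - f)"]
    by (simp add: norm_minus_commute)
  finally have 1: "norm ((u - w) + e *v (u - w)) \<le> 2 * norm (e - f) * norm z" by simp
  have "norm (e *v (u - w)) \<le> (1/2) * norm (u - w)"
    using norm_matrix_vector_le[of e "u - w"] mult_right_mono[OF e(2), of "norm (u - w)"] by simp
  moreover have "norm (u - w) \<le> norm ((u - w) + e *v (u - w)) + norm (e *v (u - w))"
    using norm_triangle_ineq4[of "(u - w) + e *v (u - w)" "e *v (u - w)"] by simp
  ultimately have uw: "norm (u - w) \<le> 4 * norm (e - f) * norm z" using 1 by linarith
  have "\<bar>z \<bullet> w - z \<bullet> u\<bar> \<le> norm z * norm (u - w)"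
    using Cauchy_Schwarz_ineq2[of z "w - u"] by (simp add: inner_diff_right norm_minus_commute)
  also have "\<dots> \<le> norm z * (4 * norm (e - f) * norm z)" using uw by (intro mult_left_mono) auto
  finally have d: "\<bar>z \<bullet> w - z \<bullet> u\<bar> \<le> 4 * norm (e - f) * s"
    by (simp add: s_def power2_norm_eq_inner[symmetric] power2_eq_square mult_ac)
  have p: "\<nu> + z \<bullet> u > 0" "\<nu> + z \<bullet> w > 0" using E(3) F(3) nu s0 unfolding s_def by linarith+
  have q: "s / (\<nu> + z \<bullet> u) \<le> 3/2" "s / (\<nu> + z \<bullet> w) \<le> 3/2"
    using E(3) F(3) nu p by (simp_all add: s_def divide_le_eq)
  have "norm (score \<nu> (mat 1 + e) z - score \<nu> (mat 1 + f) z) = \<bar>1 / (\<nu> + z \<bullet> u) - 1 / (\<nu> + z \<bullet> w)\<bar> * s"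
    by (simp add: score_def u_def w_def s_def norm_outer flip: scaleR_diff_left)
  also have "1 / (\<nu> + z \<bullet> u) - 1 / (\<nu> + z \<bullet> w) = (z \<bullet> w - z \<bullet> u) / ((\<nu> + z \<bullet> u) * (\<nu> + z \<bullet> w))"
    using p by (simp add: field_simps)
  also have "\<bar>(z \<bullet> w - z \<bullet> u) / ((\<nu> + z \<bullet> u) * (\<nu> + z \<bullet> w))\<bar> * s
      \<le> (4 * norm (e - f) * s) / ((\<nu> + z \<bullet> u) * (\<nu> + z \<bullet> w)) * s"
    using d p s0 by (intro mult_right_mono) (simp_all add: abs_mult divide_right_mono)
  also have "\<dots> = 4 * norm (e - f) * ((s / (\<nu> + z \<bullet> u)) * (s / (\<nu> + z \<bullet> w)))"
    by simp
  also have "\<dots> \<le> 4 * norm (e - f) * ((3/2) * (3/2))"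
    using q p s0 by (intro mult_left_mono mult_mono) auto
  finally show ?thesis by simp
qed

text \<open>The weight at \<open>I + e\<close> is \<open>1 / (x + p)\<close> with \<open>x = \<nu> + |z|\<^sup>2\<close> and \<open>p = - z' e z + O(|e|\<^sup>2 |z|\<^sup>2)\<close>. Expanding
  \<open>1 / (x + p)\<close> to second order, each remainder term carries as many factors \<open>|z|\<^sup>2\<close> as factors
  \<open>x\<close> in the denominator, so the error is uniform in \<open>z\<close>.\<close>

lemma score_expansion:
  fixes e :: "real^'n^'n"
  assumes e: "e \<in> sym_mats" "norm e \<le> 1/2" and nu: "\<nu> > 0"
  defines "m \<equiv> score \<nu> (mat 1)"
  shows "norm (score \<nu> (mat 1 + e) z - m z - (m z \<bullet> e) *\<^sub>R m z) \<le> 8 * (norm e)\<^sup>2"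
proof -
  define u where "u = matrix_inv (mat 1 + e) *v z"
  note E = inverse_near_identity[OF e, of z, folded u_def]
  define s where "s = z \<bullet> z"
  define b where "b = z \<bullet> (e *v z)"
  define p where "p = z \<bullet> u - s"
  have s0: "s \<ge> 0" by (simp add: s_def)
  have ps: "p = - (z \<bullet> (e *v u))"
  proof -
    have "z \<bullet> (u + e *v u) = z \<bullet> z" by (simp only: E(1)[symmetric])
    then have "z \<bullet> u + z \<bullet> (e *v u) = z \<bullet> z" by (simp only: inner_add_right)
    then show ?thesis by (simp add: p_def s_def)
  qed
  have zu: "z - u = e *v u" by (subst diff_eq_eq, subst add.commute, rule E(1))
  have eu: "norm (e *v u) \<le> norm e * (2 * norm z)"
    using norm_matrix_vector_le[of e u] mult_left_mono[OF E(2), of "norm e"] by simp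
  have "\<bar>p\<bar> \<le> norm z * (norm e * (2 * norm z))"
    unfolding ps using Cauchy_Schwarz_ineq2[of z "e *v u"] mult_left_mono[OF eu, of "norm z"] by simp
  then have p1: "\<bar>p\<bar> \<le> 2 * norm e * s" by (simp add: s_def power2_norm_eq_inner[symmetric] power2_eq_square mult_ac)
  have pb: "p + b = z \<bullet> (e *v (e *v u))"
  proof -
    have "p + b = z \<bullet> (e *v (z - u))"
      by (simp add: ps b_def matrix_vector_mult_diff_distrib inner_diff_right)
    then show ?thesis by (simp only: zu)
  qed
  have "norm (e *v (e *v u)) \<le> norm e * (norm e * (2 * norm z))"
    using norm_matrix_vector_le[of e "e *v u"] mult_left_mono[OF eu, of "norm e"] by simp
  then have "\<bar>p + b\<bar> \<le> norm z * (norm e * (norm e * (2 * norm z)))"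
    unfolding pb using Cauchy_Schwarz_ineq2[of z "e *v (e *v u)"]
      mult_left_mono[of "norm (e *v (e *v u))" "norm e * (norm e * (2 * norm z))" "norm z"] by simp
  then have p2: "\<bar>p + b\<bar> \<le> 2 * (norm e)\<^sup>2 * s"
    by (simp add: s_def power2_norm_eq_inner[symmetric] power2_eq_square mult_ac)
  have den: "\<nu> + s > 0" "\<nu> + (s + p) > 0" using nu s0 E(3) unfolding p_def s_def by linarith+
  have q1: "s / (\<nu> + s) \<le> 1" using nu den by (simp add: divide_le_eq)
  have q2: "s / (\<nu> + (s + p)) \<le> 3/2" using E(3) nu den by (simp add: p_def s_def divide_le_eq)
  have me: "m z \<bullet> e = b / (\<nu> + s)"
    by (simp add: m_def score_identity b_def s_def inner_commute[of _ e] inner_outer)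
  have "score \<nu> (mat 1 + e) z - m z - (m z \<bullet> e) *\<^sub>R m z
      = (1 / (\<nu> + (s + p)) - 1 / (\<nu> + s) - b / (\<nu> + s) * (1 / (\<nu> + s))) *\<^sub>R outer z"
    unfolding me by (simp add: m_def score_identity score_def s_def p_def u_def scaleR_diff_left)
  also have "1 / (\<nu> + (s + p)) - 1 / (\<nu> + s) - b / (\<nu> + s) * (1 / (\<nu> + s))
      = p\<^sup>2 / ((\<nu> + s)\<^sup>2 * (\<nu> + (s + p))) - (p + b) / (\<nu> + s)\<^sup>2"
  proof -
    define x where "x = \<nu> + s"
    have x: "x > 0" "x + p > 0" "\<nu> + (s + p) = x + p" using den by (auto simp: x_def)
    show ?thesis unfolding x(3) x_def[symmetric] using x(1,2)
      by (simp add: divide_simps power2_eq_square) (simp add: algebra_simps)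
  qed
  finally have "norm (score \<nu> (mat 1 + e) z - m z - (m z \<bullet> e) *\<^sub>R m z)
      = \<bar>p\<^sup>2 / ((\<nu> + s)\<^sup>2 * (\<nu> + (s + p))) - (p + b) / (\<nu> + s)\<^sup>2\<bar> * s"
    by (simp add: norm_outer s_def)
  also have "\<dots> \<le> (p\<^sup>2 / ((\<nu> + s)\<^sup>2 * (\<nu> + (s + p))) + \<bar>p + b\<bar> / (\<nu> + s)\<^sup>2) * s"
  proof (intro mult_right_mono s0)
    have "0 \<le> p\<^sup>2 / ((\<nu> + s)\<^sup>2 * (\<nu> + (s + p)))"
      using den by (intro divide_nonneg_nonneg mult_nonneg_nonneg) auto
    then have "\<bar>p\<^sup>2 / ((\<nu> + s)\<^sup>2 * (\<nu> + (s + p)))\<bar> = p\<^sup>2 / ((\<nu> + s)\<^sup>2 * (\<nu> + (s + p)))"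
      by (rule abs_of_nonneg)
    moreover have "\<bar>(p + b) / (\<nu> + s)\<^sup>2\<bar> = \<bar>p + b\<bar> / (\<nu> + s)\<^sup>2" by (simp add: abs_divide)
    ultimately show "\<bar>p\<^sup>2 / ((\<nu> + s)\<^sup>2 * (\<nu> + (s + p))) - (p + b) / (\<nu> + s)\<^sup>2\<bar>
      \<le> p\<^sup>2 / ((\<nu> + s)\<^sup>2 * (\<nu> + (s + p))) + \<bar>p + b\<bar> / (\<nu> + s)\<^sup>2"
      using abs_triangle_ineq4[of "p\<^sup>2 / ((\<nu> + s)\<^sup>2 * (\<nu> + (s + p)))" "(p + b) / (\<nu> + s)\<^sup>2"] by linarith
  qed
  also have "\<dots> \<le> ((2 * norm e * s)\<^sup>2 / ((\<nu> + s)\<^sup>2 * (\<nu> + (s + p))) + (2 * (norm e)\<^sup>2 * s) / (\<nu> + s)\<^sup>2) * s"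
  proof (intro mult_right_mono add_mono divide_right_mono s0 p2)
    show "p\<^sup>2 \<le> (2 * norm e * s)\<^sup>2" using p1 by (metis abs_ge_zero power2_abs power_mono)
  qed (use den in auto)
  also have "\<dots> = 4 * (norm e)\<^sup>2 * ((s / (\<nu> + s)) * (s / (\<nu> + s)) * (s / (\<nu> + (s + p))))
      + 2 * (norm e)\<^sup>2 * ((s / (\<nu> + s)) * (s / (\<nu> + s)))"
  proof -
    have "((2 * t * s)\<^sup>2 / (x\<^sup>2 * y) + (2 * t\<^sup>2 * s) / x\<^sup>2) * s
      = 4 * t\<^sup>2 * ((s / x) * (s / x) * (s / y)) + 2 * t\<^sup>2 * ((s / x) * (s / x))" for t x y :: real
      by (simp add: power2_eq_square distrib_left mult_ac)
    then show ?thesis .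
  qed
  also have "\<dots> \<le> 4 * (norm e)\<^sup>2 * (1 * 1 * (3/2)) + 2 * (norm e)\<^sup>2 * (1 * 1)"
    using q1 q2 den s0 by (intro add_mono mult_left_mono mult_mono) auto
  finally show ?thesis by simp
qed


section \<open>Coercivity of the linearized equation\<close>

text \<open>The derivative at \<open>I\<close> of the right side of the estimating equation, in the direction \<open>e\<close>.\<close>

definition deriv_op :: "real \<Rightarrow> (real^'n) measure \<Rightarrow> real^'n^'n \<Rightarrow> real^'n^'n" where
  "deriv_op \<nu> R e = (\<nu> + real CARD('n)) *\<^sub>R (\<integral>z. (score \<nu> (mat 1) z \<bullet> e) *\<^sub>R score \<nu> (mat 1) z \<partial>R)"

lemma integrable_deriv_op:
  fixes R :: "(real^'n) measure"
  assumes nu: "\<nu> > 0" and R: "R \<in> laws"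
  shows "integrable R (\<lambda>z. (score \<nu> (mat 1) z \<bullet> e) *\<^sub>R score \<nu> (mat 1) z)"
proof (rule laws_integrable_bounded[OF R])
  show "(\<lambda>z. (score \<nu> (mat 1) z \<bullet> e) *\<^sub>R score \<nu> (mat 1) z) \<in> borel_measurable borel"
    by (intro borel_measurable_continuous_onI continuous_intros continuous_score mat_1_pd nu)
  fix z :: "real^'n"
  have "\<bar>score \<nu> (mat 1) z \<bullet> e\<bar> \<le> 1 * norm e"
    using Cauchy_Schwarz_ineq2[of "score \<nu> (mat 1) z" e] norm_score_identity[OF nu, of z]
    by (meson mult_right_mono norm_ge_zero order_trans)
  then show "norm ((score \<nu> (mat 1) z \<bullet> e) *\<^sub>R score \<nu> (mat 1) z) \<le> norm e * 1"
    using norm_score_identity[OF nu, of z] by (simp only: norm_scaleR) (intro mult_mono, auto)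
qed

lemma deriv_op_sym: "deriv_op \<nu> R e \<in> sym_mats"
  unfolding deriv_op_def
  by (intro subspace_scale[OF sym_mats_subspace] integral_in_subspace[OF sym_mats_subspace] score_sym)

lemma linear_deriv_op:
  assumes "\<nu> > 0" "R \<in> laws"
  shows "linear (deriv_op \<nu> R)"
proof (rule linearI)
  show "deriv_op \<nu> R (x + y) = deriv_op \<nu> R x + deriv_op \<nu> R y" for x y
    using integrable_deriv_op[OF assms]
    by (simp add: deriv_op_def inner_add_right scaleR_add_left Bochner_Integration.integral_add scaleR_add_right)
  show "deriv_op \<nu> R (c *\<^sub>R x) = c *\<^sub>R deriv_op \<nu> R x" for c x
    by (simp add: deriv_op_def scaleR_scaleR[symmetric] scaleR_left_commute del: scaleR_scaleR)
qed

text \<open>Pointwise, Cauchy-Schwarz gives \<open>(m \<bullet> e)\<^sup>2 \<le> (1 - \<nu> / (\<nu> + |z|\<^sup>2)) g\<close> with \<open>g = |e z|\<^sup>2 / (\<nu> + |z|\<^sup>2)\<close>, and the equation makes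
  \<open>(\<nu> + d) \<integral> g dQ\<close> equal to \<open>|e|\<^sup>2\<close>. So the gap is at least \<open>\<nu> / (\<nu> + M\<^sup>2)\<close> times the part of \<open>|e|\<^sup>2\<close> that comes
  from \<open>|z| \<le> M\<close>. Since \<open>g \<le> |e|\<^sup>2\<close>, the tail contributes at most \<open>(\<nu> + d) Q(|z| > M) |e|\<^sup>2 \<le> (1 - \<delta>) |e|\<^sup>2\<close>.\<close>

lemma derivative_coercive:
  fixes Q :: "(real^'n) measure" and e :: "real^'n^'n"
  assumes nu: "\<nu> > 0" and Q: "Q \<in> laws" and sol: "solves_scatter \<nu> Q (mat 1)" and M: "M \<ge> 0"
    and tail: "measure Q {z. norm z > M} \<le> (1 - \<delta>) / (\<nu> + real CARD('n))"
  shows "\<delta> * \<nu> / (\<nu> + M\<^sup>2) * (norm e)\<^sup>2 \<le> e \<bullet> (e - deriv_op \<nu> Q e)"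
proof -
  interpret Q: prob_space Q using Q by (rule laws_prob_space)
  define a where "a = \<nu> + real CARD('n)"
  have a: "a > 0" using nu by (simp add: a_def)
  define \<kappa> where "\<kappa> = \<nu> / (\<nu> + M\<^sup>2)"
  have \<kappa>: "\<kappa> > 0" using nu by (simp add: \<kappa>_def add_pos_nonneg)
  define m where "m = score \<nu> (mat 1 :: real^'n^'n)"
  define T where "T = {z :: real^'n. norm z > M}"
  have "open T" unfolding T_def by (intro open_Collect_less continuous_intros)
  then have T: "T \<in> sets Q" by (simp add: laws_sets[OF Q])
  define g where "g z = (norm (e *v z))\<^sup>2 / (\<nu> + z \<bullet> z)" for z
  have zz: "\<nu> + z \<bullet> z > 0" for z :: "real^'n" using nu by (intro add_pos_nonneg) auto
  have g_eq: "g z = (\<Sum>i\<in>UNIV. (e $ i \<bullet> z)\<^sup>2 / (\<nu> + z \<bullet> z))" for z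
    by (simp add: g_def power2_norm_vec matrix_vector_mul_component sum_divide_distrib)
  have int_w: "integrable Q (\<lambda>z. (x \<bullet> z)\<^sup>2 / (\<nu> + z \<bullet> z))" for x
    using integrable_weighted_square[OF mat_1_pd nu Q, of x] by simp
  have int_g: "integrable Q g" unfolding g_eq by (intro Bochner_Integration.integrable_sum int_w)
  have "a * (\<integral>z. g z \<partial>Q) = (\<Sum>i\<in>UNIV. a * (\<integral>z. (e $ i \<bullet> z)\<^sup>2 / (\<nu> + z \<bullet> z) \<partial>Q))"
    unfolding g_eq by (subst Bochner_Integration.integral_sum) (auto simp: int_w sum_distrib_left)
  also have "\<dots> = (\<Sum>i\<in>UNIV. e $ i \<bullet> e $ i)"
    unfolding a_def by (intro sum.cong refl) (rule solves_scatter_identity[OF sol, symmetric])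
  finally have ag: "a * (\<integral>z. g z \<partial>Q) = (norm e)\<^sup>2" by (simp add: power2_norm_matrix power2_norm_eq_inner)
  have int_me: "integrable Q (\<lambda>z. (m z \<bullet> e)\<^sup>2)"
    using integrable_inner_left[OF integrable_deriv_op[OF nu Q, of e], of e] by (simp add: m_def power2_eq_square)
  have eJ: "e \<bullet> deriv_op \<nu> Q e = a * (\<integral>z. (m z \<bullet> e)\<^sup>2 \<partial>Q)"
    using integrable_deriv_op[OF nu Q, of e]
    by (simp add: deriv_op_def m_def a_def inner_commute[of e] power2_eq_square flip: integral_inner_left)
  have pt: "\<kappa> * (g z - (norm e)\<^sup>2 * indicator T z) \<le> g z - (m z \<bullet> e)\<^sup>2" for z
  proof -
    have b: "(m z \<bullet> e)\<^sup>2 \<le> (z \<bullet> z) / (\<nu> + z \<bullet> z) * g z"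
    proof -
      have "(m z \<bullet> e)\<^sup>2 = (z \<bullet> (e *v z))\<^sup>2 / (\<nu> + z \<bullet> z)\<^sup>2"
        by (simp add: m_def score_identity inner_commute[of _ e] inner_outer power_divide)
      also have "\<dots> \<le> ((z \<bullet> z) * (norm (e *v z))\<^sup>2) / (\<nu> + z \<bullet> z)\<^sup>2"
        using Cauchy_Schwarz_ineq[of z "e *v z"] by (intro divide_right_mono) (auto simp: power2_norm_eq_inner)
      also have "\<dots> = (z \<bullet> z) / (\<nu> + z \<bullet> z) * g z" by (simp add: g_def power2_eq_square)
      finally show ?thesis .
    qed
    have g0: "g z \<ge> 0" using zz[of z] by (simp add: g_def)
    have r: "(z \<bullet> z) / (\<nu> + z \<bullet> z) = 1 - \<nu> / (\<nu> + z \<bullet> z)" using zz[of z] by (simp add: field_simps)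
    have c: "\<nu> / (\<nu> + z \<bullet> z) * g z \<le> g z - (m z \<bullet> e)\<^sup>2" using b unfolding r by (simp add: left_diff_distrib)
    show ?thesis
    proof (cases "z \<in> T")
      case True
      have "(norm (e *v z))\<^sup>2 \<le> (norm e * norm z)\<^sup>2" by (intro power_mono norm_matrix_vector_le) simp
      also have "\<dots> = (norm e)\<^sup>2 * (z \<bullet> z)" by (simp add: power_mult_distrib power2_norm_eq_inner)
      also have "\<dots> \<le> (norm e)\<^sup>2 * (\<nu> + z \<bullet> z)" using nu by (intro mult_left_mono) auto
      finally have "g z \<le> (norm e)\<^sup>2" using zz[of z] by (simp add: g_def divide_le_eq)
      then have "\<kappa> * (g z - (norm e)\<^sup>2 * indicator T z) \<le> 0" using \<kappa> True by (simp add: mult_nonneg_nonpos)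
      moreover have "0 \<le> \<nu> / (\<nu> + z \<bullet> z) * g z" using g0 nu zz[of z] by simp
      ultimately show ?thesis using c by linarith
    next
      case False
      then have "norm z \<le> M" by (simp add: T_def)
      then have "z \<bullet> z \<le> M\<^sup>2" using M by (metis norm_ge_zero power2_norm_eq_inner power_mono)
      then have "\<kappa> \<le> \<nu> / (\<nu> + z \<bullet> z)" unfolding \<kappa>_def using nu zz[of z] by (intro divide_left_mono) (auto intro!: mult_pos_pos add_pos_nonneg)
      then have "\<kappa> * g z \<le> \<nu> / (\<nu> + z \<bullet> z) * g z" using g0 by (rule mult_right_mono)
      then show ?thesis using c False by simp
    qed
  qed
  have int_T: "integrable Q (indicator T :: _ \<Rightarrow> real)"
    using T by (intro integrable_real_indicator) (auto simp: Q.emeasure_eq_measure)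
  have "(\<integral>z. \<kappa> * (g z - (norm e)\<^sup>2 * indicator T z) \<partial>Q) \<le> (\<integral>z. g z - (m z \<bullet> e)\<^sup>2 \<partial>Q)"
    using int_g int_me int_T pt by (intro integral_mono) auto
  moreover have "(\<integral>z. \<kappa> * (g z - (norm e)\<^sup>2 * indicator T z) \<partial>Q) = \<kappa> * ((\<integral>z. g z \<partial>Q) - (norm e)\<^sup>2 * measure Q T)"
    using int_g int_T by (simp add: Bochner_Integration.integral_diff laws_space[OF Q])
  moreover have "(\<integral>z. g z - (m z \<bullet> e)\<^sup>2 \<partial>Q) = (\<integral>z. g z \<partial>Q) - (\<integral>z. (m z \<bullet> e)\<^sup>2 \<partial>Q)"
    using int_g int_me by (rule Bochner_Integration.integral_diff)
  ultimately have "a * (\<kappa> * ((\<integral>z. g z \<partial>Q) - (norm e)\<^sup>2 * measure Q T)) \<le> a * ((\<integral>z. g z \<partial>Q) - (\<integral>z. (m z \<bullet> e)\<^sup>2 \<partial>Q))"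
    using a by (intro mult_left_mono) auto
  then have main: "\<kappa> * ((norm e)\<^sup>2 - (norm e)\<^sup>2 * (a * measure Q T)) \<le> e \<bullet> (e - deriv_op \<nu> Q e)"
    using ag eJ by (simp add: right_diff_distrib inner_diff_right power2_norm_eq_inner algebra_simps)
  have "a * measure Q T \<le> 1 - \<delta>" using tail a by (simp add: T_def a_def field_simps)
  then have "(norm e)\<^sup>2 * (a * measure Q T) \<le> (norm e)\<^sup>2 * (1 - \<delta>)" by (intro mult_left_mono) auto
  then have "\<kappa> * ((norm e)\<^sup>2 * \<delta>) \<le> \<kappa> * ((norm e)\<^sup>2 - (norm e)\<^sup>2 * (a * measure Q T))"
    using \<kappa> by (intro mult_left_mono) (auto simp: algebra_simps)
  with main show ?thesis by (simp add: \<kappa>_def mult_ac)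
qed


section \<open>Solutions for nearby laws\<close>

text \<open>The tensor \<open>m \<otimes> m\<close>; its integral determines the derivative \<open>deriv_op\<close>.\<close>

definition score_tensor :: "real \<Rightarrow> real^'n \<Rightarrow> real^'n^'n^'n^'n" where
  "score_tensor \<nu> z = (\<chi> i j. score \<nu> (mat 1) z $ i $ j *\<^sub>R score \<nu> (mat 1) z)"

text \<open>The bounded statistic through which the estimating equation near \<open>I\<close> depends on the law to first order.\<close>

definition score_stat :: "real \<Rightarrow> real^'n \<Rightarrow> (real^'n^'n) \<times> (real^'n^'n^'n^'n)" where
  "score_stat \<nu> z = (score \<nu> (mat 1) z, score_tensor \<nu> z)"

lemma score_stat_components [simp]:
  "fst (score_stat \<nu> z) = score \<nu> (mat 1) z" "snd (score_stat \<nu> z) = score_tensor \<nu> z"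
  by (simp_all add: score_stat_def)

lemma norm_fst_snd_le: "norm (fst x) \<le> norm x" "norm (snd x) \<le> norm x"
  by (metis norm_fst_le norm_snd_le prod.collapse)+

lemma continuous_score_stat:
  assumes "\<nu> > 0"
  shows "continuous_on S (score_stat \<nu>)"
  unfolding score_stat_def score_tensor_def
  by (intro continuous_intros continuous_score mat_1_pd assms)

lemma norm_score_tensor:
  assumes "\<nu> > 0"
  shows "norm (score_tensor \<nu> z) \<le> 1"
proof -
  define m where "m = score \<nu> (mat 1) z"
  have "(norm (score_tensor \<nu> z))\<^sup>2 = (\<Sum>i\<in>UNIV. \<Sum>j\<in>UNIV. (m $ i $ j)\<^sup>2 * (norm m)\<^sup>2)"
    by (simp add: power2_norm_eq_inner inner_vec_def[of "score_tensor \<nu> z"] inner_vec_def[of "score_tensor \<nu> z $ _"])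
       (simp add: score_tensor_def m_def power2_norm_eq_inner power2_eq_square mult_ac)
  also have "\<dots> = (norm m)\<^sup>2 * (norm m)\<^sup>2"
    by (simp add: power2_norm_matrix power2_norm_vec flip: sum_distrib_right)
  also have "\<dots> \<le> 1"
    using norm_score_identity[OF assms, of z] unfolding m_def[symmetric]
    by (metis mult_le_one norm_ge_zero power_le_one zero_le_power)
  finally show ?thesis by (simp add: power_le_one_iff)
qed

lemma norm_score_stat:
  assumes "\<nu> > 0"
  shows "norm (score_stat \<nu> z) \<le> 2"
  using norm_Pair_le[of "score \<nu> (mat 1) z" "score_tensor \<nu> z"] norm_score_tensor[OF assms, of z]
    norm_score_identity[OF assms, of z] unfolding score_stat_def by linarith

lemma integrable_score_stat:
  assumes "\<nu> > 0" "R \<in> laws"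
  shows "integrable R (score_stat \<nu>)"
  by (rule laws_integrable_bounded[OF assms(2) borel_measurable_continuous_onI[OF continuous_score_stat[OF assms(1)]]
        norm_score_stat[OF assms(1)]])

text \<open>Contraction of a tensor with a matrix, so that \<open>deriv_op\<close> becomes a linear function of the integrated statistic.\<close>

definition tensor_apply :: "real^'n^'n^'n^'n \<Rightarrow> real^'n^'n \<Rightarrow> real^'n^'n" where
  "tensor_apply t e = (\<Sum>i\<in>UNIV. \<Sum>j\<in>UNIV. e $ i $ j *\<^sub>R t $ i $ j)"

lemma norm_tensor_apply: "norm (tensor_apply t e) \<le> norm e * norm t"
proof -
  have "norm (tensor_apply t e) \<le> (\<Sum>i\<in>UNIV. norm (\<Sum>j\<in>UNIV. e $ i $ j *\<^sub>R t $ i $ j))"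
    unfolding tensor_apply_def by (rule norm_sum)
  also have "\<dots> \<le> (\<Sum>i\<in>UNIV. norm (e $ i) * norm (t $ i))"
  proof (rule sum_mono)
    fix i
    have "norm (\<Sum>j\<in>UNIV. e $ i $ j *\<^sub>R t $ i $ j) \<le> (\<Sum>j\<in>UNIV. \<bar>e $ i $ j\<bar> * \<bar>norm (t $ i $ j)\<bar>)"
      by (rule order_trans[OF norm_sum]) simp
    also have "\<dots> \<le> L2_set (\<lambda>j. e $ i $ j) UNIV * L2_set (\<lambda>j. norm (t $ i $ j)) UNIV"
      by (rule L2_set_mult_ineq)
    finally show "norm (\<Sum>j\<in>UNIV. e $ i $ j *\<^sub>R t $ i $ j) \<le> norm (e $ i) * norm (t $ i)"
      by (simp add: norm_vec_def L2_set_def)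
  qed
  also have "\<dots> \<le> (\<Sum>i\<in>UNIV. \<bar>norm (e $ i)\<bar> * \<bar>norm (t $ i)\<bar>)" by simp
  also have "\<dots> \<le> L2_set (\<lambda>i. norm (e $ i)) UNIV * L2_set (\<lambda>i. norm (t $ i)) UNIV"
    by (rule L2_set_mult_ineq)
  finally show ?thesis by (simp add: norm_vec_def)
qed

lemma tensor_apply_diff: "tensor_apply (s - t) e = tensor_apply s e - tensor_apply t e"
  by (simp add: tensor_apply_def scaleR_diff_right sum_subtractf)

lemma bounded_linear_tensor_apply: "bounded_linear (\<lambda>t. tensor_apply t e)"
  by (intro linear_conv_bounded_linear[THEN iffD1] linearI)
     (simp_all add: tensor_apply_def scaleR_add_right sum.distrib scaleR_sum_right mult.commute)

lemma tensor_apply_score: "tensor_apply (score_tensor \<nu> z) e = (score \<nu> (mat 1) z \<bullet> e) *\<^sub>R score \<nu> (mat 1) z"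
  by (simp add: tensor_apply_def score_tensor_def inner_vec_def scaleR_sum_left mult.commute)

lemma deriv_op_tensor:
  fixes R :: "(real^'n) measure"
  assumes "\<nu> > 0" "R \<in> laws"
  shows "deriv_op \<nu> R e = (\<nu> + real CARD('n)) *\<^sub>R tensor_apply (snd (\<integral>z. score_stat \<nu> z \<partial>R)) e"
proof -
  have "bounded_linear (\<lambda>t. tensor_apply (snd t) e)"
    by (rule bounded_linear_compose[OF bounded_linear_tensor_apply bounded_linear_snd])
  from integral_bounded_linear[OF this integrable_score_stat[OF assms]]
  show ?thesis by (simp add: deriv_op_def tensor_apply_score)
qed

lemma fst_integral_score_stat:
  assumes "\<nu> > 0" "R \<in> laws"
  shows "fst (\<integral>z. score_stat \<nu> z \<partial>R) = (\<integral>z. score \<nu> (mat 1) z \<partial>R)"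
  using integral_bounded_linear[OF bounded_linear_fst integrable_score_stat[OF assms]] by simp

lemma coercive_inverse_norm:
  fixes J G :: "'b::real_inner \<Rightarrow> 'b"
  assumes c: "c > 0" and coercive: "\<And>e. c * (norm e)\<^sup>2 \<le> e \<bullet> (e - J e)" and G: "\<And>x. G x - J (G x) = x"
  shows "norm (G x) \<le> norm x / c"
proof (cases "G x = 0")
  case True then show ?thesis using c by simp
next
  case False
  have "c * (norm (G x))\<^sup>2 \<le> G x \<bullet> x" using coercive[of "G x"] by (simp add: G)
  also have "\<dots> \<le> norm (G x) * norm x" by (rule norm_cauchy_schwarz)
  finally have "norm (G x) * (c * norm (G x)) \<le> norm (G x) * norm x" by (simp add: power2_eq_square mult_ac)
  then have "c * norm (G x) \<le> norm x" using False by simp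
  then show ?thesis using c by (simp add: field_simps)
qed

text \<open>Let \<open>\<Psi> e\<close> be the defect of the equation for \<open>R\<close> at \<open>I + e\<close> and \<open>G\<close> the inverse of the linearization at \<open>Q\<close>.
  The map \<open>e \<mapsto> e + G(\<Psi> e)\<close> differs from the constant \<open>G \<Delta>\<close> by terms that are quadratic in \<open>e\<close> and
  \<open>\<eta>\<close>, so it maps a small ball of symmetric matrices into itself. Brouwer's theorem provides a fixed point, and a
  fixed point solves the equation. The factor \<open>40\<close> leaves room for the numerical constants of the expansion.\<close>

proposition local_solution_at_identity:
  fixes Q R :: "(real^'n) measure"
  assumes nu: "\<nu> > 0" and Q: "Q \<in> laws" and R: "R \<in> laws" and sol: "solves_scatter \<nu> Q (mat 1)"
    and c: "c > 0" "c \<le> 1" and coercive: "\<And>e. c * (norm e)\<^sup>2 \<le> e \<bullet> (e - deriv_op \<nu> Q e)"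
    and G: "linear G" "\<And>x. G x - deriv_op \<nu> Q (G x) = x"
  defines "a \<equiv> \<nu> + real CARD('n)" and "\<eta> \<equiv> norm ((\<integral>z. score_stat \<nu> z \<partial>R) - (\<integral>z. score_stat \<nu> z \<partial>Q))"
  assumes small: "\<eta> * (40 * (a + 1)\<^sup>2 / c\<^sup>2) \<le> 1"
  shows "\<exists>e. solves_scatter \<nu> R (mat 1 + e) \<and>
     norm (e - G (a *\<^sub>R (\<integral>z. score \<nu> (mat 1) z \<partial>R) - mat 1)) \<le> (40 * (a + 1) ^ 3 / c ^ 3) * \<eta>\<^sup>2"
proof -
  have a: "a > 0" using nu by (simp add: a_def)
  have \<eta>: "\<eta> \<ge> 0" by (simp add: \<eta>_def)
  have normG: "norm (G x) \<le> norm x / c" for x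
    by (rule coercive_inverse_norm[OF c(1) coercive G(2)])
  have L0: "e = 0" if "e - deriv_op \<nu> Q e = 0" for e
    using coercive[of e] c that by (simp add: mult_le_0_iff)
  have GL: "G (e - deriv_op \<nu> Q e) = e" for e
  proof -
    define L where "L e = e - deriv_op \<nu> Q e" for e
    have linL: "linear L" unfolding L_def by (intro linear_compose_sub linear_id[unfolded id_def] linear_deriv_op nu Q)
    have "L (G x) = x" for x using G(2) by (simp add: L_def)
    then have "L (G (L e) - e) = 0" by (simp add: linear_diff[OF linL])
    then have "G (L e) - e = 0" unfolding L_def by (rule L0)
    then show ?thesis by (simp add: L_def)
  qed
  have Gsym: "G x \<in> sym_mats" if "x \<in> sym_mats" for x
  proof -
    have "G x = x + deriv_op \<nu> Q (G x)" using G(2)[of x] by (simp add: algebra_simps)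
    then show ?thesis using subspace_add[OF sym_mats_subspace that deriv_op_sym] by metis
  qed
  define \<Delta> where "\<Delta> = a *\<^sub>R (\<integral>z. score \<nu> (mat 1) z \<partial>R) - (mat 1 :: real^'n^'n)"
  have one: "(mat 1 :: real^'n^'n) = a *\<^sub>R (\<integral>z. score \<nu> (mat 1) z \<partial>Q)"
    using sol unfolding solves_scatter_iff_score[OF mat_1_pd nu Q] by (simp add: a_def)
  have norm\<Delta>: "norm \<Delta> \<le> a * \<eta>"
  proof -
    have "\<Delta> = a *\<^sub>R fst ((\<integral>z. score_stat \<nu> z \<partial>R) - (\<integral>z. score_stat \<nu> z \<partial>Q))"
      unfolding \<Delta>_def by (subst one) (simp add: fst_integral_score_stat nu Q R scaleR_diff_right)
    then have "norm \<Delta> = a * norm (fst ((\<integral>z. score_stat \<nu> z \<partial>R) - (\<integral>z. score_stat \<nu> z \<partial>Q)))"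
      using a by simp
    also have "\<dots> \<le> a * \<eta>" unfolding \<eta>_def using a by (intro mult_left_mono norm_fst_snd_le) auto
    finally show ?thesis .
  qed
  have Jdiff: "norm (deriv_op \<nu> R e - deriv_op \<nu> Q e) \<le> a * (norm e * \<eta>)" for e
  proof -
    have "deriv_op \<nu> R e - deriv_op \<nu> Q e = a *\<^sub>R tensor_apply (snd ((\<integral>z. score_stat \<nu> z \<partial>R) - (\<integral>z. score_stat \<nu> z \<partial>Q))) e"
      by (simp add: deriv_op_tensor nu Q R a_def tensor_apply_diff scaleR_diff_right)
    then have "norm (deriv_op \<nu> R e - deriv_op \<nu> Q e) \<le> a * (norm e * norm (snd ((\<integral>z. score_stat \<nu> z \<partial>R) - (\<integral>z. score_stat \<nu> z \<partial>Q))))"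
      using a norm_tensor_apply by (simp add: mult_left_mono)
    also have "\<dots> \<le> a * (norm e * \<eta>)" unfolding \<eta>_def
      using a by (intro mult_left_mono norm_fst_snd_le) auto
    finally show ?thesis .
  qed
  define \<Psi> where "\<Psi> e = a *\<^sub>R (\<integral>z. score \<nu> (mat 1 + e) z \<partial>R) - (mat 1 + e)" for e
  have \<Psi>_sym: "\<Psi> e \<in> sym_mats" if "e \<in> sym_mats" for e
    unfolding \<Psi>_def using that
    by (intro subspace_diff[OF sym_mats_subspace] subspace_scale[OF sym_mats_subspace]
        integral_in_subspace[OF sym_mats_subspace] score_sym subspace_add[OF sym_mats_subspace]
        pd_mats_sym_mats[OF mat_1_pd])
  have int: "integrable R (score \<nu> (mat 1 + e))" if "e \<in> sym_mats" "norm e \<le> 1/2" for e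
    by (intro integrable_score near_identity_pd that nu R)
  have Rp: "prob_space R" using R by (rule laws_prob_space)
  have integral_norm_bound_const: "norm (\<integral>z. f z \<partial>R) \<le> K"
    if "integrable R f" "\<And>z. norm (f z) \<le> K" for f :: "real^'n \<Rightarrow> real^'n^'n" and K
  proof -
    have "norm (\<integral>z. f z \<partial>R) \<le> (\<integral>z. norm (f z) \<partial>R)" by (rule integral_norm_bound)
    also have "\<dots> \<le> (\<integral>z. K \<partial>R)"
      using that prob_space.finite_measure[OF Rp] by (intro integral_mono finite_measure.integrable_const) auto
    also have "\<dots> = K" using prob_space.prob_space[OF Rp] by simp
    finally show ?thesis .
  qed
  have expansion: "norm (e + G (\<Psi> e) - G \<Delta>) \<le> (a / c) * (norm e * \<eta> + 8 * (norm e)\<^sup>2)"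
    if e: "e \<in> sym_mats" "norm e \<le> 1/2" for e
  proof -
    define \<rho> where "\<rho> = (\<integral>z. score \<nu> (mat 1 + e) z - score \<nu> (mat 1) z - (score \<nu> (mat 1) z \<bullet> e) *\<^sub>R score \<nu> (mat 1) z \<partial>R)"
    have i0: "integrable R (score \<nu> (mat 1))" by (intro integrable_score mat_1_pd nu R)
    have \<rho>: "norm \<rho> \<le> 8 * (norm e)\<^sup>2"
      unfolding \<rho>_def using int[OF e] i0 integrable_deriv_op[OF nu R, of e] score_expansion[OF e nu]
      by (intro integral_norm_bound_const Bochner_Integration.integrable_diff) auto
    have "\<rho> = (\<integral>z. score \<nu> (mat 1 + e) z \<partial>R) - (\<integral>z. score \<nu> (mat 1) z \<partial>R) - (\<integral>z. (score \<nu> (mat 1) z \<bullet> e) *\<^sub>R score \<nu> (mat 1) z \<partial>R)"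
      unfolding \<rho>_def using int[OF e] i0 integrable_deriv_op[OF nu R, of e]
      by (simp add: Bochner_Integration.integral_diff Bochner_Integration.integrable_diff)
    then have "a *\<^sub>R \<rho> = a *\<^sub>R (\<integral>z. score \<nu> (mat 1 + e) z \<partial>R) - a *\<^sub>R (\<integral>z. score \<nu> (mat 1) z \<partial>R) - deriv_op \<nu> R e"
      by (simp add: scaleR_diff_right deriv_op_def a_def)
    then have "\<Psi> e = (\<Delta> - (e - deriv_op \<nu> Q e)) + ((deriv_op \<nu> R e - deriv_op \<nu> Q e) + a *\<^sub>R \<rho>)"
      by (simp add: \<Psi>_def \<Delta>_def)
    then have "G (\<Psi> e) = G (\<Delta> - (e - deriv_op \<nu> Q e)) + G ((deriv_op \<nu> R e - deriv_op \<nu> Q e) + a *\<^sub>R \<rho>)"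
      by (simp only: linear_add[OF G(1)])
    also have "G (\<Delta> - (e - deriv_op \<nu> Q e)) = G \<Delta> - e" by (simp only: linear_diff[OF G(1), of \<Delta>] GL)
    finally have "G (\<Psi> e) = G \<Delta> - e + G ((deriv_op \<nu> R e - deriv_op \<nu> Q e) + a *\<^sub>R \<rho>)" .
    then have "e + G (\<Psi> e) - G \<Delta> = G ((deriv_op \<nu> R e - deriv_op \<nu> Q e) + a *\<^sub>R \<rho>)" by simp
    then have "norm (e + G (\<Psi> e) - G \<Delta>) \<le> norm ((deriv_op \<nu> R e - deriv_op \<nu> Q e) + a *\<^sub>R \<rho>) / c"
      using normG by simp
    also have "\<dots> \<le> (a * (norm e * \<eta>) + a * (8 * (norm e)\<^sup>2)) / c"
    proof (intro divide_right_mono order_trans[OF norm_triangle_ineq] add_mono Jdiff)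
      show "norm (a *\<^sub>R \<rho>) \<le> a * (8 * (norm e)\<^sup>2)" using a \<rho> by simp
    qed (use c in simp)
    also have "\<dots> = (a / c) * (norm e * \<eta> + 8 * (norm e)\<^sup>2)" by (simp add: field_simps)
    finally show ?thesis .
  qed
  \<comment> \<open>Twice the bound on \<open>G \<Delta>\<close>, the first order location of the solution.\<close>
  define r where "r = 2 * (a * \<eta>) / c"
  have r0: "r \<ge> 0" using a \<eta> c by (simp add: r_def)
  have ac: "a \<le> a + 1" "1 \<le> a + 1" "(a + 1) \<le> (a + 1)\<^sup>2" using a by (auto simp: power2_eq_square)
  have c2: "c\<^sup>2 \<le> c" using c by (simp add: power2_eq_square mult_left_le)
  have sm: "40 * ((a + 1)\<^sup>2 * \<eta>) \<le> c\<^sup>2" using small c by (simp add: field_simps)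
  have a\<eta>: "a * \<eta> \<le> (a + 1)\<^sup>2 * \<eta>" "a * (a * \<eta>) \<le> (a + 1)\<^sup>2 * \<eta>"
  proof -
    have "a \<le> (a + 1)\<^sup>2" "a * a \<le> (a + 1)\<^sup>2" using a by (auto simp: power2_eq_square algebra_simps)
    then show "a * \<eta> \<le> (a + 1)\<^sup>2 * \<eta>" "a * (a * \<eta>) \<le> (a + 1)\<^sup>2 * \<eta>"
      using \<eta> by (auto simp: mult.assoc[symmetric] intro: mult_right_mono)
  qed
  have X0: "0 \<le> (a + 1)\<^sup>2 * \<eta>" using \<eta> by simp
  have r_half: "r \<le> 1/2"
  proof -
    have "4 * (a * \<eta>) \<le> c" using sm a\<eta>(1) c2 X0 by linarith
    then show ?thesis using c by (simp add: r_def field_simps)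
  qed
  have contract: "(a / c) * (\<eta> + 8 * r) \<le> 1/2"
  proof -
    have "2 * (a * \<eta> * c + 16 * (a * (a * \<eta>))) \<le> c\<^sup>2"
    proof -
      have "a * \<eta> * c \<le> a * \<eta> * 1" using a \<eta> c by (intro mult_left_mono) auto
      then have "a * \<eta> * c \<le> a * \<eta>" by (simp only: mult_1_right)
      then show ?thesis using sm a\<eta> X0 by argo
    qed
    then have "2 * ((a * \<eta> * c + 16 * (a * (a * \<eta>))) / c\<^sup>2) \<le> 1" using c by (simp add: field_simps)
    moreover have "(a / c) * (\<eta> + 8 * r) = (a * \<eta> * c + 16 * (a * (a * \<eta>))) / c\<^sup>2"
      using c by (simp add: r_def field_simps power2_eq_square)
    ultimately show ?thesis by linarith
  qed
  have G\<Delta>: "norm (G \<Delta>) \<le> r / 2"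
    using normG[of \<Delta>] divide_right_mono[OF norm\<Delta>, of c] c by (simp add: r_def)
  define K where "K = cball 0 r \<inter> (sym_mats :: (real^'n^'n) set)"
  have Kh: "e \<in> sym_mats" "norm e \<le> 1/2" "norm e \<le> r" if "e \<in> K" for e
    using that r_half by (auto simp: K_def)
  define \<Phi> where "\<Phi> e = e + G (\<Psi> e)" for e
  have into: "\<Phi> ` K \<subseteq> K"
  proof
    fix x assume "x \<in> \<Phi> ` K"
    then obtain e where e: "e \<in> K" "x = \<Phi> e" by auto
    have "norm (x - G \<Delta>) \<le> (a / c) * (norm e * \<eta> + 8 * (norm e)\<^sup>2)"
      using expansion[OF Kh(1,2)[OF e(1)]] by (simp add: e(2) \<Phi>_def)
    also have "\<dots> = (a / c) * (\<eta> + 8 * norm e) * norm e" by (simp add: power2_eq_square algebra_simps)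
    also have "\<dots> \<le> (a / c) * (\<eta> + 8 * r) * r"
      using Kh(3)[OF e(1)] a c \<eta> r0 by (intro mult_mono mult_left_mono add_left_mono mult_nonneg_nonneg) auto
    also have "\<dots> \<le> (1/2) * r" using contract r0 by (rule mult_right_mono)
    finally have "norm (x - G \<Delta>) \<le> r / 2" by simp
    then have "norm x \<le> r" using G\<Delta> norm_triangle_ineq[of "x - G \<Delta>" "G \<Delta>"] by simp
    moreover have "x \<in> sym_mats"
      unfolding e(2) \<Phi>_def using Kh(1)[OF e(1)]
      by (intro subspace_add[OF sym_mats_subspace] Gsym \<Psi>_sym)
    ultimately show "x \<in> K" by (simp add: K_def)
  qed
  have cont: "continuous_on K \<Phi>"
  proof -
    have "9-lipschitz_on K (\<lambda>e. \<integral>z. score \<nu> (mat 1 + e) z \<partial>R)"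
    proof (rule lipschitz_onI)
      fix e f assume e: "e \<in> K" and f: "f \<in> K"
      have "norm (\<integral>z. score \<nu> (mat 1 + e) z - score \<nu> (mat 1 + f) z \<partial>R) \<le> 9 * norm (e - f)"
        using Kh[OF e] Kh[OF f] nu
        by (intro integral_norm_bound_const Bochner_Integration.integrable_diff int score_lipschitz)
      then show "dist (\<integral>z. score \<nu> (mat 1 + e) z \<partial>R) (\<integral>z. score \<nu> (mat 1 + f) z \<partial>R) \<le> 9 * dist e f"
        using int Kh[OF e] Kh[OF f] by (simp add: dist_norm Bochner_Integration.integral_diff)
    qed simp
    then have "continuous_on K (\<lambda>e. \<integral>z. score \<nu> (mat 1 + e) z \<partial>R)" by (rule lipschitz_on_continuous_on)
    then have "continuous_on K \<Psi>" unfolding \<Psi>_def by (intro continuous_intros)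
    then have "continuous_on K (\<lambda>e. G (\<Psi> e))"
      by (intro continuous_on_compose2[OF linear_continuous_on[OF linear_conv_bounded_linear[THEN iffD1, OF G(1)], of UNIV]]) auto
    then show ?thesis unfolding \<Phi>_def by (intro continuous_intros)
  qed
  have "compact K" unfolding K_def by (intro compact_Int_closed compact_cball closed_subspace sym_mats_subspace)
  moreover have "convex K" unfolding K_def by (intro convex_Int convex_cball subspace_imp_convex sym_mats_subspace)
  moreover have "0 \<in> K" using r0 subspace_0[OF sym_mats_subspace] by (simp add: K_def)
  then have "K \<noteq> {}" by auto
  moreover have "\<Phi> \<in> K \<rightarrow> K" using into by auto
  ultimately obtain e where e: "e \<in> K" "\<Phi> e = e" using brouwer[OF _ _ _ cont] by metis
  then have "G (\<Psi> e) = 0" by (simp add: \<Phi>_def)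
  then have "\<Psi> e = 0" using G(2)[of "\<Psi> e"] linear_0[OF linear_deriv_op[OF nu Q]] by simp
  then have "solves_scatter \<nu> R (mat 1 + e)"
    unfolding solves_scatter_iff_score[OF near_identity_pd[OF Kh(1,2)[OF e(1)]] nu R]
    by (simp add: \<Psi>_def a_def)
  moreover have "norm (e - G \<Delta>) \<le> (40 * (a + 1) ^ 3 / c ^ 3) * \<eta>\<^sup>2"
  proof -
    have "norm (e - G \<Delta>) \<le> (a / c) * (norm e * \<eta> + 8 * (norm e)\<^sup>2)"
      using expansion[OF Kh(1,2)[OF e(1)]] e(2) by (simp add: \<Phi>_def)
    also have "\<dots> \<le> (a / c) * (r * \<eta> + 8 * r\<^sup>2)"
      using Kh(3)[OF e(1)] a c \<eta> by (intro mult_left_mono add_mono mult_right_mono power_mono) auto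
    also have "\<dots> = (2 * (a * a) * c + 32 * (a * a * a)) / c ^ 3 * \<eta>\<^sup>2"
      using c by (simp add: r_def field_simps power2_eq_square power3_eq_cube)
    also have "\<dots> \<le> (40 * (a + 1) ^ 3 / c ^ 3) * \<eta>\<^sup>2"
    proof (intro mult_right_mono divide_right_mono)
      have "2 * (a * a) * c \<le> 2 * (a * a) * 1" using a c by (intro mult_left_mono) auto
      moreover have "2 * (a * a) * 1 + 32 * (a * a * a) \<le> 40 * (a + 1) ^ 3"
        using a by (simp add: power3_eq_cube algebra_simps add_nonneg_nonneg)
      ultimately show "2 * (a * a) * c + 32 * (a * a * a) \<le> 40 * (a + 1) ^ 3" by linarith
    qed (use c in auto)
    finally show ?thesis .
  qed
  ultimately show ?thesis unfolding \<Delta>_def by blast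
qed


section \<open>Bounded Lipschitz functions\<close>

text \<open>The unit ball of the metric \<open>beta_dist\<close> is contained in the set \<open>BL\<close> below, which suffices for upper bounds
  on distances.\<close>

lemma sup_lip_le_1_bounds:
  fixes f :: "'a::metric_space \<Rightarrow> real"
  assumes "sup_norm f + lip_seminorm f \<le> 1"
  shows "\<bar>f x\<bar> \<le> 1" "\<bar>f x - f y\<bar> \<le> dist x y"
proof -
  have s: "sup_norm f \<le> 1" "lip_seminorm f \<le> 1"
    by (rule order_trans[OF _ assms], simp)+
  have "ennreal \<bar>f x\<bar> \<le> sup_norm f" unfolding sup_norm_def by (rule SUP_upper) simp
  then show "\<bar>f x\<bar> \<le> 1" using s(1) by (meson ennreal_le_1 order_trans)
  show "\<bar>f x - f y\<bar> \<le> dist x y"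
  proof (cases "x = y")
    case False
    have "ennreal (\<bar>f x - f y\<bar> / dist x y) \<le> lip_seminorm f"
      unfolding lip_seminorm_def by (rule SUP_upper2[of "(x, y)"]) (use False in auto)
    then have "ennreal (\<bar>f x - f y\<bar> / dist x y) \<le> 1" using s(2) by (rule order_trans)
    then show ?thesis using False by (simp add: divide_le_eq)
  qed simp
qed

definition BL :: "('a::metric_space \<Rightarrow> real) set" where
  "BL = {f. (\<forall>x. \<bar>f x\<bar> \<le> 1) \<and> (\<forall>x y. \<bar>f x - f y\<bar> \<le> dist x y)}"

lemma BL_continuous:
  fixes f :: "'a::metric_space \<Rightarrow> real"
  assumes "f \<in> BL"
  shows "continuous_on UNIV f"
  unfolding continuous_on_iff
proof (intro ballI allI impI)
  fix x and e :: real assume "e > 0"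
  then show "\<exists>d>0. \<forall>x'\<in>UNIV. dist x' x < d \<longrightarrow> dist (f x') (f x) < e"
    using assms unfolding BL_def dist_real_def
    by (intro exI[of _ e]) (auto intro: le_less_trans)
qed

lemma BL_measurable:
  fixes f :: "'a::metric_space \<Rightarrow> real"
  shows "f \<in> BL \<Longrightarrow> f \<in> borel_measurable borel"
  by (intro borel_measurable_continuous_onI BL_continuous)

lemma BL_bounded: "f \<in> BL \<Longrightarrow> norm (f x) \<le> 1"
  by (simp add: BL_def)

lemma BL_integrable:
  fixes f :: "'a::metric_space \<Rightarrow> real"
  shows "f \<in> BL \<Longrightarrow> N \<in> laws \<Longrightarrow> integrable N f"
  by (rule laws_integrable_bounded[OF _ BL_measurable BL_bounded])

lemma beta_dist_le:
  fixes L1 L2 :: "'a::metric_space measure"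
  assumes "\<And>f. f \<in> BL \<Longrightarrow> \<bar>(\<integral>x. f x \<partial>L1) - (\<integral>x. f x \<partial>L2)\<bar> \<le> e"
  shows "beta_dist L1 L2 \<le> e"
  unfolding beta_dist_def
proof (rule cSUP_least)
  have "sup_norm (\<lambda>x::'a. 0) + lip_seminorm (\<lambda>x::'a. 0) \<le> 1"
    by (simp add: sup_norm_def lip_seminorm_def SUP_le_iff)
  then show "{f::'a \<Rightarrow> real. sup_norm f + lip_seminorm f \<le> 1} \<noteq> {}" by blast
  fix f :: "'a \<Rightarrow> real" assume "f \<in> {f. sup_norm f + lip_seminorm f \<le> 1}"
  then have "f \<in> BL" using sup_lip_le_1_bounds[of f] by (simp add: BL_def)
  then show "\<bar>(\<integral>x. f x \<partial>L1) - (\<integral>x. f x \<partial>L2)\<bar> \<le> e" by (rule assms)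
qed

lemma beta_dist_nonneg:
  fixes L1 L2 :: "'a::metric_space measure"
  assumes L: "L1 \<in> laws" "L2 \<in> laws"
  shows "0 \<le> beta_dist L1 L2"
proof -
  let ?F = "{f::'a \<Rightarrow> real. sup_norm f + lip_seminorm f \<le> 1}"
  let ?g = "\<lambda>f. \<bar>(\<integral>x. f x \<partial>L1) - (\<integral>x. f x \<partial>L2)\<bar>"
  have z: "(\<lambda>x::'a. 0) \<in> ?F" by (simp add: sup_norm_def lip_seminorm_def SUP_le_iff)
  have "bdd_above (?g ` ?F)"
  proof (rule bdd_aboveI2)
    fix f :: "'a \<Rightarrow> real" assume "f \<in> ?F"
    then have f: "f \<in> BL" using sup_lip_le_1_bounds[of f] by (simp add: BL_def)
    have "\<bar>\<integral>x. f x \<partial>L1\<bar> \<le> 1" "\<bar>\<integral>x. f x \<partial>L2\<bar> \<le> 1"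
      using law_integral_bounded[OF L(1) BL_measurable[OF f]] law_integral_bounded[OF L(2) BL_measurable[OF f]]
        BL_bounded[OF f] by simp_all
    then show "?g f \<le> 2" by linarith
  qed
  then have "?g (\<lambda>x. 0) \<le> beta_dist L1 L2" unfolding beta_dist_def by (rule cSUP_upper[OF z])
  then show ?thesis by simp
qed

text \<open>Arzela-Ascoli in elementary form: up to \<open>e\<close>, a function in \<open>BL\<close> is determined on a compact set by its
  values, rounded to a grid, at finitely many points.\<close>

lemma BL_totally_bounded:
  fixes K :: "'a::metric_space set"
  assumes K: "compact K" and e: "e > 0"
  obtains G :: "('a \<Rightarrow> real) set" where "finite G" "G \<subseteq> BL"
    "\<forall>f\<in>BL. \<exists>g\<in>G. \<forall>x\<in>K. \<bar>f x - g x\<bar> \<le> e"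
proof -
  define e' where "e' = e / 3"
  have e': "e' > 0" using e by (simp add: e'_def)
  obtain X where "X \<subseteq> K" "finite X" "K \<subseteq> (\<Union>x\<in>X. ball x e')"
  proof (rule compactE_image[OF K, of K "\<lambda>x. ball x e'"])
    show "K \<subseteq> (\<Union>x\<in>K. ball x e')" using e' by auto
  qed (auto intro: that)
  then have X: "finite X" "X \<subseteq> K" "K \<subseteq> (\<Union>x\<in>X. ball x e')" by auto
  define key where "key f = restrict (\<lambda>x. \<lfloor>f x / e'\<rfloor>) X" for f :: "'a \<Rightarrow> real"
  have "key ` BL \<subseteq> Pi\<^sub>E X (\<lambda>_. {\<lfloor>-1/e'\<rfloor>..\<lfloor>1/e'\<rfloor>})"
  proof
    fix k assume "k \<in> key ` BL"
    then obtain f where f: "f \<in> BL" "k = key f" by auto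
    have "\<lfloor>f x / e'\<rfloor> \<in> {\<lfloor>-1/e'\<rfloor>..\<lfloor>1/e'\<rfloor>}" for x
    proof -
      have "-1 \<le> f x" "f x \<le> 1" using f(1) by (auto simp: BL_def abs_le_iff dest: spec[of _ x])
      then have "-1 / e' \<le> f x / e'" "f x / e' \<le> 1 / e'" using e' by (auto intro: divide_right_mono simp only: less_imp_le)
      then show ?thesis by (auto intro: floor_mono simp only: atLeastAtMost_iff)
    qed
    then show "k \<in> Pi\<^sub>E X (\<lambda>_. {\<lfloor>-1/e'\<rfloor>..\<lfloor>1/e'\<rfloor>})" by (simp add: f(2) key_def)
  qed
  then have "finite (key ` BL)" by (rule finite_subset) (use X(1) in \<open>auto intro: finite_PiE\<close>)
  then obtain G where G: "G \<subseteq> BL" "finite G" "key ` BL = key ` G"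
    using finite_subset_image[of "key ` BL" key BL] by auto
  show ?thesis
  proof (rule that[OF G(2,1)], intro ballI)
    fix f :: "'a \<Rightarrow> real" assume f: "f \<in> BL"
    then obtain g where g: "g \<in> G" "key f = key g" using G(3) by (metis imageE imageI)
    have gB: "g \<in> BL" using g(1) G(1) by auto
    have "\<bar>f x - g x\<bar> \<le> e" if x: "x \<in> K" for x
    proof -
      obtain y where y: "y \<in> X" "dist y x < e'" using X(3) x by auto
      have fl: "\<lfloor>f y / e'\<rfloor> = \<lfloor>g y / e'\<rfloor>"
        using fun_cong[OF g(2), of y] y(1) by (simp add: key_def)
      have "\<bar>f y / e' - g y / e'\<bar> \<le> 1"
        using fl of_int_floor_le[of "f y / e'"] of_int_floor_le[of "g y / e'"]
          real_of_int_floor_add_one_ge[of "f y / e'"] real_of_int_floor_add_one_ge[of "g y / e'"]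
        unfolding fl by linarith
      then have "\<bar>f y - g y\<bar> \<le> e'" using e' by (simp flip: diff_divide_distrib)
      moreover have "\<bar>f y - f x\<bar> \<le> dist y x" "\<bar>g y - g x\<bar> \<le> dist y x" using f gB by (simp_all add: BL_def)
      ultimately show ?thesis using y(2) unfolding e'_def by linarith
    qed
    with g(1) show "\<exists>g\<in>G. \<forall>x\<in>K. \<bar>f x - g x\<bar> \<le> e" by blast
  qed
qed


section \<open>Trigonometric polynomials and convergence of laws\<close>

text \<open>Linear combinations of the real and imaginary parts of the characters \<open>x \<mapsto> exp(i t \<bullet> x)\<close>.\<close>

inductive_set trig_polys :: "('a::euclidean_space \<Rightarrow> real) set" where
  trig_cos: "(\<lambda>x. c * cos (t \<bullet> x)) \<in> trig_polys"
| trig_sin: "(\<lambda>x. c * sin (t \<bullet> x)) \<in> trig_polys"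
| trig_add: "f \<in> trig_polys \<Longrightarrow> g \<in> trig_polys \<Longrightarrow> (\<lambda>x. f x + g x) \<in> trig_polys"

lemma trig_const: "(\<lambda>x. c) \<in> trig_polys"
  using trig_cos[of c 0] by simp

lemma trig_scale: "f \<in> trig_polys \<Longrightarrow> (\<lambda>x. c * f x) \<in> trig_polys"
proof (induction rule: trig_polys.induct)
  case (trig_cos d t) then show ?case using trig_polys.trig_cos[of "c * d" t] by (simp add: mult.assoc)
next
  case (trig_sin d t) then show ?case using trig_polys.trig_sin[of "c * d" t] by (simp add: mult.assoc)
next
  case (trig_add f g) then show ?case
    using trig_polys.trig_add[OF trig_add.IH] by (simp add: distrib_left)
qed

text \<open>The product formulas make trigonometric polynomials an algebra.\<close>

lemma trig_mult_basic:
  fixes s t :: "'a::euclidean_space"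
  shows "(\<lambda>x. cos (s \<bullet> x) * cos (t \<bullet> x)) \<in> trig_polys"
    "(\<lambda>x. cos (s \<bullet> x) * sin (t \<bullet> x)) \<in> trig_polys"
    "(\<lambda>x. sin (s \<bullet> x) * sin (t \<bullet> x)) \<in> trig_polys"
proof -
  have E: "cos (s \<bullet> x) * cos (t \<bullet> x) = (1/2) * cos ((s - t) \<bullet> x) + (1/2) * cos ((s + t) \<bullet> x)"
    "cos (s \<bullet> x) * sin (t \<bullet> x) = (1/2) * sin ((s + t) \<bullet> x) + (-1/2) * sin ((s - t) \<bullet> x)"
    "sin (s \<bullet> x) * sin (t \<bullet> x) = (1/2) * cos ((s - t) \<bullet> x) + (-1/2) * cos ((s + t) \<bullet> x)" for x
    by (simp_all add: inner_diff_left inner_add_left cos_add cos_diff sin_add sin_diff field_simps)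
  show "(\<lambda>x. cos (s \<bullet> x) * cos (t \<bullet> x)) \<in> trig_polys" unfolding E(1) by (intro trig_polys.intros)
  show "(\<lambda>x. cos (s \<bullet> x) * sin (t \<bullet> x)) \<in> trig_polys" unfolding E(2) by (intro trig_polys.intros)
  show "(\<lambda>x. sin (s \<bullet> x) * sin (t \<bullet> x)) \<in> trig_polys" unfolding E(3) by (intro trig_polys.intros)
qed

lemma trig_mult:
  fixes f g :: "'a::euclidean_space \<Rightarrow> real"
  assumes "f \<in> trig_polys" "g \<in> trig_polys"
  shows "(\<lambda>x. f x * g x) \<in> trig_polys"
  using assms(1)
proof (induction rule: trig_polys.induct)
  case (trig_cos c s)
  show ?case using assms(2)
  proof (induction rule: trig_polys.induct)
    case (trig_cos d t) then show ?case
      using trig_scale[OF trig_mult_basic(1)[of s t], of "c * d"] by (simp add: mult_ac)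
  next
    case (trig_sin d t) then show ?case
      using trig_scale[OF trig_mult_basic(2)[of s t], of "c * d"] by (simp add: mult_ac)
  next
    case (trig_add f g) then show ?case
      using trig_polys.trig_add[OF trig_add.IH] by (simp add: distrib_left)
  qed
next
  case (trig_sin c s)
  show ?case using assms(2)
  proof (induction rule: trig_polys.induct)
    case (trig_cos d t) then show ?case
      using trig_scale[OF trig_mult_basic(2)[of t s], of "c * d"] by (simp add: mult_ac)
  next
    case (trig_sin d t) then show ?case
      using trig_scale[OF trig_mult_basic(3)[of s t], of "c * d"] by (simp add: mult_ac)
  next
    case (trig_add f g) then show ?case
      using trig_polys.trig_add[OF trig_add.IH] by (simp add: distrib_left)
  qed
next
  case (trig_add f g) then show ?case
    using trig_polys.trig_add[OF trig_add.IH] by (simp add: distrib_right)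
qed

lemma trig_continuous: "f \<in> trig_polys \<Longrightarrow> continuous_on S f"
  by (induction rule: trig_polys.induct) (auto intro!: continuous_intros)

lemma trig_bounded: "f \<in> trig_polys \<Longrightarrow> \<exists>C\<ge>0. \<forall>x. \<bar>f x\<bar> \<le> C"
proof (induction rule: trig_polys.induct)
  case (trig_cos c t)
  show ?case by (rule exI[of _ "\<bar>c\<bar>"]) (auto simp: abs_mult intro!: mult_left_le)
next
  case (trig_sin c t)
  show ?case by (rule exI[of _ "\<bar>c\<bar>"]) (auto simp: abs_mult intro!: mult_left_le)
next
  case (trig_add f g)
  then obtain C D where "C \<ge> 0" "D \<ge> 0" "\<forall>x. \<bar>f x\<bar> \<le> C" "\<forall>x. \<bar>g x\<bar> \<le> D" by auto
  then show ?case by (intro exI[of _ "C + D"]) (auto intro: order_trans[OF abs_triangle_ineq] add_mono)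
qed

lemma trig_poly_comp:
  assumes "real_polynomial_function (p :: real \<Rightarrow> real)" "f \<in> trig_polys"
  shows "(\<lambda>x. p (f x)) \<in> trig_polys"
  using assms(1)
proof (induction rule: real_polynomial_function.induct)
  case (linear p)
  have p1: "p y = p 1 * y" for y
    using linear_scale[OF bounded_linear.linear[OF linear], of y 1] by (simp add: mult.commute)
  have "(\<lambda>x. p (f x)) = (\<lambda>x. p 1 * f x)" by (rule ext) (rule p1)
  then show ?case by (simp only: trig_scale[OF assms(2)])
next
  case (const c) then show ?case by (rule trig_const)
next
  case (add p q) then show ?case by (intro trig_add)
next
  case (mult p q) then show ?case by (intro trig_mult)
qed

text \<open>Stone-Weierstrass approximates on the compact set only. To keep the approximation bounded everywhere, it is composed
  with a polynomial that approximates the truncation to \<open>{-1..1}\<close> on its range.\<close>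

lemma trig_approximation:
  fixes f :: "'a::euclidean_space \<Rightarrow> real"
  assumes K: "compact K" and f: "continuous_on K f" "\<And>x. \<bar>f x\<bar> \<le> 1" and e: "e > 0"
  obtains p where "p \<in> trig_polys" "\<forall>x. \<bar>p x\<bar> \<le> 1 + e" "\<forall>x\<in>K. \<bar>f x - p x\<bar> \<le> e"
proof -
  have "\<exists>g\<in>trig_polys. \<forall>x\<in>K. \<bar>f x - g x\<bar> < e / 2"
  proof (rule function_ring_on.Stone_Weierstrass_basic)
    show "function_ring_on trig_polys K"
    proof (unfold_locales)
      show "\<exists>f\<in>trig_polys. f x \<noteq> f y" if "x \<in> K" "y \<in> K" "x \<noteq> y" for x y
      proof -
        \<comment> \<open>Along this frequency the phases of \<open>x\<close> and \<open>y\<close> differ by \<open>1\<close>, so cosine and sine separate them.\<close>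
        define t where "t = (1 / (norm (x - y))\<^sup>2) *\<^sub>R (x - y)"
        have "t \<bullet> (x - y) = 1" using that(3) by (simp add: t_def power2_norm_eq_inner[symmetric])
        then have tx: "t \<bullet> x = t \<bullet> y + 1" by (simp add: inner_diff_right)
        have "cos (t \<bullet> x) \<noteq> cos (t \<bullet> y) \<or> sin (t \<bullet> x) \<noteq> sin (t \<bullet> y)"
        proof (rule ccontr)
          assume "\<not> (cos (t \<bullet> x) \<noteq> cos (t \<bullet> y) \<or> sin (t \<bullet> x) \<noteq> sin (t \<bullet> y))"
          then have "cos (t \<bullet> x - t \<bullet> y) = 1"
            by (simp add: cos_diff)
          then have "cos (1::real) = 1" by (simp add: tx)
          then show False using cos_monotone_0_pi[of 0 1] pi_gt3 by simp
        qed
        then show ?thesis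
        proof
          assume "cos (t \<bullet> x) \<noteq> cos (t \<bullet> y)"
          then show ?thesis by (intro bexI[OF _ trig_polys.trig_cos[of 1 t]]) simp
        next
          assume "sin (t \<bullet> x) \<noteq> sin (t \<bullet> y)"
          then show ?thesis by (intro bexI[OF _ trig_polys.trig_sin[of 1 t]]) simp
        qed
      qed
    qed (auto intro: K trig_continuous trig_polys.trig_add trig_mult trig_const)
  qed (use f e in auto)
  then obtain g where g: "g \<in> trig_polys" "\<forall>x\<in>K. \<bar>f x - g x\<bar> < e / 2" by blast
  obtain C where C: "C \<ge> 0" "\<forall>x. \<bar>g x\<bar> \<le> C" using trig_bounded[OF g(1)] by blast
  define clamp where "clamp y = max (-1) (min 1 y)" for y :: real
  have "compact {-C..C}" by simp
  moreover have "continuous_on {-C..C} clamp" unfolding clamp_def by (intro continuous_intros)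
  ultimately obtain q where q: "real_polynomial_function q" "\<And>y. y \<in> {-C..C} \<Longrightarrow> \<bar>clamp y - q y\<bar> < e / 2"
    using Stone_Weierstrass_real_polynomial_function[of "{-C..C}" clamp "e/2"] e by auto
  have qg: "\<bar>clamp (g x) - q (g x)\<bar> < e / 2" for x
    using C(2) by (intro q(2)) (auto simp: abs_le_iff minus_le_iff)
  show ?thesis
  proof
    show "(\<lambda>x. q (g x)) \<in> trig_polys" by (rule trig_poly_comp[OF q(1) g(1)])
    have "\<bar>clamp y\<bar> \<le> 1" for y by (auto simp: clamp_def)
    then have "\<bar>q (g x)\<bar> \<le> 1 + e" for x
    proof -
      have "\<bar>clamp (g x)\<bar> \<le> 1" by (rule \<open>\<And>y. \<bar>clamp y\<bar> \<le> 1\<close>)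
      then show ?thesis using qg[of x] e by linarith
    qed
    then show "\<forall>x. \<bar>q (g x)\<bar> \<le> 1 + e" by blast
    show "\<forall>x\<in>K. \<bar>f x - q (g x)\<bar> \<le> e"
    proof
      fix x assume "x \<in> K"
      then have "\<bar>f x - g x\<bar> < e / 2" using g(2) by blast
      moreover have "\<bar>f x - clamp (g x)\<bar> \<le> \<bar>f x - g x\<bar>" using f(2)[of x] by (auto simp: clamp_def)
      ultimately show "\<bar>f x - q (g x)\<bar> \<le> e" using qg[of x] by linarith
    qed
  qed
qed

lemma trig_integral_close:
  assumes "p \<in> trig_polys" "e > 0"
  shows "\<exists>F \<eta>. finite F \<and> \<eta> > 0 \<and> (\<forall>\<mu>\<in>laws. \<forall>\<nu>\<in>laws.
     (\<forall>t\<in>F. \<bar>(\<integral>x. cos (t \<bullet> x) \<partial>\<mu>) - (\<integral>x. cos (t \<bullet> x) \<partial>\<nu>)\<bar> \<le> \<eta> \<and> \<bar>(\<integral>x. sin (t \<bullet> x) \<partial>\<mu>) - (\<integral>x. sin (t \<bullet> x) \<partial>\<nu>)\<bar> \<le> \<eta>) \<longrightarrow>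
     \<bar>(\<integral>x. p x \<partial>\<mu>) - (\<integral>x. p x \<partial>(\<nu> :: 'a::euclidean_space measure))\<bar> \<le> e)"
  using assms
proof (induction arbitrary: e rule: trig_polys.induct)
  case (trig_cos c t)
  have "\<bar>(\<integral>x. c * cos (t \<bullet> x) \<partial>\<mu>) - (\<integral>x. c * cos (t \<bullet> x) \<partial>\<nu>)\<bar> \<le> e"
    if "\<bar>(\<integral>x. cos (t \<bullet> x) \<partial>\<mu>) - (\<integral>x. cos (t \<bullet> x) \<partial>\<nu>)\<bar> \<le> e / (\<bar>c\<bar> + 1)" for \<mu> \<nu> :: "'a measure"
  proof -
    have "\<bar>(\<integral>x. c * cos (t \<bullet> x) \<partial>\<mu>) - (\<integral>x. c * cos (t \<bullet> x) \<partial>\<nu>)\<bar> = \<bar>c\<bar> * \<bar>(\<integral>x. cos (t \<bullet> x) \<partial>\<mu>) - (\<integral>x. cos (t \<bullet> x) \<partial>\<nu>)\<bar>"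
      by (simp flip: right_diff_distrib abs_mult)
    also have "\<dots> \<le> (\<bar>c\<bar> + 1) * (e / (\<bar>c\<bar> + 1))" using that trig_cos by (intro mult_mono) auto
    finally show ?thesis by simp
  qed
  then show ?case using trig_cos by (intro exI[of _ "{t}"] exI[of _ "e / (\<bar>c\<bar> + 1)"]) (auto intro: divide_pos_pos)
next
  case (trig_sin c t)
  have "\<bar>(\<integral>x. c * sin (t \<bullet> x) \<partial>\<mu>) - (\<integral>x. c * sin (t \<bullet> x) \<partial>\<nu>)\<bar> \<le> e"
    if "\<bar>(\<integral>x. sin (t \<bullet> x) \<partial>\<mu>) - (\<integral>x. sin (t \<bullet> x) \<partial>\<nu>)\<bar> \<le> e / (\<bar>c\<bar> + 1)" for \<mu> \<nu> :: "'a measure"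
  proof -
    have "\<bar>(\<integral>x. c * sin (t \<bullet> x) \<partial>\<mu>) - (\<integral>x. c * sin (t \<bullet> x) \<partial>\<nu>)\<bar> = \<bar>c\<bar> * \<bar>(\<integral>x. sin (t \<bullet> x) \<partial>\<mu>) - (\<integral>x. sin (t \<bullet> x) \<partial>\<nu>)\<bar>"
      by (simp flip: right_diff_distrib abs_mult)
    also have "\<dots> \<le> (\<bar>c\<bar> + 1) * (e / (\<bar>c\<bar> + 1))" using that trig_sin by (intro mult_mono) auto
    finally show ?thesis by simp
  qed
  then show ?case using trig_sin by (intro exI[of _ "{t}"] exI[of _ "e / (\<bar>c\<bar> + 1)"]) (auto intro: divide_pos_pos)
next
  case (trig_add f g)
  have int: "integrable \<mu> h" if h: "h \<in> trig_polys" and m: "\<mu> \<in> laws" for h :: "'a \<Rightarrow> real" and \<mu>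
  proof -
    obtain C where "\<forall>x. \<bar>h x\<bar> \<le> C" using trig_bounded[OF h] by blast
    then show ?thesis
      by (intro laws_integrable_bounded[OF m, of _ C] borel_measurable_continuous_onI trig_continuous h) auto
  qed
  have e2: "e / 2 > 0" using trig_add.prems by simp
  obtain F \<eta> where F: "finite F" "\<eta> > 0" "\<forall>\<mu>\<in>laws. \<forall>\<nu>\<in>laws.
     (\<forall>t\<in>F. \<bar>(\<integral>x. cos (t \<bullet> x) \<partial>\<mu>) - (\<integral>x. cos (t \<bullet> x) \<partial>\<nu>)\<bar> \<le> \<eta> \<and> \<bar>(\<integral>x. sin (t \<bullet> x) \<partial>\<mu>) - (\<integral>x. sin (t \<bullet> x) \<partial>\<nu>)\<bar> \<le> \<eta>) \<longrightarrow>
     \<bar>(\<integral>x. f x \<partial>\<mu>) - (\<integral>x. f x \<partial>\<nu>)\<bar> \<le> e / 2" using trig_add.IH(1)[OF e2] by blast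
  obtain G \<theta> where G: "finite G" "\<theta> > 0" "\<forall>\<mu>\<in>laws. \<forall>\<nu>\<in>laws.
     (\<forall>t\<in>G. \<bar>(\<integral>x. cos (t \<bullet> x) \<partial>\<mu>) - (\<integral>x. cos (t \<bullet> x) \<partial>\<nu>)\<bar> \<le> \<theta> \<and> \<bar>(\<integral>x. sin (t \<bullet> x) \<partial>\<mu>) - (\<integral>x. sin (t \<bullet> x) \<partial>\<nu>)\<bar> \<le> \<theta>) \<longrightarrow>
     \<bar>(\<integral>x. g x \<partial>\<mu>) - (\<integral>x. g x \<partial>\<nu>)\<bar> \<le> e / 2" using trig_add.IH(2)[OF e2] by blast
  show ?case
  proof (intro exI[of _ "F \<union> G"] exI[of _ "min \<eta> \<theta>"] conjI ballI impI)
    fix \<mu> \<nu> :: "'a measure" assume L: "\<mu> \<in> laws" "\<nu> \<in> laws"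
    assume "\<forall>t\<in>F \<union> G. \<bar>(\<integral>x. cos (t \<bullet> x) \<partial>\<mu>) - (\<integral>x. cos (t \<bullet> x) \<partial>\<nu>)\<bar> \<le> min \<eta> \<theta> \<and> \<bar>(\<integral>x. sin (t \<bullet> x) \<partial>\<mu>) - (\<integral>x. sin (t \<bullet> x) \<partial>\<nu>)\<bar> \<le> min \<eta> \<theta>"
    then have "\<bar>(\<integral>x. f x \<partial>\<mu>) - (\<integral>x. f x \<partial>\<nu>)\<bar> \<le> e / 2" "\<bar>(\<integral>x. g x \<partial>\<mu>) - (\<integral>x. g x \<partial>\<nu>)\<bar> \<le> e / 2"
      using F(3) G(3) L by (simp_all add: ball_Un)
    moreover have "(\<integral>x. f x + g x \<partial>\<mu>) = (\<integral>x. f x \<partial>\<mu>) + (\<integral>x. g x \<partial>\<mu>)" "(\<integral>x. f x + g x \<partial>\<nu>) = (\<integral>x. f x \<partial>\<nu>) + (\<integral>x. g x \<partial>\<nu>)"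
      by (intro Bochner_Integration.integral_add int trig_add.hyps L)+
    ultimately show "\<bar>(\<integral>x. f x + g x \<partial>\<mu>) - (\<integral>x. f x + g x \<partial>\<nu>)\<bar> \<le> e"
      by linarith
  qed (use F G in auto)
qed

text \<open>A quantitative continuity theorem, in which frequencies and tolerance depend only on the moment bound \<open>K\<close> and on
  \<open>e\<close>. Off a large ball Chebyshev's inequality applies; on the ball finitely many functions represent \<open>BL\<close>, and each of them
  is replaced by a trigonometric polynomial, which involves finitely many frequencies.\<close>

theorem BL_integrals_close_if_char_close:
  assumes e: "e > 0" and K: "K \<ge> 0"
  obtains F :: "'a::euclidean_space set" and \<eta> where "finite F" "\<eta> > 0"
    "\<forall>\<mu>\<in>laws. \<forall>\<nu>\<in>laws. integrable \<mu> (\<lambda>x. (norm x)\<^sup>2) \<and> (\<integral>x. (norm x)\<^sup>2 \<partial>\<mu>) \<le> K \<and>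
       integrable \<nu> (\<lambda>x. (norm x)\<^sup>2) \<and> (\<integral>x. (norm x)\<^sup>2 \<partial>\<nu>) \<le> K \<and>
       (\<forall>t\<in>F. \<bar>(\<integral>x. cos (t \<bullet> x) \<partial>\<mu>) - (\<integral>x. cos (t \<bullet> x) \<partial>\<nu>)\<bar> \<le> \<eta> \<and> \<bar>(\<integral>x. sin (t \<bullet> x) \<partial>\<mu>) - (\<integral>x. sin (t \<bullet> x) \<partial>\<nu>)\<bar> \<le> \<eta>) \<longrightarrow>
       (\<forall>f\<in>BL. \<bar>(\<integral>x. f x \<partial>\<mu>) - (\<integral>x. f x \<partial>\<nu>)\<bar> \<le> e)"
proof -
  define \<epsilon> where "\<epsilon> = min 1 (e / 12)"
  have \<epsilon>: "\<epsilon> > 0" "\<epsilon> \<le> 1" "12 * \<epsilon> \<le> e" using e by (auto simp: \<epsilon>_def)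
  \<comment> \<open>With this radius the part outside the ball contributes at most \<open>3 K / R\<^sup>2 \<le> 3 \<epsilon>\<close>.\<close>
  define R where "R = sqrt ((K + 1) / \<epsilon>)"
  have R: "R > 0" "R\<^sup>2 = (K + 1) / \<epsilon>" using \<epsilon> K by (auto simp: R_def)
  have cK: "compact (cball (0::'a) R)" by simp
  obtain G :: "('a \<Rightarrow> real) set" where G: "finite G" "G \<subseteq> BL" "\<forall>f\<in>BL. \<exists>g\<in>G. \<forall>x\<in>cball 0 R. \<bar>f x - g x\<bar> \<le> \<epsilon>"
    by (rule BL_totally_bounded[OF cK \<epsilon>(1)])
  have "\<forall>g\<in>G. \<exists>p. p \<in> trig_polys \<and> (\<forall>x. \<bar>p x\<bar> \<le> 1 + \<epsilon>) \<and> (\<forall>x\<in>cball 0 R. \<bar>g x - p x\<bar> \<le> \<epsilon>)"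
  proof
    fix g assume "g \<in> G"
    then have g: "g \<in> BL" using G by auto
    obtain p where "p \<in> trig_polys" "\<forall>x. \<bar>p x\<bar> \<le> 1 + \<epsilon>" "\<forall>x\<in>cball 0 R. \<bar>g x - p x\<bar> \<le> \<epsilon>"
      by (rule trig_approximation[OF cK continuous_on_subset[OF BL_continuous[OF g]] _ \<epsilon>(1)])
         (use BL_bounded[OF g] in auto)
    then show "\<exists>p. p \<in> trig_polys \<and> (\<forall>x. \<bar>p x\<bar> \<le> 1 + \<epsilon>) \<and> (\<forall>x\<in>cball 0 R. \<bar>g x - p x\<bar> \<le> \<epsilon>)" by blast
  qed
  from bchoice[OF this] obtain P where
    P': "\<forall>g\<in>G. P g \<in> trig_polys \<and> (\<forall>x. \<bar>P g x\<bar> \<le> 1 + \<epsilon>) \<and> (\<forall>x\<in>cball 0 R. \<bar>g x - P g x\<bar> \<le> \<epsilon>)" by blast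
  then have P: "\<And>g. g \<in> G \<Longrightarrow> P g \<in> trig_polys" "\<And>g x. g \<in> G \<Longrightarrow> \<bar>P g x\<bar> \<le> 1 + \<epsilon>"
      "\<And>g x. g \<in> G \<Longrightarrow> x \<in> cball 0 R \<Longrightarrow> \<bar>g x - P g x\<bar> \<le> \<epsilon>" by simp_all
  have "\<forall>g\<in>G. \<exists>F\<eta>. finite (fst F\<eta>) \<and> snd F\<eta> > 0 \<and> (\<forall>\<mu>\<in>laws. \<forall>\<nu>\<in>laws.
     (\<forall>t\<in>fst F\<eta>. \<bar>(\<integral>x. cos (t \<bullet> x) \<partial>\<mu>) - (\<integral>x. cos (t \<bullet> x) \<partial>\<nu>)\<bar> \<le> snd F\<eta> \<and> \<bar>(\<integral>x. sin (t \<bullet> x) \<partial>\<mu>) - (\<integral>x. sin (t \<bullet> x) \<partial>\<nu>)\<bar> \<le> snd F\<eta>) \<longrightarrow>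
     \<bar>(\<integral>x. P g x \<partial>\<mu>) - (\<integral>x. P g x \<partial>(\<nu> :: 'a measure))\<bar> \<le> \<epsilon>)"
  proof
    fix g assume "g \<in> G"
    from trig_integral_close[OF P(1)[OF this] \<epsilon>(1)] obtain F :: "'a set" and \<eta> where
      F\<eta>: "finite F \<and> \<eta> > 0 \<and> (\<forall>\<mu>\<in>laws. \<forall>\<nu>\<in>laws.
     (\<forall>t\<in>F. \<bar>(\<integral>x. cos (t \<bullet> x) \<partial>\<mu>) - (\<integral>x. cos (t \<bullet> x) \<partial>\<nu>)\<bar> \<le> \<eta> \<and> \<bar>(\<integral>x. sin (t \<bullet> x) \<partial>\<mu>) - (\<integral>x. sin (t \<bullet> x) \<partial>\<nu>)\<bar> \<le> \<eta>) \<longrightarrow>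
     \<bar>(\<integral>x. P g x \<partial>\<mu>) - (\<integral>x. P g x \<partial>(\<nu> :: 'a measure))\<bar> \<le> \<epsilon>)" by blast
    show "\<exists>F\<eta>. finite (fst F\<eta>) \<and> snd F\<eta> > 0 \<and> (\<forall>\<mu>\<in>laws. \<forall>\<nu>\<in>laws.
     (\<forall>t\<in>fst F\<eta>. \<bar>(\<integral>x. cos (t \<bullet> x) \<partial>\<mu>) - (\<integral>x. cos (t \<bullet> x) \<partial>\<nu>)\<bar> \<le> snd F\<eta> \<and> \<bar>(\<integral>x. sin (t \<bullet> x) \<partial>\<mu>) - (\<integral>x. sin (t \<bullet> x) \<partial>\<nu>)\<bar> \<le> snd F\<eta>) \<longrightarrow>
     \<bar>(\<integral>x. P g x \<partial>\<mu>) - (\<integral>x. P g x \<partial>(\<nu> :: 'a measure))\<bar> \<le> \<epsilon>)"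
      by (rule exI[of _ "(F, \<eta>)"], unfold fst_conv snd_conv, rule F\<eta>)
  qed
  from bchoice[OF this] obtain F\<eta> where F\<eta>': "\<forall>g\<in>G. finite (fst (F\<eta> g)) \<and> snd (F\<eta> g) > 0 \<and> (\<forall>\<mu>\<in>laws. \<forall>\<nu>\<in>laws.
     (\<forall>t\<in>fst (F\<eta> g). \<bar>(\<integral>x. cos (t \<bullet> x) \<partial>\<mu>) - (\<integral>x. cos (t \<bullet> x) \<partial>\<nu>)\<bar> \<le> snd (F\<eta> g) \<and> \<bar>(\<integral>x. sin (t \<bullet> x) \<partial>\<mu>) - (\<integral>x. sin (t \<bullet> x) \<partial>\<nu>)\<bar> \<le> snd (F\<eta> g)) \<longrightarrow>
     \<bar>(\<integral>x. P g x \<partial>\<mu>) - (\<integral>x. P g x \<partial>(\<nu> :: 'a measure))\<bar> \<le> \<epsilon>)" by (rule exE)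
  have F\<eta>: "\<And>g. g \<in> G \<Longrightarrow> finite (fst (F\<eta> g))" "\<And>g. g \<in> G \<Longrightarrow> snd (F\<eta> g) > 0"
     "\<And>g. g \<in> G \<Longrightarrow> (\<forall>\<mu>\<in>laws. \<forall>\<nu>\<in>laws.
     (\<forall>t\<in>fst (F\<eta> g). \<bar>(\<integral>x. cos (t \<bullet> x) \<partial>\<mu>) - (\<integral>x. cos (t \<bullet> x) \<partial>\<nu>)\<bar> \<le> snd (F\<eta> g) \<and> \<bar>(\<integral>x. sin (t \<bullet> x) \<partial>\<mu>) - (\<integral>x. sin (t \<bullet> x) \<partial>\<nu>)\<bar> \<le> snd (F\<eta> g)) \<longrightarrow>
     \<bar>(\<integral>x. P g x \<partial>\<mu>) - (\<integral>x. P g x \<partial>(\<nu> :: 'a measure))\<bar> \<le> \<epsilon>)"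
    using bspec[OF F\<eta>'] by blast+
  define F where "F = (\<Union>g\<in>G. fst (F\<eta> g))"
  define \<eta> where "\<eta> = Min (insert 1 ((\<lambda>g. snd (F\<eta> g)) ` G))"
  have \<eta>_le: "\<eta> \<le> snd (F\<eta> g)" if "g \<in> G" for g using that G(1) by (simp add: \<eta>_def)
  show ?thesis
  proof (rule that[of F \<eta>])
    show "finite F" using G(1) F\<eta>(1) by (simp add: F_def)
    show "\<eta> > 0" using G(1) F\<eta>(2) by (simp add: \<eta>_def)
    show "\<forall>\<mu>\<in>laws. \<forall>\<nu>\<in>laws. integrable \<mu> (\<lambda>x. (norm x)\<^sup>2) \<and> (\<integral>x. (norm x)\<^sup>2 \<partial>\<mu>) \<le> K \<and>
       integrable \<nu> (\<lambda>x. (norm x)\<^sup>2) \<and> (\<integral>x. (norm x)\<^sup>2 \<partial>\<nu>) \<le> K \<and>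
       (\<forall>t\<in>F. \<bar>(\<integral>x. cos (t \<bullet> x) \<partial>\<mu>) - (\<integral>x. cos (t \<bullet> x) \<partial>\<nu>)\<bar> \<le> \<eta> \<and> \<bar>(\<integral>x. sin (t \<bullet> x) \<partial>\<mu>) - (\<integral>x. sin (t \<bullet> x) \<partial>\<nu>)\<bar> \<le> \<eta>) \<longrightarrow>
       (\<forall>f\<in>BL. \<bar>(\<integral>x. f x \<partial>\<mu>) - (\<integral>x. f x \<partial>\<nu>)\<bar> \<le> e)"
    proof (rule ballI, rule ballI, rule impI)
      fix \<mu> \<nu> :: "'a measure" assume L: "\<mu> \<in> laws" "\<nu> \<in> laws"
      assume H: "integrable \<mu> (\<lambda>x. (norm x)\<^sup>2) \<and> (\<integral>x. (norm x)\<^sup>2 \<partial>\<mu>) \<le> K \<and>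
       integrable \<nu> (\<lambda>x. (norm x)\<^sup>2) \<and> (\<integral>x. (norm x)\<^sup>2 \<partial>\<nu>) \<le> K \<and>
       (\<forall>t\<in>F. \<bar>(\<integral>x. cos (t \<bullet> x) \<partial>\<mu>) - (\<integral>x. cos (t \<bullet> x) \<partial>\<nu>)\<bar> \<le> \<eta> \<and> \<bar>(\<integral>x. sin (t \<bullet> x) \<partial>\<mu>) - (\<integral>x. sin (t \<bullet> x) \<partial>\<nu>)\<bar> \<le> \<eta>)"
      show "(\<forall>f\<in>BL. \<bar>(\<integral>x. f x \<partial>\<mu>) - (\<integral>x. f x \<partial>\<nu>)\<bar> \<le> e)"
      proof (rule ballI)
        fix f :: "'a \<Rightarrow> real" assume f: "f \<in> BL"
        then obtain g where g: "g \<in> G" "\<forall>x\<in>cball 0 R. \<bar>f x - g x\<bar> \<le> \<epsilon>" using G(3) by blast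
        let ?p = "P g"
        have pm: "?p \<in> borel_measurable borel"
          by (intro borel_measurable_continuous_onI trig_continuous P(1) g)
        have pt: "\<bar>f x - ?p x\<bar> \<le> 2 * \<epsilon> + 3 / R\<^sup>2 * (norm x)\<^sup>2" for x
        proof (cases "x \<in> cball 0 R")
          case True
          then have "\<bar>f x - ?p x\<bar> \<le> 2 * \<epsilon>" using g(2) P(3)[OF g(1), of x] by fastforce
          then show ?thesis by (simp add: add_increasing2)
        next
          case False
          then have "R\<^sup>2 \<le> (norm x)\<^sup>2" using R(1) by (intro power_mono) auto
          then have "3 \<le> 3 / R\<^sup>2 * (norm x)\<^sup>2" using R(1) by (simp add: field_simps)
          moreover have "\<bar>f x - ?p x\<bar> \<le> 3" using BL_bounded[OF f, of x] P(2)[OF g(1), of x] \<epsilon>(2) by auto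
          ultimately show ?thesis using \<epsilon>(1) by linarith
        qed
        have diff: "\<bar>(\<integral>x. f x \<partial>M) - (\<integral>x. ?p x \<partial>M)\<bar> \<le> 5 * \<epsilon>"
          if M: "M \<in> laws" "integrable M (\<lambda>x. (norm x)\<^sup>2)" "(\<integral>x. (norm x)\<^sup>2 \<partial>M) \<le> K" for M
        proof -
          interpret M: prob_space M using M(1) by (rule laws_prob_space)
          have ip: "integrable M ?p" using P(2)[OF g(1)] by (intro laws_integrable_bounded[OF M(1) pm, of "1 + \<epsilon>"]) auto
          have "\<bar>(\<integral>x. f x \<partial>M) - (\<integral>x. ?p x \<partial>M)\<bar> = \<bar>\<integral>x. f x - ?p x \<partial>M\<bar>"
            using BL_integrable[OF f M(1)] ip by (simp add: Bochner_Integration.integral_diff)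
          also have "\<dots> \<le> (\<integral>x. \<bar>f x - ?p x\<bar> \<partial>M)" by (rule integral_abs_bound)
          also have "\<dots> \<le> (\<integral>x. 2 * \<epsilon> + 3 / R\<^sup>2 * (norm x)\<^sup>2 \<partial>M)"
            using BL_integrable[OF f M(1)] ip M(2) pt by (intro integral_mono) auto
          also have "\<dots> = 2 * \<epsilon> + 3 / R\<^sup>2 * (\<integral>x. (norm x)\<^sup>2 \<partial>M)"
            using M(2) by (simp add: Bochner_Integration.integral_add M.prob_space)
          also have "\<dots> \<le> 2 * \<epsilon> + 3 / R\<^sup>2 * (K + 1)" using M(3) by (intro add_left_mono mult_left_mono) auto
          also have "\<dots> = 5 * \<epsilon>" using K \<epsilon>(1) by (simp add: R(2))
          finally show ?thesis .
        qed
        have "\<bar>(\<integral>x. ?p x \<partial>\<mu>) - (\<integral>x. ?p x \<partial>\<nu>)\<bar> \<le> \<epsilon>"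
        proof -
          have "\<forall>t\<in>fst (F\<eta> g). \<bar>(\<integral>x. cos (t \<bullet> x) \<partial>\<mu>) - (\<integral>x. cos (t \<bullet> x) \<partial>\<nu>)\<bar> \<le> snd (F\<eta> g) \<and> \<bar>(\<integral>x. sin (t \<bullet> x) \<partial>\<mu>) - (\<integral>x. sin (t \<bullet> x) \<partial>\<nu>)\<bar> \<le> snd (F\<eta> g)"
          proof
            fix t assume "t \<in> fst (F\<eta> g)"
            then have "t \<in> F" using g(1) by (auto simp: F_def)
            then show "\<bar>(\<integral>x. cos (t \<bullet> x) \<partial>\<mu>) - (\<integral>x. cos (t \<bullet> x) \<partial>\<nu>)\<bar> \<le> snd (F\<eta> g) \<and> \<bar>(\<integral>x. sin (t \<bullet> x) \<partial>\<mu>) - (\<integral>x. sin (t \<bullet> x) \<partial>\<nu>)\<bar> \<le> snd (F\<eta> g)"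
              using H \<eta>_le[OF g(1)] by (meson order_trans)
          qed
          then show ?thesis using F\<eta>(3)[OF g(1)] L by blast
        qed
        moreover have "\<bar>(\<integral>x. f x \<partial>\<mu>) - (\<integral>x. ?p x \<partial>\<mu>)\<bar> \<le> 5 * \<epsilon>" using diff[OF L(1)] H by blast
        moreover have "\<bar>(\<integral>x. f x \<partial>\<nu>) - (\<integral>x. ?p x \<partial>\<nu>)\<bar> \<le> 5 * \<epsilon>" using diff[OF L(2)] H by blast
        ultimately show "\<bar>(\<integral>x. f x \<partial>\<mu>) - (\<integral>x. f x \<partial>\<nu>)\<bar> \<le> e" using \<epsilon>(1,3) by linarith
      qed
    qed
  qed
qed


section \<open>Independent observations\<close>

lemma prob_space_iid:
  assumes "prob_space Q"
  shows "prob_space (iid Q)"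
  unfolding iid_def by (intro prob_space_PiM assms)

lemma iid_component_measurable: "(\<lambda>\<omega>. \<omega> i) \<in> measurable (iid Q) Q"
  unfolding iid_def by (rule measurable_component_singleton) simp

lemma distr_iid_component:
  assumes "prob_space Q"
  shows "distr (iid Q) Q (\<lambda>\<omega>. \<omega> i) = Q"
  unfolding iid_def by (rule distr_PiM_component[OF assms]) simp

lemma indep_vars_iid:
  assumes Q: "prob_space Q"
  shows "prob_space.indep_vars (iid Q) (\<lambda>_. Q) (\<lambda>i \<omega>. \<omega> i) UNIV"
proof -
  interpret I: prob_space "iid Q" using Q by (rule prob_space_iid)
  have "distr (iid Q) (\<Pi>\<^sub>M i\<in>UNIV. Q) (\<lambda>\<omega>. \<lambda>i\<in>UNIV. \<omega> i) = distr (iid Q) (iid Q) (\<lambda>\<omega>. \<omega>)"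
    by (intro distr_cong) (auto simp: iid_def)
  also have "\<dots> = iid Q" by (rule distr_id2) simp
  also have "\<dots> = (\<Pi>\<^sub>M i\<in>UNIV. distr (iid Q) Q (\<lambda>\<omega>. \<omega> i))"
    unfolding distr_iid_component[OF Q] by (simp add: iid_def)
  finally show ?thesis
    by (subst I.indep_vars_iff_distr_eq_PiM') (auto intro: iid_component_measurable)
qed

lemma indep_vars_iid_compose:
  assumes Q: "prob_space Q" and f: "\<And>i. i \<in> I \<Longrightarrow> f i \<in> measurable Q N"
  shows "prob_space.indep_vars (iid Q) (\<lambda>_. N) (\<lambda>i \<omega>. f i (\<omega> i)) I"
proof -
  interpret I: prob_space "iid Q" using Q by (rule prob_space_iid)
  have "I.indep_vars (\<lambda>_. Q) (\<lambda>i \<omega>. \<omega> i) I"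
    by (rule I.indep_vars_subset[OF indep_vars_iid[OF Q]]) simp
  from I.indep_vars_compose2[OF this, of f "\<lambda>_. N", OF f] show ?thesis .
qed

lemma integral_iid_component:
  fixes f :: "'a \<Rightarrow> 'b::{banach,second_countable_topology}"
  assumes Q: "prob_space Q" and f: "f \<in> borel_measurable Q"
  shows "(\<integral>\<omega>. f (\<omega> i) \<partial>iid Q) = (\<integral>x. f x \<partial>Q)"
  using integral_distr[OF iid_component_measurable[of i Q] f] by (simp add: distr_iid_component[OF Q])

lemma char_iid_sum:
  assumes Q: "prob_space Q" and u: "\<And>j. j < n \<Longrightarrow> u j \<in> borel_measurable Q"
  shows "char (distr (iid Q) borel (\<lambda>\<omega>. \<Sum>j<n. u j (\<omega> j))) s = (\<Prod>j<n. char (distr Q borel (u j)) s)"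
proof -
  interpret I: prob_space "iid Q" using Q by (rule prob_space_iid)
  have "char (distr (iid Q) borel (\<lambda>\<omega>. \<Sum>j<n. u j (\<omega> j))) s = (\<Prod>j<n. char (distr (iid Q) borel (\<lambda>\<omega>. u j (\<omega> j))) s)"
    by (rule I.char_distr_sum, rule indep_vars_iid_compose[OF Q, of _ u]) (simp add: u)
  also have "\<dots> = (\<Prod>j<n. char (distr Q borel (u j)) s)"
  proof (intro prod.cong refl)
    fix j assume "j \<in> {..<n}"
    then have uj: "u j \<in> borel_measurable Q" by (simp add: u)
    have "distr (distr (iid Q) Q (\<lambda>\<omega>. \<omega> j)) borel (u j) = distr (iid Q) borel (\<lambda>\<omega>. u j (\<omega> j))"
      using distr_distr[OF uj iid_component_measurable[of j]] by (simp only: comp_def)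
    then show "char (distr (iid Q) borel (\<lambda>\<omega>. u j (\<omega> j))) s = char (distr Q borel (u j)) s"
      by (simp only: distr_iid_component[OF Q])
  qed
  finally show ?thesis .
qed

text \<open>Independence and centring remove the mixed terms; the inner product is expanded in a basis to reduce to products of
  real random variables.\<close>

lemma iid_sum_second_moment:
  fixes f :: "'a::topological_space \<Rightarrow> 'b::euclidean_space"
  assumes Q: "Q \<in> laws" and f: "f \<in> borel_measurable borel" "\<And>x. norm (f x) \<le> K" and f0: "(\<integral>x. f x \<partial>Q) = 0"
  shows "integrable (iid Q) (\<lambda>\<omega>. (norm (\<Sum>j<n. f (\<omega> j)))\<^sup>2)" 
    and "(\<integral>\<omega>. (norm (\<Sum>j<n. f (\<omega> j)))\<^sup>2 \<partial>iid Q) = real n * (\<integral>x. (norm (f x))\<^sup>2 \<partial>Q)"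
proof -
  have Qp: "prob_space Q" using Q by (rule laws_prob_space)
  interpret I: prob_space "iid Q" using Qp by (rule prob_space_iid)
  have fm: "f \<in> borel_measurable Q" unfolding laws_measurable[OF Q] by (rule f(1))
  have cm: "(\<lambda>\<omega>. f (\<omega> j)) \<in> borel_measurable (iid Q)" for j
    by (rule measurable_compose[OF iid_component_measurable[of j Q] fm])
  have int: "integrable (iid Q) (\<lambda>\<omega>. f (\<omega> j) \<bullet> f (\<omega> k))" for j k
  proof (rule I.integrable_const_bound[of _ "K * K"])
    have K0: "0 \<le> K" using norm_ge_zero f(2) by (rule order_trans)
    have "\<bar>f x \<bullet> f y\<bar> \<le> K * K" for x y
      by (rule order_trans[OF Cauchy_Schwarz_ineq2 mult_mono[OF f(2) f(2) K0 norm_ge_zero]])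
    then show "AE \<omega> in iid Q. norm (f (\<omega> j) \<bullet> f (\<omega> k)) \<le> K * K" by simp
    show "(\<lambda>\<omega>. f (\<omega> j) \<bullet> f (\<omega> k)) \<in> borel_measurable (iid Q)" by (intro borel_measurable_inner cm)
  qed
  have comp0: "(\<integral>\<omega>. f (\<omega> j) \<bullet> b \<partial>iid Q) = 0" for j b
  proof -
    have "(\<integral>\<omega>. f (\<omega> j) \<bullet> b \<partial>iid Q) = (\<integral>x. f x \<bullet> b \<partial>Q)"
      by (rule integral_iid_component[OF Qp borel_measurable_inner[OF fm borel_measurable_const]])
    also have "\<dots> = (\<integral>x. f x \<partial>Q) \<bullet> b"
      by (rule integral_inner_left) (rule laws_integrable_bounded[OF Q f])
    finally show ?thesis by (simp add: f0)
  qed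
  have cross: "(\<integral>\<omega>. f (\<omega> j) \<bullet> f (\<omega> k) \<partial>iid Q) = (if j = k then (\<integral>x. (norm (f x))\<^sup>2 \<partial>Q) else 0)" for j k
  proof (cases "j = k")
    case True
    have "(\<integral>\<omega>. f (\<omega> k) \<bullet> f (\<omega> k) \<partial>iid Q) = (\<integral>x. f x \<bullet> f x \<partial>Q)"
      by (rule integral_iid_component[OF Qp borel_measurable_inner[OF fm fm]])
    then show ?thesis using True by (simp only: power2_norm_eq_inner simp_thms if_True)
  next
    case False
    have ic: "integrable (iid Q) (\<lambda>\<omega>. f (\<omega> i) \<bullet> b)" if "b \<in> Basis" for i b
    proof (rule I.integrable_const_bound[of _ "K"])
      have "\<bar>f x \<bullet> b\<bar> \<le> K" for x using Basis_le_norm[OF that, of "f x"] f(2)[of x] by linarith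
      then show "AE \<omega> in iid Q. norm (f (\<omega> i) \<bullet> b) \<le> K" by simp
      show "(\<lambda>\<omega>. f (\<omega> i) \<bullet> b) \<in> borel_measurable (iid Q)" by (intro borel_measurable_inner cm borel_measurable_const)
    qed
    have ind: "I.indep_var borel (\<lambda>\<omega>. f (\<omega> j) \<bullet> b) borel (\<lambda>\<omega>. f (\<omega> k) \<bullet> b)" for b
    proof -
      have "I.indep_vars (\<lambda>_. borel) (\<lambda>i \<omega>. f (\<omega> i) \<bullet> b) (insert j {k})"
        by (rule indep_vars_iid_compose[OF Qp, of _ "\<lambda>_ x. f x \<bullet> b"])
          (rule borel_measurable_inner[OF fm borel_measurable_const])
      from I.indep_vars_sum[OF _ _ this] False show ?thesis by simp
    qed
    have prod: "integrable (iid Q) (\<lambda>\<omega>. (f (\<omega> j) \<bullet> b) * (f (\<omega> k) \<bullet> b))"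
        "(\<integral>\<omega>. (f (\<omega> j) \<bullet> b) * (f (\<omega> k) \<bullet> b) \<partial>iid Q) = 0" if b: "b \<in> Basis" for b
    proof -
      show "integrable (iid Q) (\<lambda>\<omega>. (f (\<omega> j) \<bullet> b) * (f (\<omega> k) \<bullet> b))"
        by (rule I.indep_var_integrable[OF ind[of b] ic[OF b, of j] ic[OF b, of k]])
      have "(\<integral>\<omega>. (f (\<omega> j) \<bullet> b) * (f (\<omega> k) \<bullet> b) \<partial>iid Q) = (\<integral>\<omega>. f (\<omega> j) \<bullet> b \<partial>iid Q) * (\<integral>\<omega>. f (\<omega> k) \<bullet> b \<partial>iid Q)"
        by (rule I.indep_var_lebesgue_integral[OF ind[of b] ic[OF b, of j] ic[OF b, of k]])
      then show "(\<integral>\<omega>. (f (\<omega> j) \<bullet> b) * (f (\<omega> k) \<bullet> b) \<partial>iid Q) = 0" by (simp only: comp0 mult_zero_left)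
    qed
    have "(\<integral>\<omega>. f (\<omega> j) \<bullet> f (\<omega> k) \<partial>iid Q) = (\<Sum>b\<in>Basis. \<integral>\<omega>. (f (\<omega> j) \<bullet> b) * (f (\<omega> k) \<bullet> b) \<partial>iid Q)"
      unfolding euclidean_inner[of "f _" "f _"] by (rule Bochner_Integration.integral_sum[OF prod(1)])
    also have "\<dots> = 0" by (simp add: prod(2))
    finally show ?thesis using False by simp
  qed
  have exp: "(norm (\<Sum>j<n. f (\<omega> j)))\<^sup>2 = (\<Sum>j<n. \<Sum>k<n. f (\<omega> j) \<bullet> f (\<omega> k))" for \<omega> :: "nat \<Rightarrow> 'a"
    unfolding power2_norm_eq_inner by (subst inner_sum_left) (simp only: inner_sum_right)
  show "integrable (iid Q) (\<lambda>\<omega>. (norm (\<Sum>j<n. f (\<omega> j)))\<^sup>2)"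
    unfolding exp by (intro Bochner_Integration.integrable_sum int)
  have "(\<integral>\<omega>. (norm (\<Sum>j<n. f (\<omega> j)))\<^sup>2 \<partial>iid Q) = (\<Sum>j<n. \<Sum>k<n. \<integral>\<omega>. f (\<omega> j) \<bullet> f (\<omega> k) \<partial>iid Q)"
    unfolding exp
    by (subst Bochner_Integration.integral_sum, intro Bochner_Integration.integrable_sum int,
        intro sum.cong refl Bochner_Integration.integral_sum int)
  also have "\<dots> = real n * (\<integral>x. (norm (f x))\<^sup>2 \<partial>Q)" by (simp only: cross) simp
  finally show "(\<integral>\<omega>. (norm (\<Sum>j<n. f (\<omega> j)))\<^sup>2 \<partial>iid Q) = real n * (\<integral>x. (norm (f x))\<^sup>2 \<partial>Q)" .
qed

lemma iid_sum_measurable: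
  fixes k :: "'a::topological_space \<Rightarrow> 'c::euclidean_space"
  assumes Q: "Q \<in> laws" and k: "k \<in> borel_measurable borel"
  shows "(\<lambda>X. \<Sum>j<n. k (X j)) \<in> borel_measurable (iid Q)"
proof (rule borel_measurable_sum)
  fix j
  have "k \<in> borel_measurable Q" unfolding laws_measurable[OF Q] by (rule k)
  then show "(\<lambda>X. k (X j)) \<in> borel_measurable (iid Q)"
    by (rule measurable_compose[OF iid_component_measurable[of j Q]])
qed

lemma iid_distr_laws:
  assumes "Q \<in> laws" "f \<in> borel_measurable (iid Q)"
  shows "distr (iid Q) borel f \<in> laws"
  using prob_space.prob_space_distr[OF prob_space_iid[OF laws_prob_space[OF assms(1)]] assms(2)]
  by (simp add: laws_def)


section \<open>Normal laws with a given covariance\<close>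

lemma normal_law_0_eq_scaled:
  assumes "\<sigma> \<ge> 0"
  shows "normal_law_0 \<sigma> = distr std_normal_distribution borel (\<lambda>x. \<sigma> * x)"
proof (cases "\<sigma> = 0")
  case True
  interpret prob_space std_normal_distribution by (rule prob_space_normal_density) simp
  show ?thesis using True by (simp add: normal_law_0_def)
next
  case False
  interpret prob_space std_normal_distribution by (rule prob_space_normal_density) simp
  have "distributed std_normal_distribution lborel (\<lambda>x. x) (normal_density 0 1)"
    unfolding distributed_def by (auto intro!: distr_id2)
  from normal_density_affine[OF this, of \<sigma> 0] have
    "distributed std_normal_distribution lborel (\<lambda>x. \<sigma> * x) (normal_density 0 \<sigma>)"
    using assms False by simp
  then have "distr std_normal_distribution lborel (\<lambda>x. \<sigma> * x) = density lborel (normal_density 0 \<sigma>)"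
    by (simp add: distributed_def)
  moreover have "distr std_normal_distribution lborel (\<lambda>x. \<sigma> * x) = distr std_normal_distribution borel (\<lambda>x. \<sigma> * x)"
    by (intro distr_cong) auto
  ultimately show ?thesis using False by (simp add: normal_law_0_def)
qed

lemma std_normal_second_moment:
  "integrable std_normal_distribution (\<lambda>x. (c * x)\<^sup>2)" "(\<integral>x. (c * x)\<^sup>2 \<partial>std_normal_distribution) = c\<^sup>2"
proof -
  have "integrable std_normal_distribution (\<lambda>x. x\<^sup>2)"
    using std_normal_distribution_even_moments(2)[of 1] by (simp only: mult_1_right)
  then show "integrable std_normal_distribution (\<lambda>x. (c * x)\<^sup>2)"
    unfolding power_mult_distrib by (rule integrable_mult_right)
  have "(\<integral>x. x\<^sup>2 \<partial>std_normal_distribution) = fact (2 * 1) / (2 ^ 1 * fact 1)"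
    using std_normal_distribution_even_moments(1)[of 1] by (simp only: mult_1_right)
  also have "\<dots> = (1::real)" by (simp add: fact_numeral)
  finally show "(\<integral>x. (c * x)\<^sup>2 \<partial>std_normal_distribution) = c\<^sup>2"
    unfolding power_mult_distrib by (simp only: integral_mult_right_zero mult_1_right)
qed

lemma real_distribution_distr:
  assumes "prob_space M" "f \<in> borel_measurable M"
  shows "real_distribution (distr M borel f)"
  using prob_space.prob_space_distr[OF assms] by (simp add: real_distribution_def real_distribution_axioms_def)

lemma char_distr_scale:
  assumes "f \<in> borel_measurable M"
  shows "char (distr M borel (\<lambda>x. c * f x)) s = char (distr M borel f) (c * s)"
  using assms by (simp add: char_def integral_distr mult_ac)

lemma char_normal_law_0:
  assumes "\<sigma> \<ge> 0"
  shows "char (normal_law_0 \<sigma>) s = exp (- (\<sigma> * s)\<^sup>2 / 2)"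
  unfolding normal_law_0_eq_scaled[OF assms]
  by (subst char_distr_scale[where f = "\<lambda>x. x"]) (simp_all add: distr_id2 char_std_normal_distribution)

text \<open>Successive completion of squares: subtracting \<open>(x \<bullet> v)\<^sup>2\<close> with \<open>v\<close> proportional to \<open>B b \<cdot>\<close> leaves a positive
  semidefinite form with one more basis vector \<open>b\<close> in its kernel.\<close>

lemma psd_form_sum_of_squares:
  fixes B :: "'b::euclidean_space \<Rightarrow> 'b \<Rightarrow> real"
  assumes "\<And>x. linear (B x)" "\<And>x y. B x y = B y x" "\<And>x. 0 \<le> B x x"
  shows "\<exists>vs. \<forall>t. B t t = (\<Sum>v\<leftarrow>vs. (t \<bullet> v)\<^sup>2)"
  using assms
proof (induction "card {b\<in>Basis. B b b \<noteq> 0}" arbitrary: B rule: less_induct)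
  case less
  note lin = less.prems(1) and sym = less.prems(2) and psd = less.prems(3)
  have l: "B z (x + t *\<^sub>R y) = B z x + t * B z y" for z x y t
    using linear_add[OF lin, of z x "t *\<^sub>R y"] linear_scale[OF lin, of z t y] by simp
  have quad: "B (x + t *\<^sub>R y) (x + t *\<^sub>R y) = B x x + 2 * t * B x y + t\<^sup>2 * B y y" for x y t
  proof -
    have "B (x + t *\<^sub>R y) (x + t *\<^sub>R y) = B (x + t *\<^sub>R y) x + t * B (x + t *\<^sub>R y) y" by (rule l)
    also have "B (x + t *\<^sub>R y) x = B x x + t * B x y" by (rule trans[OF sym l])
    also have "B (x + t *\<^sub>R y) y = B y x + t * B y y" by (rule trans[OF sym l])
    also have "B y x = B x y" by (rule sym)
    finally show ?thesis by (simp add: power2_eq_square algebra_simps)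
  qed
  have expand: "B x y = (\<Sum>e\<in>Basis. (y \<bullet> e) * B x e)" for x y
  proof -
    have "B x y = B x (\<Sum>e\<in>Basis. (y \<bullet> e) *\<^sub>R e)" by (simp add: euclidean_representation)
    also have "\<dots> = (\<Sum>e\<in>Basis. (y \<bullet> e) * B x e)" by (simp add: linear_sum[OF lin] linear_scale[OF lin])
    finally show ?thesis .
  qed
  show ?case
  proof (cases "\<forall>b\<in>Basis. B b b = 0")
    case True
    have z: "B x b = 0" if "b \<in> Basis" for x b
    proof (rule quadratic_nonneg_linear_zero)
      fix t
      have "0 \<le> B (b + t *\<^sub>R x) (b + t *\<^sub>R x)" by (rule psd)
      then show "0 \<le> 2 * t * B x b + t\<^sup>2 * B x x"
        using True that unfolding quad by (simp add: sym[of b x])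
    qed
    then have "B t t = 0" for t by (subst expand) simp
    then show ?thesis by (intro exI[of _ "[]"]) simp
  next
    case False
    then obtain b where b: "b \<in> Basis" "B b b \<noteq> 0" by auto
    then have bp: "B b b > 0" using psd[of b] by simp
    define v where "v = (\<Sum>e\<in>Basis. (B b e / sqrt (B b b)) *\<^sub>R e)"
    have xv: "x \<bullet> v = B b x / sqrt (B b b)" for x
      by (subst expand[of b x]) (simp add: v_def inner_sum_right sum_divide_distrib mult.commute)
    define B' where "B' x y = B x y - (x \<bullet> v) * (y \<bullet> v)" for x y
    have cs: "(B b x)\<^sup>2 \<le> B b b * B x x" for x
    proof -
      define t where "t = - B b x / B b b"
      have "0 \<le> B (x + t *\<^sub>R b) (x + t *\<^sub>R b)" by (rule psd)
      also have "\<dots> = B x x - (B b x)\<^sup>2 / B b b"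
        unfolding quad using bp by (simp add: t_def sym[of x b] power2_eq_square field_simps)
      finally show ?thesis using bp by (simp add: field_simps)
    qed
    have v2: "(x \<bullet> v)\<^sup>2 = (B b x)\<^sup>2 / B b b" for x using bp by (simp add: xv power_divide)
    have le: "B' x x \<le> B x x" for x by (simp add: B'_def)
    have psd': "0 \<le> B' x x" for x
    proof -
      have "B' x x = B x x - (B b x)\<^sup>2 / B b b" using v2[of x] unfolding B'_def power2_eq_square by simp
      moreover have "(B b x)\<^sup>2 / B b b \<le> B x x" using cs[of x] bp by (simp add: pos_divide_le_eq mult.commute)
      ultimately show ?thesis by linarith
    qed
    have "B' b b = 0" using bp by (simp add: B'_def xv)
    have "{e\<in>Basis. B' e e \<noteq> 0} \<subset> {e\<in>Basis. B e e \<noteq> 0}"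
    proof
      show "{e\<in>Basis. B' e e \<noteq> 0} \<subseteq> {e\<in>Basis. B e e \<noteq> 0}"
      proof safe
        fix e assume "e \<in> Basis" "B' e e \<noteq> 0" "B e e = 0"
        then show False using le[of e] psd'[of e] by simp
      qed
      show "{e\<in>Basis. B' e e \<noteq> 0} \<noteq> {e\<in>Basis. B e e \<noteq> 0}"
        using b \<open>B' b b = 0\<close> by blast
    qed
    then have "card {e\<in>Basis. B' e e \<noteq> 0} < card {e\<in>Basis. B e e \<noteq> 0}" by (intro psubset_card_mono) auto
    then have "\<exists>vs. \<forall>t. B' t t = (\<Sum>v\<leftarrow>vs. (t \<bullet> v)\<^sup>2)"
    proof (rule less.hyps[of B'])
      show "linear (B' x)" for x
        unfolding B'_def
        by (intro linear_compose_sub lin) (auto intro!: linearI simp: inner_add_left algebra_simps)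
      show "B' x y = B' y x" for x y using sym[of x y] by (simp add: B'_def mult.commute)
    qed (rule psd')
    then obtain vs where vs: "\<forall>t. B' t t = (\<Sum>v\<leftarrow>vs. (t \<bullet> v)\<^sup>2)" by blast
    have "B t t = (\<Sum>v\<leftarrow>v#vs. (t \<bullet> v)\<^sup>2)" for t
    proof -
      have "B t t = B' t t + (t \<bullet> v)\<^sup>2" by (simp add: B'_def power2_eq_square)
      then show ?thesis using vs by simp
    qed
    then show ?thesis by blast
  qed
qed

text \<open>If the form is \<open>t \<mapsto> \<Sum>k. (t \<bullet> v\<^sub>k)\<^sup>2\<close>, the law of \<open>\<Sum>k. \<xi>\<^sub>k v\<^sub>k\<close> with independent standard normal \<open>\<xi>\<^sub>k\<close> has
  the required covariance. The vectors \<open>v\<^sub>k\<close> lie in \<open>S\<close> because the form vanishes on its orthogonal complement.\<close>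

proposition mean_zero_normal_exists:
  fixes B :: "'b::euclidean_space \<Rightarrow> 'b \<Rightarrow> real"
  assumes S: "subspace S" and B: "\<And>x. linear (B x)" "\<And>x y. B x y = B y x" "\<And>x. 0 \<le> B x x"
    and BS: "\<And>s. s \<in> S\<^sup>\<bottom> \<Longrightarrow> B s s = 0"
  shows "\<exists>N. mean_zero_normal_on S N \<and> (\<forall>t. char (distr N borel (\<lambda>x. t \<bullet> x)) 1 = exp (- B t t / 2)) \<and>
     integrable N (\<lambda>x. (norm x)\<^sup>2) \<and> (\<integral>x. (norm x)\<^sup>2 \<partial>N) = (\<Sum>b\<in>Basis. B b b)"
proof -
  obtain vs where vs: "\<forall>t. B t t = (\<Sum>v\<leftarrow>vs. (t \<bullet> v)\<^sup>2)" using psd_form_sum_of_squares[OF B] by blast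
  define m where "m = length vs"
  have Bt: "B t t = (\<Sum>k<m. (t \<bullet> vs ! k)\<^sup>2)" for t
    using vs by (simp add: m_def sum_list_sum_nth atLeast0LessThan)
  have P: "prob_space std_normal_distribution" by (rule prob_space_normal_density) simp
  define M where "M = iid std_normal_distribution"
  interpret M: prob_space M unfolding M_def by (rule prob_space_iid[OF P])
  define X where "X \<omega> = (\<Sum>k<m. \<omega> k *\<^sub>R vs ! k)" for \<omega> :: "nat \<Rightarrow> real"
  have [measurable]: "(\<lambda>\<omega>. \<omega> k) \<in> borel_measurable M" for k
    unfolding M_def using iid_component_measurable[of k std_normal_distribution]
    by (simp cong: measurable_cong_sets)
  have Xm [measurable]: "X \<in> borel_measurable M" unfolding X_def by measurable
  define N where "N = distr M borel X"
  have N: "N \<in> laws" unfolding N_def laws_def using M.prob_space_distr[OF Xm] by simp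
  have dt: "distr N borel (\<lambda>x. t \<bullet> x) = distr M borel (\<lambda>\<omega>. \<Sum>k<m. (t \<bullet> vs ! k) * \<omega> k)" for t
    unfolding N_def by (subst distr_distr) (auto simp: comp_def X_def inner_sum_right mult.commute)
  have ch: "char (distr N borel (\<lambda>x. t \<bullet> x)) s = exp (- (B t t * s\<^sup>2) / 2)" for t s
  proof -
    have "char (distr N borel (\<lambda>x. t \<bullet> x)) s = (\<Prod>k<m. char (distr std_normal_distribution borel (\<lambda>x. (t \<bullet> vs ! k) * x)) s)"
      unfolding dt M_def by (rule char_iid_sum[OF P]) simp
    also have "\<dots> = (\<Prod>k<m. complex_of_real (exp (- ((t \<bullet> vs ! k) * s)\<^sup>2 / 2)))"
      by (subst char_distr_scale[where f = "\<lambda>x. x"]) (simp_all add: distr_id2 char_std_normal_distribution)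
    also have "\<dots> = complex_of_real (exp (\<Sum>k<m. - ((t \<bullet> vs ! k) * s)\<^sup>2 / 2))"
      by (simp add: exp_sum)
    also have "(\<Sum>k<m. - ((t \<bullet> vs ! k) * s)\<^sup>2 / 2) = - (B t t * s\<^sup>2) / 2"
      by (simp add: Bt sum_distrib_right sum_divide_distrib sum_negf power_mult_distrib)
    finally show ?thesis .
  qed
  have nl: "distr N borel (\<lambda>x. t \<bullet> x) = normal_law_0 (sqrt (B t t))" for t
  proof (rule Levy_uniqueness)
    have "prob_space N" using N by (rule laws_prob_space)
    then show "real_distribution (distr N borel (\<lambda>x. t \<bullet> x))"
      by (rule real_distribution_distr) (simp add: laws_measurable[OF N])
    have s: "sqrt (B t t) \<ge> 0" using B(3) by simp
    then show "real_distribution (normal_law_0 (sqrt (B t t)))"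
      unfolding normal_law_0_eq_scaled[OF s] by (intro real_distribution_distr P) simp
    show "char (distr N borel (\<lambda>x. t \<bullet> x)) = char (normal_law_0 (sqrt (B t t)))"
    proof (rule ext)
      fix r
      have "(sqrt (B t t) * r)\<^sup>2 = B t t * r\<^sup>2" using B(3)[of t] by (simp add: power_mult_distrib)
      then show "char (distr N borel (\<lambda>x. t \<bullet> x)) r = char (normal_law_0 (sqrt (B t t))) r"
        unfolding ch char_normal_law_0[OF s] by simp
    qed
  qed
  have vsS: "vs ! k \<in> S" if "k < m" for k
  proof -
    have "vs ! k \<in> (S\<^sup>\<bottom>)\<^sup>\<bottom>"
      unfolding orthogonal_comp_def
    proof (intro CollectI ballI)
      fix s assume "s \<in> {x. \<forall>y\<in>S. orthogonal y x}"
      then have "s \<in> S\<^sup>\<bottom>" by (simp add: orthogonal_comp_def)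
      then have "(\<Sum>k<m. (s \<bullet> vs ! k)\<^sup>2) = 0" unfolding Bt[symmetric] by (rule BS)
      then have "(s \<bullet> vs ! k)\<^sup>2 = 0" using that by (subst (asm) sum_nonneg_eq_0_iff) auto
      then show "orthogonal s (vs ! k)" by (simp add: orthogonal_def)
    qed
    then show ?thesis using orthogonal_comp_self[OF S] by simp
  qed
  have XS: "X \<omega> \<in> S" for \<omega> unfolding X_def using vsS by (intro subspace_sum S subspace_scale) auto
  have S_meas: "{x \<in> space borel. x \<in> S} \<in> sets borel"
    using borel_closed[OF closed_subspace[OF S]] by simp
  have "AE x in N. x \<in> S"
    unfolding N_def AE_distr_iff[OF Xm S_meas] using XS by (intro AE_I2)
  have mz: "mean_zero_normal_on S N"
    unfolding mean_zero_normal_on_def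
  proof (intro conjI allI)
    show "N \<in> laws" by (rule N)
    show "AE x in N. x \<in> S" by fact
    fix t
    show "\<exists>\<sigma>\<ge>0. distr N borel (\<lambda>x. t \<bullet> x) = normal_law_0 \<sigma>"
      by (rule exI[of _ "sqrt (B t t)"]) (simp only: nl real_sqrt_ge_zero B(3) simp_thms)
  qed
  have mom: "integrable N (\<lambda>x. (t \<bullet> x)\<^sup>2)" "(\<integral>x. (t \<bullet> x)\<^sup>2 \<partial>N) = B t t" for t
  proof -
    have s: "sqrt (B t t) \<ge> 0" using B(3) by simp
    have e: "distr N borel (\<lambda>x. t \<bullet> x) = distr std_normal_distribution borel (\<lambda>x. sqrt (B t t) * x)"
      unfolding nl by (rule normal_law_0_eq_scaled[OF s])
    have tm: "(\<lambda>x. t \<bullet> x) \<in> borel_measurable N" unfolding laws_measurable[OF N]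
      by (intro borel_measurable_continuous_onI continuous_intros)
    have "(\<lambda>x. sqrt (B t t) * x) \<in> borel_measurable (borel :: real measure)"
      by (intro borel_measurable_continuous_onI continuous_intros)
    then have sm: "(\<lambda>x. sqrt (B t t) * x) \<in> borel_measurable std_normal_distribution" by simp
    have qm: "(\<lambda>x. x\<^sup>2) \<in> borel_measurable (borel :: real measure)"
      by (intro borel_measurable_continuous_onI continuous_intros)
    have "integrable (distr N borel (\<lambda>x. t \<bullet> x)) (\<lambda>x. x\<^sup>2)"
      unfolding e integrable_distr_eq[OF sm qm] by (rule std_normal_second_moment(1))
    then show "integrable N (\<lambda>x. (t \<bullet> x)\<^sup>2)" unfolding integrable_distr_eq[OF tm qm] .
    have "(\<integral>x. (t \<bullet> x)\<^sup>2 \<partial>N) = (\<integral>x. x\<^sup>2 \<partial>distr N borel (\<lambda>x. t \<bullet> x))"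
      by (rule integral_distr[OF tm qm, symmetric])
    also have "\<dots> = (\<integral>x. (sqrt (B t t) * x)\<^sup>2 \<partial>std_normal_distribution)"
      unfolding e by (rule integral_distr[OF sm qm])
    also have "\<dots> = (sqrt (B t t))\<^sup>2" by (rule std_normal_second_moment(2))
    also have "\<dots> = B t t" using B(3) by simp
    finally show "(\<integral>x. (t \<bullet> x)\<^sup>2 \<partial>N) = B t t" .
  qed
  have nb: "(norm x)\<^sup>2 = (\<Sum>b\<in>Basis. (b \<bullet> x)\<^sup>2)" for x :: 'b
    unfolding power2_norm_eq_inner by (subst euclidean_inner) (simp add: power2_eq_square inner_commute)
  have "integrable N (\<lambda>x. (norm x)\<^sup>2)" unfolding nb by (intro Bochner_Integration.integrable_sum mom)
  moreover have "(\<integral>x. (norm x)\<^sup>2 \<partial>N) = (\<Sum>b\<in>Basis. B b b)"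
    unfolding nb by (subst Bochner_Integration.integral_sum) (simp_all add: mom)
  moreover have "char (distr N borel (\<lambda>x. t \<bullet> x)) 1 = exp (- B t t / 2)" for t
    unfolding ch by simp
  ultimately show ?thesis using mz by (intro exI[of _ N] conjI allI)
qed


section \<open>A uniform central limit theorem\<close>

lemma exp_minus_linear_bound:
  fixes x :: real
  assumes "x \<ge> 0"
  shows "\<bar>exp (- x) - (1 - x)\<bar> \<le> x\<^sup>2"
proof -
  have "1 - x \<le> exp (- x)" using exp_ge_add_one_self[of "- x"] by simp
  moreover have "exp (- x) \<le> 1 - x + x\<^sup>2"
  proof -
    have p: "0 < 1 + x" using assms by simp
    have "exp (- x) = 1 / exp x" by (simp add: exp_minus field_simps)
    also have "\<dots> \<le> 1 / (1 + x)" using p exp_ge_add_one_self[of x] by (intro divide_left_mono mult_pos_pos) auto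
    also have "\<dots> \<le> 1 - x + x\<^sup>2"
    proof -
      have "1 \<le> (1 - x + x\<^sup>2) * (1 + x)"
      proof -
        have "(1 - x + x\<^sup>2) * (1 + x) = 1 + x ^ 3" by (simp add: algebra_simps power2_eq_square power3_eq_cube)
        then show ?thesis using assms by simp
      qed
      then show ?thesis using p by (simp add: divide_le_eq)
    qed
    finally show ?thesis .
  qed
  ultimately show ?thesis by (simp add: abs_le_iff)
qed

text \<open>The characteristic functions of a summand and of the normal law with the same variance differ by
  \<open>O(n\<^sup>-\<^sup>3\<^sup>/\<^sup>2)\<close>, and taking \<open>n\<close>-th powers multiplies the difference by at most \<open>n\<close>.\<close>

lemma clt_char_bound:
  fixes u :: "'a::topological_space \<Rightarrow> real"
  assumes Q: "Q \<in> laws" and u: "u \<in> borel_measurable borel" "\<And>x. \<bar>u x\<bar> \<le> c" and u0: "(\<integral>x. u x \<partial>Q) = 0" and n: "n > 0"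
  shows "cmod (char (distr (iid Q) borel (\<lambda>X. \<Sum>j<n. u (X j) / sqrt n)) 1 - exp (- (\<integral>x. (u x)\<^sup>2 \<partial>Q) / 2)) \<le> (c ^ 3 + c ^ 4) / sqrt n"
proof -
  interpret Q: prob_space Q using Q by (rule laws_prob_space)
  have um: "u \<in> borel_measurable Q" unfolding laws_measurable[OF Q] by (rule u(1))
  have c: "c \<ge> 0" using abs_ge_zero u(2) by (rule order_trans)
  define v where "v = (\<integral>x. (u x)\<^sup>2 \<partial>Q)"
  define t where "t = 1 / sqrt n"
  have t: "t > 0" "t\<^sup>2 = 1 / n" using n by (auto simp: t_def power_divide)
  have iu: "integrable Q u" by (rule laws_integrable_bounded[OF Q u(1)]) (use u(2) in simp)
  have u2: "(u x)\<^sup>2 \<le> c\<^sup>2" for x using power_mono[OF u(2)[of x], of 2] by simp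
  have iu2: "integrable Q (\<lambda>x. (u x)\<^sup>2)"
    by (rule laws_integrable_bounded[OF Q, of _ "c\<^sup>2"]) (use u(1) u2 in auto)
  have v: "0 \<le> v" "v \<le> c\<^sup>2"
  proof -
    show "0 \<le> v" unfolding v_def by (intro integral_nonneg_AE AE_I2) simp
    have "v \<le> (\<integral>x. c\<^sup>2 \<partial>Q)" unfolding v_def by (intro integral_mono iu2 u2) simp
    then show "v \<le> c\<^sup>2" by (simp add: Q.prob_space)
  qed
  define \<phi> where "\<phi> = char (distr Q borel u) t"
  interpret D: real_distribution "distr Q borel u" by (rule real_distribution_distr[OF Q.prob_space_axioms um])
  have var: "Q.variance u = v" unfolding v_def by (simp add: u0)
  have "cmod (\<phi> - (1 - t\<^sup>2 * v / 2)) \<le> (t\<^sup>2 / 6) * (\<integral>x. min (6 * (u x)\<^sup>2) (\<bar>t\<bar> * \<bar>u x\<bar> ^ 3) \<partial>Q)"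
    unfolding \<phi>_def by (rule Q.char_approx3'[OF um iu iu2 u0 var refl])
  also have "\<dots> \<le> (t\<^sup>2 / 6) * (\<integral>x. t * c ^ 3 \<partial>Q)"
  proof (intro mult_left_mono integral_mono)
    fix x
    have "\<bar>u x\<bar> ^ 3 \<le> c ^ 3" by (intro power_mono u) simp
    then have "\<bar>t\<bar> * \<bar>u x\<bar> ^ 3 \<le> t * c ^ 3" using t by simp
    then show "min (6 * (u x)\<^sup>2) (\<bar>t\<bar> * \<bar>u x\<bar> ^ 3) \<le> t * c ^ 3" by linarith
    show "integrable Q (\<lambda>x. min (6 * (u x)\<^sup>2) (\<bar>t\<bar> * \<bar>u x\<bar> ^ 3))"
    proof (rule laws_integrable_bounded[OF Q])
      show "(\<lambda>x. min (6 * (u x)\<^sup>2) (\<bar>t\<bar> * \<bar>u x\<bar> ^ 3)) \<in> borel_measurable borel" using u(1) by measurable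
      fix x
      have "0 \<le> min (6 * (u x)\<^sup>2) (\<bar>t\<bar> * \<bar>u x\<bar> ^ 3)" by simp
      moreover have "min (6 * (u x)\<^sup>2) (\<bar>t\<bar> * \<bar>u x\<bar> ^ 3) \<le> 6 * c\<^sup>2" using u2[of x] by linarith
      ultimately show "norm (min (6 * (u x)\<^sup>2) (\<bar>t\<bar> * \<bar>u x\<bar> ^ 3)) \<le> 6 * c\<^sup>2" by simp
    qed
  qed simp_all
  also have "\<dots> = t ^ 3 * c ^ 3 / 6" by (simp add: Q.prob_space power2_eq_square power3_eq_cube)
  finally have b1: "cmod (\<phi> - (1 - t\<^sup>2 * v / 2)) \<le> t ^ 3 * c ^ 3 / 6" .
  define x where "x = t\<^sup>2 * v / 2"
  have x: "x \<ge> 0" using v by (simp add: x_def)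
  have "cmod (complex_of_real (exp (- x)) - complex_of_real (1 - x)) \<le> x\<^sup>2"
    using exp_minus_linear_bound[OF x] by (simp only: of_real_diff[symmetric] norm_of_real)
  then have b2: "cmod ((1 - complex_of_real x) - complex_of_real (exp (- x))) \<le> x\<^sup>2"
    by (simp add: norm_minus_commute)
  have "\<phi> - complex_of_real (exp (- x)) = (\<phi> - (1 - complex_of_real x)) + ((1 - complex_of_real x) - complex_of_real (exp (- x)))"
    by simp
  then have "cmod (\<phi> - complex_of_real (exp (- x))) \<le> cmod (\<phi> - (1 - complex_of_real x)) + cmod ((1 - complex_of_real x) - complex_of_real (exp (- x)))"
    by (metis norm_triangle_ineq)
  also have "\<dots> \<le> t ^ 3 * c ^ 3 / 6 + x\<^sup>2" using b1 b2 by (intro add_mono) (simp_all add: x_def)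
  finally have b: "cmod (\<phi> - complex_of_real (exp (- x))) \<le> t ^ 3 * c ^ 3 / 6 + x\<^sup>2" .
  have "char (distr (iid Q) borel (\<lambda>X. \<Sum>j<n. u (X j) / sqrt n)) 1 = (\<Prod>j<n. char (distr Q borel (\<lambda>x. u x / sqrt n)) 1)"
    using um by (intro char_iid_sum Q.prob_space_axioms) simp
  also have "char (distr Q borel (\<lambda>x. u x / sqrt n)) 1 = \<phi>"
    using char_distr_scale[OF um, of t 1] by (simp add: \<phi>_def t_def)
  finally have ch: "char (distr (iid Q) borel (\<lambda>X. \<Sum>j<n. u (X j) / sqrt n)) 1 = \<phi> ^ n" by simp
  have "complex_of_real (exp (- x)) ^ n = exp (- v / 2)"
  proof -
    have "exp (- x) ^ n = exp (real n * (- x))" by (rule exp_of_nat_mult[symmetric])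
    also have "real n * (- x) = - v / 2" using n by (simp add: x_def t(2))
    finally show ?thesis by (metis of_real_power)
  qed
  then have "cmod (char (distr (iid Q) borel (\<lambda>X. \<Sum>j<n. u (X j) / sqrt n)) 1 - exp (- v / 2)) = cmod (\<phi> ^ n - complex_of_real (exp (- x)) ^ n)"
    unfolding ch by simp
  also have "\<dots> \<le> n * cmod (\<phi> - complex_of_real (exp (- x)))"
    using x by (intro norm_power_diff) (simp_all add: \<phi>_def D.cmod_char_le_1)
  also have "\<dots> \<le> n * (t ^ 3 * c ^ 3 / 6 + x\<^sup>2)" using b by (intro mult_left_mono) auto
  also have "\<dots> \<le> t * c ^ 3 + t * c ^ 4"
  proof -
    have nt: "real n * t\<^sup>2 = 1" using n t by simp
    have "real n * (t ^ 3 * c ^ 3 / 6) = (real n * t\<^sup>2) * t * c ^ 3 / 6" by (simp add: power2_eq_square power3_eq_cube)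
    also have "\<dots> \<le> t * c ^ 3" using t c by (simp add: nt)
    finally have p1: "real n * (t ^ 3 * c ^ 3 / 6) \<le> t * c ^ 3" .
    have "t\<^sup>2 \<le> t" 
    proof -
      have "1 \<le> sqrt n" using n by simp
      then have "t \<le> 1" by (simp add: t_def)
      then show ?thesis using t(1) by (simp add: power2_eq_square mult_left_le)
    qed
    have "v\<^sup>2 \<le> c ^ 4" using power_mono[OF v(2,1), of 2] by (simp flip: power_mult)
    have "real n * x\<^sup>2 = (real n * t\<^sup>2) * t\<^sup>2 * v\<^sup>2 / 4" by (simp add: x_def power2_eq_square)
    also have "\<dots> \<le> t\<^sup>2 * v\<^sup>2" by (simp add: nt)
    also have "\<dots> \<le> t * c ^ 4" using \<open>t\<^sup>2 \<le> t\<close> \<open>v\<^sup>2 \<le> c ^ 4\<close> t by (intro mult_mono) auto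
    finally show ?thesis using p1 by (simp add: distrib_left)
  qed
  also have "\<dots> = (c ^ 3 + c ^ 4) / sqrt n" by (simp add: t_def add_divide_distrib)
  finally show ?thesis by (simp add: v_def)
qed

lemma re_im_char:
  fixes N :: "'b::euclidean_space measure"
  assumes N: "N \<in> laws"
  shows "Re (char (distr N borel (\<lambda>x. t \<bullet> x)) 1) = (\<integral>x. cos (t \<bullet> x) \<partial>N)"
    and "Im (char (distr N borel (\<lambda>x. t \<bullet> x)) 1) = (\<integral>x. sin (t \<bullet> x) \<partial>N)"
proof -
  have i: "integrable N (\<lambda>x. iexp (t \<bullet> x))"
    by (rule laws_integrable_bounded[OF N, of _ 1]) (auto simp: norm_exp_i_times)
  have "char (distr N borel (\<lambda>x. t \<bullet> x)) 1 = (CLINT x|N. iexp (t \<bullet> x))"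
    unfolding char_def by (subst integral_distr) (auto simp: laws_measurable[OF N])
  then show "Re (char (distr N borel (\<lambda>x. t \<bullet> x)) 1) = (\<integral>x. cos (t \<bullet> x) \<partial>N)"
    "Im (char (distr N borel (\<lambda>x. t \<bullet> x)) 1) = (\<integral>x. sin (t \<bullet> x) \<partial>N)"
    using i by (simp_all add: integral_Re[symmetric] integral_Im[symmetric] Re_exp Im_exp del: integral_Re integral_Im)
qed

lemma const_over_sqrt_tendsto_0: "(\<lambda>n. c / sqrt (real n)) \<longlonglongrightarrow> 0"
  by (rule tendsto_divide_0[OF tendsto_const
      filterlim_at_top_imp_at_infinity[OF filterlim_compose[OF sqrt_at_top filterlim_real_sequentially]]])

text \<open>The threshold \<open>n0\<close> depends on the bound \<open>K\<close> and on \<open>e\<close> only, not on the law or on the function: second moments are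
  at most \<open>K\<^sup>2\<close>, so the relevant frequencies are fixed in advance, and at each of them the bound of
  \<open>clt_char_bound\<close> is uniform.\<close>

theorem uniform_clt:
  fixes K e :: real
  assumes e: "e > 0" and K: "K \<ge> 0"
  shows "\<exists>n0. \<forall>n\<ge>n0. \<forall>Q l N. Q \<in> laws \<and> l \<in> borel_measurable borel \<and> (\<forall>x. norm (l x) \<le> K) \<and> (\<integral>x. l x \<partial>Q) = 0 \<and>
    N \<in> laws \<and> (\<forall>t. char (distr N borel (\<lambda>x. t \<bullet> x)) 1 = exp (- (\<integral>x. (t \<bullet> l x)\<^sup>2 \<partial>Q) / 2)) \<and>
    integrable N (\<lambda>x. (norm x)\<^sup>2) \<and> (\<integral>x. (norm x)\<^sup>2 \<partial>N) \<le> K\<^sup>2 \<longrightarrow>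
    (\<forall>f\<in>BL. \<bar>(\<integral>x. f x \<partial>distr (iid Q) borel (\<lambda>X. (1 / sqrt (real n)) *\<^sub>R (\<Sum>j<n. l (X j :: 'a::topological_space))))
        - (\<integral>x. f x \<partial>(N :: 'b::euclidean_space measure))\<bar> \<le> e)"
proof -
  have K2: "K\<^sup>2 \<ge> 0" by simp
  obtain F :: "'b set" and \<eta> where F: "finite F" and \<eta>: "\<eta> > 0" and close:
    "\<forall>\<mu>\<in>laws. \<forall>\<nu>\<in>laws. integrable \<mu> (\<lambda>x. (norm x)\<^sup>2) \<and> (\<integral>x. (norm x)\<^sup>2 \<partial>\<mu>) \<le> K\<^sup>2 \<and>
       integrable \<nu> (\<lambda>x. (norm x)\<^sup>2) \<and> (\<integral>x. (norm x)\<^sup>2 \<partial>\<nu>) \<le> K\<^sup>2 \<and>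
       (\<forall>t\<in>F. \<bar>(\<integral>x. cos (t \<bullet> x) \<partial>\<mu>) - (\<integral>x. cos (t \<bullet> x) \<partial>\<nu>)\<bar> \<le> \<eta> \<and> \<bar>(\<integral>x. sin (t \<bullet> x) \<partial>\<mu>) - (\<integral>x. sin (t \<bullet> x) \<partial>\<nu>)\<bar> \<le> \<eta>) \<longrightarrow>
       (\<forall>f\<in>BL. \<bar>(\<integral>x. f x \<partial>\<mu>) - (\<integral>x. f x \<partial>\<nu>)\<bar> \<le> e)"
    by (rule BL_integrals_close_if_char_close[OF e K2])
  define c where "c t = norm t * K" for t :: 'b
  have "\<forall>\<^sub>F n in sequentially. \<forall>t\<in>F. (c t ^ 3 + c t ^ 4) / sqrt (real n) < \<eta>"
    using F \<eta> by (intro eventually_ball_finite ballI order_tendstoD(2)[OF const_over_sqrt_tendsto_0]) auto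
  then obtain n1 where n1: "\<And>n t. n \<ge> n1 \<Longrightarrow> t \<in> F \<Longrightarrow> (c t ^ 3 + c t ^ 4) / sqrt (real n) < \<eta>"
    by (auto simp: eventually_sequentially)
  show ?thesis
  proof (intro exI[of _ "max 1 n1"] allI impI)
    fix n and Q :: "'a measure" and l :: "'a \<Rightarrow> 'b" and N :: "'b measure"
    assume n: "max 1 n1 \<le> n"
    assume H: "Q \<in> laws \<and> l \<in> borel_measurable borel \<and> (\<forall>x. norm (l x) \<le> K) \<and> (\<integral>x. l x \<partial>Q) = 0 \<and>
      N \<in> laws \<and> (\<forall>t. char (distr N borel (\<lambda>x. t \<bullet> x)) 1 = exp (- (\<integral>x. (t \<bullet> l x)\<^sup>2 \<partial>Q) / 2)) \<and>
      integrable N (\<lambda>x. (norm x)\<^sup>2) \<and> (\<integral>x. (norm x)\<^sup>2 \<partial>N) \<le> K\<^sup>2"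
    then have Q: "Q \<in> laws" and l: "l \<in> borel_measurable borel" and lK: "\<And>x. norm (l x) \<le> K"
      and l0: "(\<integral>x. l x \<partial>Q) = 0" and N: "N \<in> laws"
      and chN: "\<And>t. char (distr N borel (\<lambda>x. t \<bullet> x)) 1 = exp (- (\<integral>x. (t \<bullet> l x)\<^sup>2 \<partial>Q) / 2)"
      and N2: "integrable N (\<lambda>x. (norm x)\<^sup>2)" "(\<integral>x. (norm x)\<^sup>2 \<partial>N) \<le> K\<^sup>2" by blast+
    have n0: "n > 0" using n by simp
    define W where "W X = (1 / sqrt (real n)) *\<^sub>R (\<Sum>j<n. l (X j))" for X :: "nat \<Rightarrow> 'a"
    define L where "L = distr (iid Q) borel W"
    have Wm: "W \<in> borel_measurable (iid Q)" unfolding W_def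
      by (intro borel_measurable_scaleR borel_measurable_const iid_sum_measurable Q l)
    have L: "L \<in> laws" unfolding L_def by (rule iid_distr_laws[OF Q Wm])
    have qm: "(\<lambda>x. (norm x)\<^sup>2) \<in> borel_measurable (borel :: 'b measure)"
      by (intro borel_measurable_continuous_onI continuous_intros)
    have nW: "(norm (W X))\<^sup>2 = (1 / real n) * (norm (\<Sum>j<n. l (X j)))\<^sup>2" for X
      by (simp add: W_def power_mult_distrib power_divide)
    have "integrable (iid Q) (\<lambda>X. (norm (W X))\<^sup>2)"
      unfolding nW by (intro integrable_mult_right iid_sum_second_moment(1)[OF Q l lK l0])
    then have iL: "integrable L (\<lambda>x. (norm x)\<^sup>2)" unfolding L_def integrable_distr_eq[OF Wm qm] .
    have "(\<integral>x. (norm x)\<^sup>2 \<partial>L) = (\<integral>X. (norm (W X))\<^sup>2 \<partial>iid Q)"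
      unfolding L_def by (rule integral_distr[OF Wm qm])
    also have "\<dots> = (1 / real n) * (real n * (\<integral>x. (norm (l x))\<^sup>2 \<partial>Q))"
      unfolding nW integral_mult_right_zero iid_sum_second_moment(2)[OF Q l lK l0] ..
    also have "\<dots> = (\<integral>x. (norm (l x))\<^sup>2 \<partial>Q)" using n0 by simp
    also have "\<dots> \<le> K\<^sup>2"
    proof (rule law_mean_le[OF Q])
      show "(\<lambda>x. (norm (l x))\<^sup>2) \<in> borel_measurable borel" using l by simp
      show "(norm (l x))\<^sup>2 \<le> K\<^sup>2" for x by (intro power_mono lK) simp
    qed simp
    finally have L2: "(\<integral>x. (norm x)\<^sup>2 \<partial>L) \<le> K\<^sup>2" .
    have "\<bar>(\<integral>x. cos (t \<bullet> x) \<partial>L) - (\<integral>x. cos (t \<bullet> x) \<partial>N)\<bar> \<le> \<eta> \<and> \<bar>(\<integral>x. sin (t \<bullet> x) \<partial>L) - (\<integral>x. sin (t \<bullet> x) \<partial>N)\<bar> \<le> \<eta>"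
      if t: "t \<in> F" for t
    proof -
      define u where "u x = t \<bullet> l x" for x
      have um: "u \<in> borel_measurable borel" unfolding u_def using l by simp
      have uc: "\<bar>u x\<bar> \<le> c t" for x
        unfolding u_def c_def
        by (rule order_trans[OF Cauchy_Schwarz_ineq2 mult_left_mono[OF lK norm_ge_zero]])
      have u0: "(\<integral>x. u x \<partial>Q) = 0"
      proof -
        have "integrable Q l" by (rule laws_integrable_bounded[OF Q l lK])
        then have "(\<integral>x. u x \<partial>Q) = t \<bullet> (\<integral>x. l x \<partial>Q)" unfolding u_def by (intro integral_inner_right) auto
        then show ?thesis by (simp add: l0)
      qed
      have tm: "(\<lambda>x. t \<bullet> x) \<in> borel_measurable (borel :: 'b measure)"
        by (intro borel_measurable_continuous_onI continuous_intros)
      have "distr L borel (\<lambda>x. t \<bullet> x) = distr (iid Q) borel (\<lambda>X. \<Sum>j<n. u (X j) / sqrt (real n))"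
        unfolding L_def
        by (subst distr_distr[OF tm Wm]) (simp add: comp_def W_def u_def inner_sum_right sum_divide_distrib)
      then have "cmod (char (distr L borel (\<lambda>x. t \<bullet> x)) 1 - char (distr N borel (\<lambda>x. t \<bullet> x)) 1) \<le> (c t ^ 3 + c t ^ 4) / sqrt (real n)"
        using clt_char_bound[OF Q um uc u0 n0] unfolding chN u_def[symmetric] by simp
      also have "\<dots> \<le> \<eta>" using n1[OF _ t, of n] n by simp
      finally have "cmod (char (distr L borel (\<lambda>x. t \<bullet> x)) 1 - char (distr N borel (\<lambda>x. t \<bullet> x)) 1) \<le> \<eta>" .
      then show ?thesis
        using abs_Re_le_cmod[of "char (distr L borel (\<lambda>x. t \<bullet> x)) 1 - char (distr N borel (\<lambda>x. t \<bullet> x)) 1"]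
          abs_Im_le_cmod[of "char (distr L borel (\<lambda>x. t \<bullet> x)) 1 - char (distr N borel (\<lambda>x. t \<bullet> x)) 1"]
        unfolding minus_complex.sel re_im_char[OF L] re_im_char[OF N] by linarith
    qed
    then have "\<forall>f\<in>BL. \<bar>(\<integral>x. f x \<partial>L) - (\<integral>x. f x \<partial>N)\<bar> \<le> e"
      using close L N iL L2 N2 by blast
    then show "\<forall>f\<in>BL. \<bar>(\<integral>x. f x \<partial>distr (iid Q) borel (\<lambda>X. (1 / sqrt (real n)) *\<^sub>R (\<Sum>j<n. l (X j)))) - (\<integral>x. f x \<partial>N)\<bar> \<le> e"
      unfolding L_def W_def .
  qed
qed


section \<open>Empirical measures\<close>

lemma empirical_integral:
  fixes f :: "'a::topological_space \<Rightarrow> 'b::{banach,second_countable_topology}"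
  assumes "n > 0" "f \<in> borel_measurable borel"
  shows "(\<integral>x. f x \<partial>empirical n X) = (1 / real n) *\<^sub>R (\<Sum>j<n. f (X j))"
proof -
  have m: "X \<in> measurable (uniform_count_measure {..<n}) borel"
    by (auto simp: measurable_def sets_uniform_count_measure space_uniform_count_measure)
  have "(\<integral>x. f x \<partial>empirical n X) = (\<integral>j. f (X j) \<partial>uniform_count_measure {..<n})"
    unfolding empirical_def by (rule integral_distr[OF m assms(2)])
  also have "\<dots> = (\<Sum>j<n. (1 / real n) *\<^sub>R f (X j))"
    using assms(1) by (simp add: uniform_count_measure_def lebesgue_integral_point_measure_finite)
  finally show ?thesis by (simp add: scaleR_sum_right)
qed

lemma empirical_laws:
  assumes "n > 0"
  shows "empirical n X \<in> laws"
proof -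
  have m: "X \<in> measurable (uniform_count_measure {..<n}) borel"
    by (auto simp: measurable_def sets_uniform_count_measure space_uniform_count_measure)
  have "prob_space (uniform_count_measure {..<n})"
    using assms by (intro prob_space_uniform_count_measure) auto
  then show ?thesis using m by (simp add: laws_def empirical_def prob_space.prob_space_distr)
qed

text \<open>An empirical measure of the empty sample is the zero measure.\<close>

lemma empirical_0_not_law: "empirical 0 X \<notin> laws"
proof
  assume "empirical 0 X \<in> laws"
  then interpret prob_space "empirical 0 X" by (rule laws_prob_space)
  have "emeasure (empirical 0 X) UNIV = 0"
    unfolding empirical_def
    by (subst emeasure_distr) (auto simp: measurable_def sets_uniform_count_measure space_uniform_count_measure)
  moreover have "space (empirical 0 X) = UNIV" by (simp add: empirical_def)
  ultimately show False using emeasure_space_1 by simp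
qed

lemma sets_iid_borel:
  assumes "sets Q = sets (borel :: 'a::second_countable_topology measure)"
  shows "sets (iid Q) = sets (borel :: (nat \<Rightarrow> 'a) measure)"
  unfolding iid_def using sets_PiM_cong[OF refl assms] sets_PiM_equal_borel by blast

lemma continuous_empirical_integral:
  fixes k :: "'a::topological_space \<Rightarrow> 'c::euclidean_space"
  assumes n: "n > 0" and k: "continuous_on UNIV k"
  shows "continuous_on UNIV (\<lambda>X. \<integral>x. k x \<partial>empirical n X)"
proof -
  have "continuous_on UNIV (\<lambda>X :: nat \<Rightarrow> 'a. k (X j))" for j
    by (rule continuous_on_compose2[OF k continuous_on_product_coordinates]) simp
  then show ?thesis
    unfolding empirical_integral[OF n borel_measurable_continuous_onI[OF k]]
    by (intro continuous_intros)
qed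

lemma empirical_mean_second_moment:
  fixes k :: "'a::topological_space \<Rightarrow> 'c::euclidean_space"
  assumes Q: "Q \<in> laws" and k: "k \<in> borel_measurable borel" "\<And>x. norm (k x) \<le> K" and n: "n > 0"
  defines "\<eta> \<equiv> \<lambda>X. norm ((\<integral>x. k x \<partial>empirical n X) - (\<integral>x. k x \<partial>Q))"
  shows "integrable (iid Q) (\<lambda>X. (\<eta> X)\<^sup>2)" "(\<integral>X. (\<eta> X)\<^sup>2 \<partial>iid Q) \<le> 4 * K\<^sup>2 / real n"
proof -
  interpret Q: prob_space Q using Q by (rule laws_prob_space)
  define f where "f x = k x - (\<integral>x. k x \<partial>Q)" for x
  have ik: "integrable Q k" by (rule laws_integrable_bounded[OF Q k])
  have fm: "f \<in> borel_measurable borel" unfolding f_def using k(1) by simp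
  have "norm (\<integral>x. k x \<partial>Q) \<le> (\<integral>x. norm (k x) \<partial>Q)" by (rule integral_norm_bound)
  also have "\<dots> \<le> K" using k by (intro law_mean_le[OF Q]) auto
  finally have fK: "norm (f x) \<le> 2 * K" for x
    unfolding f_def using norm_triangle_ineq4[of "k x" "\<integral>x. k x \<partial>Q"] k(2)[of x] by linarith
  have f0: "(\<integral>x. f x \<partial>Q) = 0" unfolding f_def using ik by (simp add: Q.prob_space)
  have \<eta>f: "(\<eta> X)\<^sup>2 = (1 / (real n)\<^sup>2) * (norm (\<Sum>j<n. f (X j)))\<^sup>2" for X
  proof -
    have "(\<integral>x. k x \<partial>empirical n X) - (\<integral>x. k x \<partial>Q) = (1 / real n) *\<^sub>R (\<Sum>j<n. f (X j))"
      unfolding empirical_integral[OF n k(1)] f_def using n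
      by (simp add: sum_subtractf scaleR_diff_right sum_constant_scaleR)
    then show ?thesis by (simp add: \<eta>_def power_divide)
  qed
  show "integrable (iid Q) (\<lambda>X. (\<eta> X)\<^sup>2)"
    unfolding \<eta>f by (intro integrable_mult_right iid_sum_second_moment(1)[OF Q fm fK f0])
  have "(\<integral>X. (\<eta> X)\<^sup>2 \<partial>iid Q) = (1 / (real n)\<^sup>2) * (real n * (\<integral>x. (norm (f x))\<^sup>2 \<partial>Q))"
    unfolding \<eta>f integral_mult_right_zero iid_sum_second_moment(2)[OF Q fm fK f0] ..
  also have "\<dots> = (\<integral>x. (norm (f x))\<^sup>2 \<partial>Q) / real n" using n by (simp add: power2_eq_square)
  also have "\<dots> \<le> (2 * K)\<^sup>2 / real n"
  proof (intro divide_right_mono law_mean_le[OF Q])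
    show "(\<lambda>x. (norm (f x))\<^sup>2) \<in> borel_measurable borel" using fm by simp
    show "(norm (f x))\<^sup>2 \<le> (2 * K)\<^sup>2" for x by (intro power_mono fK) simp
  qed simp_all
  finally show "(\<integral>X. (\<eta> X)\<^sup>2 \<partial>iid Q) \<le> 4 * K\<^sup>2 / real n" by (simp add: power_mult_distrib)
qed

text \<open>Empirical measures have bounded support and therefore satisfy every tail condition beyond a suitable radius.\<close>

lemma empirical_no_tail:
  fixes X :: "nat \<Rightarrow> 'a::real_normed_vector"
  shows "measure (empirical n X) {y. norm y > (\<Sum>j<n. norm (X j))} = 0"
proof -
  have "X \<in> measurable (uniform_count_measure {..<n}) borel"
    by (auto simp: measurable_def sets_uniform_count_measure space_uniform_count_measure)
  moreover have "{y. norm y > (\<Sum>j<n. norm (X j))} \<in> sets (borel :: 'a measure)"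
    by (intro borel_open open_Collect_less continuous_intros)
  moreover have "X -` {y. norm y > (\<Sum>j<n. norm (X j))} \<inter> {..<n} = {}"
  proof -
    have "norm (X i) \<le> (\<Sum>j<n. norm (X j))" if "i < n" for i
      using member_le_sum[of i "{..<n}" "\<lambda>j. norm (X j)"] that by simp
    then show ?thesis by (auto simp: not_less[symmetric])
  qed
  ultimately show ?thesis
    by (simp add: empirical_def measure_distr space_uniform_count_measure)
qed


section \<open>Uniform asymptotic normality from local expansions\<close>

text \<open>First order expansion of \<open>T\<close> at \<open>Q\<close> with influence function \<open>l\<close> and remainder quadratic in the deviation
  of the integral of a bounded continuous statistic \<open>k\<close>, valid for all laws for which this
  deviation is at most \<open>\<epsilon>\<close>; these laws belong to the domain \<open>D\<close>. A common pair \<open>\<epsilon>\<close>, \<open>K\<close> for a class of laws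
  is the uniformity that the limit theorem needs. All perturbations \<open>R\<close> are laws, not only empirical measures, so that
  the notion does not refer to samples.\<close>

definition local_expansion ::
  "'b::euclidean_space set \<Rightarrow> 'a::topological_space measure set \<Rightarrow> ('a measure \<Rightarrow> 'b) \<Rightarrow> real \<Rightarrow> real \<Rightarrow>
   'a measure \<Rightarrow> ('a \<Rightarrow> 'c::euclidean_space) \<Rightarrow> ('a \<Rightarrow> 'b) \<Rightarrow> bool" where
  "local_expansion S D T \<epsilon> K Q k l \<longleftrightarrow>
     continuous_on UNIV k \<and> continuous_on UNIV l \<and> (\<forall>x. norm (k x) \<le> K) \<and> (\<forall>x. norm (l x) \<le> K) \<and>
     (\<forall>x. l x \<in> S) \<and> (\<integral>x. l x \<partial>Q) = 0 \<and>
     (\<forall>R\<in>laws. norm ((\<integral>x. k x \<partial>R) - (\<integral>x. k x \<partial>Q)) \<le> \<epsilon> \<longrightarrow>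
        R \<in> D \<and> norm (T R - T Q - (\<integral>x. l x \<partial>R)) \<le> K * (norm ((\<integral>x. k x \<partial>R) - (\<integral>x. k x \<partial>Q)))\<^sup>2)"

text \<open>The expansion at an empirical measure says that \<open>T\<close> is defined and continuous at all samples near the given one,
  because integrals of continuous functions depend continuously on the sample.\<close>

lemma empirical_domain_open:
  fixes D :: "'a::topological_space measure set" and T :: "'a measure \<Rightarrow> 'b::euclidean_space"
  assumes D: "D \<subseteq> laws"
    and emp: "\<And>X. empirical n X \<in> D \<Longrightarrow> \<exists>\<epsilon>>0. \<exists>K k l. local_expansion S D T \<epsilon> K (empirical n X) (k :: 'a \<Rightarrow> 'c::euclidean_space) l"
  shows "open {X. empirical n X \<in> D}" and "continuous_on {X. empirical n X \<in> D} (\<lambda>X. T (empirical n X))"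
proof -
  have main: "open {X. empirical n X \<in> D} \<and> continuous_on {X. empirical n X \<in> D} (\<lambda>X. T (empirical n X))"
  proof (cases "n = 0")
    case True
    then have "{X. empirical n X \<in> D} = {}" using D empirical_0_not_law by blast
    then show ?thesis by simp
  next
    case False
    then have n: "n > 0" by simp
    have loc: "\<exists>U. open U \<and> X0 \<in> U \<and> U \<subseteq> {X. empirical n X \<in> D}"
      and cont: "((\<lambda>X. T (empirical n X)) \<longlongrightarrow> T (empirical n X0)) (at X0)"
      if X0: "empirical n X0 \<in> D" for X0
    proof -
      obtain \<epsilon> K and k :: "'a \<Rightarrow> 'c" and l where \<epsilon>: "\<epsilon> > 0" and L: "local_expansion S D T \<epsilon> K (empirical n X0) k l"
        using emp[OF X0] by blast
      have k: "continuous_on UNIV k" and l: "continuous_on UNIV l" and l0: "(\<integral>x. l x \<partial>empirical n X0) = 0"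
        using L by (simp_all add: local_expansion_def)
      define \<eta> where "\<eta> X = norm ((\<integral>x. k x \<partial>empirical n X) - (\<integral>x. k x \<partial>empirical n X0))" for X
      have \<eta>c: "continuous_on UNIV \<eta>" unfolding \<eta>_def by (intro continuous_intros continuous_empirical_integral n k)
      define U where "U = {X. \<eta> X < \<epsilon>}"
      have "open U" unfolding U_def by (intro open_Collect_less \<eta>c continuous_intros)
      moreover have "X0 \<in> U" using \<epsilon> by (simp add: U_def \<eta>_def)
      moreover have exp: "empirical n X \<in> D \<and> norm (T (empirical n X) - T (empirical n X0) - (\<integral>x. l x \<partial>empirical n X)) \<le> K * (\<eta> X)\<^sup>2"
        if "X \<in> U" for X
        using L empirical_laws[OF n, of X] that by (simp add: local_expansion_def U_def \<eta>_def)
      ultimately show "\<exists>U. open U \<and> X0 \<in> U \<and> U \<subseteq> {X. empirical n X \<in> D}" by blast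
      have "((\<lambda>X. T (empirical n X) - T (empirical n X0)) \<longlongrightarrow> 0) (at X0)"
      proof (rule Lim_null_comparison)
        show "\<forall>\<^sub>F X in at X0. norm (T (empirical n X) - T (empirical n X0)) \<le> norm (\<integral>x. l x \<partial>empirical n X) + K * (\<eta> X)\<^sup>2"
        proof (rule eventually_mono[OF eventually_at_in_open'[OF \<open>open U\<close> \<open>X0 \<in> U\<close>]])
          fix X assume "X \<in> U"
          then show "norm (T (empirical n X) - T (empirical n X0)) \<le> norm (\<integral>x. l x \<partial>empirical n X) + K * (\<eta> X)\<^sup>2"
            using exp[of X] norm_triangle_ineq[of "\<integral>x. l x \<partial>empirical n X" "T (empirical n X) - T (empirical n X0) - (\<integral>x. l x \<partial>empirical n X)"]
            by simp
        qed
        have "continuous_on UNIV (\<lambda>X. norm (\<integral>x. l x \<partial>empirical n X) + K * (\<eta> X)\<^sup>2)"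
          by (intro continuous_intros continuous_empirical_integral n l \<eta>c)
        then have "((\<lambda>X. norm (\<integral>x. l x \<partial>empirical n X) + K * (\<eta> X)\<^sup>2) \<longlongrightarrow>
            norm (\<integral>x. l x \<partial>empirical n X0) + K * (\<eta> X0)\<^sup>2) (at X0)"
          unfolding continuous_on_def by blast
        then show "((\<lambda>X. norm (\<integral>x. l x \<partial>empirical n X) + K * (\<eta> X)\<^sup>2) \<longlongrightarrow> 0) (at X0)"
          by (simp add: l0 \<eta>_def)
      qed
      then show "((\<lambda>X. T (empirical n X)) \<longlongrightarrow> T (empirical n X0)) (at X0)" by (simp add: LIM_zero_iff)
    qed
    have o: "open {X. empirical n X \<in> D}" by (subst open_subopen) (use loc in auto)
    moreover have "continuous_on {X. empirical n X \<in> D} (\<lambda>X. T (empirical n X))"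
      unfolding continuous_on_def
    proof
      fix X0 assume "X0 \<in> {X. empirical n X \<in> D}"
      then have "((\<lambda>X. T (empirical n X)) \<longlongrightarrow> T (empirical n X0)) (at X0)" by (intro cont) simp
      then show "((\<lambda>X. T (empirical n X)) \<longlongrightarrow> T (empirical n X0)) (at X0 within {X. empirical n X \<in> D})"
        by (rule tendsto_within_subset) simp
    qed
    ultimately show ?thesis by simp
  qed
  then show "open {X. empirical n X \<in> D}" "continuous_on {X. empirical n X \<in> D} (\<lambda>X. T (empirical n X))" by auto
qed

lemma measurable_extend_by_empirical:
  fixes D :: "'a::second_countable_topology measure set" and T :: "'a measure \<Rightarrow> 'b::euclidean_space"
  assumes o: "open {X. empirical n X \<in> D}" and c: "continuous_on {X. empirical n X \<in> D} (\<lambda>X. T (empirical n X))"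
    and g: "(\<lambda>X. g (empirical n X)) \<in> borel_measurable (iid borel)"
  shows "(\<lambda>X. extend_by D T g (empirical n X)) \<in> borel_measurable (iid borel)"
proof (rule borel_measurableI)
  fix V :: "'b set" assume V: "open V"
  let ?O = "{X. empirical n X \<in> D}"
  have sp: "space (iid borel) = (UNIV :: (nat \<Rightarrow> 'a) set)" by (simp add: iid_def space_PiM)
  have s: "sets (iid borel) = sets (borel :: (nat \<Rightarrow> 'a) measure)" by (rule sets_iid_borel) simp
  have "open ((\<lambda>X. T (empirical n X)) -` V \<inter> ?O)"
    by (rule continuous_open_preimage[OF c o V, unfolded Int_commute[of ?O]])
  moreover have "(\<lambda>X. g (empirical n X)) -` V \<inter> space (iid borel) \<in> sets (iid borel)"
    using measurable_sets[OF g, of V] V by simp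
  moreover have "(\<lambda>X. extend_by D T g (empirical n X)) -` V \<inter> space (iid borel)
     = ((\<lambda>X. T (empirical n X)) -` V \<inter> ?O) \<union> (((\<lambda>X. g (empirical n X)) -` V \<inter> space (iid borel)) - ?O)"
    by (auto simp: extend_by_def sp split: if_splits)
  ultimately show "(\<lambda>X. extend_by D T g (empirical n X)) -` V \<inter> space (iid borel) \<in> sets (iid borel)"
    using o by (auto simp: s)
qed

text \<open>If the deviation \<open>\<eta>\<close> is at most \<open>\<epsilon>\<close>, the Lipschitz property and the quadratic remainder give the
  bound; otherwise the trivial bound \<open>2\<close> is at most \<open>2 \<eta>\<^sup>2 / \<epsilon>\<^sup>2\<close>. The single bound in terms of \<open>\<eta>\<^sup>2\<close>
  can be integrated at once.\<close>

lemma local_expansion_linearization_error: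
  fixes T :: "'a::second_countable_topology measure \<Rightarrow> 'b::euclidean_space" and k :: "'a \<Rightarrow> 'c::euclidean_space"
  assumes L: "local_expansion S D T \<epsilon> K Q k l" and \<epsilon>: "\<epsilon> > 0" and K: "K \<ge> 0" and n: "n > 0" and f: "f \<in> BL"
  defines "\<eta> \<equiv> \<lambda>X. norm ((\<integral>x. k x \<partial>empirical n X) - (\<integral>x. k x \<partial>Q))"
  shows "\<bar>f (sqrt (real n) *\<^sub>R (extend_by D T g (empirical n X) - T Q)) - f ((1 / sqrt (real n)) *\<^sub>R (\<Sum>j<n. l (X j)))\<bar>
     \<le> (2 / \<epsilon>\<^sup>2 + sqrt (real n) * K) * (\<eta> X)\<^sup>2"
proof (cases "\<eta> X \<le> \<epsilon>")
  case True
  have lm: "l \<in> borel_measurable borel" using L by (intro borel_measurable_continuous_onI) (simp add: local_expansion_def)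
  have E: "empirical n X \<in> D" "norm (T (empirical n X) - T Q - (\<integral>x. l x \<partial>empirical n X)) \<le> K * (\<eta> X)\<^sup>2"
    using L True empirical_laws[OF n, of X] by (simp_all add: local_expansion_def \<eta>_def)
  have sq: "sqrt (real n) * (1 / real n) = 1 / sqrt (real n)" using n by (simp add: real_div_sqrt field_simps)
  have "(1 / sqrt (real n)) *\<^sub>R (\<Sum>j<n. l (X j)) = sqrt (real n) *\<^sub>R (\<integral>x. l x \<partial>empirical n X)"
    unfolding empirical_integral[OF n lm] scaleR_scaleR sq ..
  then have "dist (sqrt (real n) *\<^sub>R (extend_by D T g (empirical n X) - T Q)) ((1 / sqrt (real n)) *\<^sub>R (\<Sum>j<n. l (X j)))
     = sqrt (real n) * norm (T (empirical n X) - T Q - (\<integral>x. l x \<partial>empirical n X))"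
    using E(1) by (simp add: extend_by_def dist_norm flip: scaleR_diff_right)
  also have "\<dots> \<le> sqrt (real n) * (K * (\<eta> X)\<^sup>2)" using E(2) by (intro mult_left_mono) auto
  also have "\<dots> \<le> (2 / \<epsilon>\<^sup>2 + sqrt (real n) * K) * (\<eta> X)\<^sup>2" by (simp add: distrib_right mult.assoc)
  finally have "dist (sqrt (real n) *\<^sub>R (extend_by D T g (empirical n X) - T Q)) ((1 / sqrt (real n)) *\<^sub>R (\<Sum>j<n. l (X j)))
    \<le> (2 / \<epsilon>\<^sup>2 + sqrt (real n) * K) * (\<eta> X)\<^sup>2" .
  moreover have "\<bar>f x - f y\<bar> \<le> dist x y" for x y using f by (simp add: BL_def)
  ultimately show ?thesis by (rule order_trans[rotated])
next
  case False
  have f1: "\<bar>f x\<bar> \<le> 1" for x using f by (simp add: BL_def)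
  have f2: "\<bar>f x - f y\<bar> \<le> 2" for x y using f1[of x] f1[of y] by linarith
  have "\<epsilon>\<^sup>2 \<le> (\<eta> X)\<^sup>2" using False \<epsilon> by (intro power_mono) auto
  then have "2 \<le> 2 / \<epsilon>\<^sup>2 * (\<eta> X)\<^sup>2" using \<epsilon> by (simp add: field_simps)
  also have "\<dots> \<le> (2 / \<epsilon>\<^sup>2 + sqrt (real n) * K) * (\<eta> X)\<^sup>2" using K by (intro mult_right_mono) auto
  finally show ?thesis using f2 by (rule order_trans[rotated])
qed

text \<open>The normal limit has the covariance of the influence function. Both errors, that of linearization and that of normal
  approximation of the linear term, are bounded in terms of \<open>K\<close>, \<open>\<epsilon>\<close> and \<open>n\<close> only.\<close>

theorem uniform_convergence_to_normal_if_local_expansion: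
  fixes C D :: "'a::second_countable_topology measure set" and T :: "'a measure \<Rightarrow> 'b::euclidean_space"
  assumes S: "subspace S" and D: "D \<subseteq> laws" and C: "C \<subseteq> laws" and \<epsilon>: "\<epsilon> > 0" and K: "K \<ge> 0"
    and unif: "\<And>Q. Q \<in> C \<Longrightarrow> \<exists>(k :: 'a \<Rightarrow> 'c::euclidean_space) l. local_expansion S D T \<epsilon> K Q k l"
    and emp: "\<And>n X. empirical n X \<in> D \<Longrightarrow>
       \<exists>\<epsilon>>0. \<exists>K (k :: 'a \<Rightarrow> 'c) l. local_expansion S D T \<epsilon> K (empirical n X) k l"
  shows "uniform_convergence_to_normal S D T C"
proof -
  have "\<forall>Q\<in>C. \<exists>p. local_expansion S D T \<epsilon> K Q (fst p :: 'a \<Rightarrow> 'c) (snd p)" using unif by simp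
  from bchoice[OF this] obtain p where p: "\<forall>Q\<in>C. local_expansion S D T \<epsilon> K Q (fst (p Q) :: 'a \<Rightarrow> 'c) (snd (p Q))" ..
  define k where "k Q = fst (p Q)" for Q
  define l where "l Q = snd (p Q)" for Q
  have LE: "local_expansion S D T \<epsilon> K Q (k Q) (l Q)" if "Q \<in> C" for Q using p that by (simp add: k_def l_def)
  have km: "k Q \<in> borel_measurable borel" and lm: "l Q \<in> borel_measurable borel"
    and kK: "norm (k Q x) \<le> K" and lK: "norm (l Q x) \<le> K" and lS: "l Q x \<in> S" and l0: "(\<integral>x. l Q x \<partial>Q) = 0"
    if "Q \<in> C" for Q x
    using LE[OF that] by (auto simp: local_expansion_def intro: borel_measurable_continuous_onI)
  define B where "B Q x y = (\<integral>z. (x \<bullet> l Q z) * (y \<bullet> l Q z) \<partial>Q)" for Q x y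
  have "\<exists>N. mean_zero_normal_on S N \<and> (\<forall>t. char (distr N borel (\<lambda>x. t \<bullet> x)) 1 = exp (- B Q t t / 2)) \<and>
     integrable N (\<lambda>x. (norm x)\<^sup>2) \<and> (\<integral>x. (norm x)\<^sup>2 \<partial>N) = (\<Sum>b\<in>Basis. B Q b b)" if Q: "Q \<in> C" for Q
  proof (rule mean_zero_normal_exists[OF S, of "B Q"])
    have QL: "Q \<in> laws" using Q C by blast
    have int: "integrable Q (\<lambda>z. (x \<bullet> l Q z) * (y \<bullet> l Q z))" for x y
    proof (rule laws_integrable_bounded[OF QL])
      show "(\<lambda>z. (x \<bullet> l Q z) * (y \<bullet> l Q z)) \<in> borel_measurable borel" using lm[OF Q] by simp
      fix z
      have ab: "\<bar>x \<bullet> l Q z\<bar> \<le> norm x * K" for x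
        by (rule order_trans[OF Cauchy_Schwarz_ineq2 mult_left_mono[OF lK[OF Q] norm_ge_zero]])
      show "norm ((x \<bullet> l Q z) * (y \<bullet> l Q z)) \<le> (norm x * K) * (norm y * K)"
        unfolding real_norm_def abs_mult by (rule mult_mono[OF ab ab]) (simp_all add: K)
    qed
    show "linear (B Q x)" for x
      unfolding B_def
    proof (rule linearI)
      show "(\<integral>z. (x \<bullet> l Q z) * ((y + y') \<bullet> l Q z) \<partial>Q) = (\<integral>z. (x \<bullet> l Q z) * (y \<bullet> l Q z) \<partial>Q) + (\<integral>z. (x \<bullet> l Q z) * (y' \<bullet> l Q z) \<partial>Q)" for y y'
        unfolding inner_add_left distrib_left by (rule Bochner_Integration.integral_add[OF int int])
      show "(\<integral>z. (x \<bullet> l Q z) * ((c *\<^sub>R y) \<bullet> l Q z) \<partial>Q) = c *\<^sub>R (\<integral>z. (x \<bullet> l Q z) * (y \<bullet> l Q z) \<partial>Q)" for c y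
        unfolding inner_scaleR_left by (simp add: mult.left_commute)
    qed
    show "B Q x y = B Q y x" for x y unfolding B_def by (simp add: mult.commute)
    show "0 \<le> B Q x x" for x unfolding B_def by (intro integral_nonneg_AE AE_I2) simp
    fix s assume "s \<in> S\<^sup>\<bottom>"
    then have "s \<bullet> l Q z = 0" for z using lS[OF Q, of z] by (auto simp: orthogonal_comp_def orthogonal_def inner_commute)
    then show "B Q s s = 0" by (simp add: B_def)
  qed
  then have "\<forall>Q\<in>C. \<exists>N. mean_zero_normal_on S N \<and> (\<forall>t. char (distr N borel (\<lambda>x. t \<bullet> x)) 1 = exp (- B Q t t / 2)) \<and>
     integrable N (\<lambda>x. (norm x)\<^sup>2) \<and> (\<integral>x. (norm x)\<^sup>2 \<partial>N) = (\<Sum>b\<in>Basis. B Q b b)" by blast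
  from bchoice[OF this] obtain N where N: "\<forall>Q\<in>C. mean_zero_normal_on S (N Q) \<and> (\<forall>t. char (distr (N Q) borel (\<lambda>x. t \<bullet> x)) 1 = exp (- B Q t t / 2)) \<and>
     integrable (N Q) (\<lambda>x. (norm x)\<^sup>2) \<and> (\<integral>x. (norm x)\<^sup>2 \<partial>N Q) = (\<Sum>b\<in>Basis. B Q b b)" ..
  have N_mom: "(\<integral>x. (norm x)\<^sup>2 \<partial>N Q) \<le> K\<^sup>2" if Q: "Q \<in> C" for Q
  proof -
    have QL: "Q \<in> laws" using Q C by blast
    have int: "integrable Q (\<lambda>z. (b \<bullet> l Q z) * (b \<bullet> l Q z))" if "b \<in> Basis" for b
    proof (rule laws_integrable_bounded[OF QL])
      show "(\<lambda>z. (b \<bullet> l Q z) * (b \<bullet> l Q z)) \<in> borel_measurable borel" using lm[OF Q] by simp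
      fix z
      have ab: "\<bar>b \<bullet> l Q z\<bar> \<le> K" using Basis_le_norm[OF that, of "l Q z"] lK[OF Q, of z] by (simp add: inner_commute)
      show "norm ((b \<bullet> l Q z) * (b \<bullet> l Q z)) \<le> K * K"
        unfolding real_norm_def abs_mult by (rule mult_mono[OF ab ab]) (simp_all add: K)
    qed
    have "(\<integral>x. (norm x)\<^sup>2 \<partial>N Q) = (\<Sum>b\<in>Basis. B Q b b)" using N Q by blast
    also have "\<dots> = (\<integral>z. (\<Sum>b\<in>Basis. (b \<bullet> l Q z) * (b \<bullet> l Q z)) \<partial>Q)"
      unfolding B_def by (rule Bochner_Integration.integral_sum[OF int, symmetric])
    also have "\<dots> = (\<integral>z. (norm (l Q z))\<^sup>2 \<partial>Q)"
    proof -
      have "(\<Sum>b\<in>Basis. (b \<bullet> y) * (b \<bullet> y)) = (norm y)\<^sup>2" for y :: 'b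
        unfolding power2_norm_eq_inner by (subst euclidean_inner[of y y]) (simp add: inner_commute)
      then show ?thesis by simp
    qed
    also have "\<dots> \<le> K\<^sup>2"
    proof (rule law_mean_le[OF QL])
      show "(\<lambda>z. (norm (l Q z))\<^sup>2) \<in> borel_measurable borel" using lm[OF Q] by simp
      show "(norm (l Q z))\<^sup>2 \<le> K\<^sup>2" for z by (intro power_mono lK[OF Q]) simp
    qed simp
    finally show ?thesis .
  qed
  define \<eta> where "\<eta> n Q X = norm ((\<integral>x. k Q x \<partial>empirical n X) - (\<integral>x. k Q x \<partial>Q))" for n Q X
  have \<eta>_mom: "integrable (iid Q) (\<lambda>X. (\<eta> n Q X)\<^sup>2)" "(\<integral>X. (\<eta> n Q X)\<^sup>2 \<partial>iid Q) \<le> 4 * K\<^sup>2 / real n"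
    if "Q \<in> C" "n > 0" for n Q
    unfolding \<eta>_def using that C
    by (auto intro!: empirical_mean_second_moment[OF _ km[OF that(1)] kK[OF that(1)]])
  have D_open: "open {X. empirical n X \<in> D}" and T_cont: "continuous_on {X. empirical n X \<in> D} (\<lambda>X. T (empirical n X))" for n
    using empirical_domain_open[OF D emp] by blast+
  have sp: "space (iid Q) = UNIV" and st: "sets (iid Q) = sets borel" if "Q \<in> laws" for Q :: "'a measure"
    using sets_iid_borel[OF laws_sets[OF that]] laws_space[OF that] by (auto simp: iid_def space_PiM)
  have D_meas: "{X. empirical n X \<in> D} \<in> sets (iid Q)" if "Q \<in> laws" for n Q
    unfolding st[OF that] using D_open by simp
  \<comment> \<open>Chebyshev: outside the domain the deviation exceeds \<open>\<epsilon>\<close>.\<close>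
  have part1: "\<bar>measure (iid Q) {X \<in> space (iid Q). empirical n X \<in> D} - 1\<bar> \<le> (4 * K\<^sup>2 / \<epsilon>\<^sup>2) / real n"
    if Q: "Q \<in> C" and n: "n > 0" for n Q
  proof -
    have QL: "Q \<in> laws" using Q C by blast
    interpret I: prob_space "iid Q" by (rule prob_space_iid[OF laws_prob_space[OF QL]])
    let ?A = "{X. empirical n X \<in> D}"
    have mA: "-?A \<in> sets (iid Q)" using D_meas[OF QL, of n] sp[OF QL] sets.compl_sets[of ?A "iid Q"] by (simp add: Compl_eq_Diff_UNIV)
    have "measure (iid Q) (-?A) = (\<integral>X. indicator (-?A) X \<partial>iid Q)" by (simp add: sp[OF QL])
    also have "\<dots> \<le> (\<integral>X. (1 / \<epsilon>\<^sup>2) * (\<eta> n Q X)\<^sup>2 \<partial>iid Q)"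
    proof (intro integral_mono integrable_mult_right \<eta>_mom(1)[OF Q n])
      show "integrable (iid Q) (indicator (-?A) :: _ \<Rightarrow> real)"
        using mA by (intro integrable_real_indicator) (auto simp: I.emeasure_eq_measure)
      fix X
      show "indicator (-?A) X \<le> (1 / \<epsilon>\<^sup>2) * (\<eta> n Q X)\<^sup>2"
      proof (cases "X \<in> ?A")
        case False
        then have "\<epsilon> < \<eta> n Q X" using LE[OF Q] empirical_laws[OF n, of X] unfolding local_expansion_def \<eta>_def
          by (meson mem_Collect_eq not_le)
        then have "\<epsilon>\<^sup>2 \<le> (\<eta> n Q X)\<^sup>2" using \<epsilon> by (intro power_mono) auto
        then show ?thesis using \<epsilon> False by (simp add: field_simps)
      qed simp
    qed
    also have "\<dots> = (1 / \<epsilon>\<^sup>2) * (\<integral>X. (\<eta> n Q X)\<^sup>2 \<partial>iid Q)" by simp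
    also have "\<dots> \<le> (1 / \<epsilon>\<^sup>2) * (4 * K\<^sup>2 / real n)" using \<eta>_mom(2)[OF Q n] by (intro mult_left_mono) auto
    finally have "measure (iid Q) (-?A) \<le> (4 * K\<^sup>2 / \<epsilon>\<^sup>2) / real n" by simp
    moreover have "measure (iid Q) (-?A) = 1 - measure (iid Q) ?A"
      using I.prob_compl[OF D_meas[OF QL, of n]] by (simp add: sp[OF QL] Compl_eq_Diff_UNIV)
    moreover have "0 \<le> measure (iid Q) (-?A)" by simp
    ultimately show ?thesis by (simp add: sp[OF QL])
  qed
  \<comment> \<open>Replacing the functional by its linear part, integrated against a bounded Lipschitz function.\<close>
  have part2: "\<bar>(\<integral>x. f x \<partial>distr (iid Q) borel (\<lambda>X. sqrt (real n) *\<^sub>R (extend_by D T g (empirical n X) - T Q)))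
      - (\<integral>x. f x \<partial>distr (iid Q) borel (\<lambda>X. (1 / sqrt (real n)) *\<^sub>R (\<Sum>j<n. l Q (X j))))\<bar>
      \<le> (8 * K\<^sup>2 / \<epsilon>\<^sup>2) / real n + (4 * K ^ 3) / sqrt (real n)"
    if Q: "Q \<in> C" and n: "n > 0" and f: "f \<in> BL"
      and gm: "(\<lambda>X. extend_by D T g (empirical n X)) \<in> borel_measurable (iid borel)" for n Q f g
  proof -
    have QL: "Q \<in> laws" using Q C by blast
    interpret I: prob_space "iid Q" by (rule prob_space_iid[OF laws_prob_space[OF QL]])
    let ?Y = "\<lambda>X. sqrt (real n) *\<^sub>R (extend_by D T g (empirical n X) - T Q)"
    let ?W = "\<lambda>X. (1 / sqrt (real n)) *\<^sub>R (\<Sum>j<n. l Q (X j))"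
    have gm': "(\<lambda>X. extend_by D T g (empirical n X)) \<in> borel_measurable (iid Q)"
      using gm by (simp add: st[OF QL] sets_iid_borel cong: measurable_cong_sets)
    have Ym: "?Y \<in> borel_measurable (iid Q)" using gm' by simp
    have Wm: "?W \<in> borel_measurable (iid Q)"
      by (intro borel_measurable_scaleR borel_measurable_const iid_sum_measurable QL lm[OF Q])
    have fm: "f \<in> borel_measurable borel" by (rule BL_measurable[OF f])
    have iY: "integrable (iid Q) (\<lambda>X. f (?Y X))" "integrable (iid Q) (\<lambda>X. f (?W X))"
      using BL_bounded[OF f] measurable_compose[OF Ym fm] measurable_compose[OF Wm fm]
      by (auto intro!: I.integrable_const_bound[of _ 1])
    have "\<bar>(\<integral>X. f (?Y X) \<partial>iid Q) - (\<integral>X. f (?W X) \<partial>iid Q)\<bar> = \<bar>\<integral>X. f (?Y X) - f (?W X) \<partial>iid Q\<bar>"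
      using iY by (simp add: Bochner_Integration.integral_diff)
    also have "\<dots> \<le> (\<integral>X. \<bar>f (?Y X) - f (?W X)\<bar> \<partial>iid Q)" by (rule integral_abs_bound)
    also have "\<dots> \<le> (\<integral>X. (2 / \<epsilon>\<^sup>2 + sqrt (real n) * K) * (\<eta> n Q X)\<^sup>2 \<partial>iid Q)"
      unfolding \<eta>_def
      by (intro integral_mono integrable_abs Bochner_Integration.integrable_diff iY integrable_mult_right
          \<eta>_mom(1)[OF Q n, unfolded \<eta>_def] local_expansion_linearization_error[OF LE[OF Q] \<epsilon> K n f])
    also have "\<dots> = (2 / \<epsilon>\<^sup>2 + sqrt (real n) * K) * (\<integral>X. (\<eta> n Q X)\<^sup>2 \<partial>iid Q)" by simp
    also have "\<dots> \<le> (2 / \<epsilon>\<^sup>2 + sqrt (real n) * K) * (4 * K\<^sup>2 / real n)"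
      using \<eta>_mom(2)[OF Q n] K by (intro mult_left_mono) auto
    also have "\<dots> = (8 * K\<^sup>2 / \<epsilon>\<^sup>2) / real n + (4 * K ^ 3) * (sqrt (real n) / real n)"
    proof -
      have "2 / \<epsilon>\<^sup>2 * (4 * K\<^sup>2 / real n) = (8 * K\<^sup>2 / \<epsilon>\<^sup>2) / real n" by simp
      moreover have "sqrt (real n) * K * (4 * K\<^sup>2 / real n) = (4 * K ^ 3) * (sqrt (real n) / real n)"
        by (simp add: power2_eq_square power3_eq_cube)
      ultimately show ?thesis by (simp only: distrib_right)
    qed
    also have "sqrt (real n) / real n = 1 / sqrt (real n)" using n by (simp add: real_div_sqrt field_simps)
    finally show ?thesis unfolding integral_distr[OF Ym fm] integral_distr[OF Wm fm] by simp
  qed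
  have lim1: "(\<lambda>n. (4 * K\<^sup>2 / \<epsilon>\<^sup>2) / real n) \<longlonglongrightarrow> 0" by (rule lim_const_over_n)
  have lim2: "(\<lambda>n. (8 * K\<^sup>2 / \<epsilon>\<^sup>2) / real n + (4 * K ^ 3) / sqrt (real n)) \<longlonglongrightarrow> 0"
    using tendsto_add[OF lim_const_over_n[of "8 * K\<^sup>2 / \<epsilon>\<^sup>2"] const_over_sqrt_tendsto_0[of "4 * K ^ 3"]]
    by (simp only: add_0_right)
  have U1: "uniform_limit C (\<lambda>n Q. measure (iid Q) {X \<in> space (iid Q). empirical n X \<in> D}) (\<lambda>_. 1) sequentially"
  proof (rule uniform_limitI)
    fix e :: real assume "e > 0"
    with lim1 have "\<forall>\<^sub>F n in sequentially. (4 * K\<^sup>2 / \<epsilon>\<^sup>2) / real n < e" by (rule order_tendstoD(2))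
    then show "\<forall>\<^sub>F n in sequentially. \<forall>Q\<in>C. dist (measure (iid Q) {X \<in> space (iid Q). empirical n X \<in> D}) 1 < e"
      using eventually_gt_at_top[of 0]
    proof eventually_elim
      case (elim n)
      show ?case
      proof
        fix Q assume "Q \<in> C"
        from part1[OF this elim(2)] elim(1)
        show "dist (measure (iid Q) {X \<in> space (iid Q). empirical n X \<in> D}) 1 < e" by (simp add: dist_real_def)
      qed
    qed
  qed
  have U2: "uniform_limit C (\<lambda>n Q. beta_dist (distr (iid Q) borel
                   (\<lambda>X. sqrt (real n) *\<^sub>R (extend_by D T g (empirical n X) - T Q))) (N Q)) (\<lambda>_. 0) sequentially"
    if gm: "\<And>n. (\<lambda>X. extend_by D T g (empirical n X)) \<in> borel_measurable (iid borel)" for g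
  proof (rule uniform_limitI)
    fix e :: real assume e: "e > 0"
    then have e4: "e / 4 > 0" by simp
    from uniform_clt[OF e4 K, where 'a = 'a and 'b = 'b] obtain n0 where n0: "\<forall>n\<ge>n0. \<forall>Q l N. Q \<in> laws \<and> l \<in> borel_measurable borel \<and> (\<forall>x. norm (l x) \<le> K) \<and> (\<integral>x. l x \<partial>Q) = 0 \<and>
      N \<in> laws \<and> (\<forall>t. char (distr N borel (\<lambda>x. t \<bullet> x)) 1 = exp (- (\<integral>x. (t \<bullet> l x)\<^sup>2 \<partial>Q) / 2)) \<and>
      integrable N (\<lambda>x. (norm x)\<^sup>2) \<and> (\<integral>x. (norm x)\<^sup>2 \<partial>N) \<le> K\<^sup>2 \<longrightarrow>
      (\<forall>f\<in>BL. \<bar>(\<integral>x. f x \<partial>distr (iid Q) borel (\<lambda>X. (1 / sqrt (real n)) *\<^sub>R (\<Sum>j<n. l (X j :: 'a))))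
        - (\<integral>x. f x \<partial>(N :: 'b measure))\<bar> \<le> e / 4)" ..
    have "\<forall>\<^sub>F n in sequentially. (8 * K\<^sup>2 / \<epsilon>\<^sup>2) / real n + (4 * K ^ 3) / sqrt (real n) < e / 4"
      using lim2 e4 by (rule order_tendstoD(2))
    then show "\<forall>\<^sub>F n in sequentially. \<forall>Q\<in>C. dist (beta_dist (distr (iid Q) borel
                   (\<lambda>X. sqrt (real n) *\<^sub>R (extend_by D T g (empirical n X) - T Q))) (N Q)) 0 < e"
      using eventually_gt_at_top[of 0] eventually_ge_at_top[of n0]
    proof eventually_elim
      case (elim n)
      show ?case
      proof
        fix Q assume Q: "Q \<in> C"
        then have QL: "Q \<in> laws" using C by blast
        let ?Y = "distr (iid Q) borel (\<lambda>X. sqrt (real n) *\<^sub>R (extend_by D T g (empirical n X) - T Q))"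
        have NL: "N Q \<in> laws" using N Q by (auto simp: mean_zero_normal_on_def)
        have chN: "\<forall>t. char (distr (N Q) borel (\<lambda>x. t \<bullet> x)) 1 = exp (- (\<integral>x. (t \<bullet> l Q x)\<^sup>2 \<partial>Q) / 2)"
          using N Q by (simp add: B_def power2_eq_square)
        have clt: "\<forall>f\<in>BL. \<bar>(\<integral>x. f x \<partial>distr (iid Q) borel (\<lambda>X. (1 / sqrt (real n)) *\<^sub>R (\<Sum>j<n. l Q (X j)))) - (\<integral>x. f x \<partial>N Q)\<bar> \<le> e / 4"
          using n0[rule_format, OF elim(3), of Q "l Q" "N Q"] QL lm[OF Q] lK[OF Q] l0[OF Q] NL chN N_mom[OF Q] N Q by blast
        have "beta_dist ?Y (N Q) \<le> e / 2"
        proof (rule beta_dist_le)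
          fix f :: "'b \<Rightarrow> real" assume f: "f \<in> BL"
          show "\<bar>(\<integral>x. f x \<partial>?Y) - (\<integral>x. f x \<partial>N Q)\<bar> \<le> e / 2"
            using bspec[OF clt f] part2[OF Q elim(2) f gm] elim(1) by linarith
        qed
        moreover have "0 \<le> beta_dist ?Y (N Q)"
        proof (rule beta_dist_nonneg[OF _ NL], rule iid_distr_laws[OF QL])
          have "(\<lambda>X. extend_by D T g (empirical n X)) \<in> borel_measurable (iid Q)"
            using gm by (simp add: st[OF QL] sets_iid_borel cong: measurable_cong_sets)
          then show "(\<lambda>X. sqrt (real n) *\<^sub>R (extend_by D T g (empirical n X) - T Q)) \<in> borel_measurable (iid Q)" by simp
        qed
        ultimately show "dist (beta_dist ?Y (N Q)) 0 < e" using e by simp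
      qed
    qed
  qed
  show ?thesis
    unfolding uniform_convergence_to_normal_def
  proof (intro conjI exI[of _ N] ballI allI impI)
    show "mean_zero_normal_on S (N Q)" if "Q \<in> C" for Q using N that by blast
    fix g :: "'a measure \<Rightarrow> 'b" assume "range g \<subseteq> S \<and> (\<forall>n. (\<lambda>X. g (empirical n X)) \<in> borel_measurable (iid borel))"
    then have gm: "(\<lambda>X. extend_by D T g (empirical n X)) \<in> borel_measurable (iid borel)" for n
      by (intro measurable_extend_by_empirical D_open T_cont) blast
    show "(\<lambda>X. extend_by D T g (empirical n X)) \<in> borel_measurable (iid borel)" for n by (rule gm)
    show "uniform_limit C (\<lambda>n Q. beta_dist (distr (iid Q) borel
                   (\<lambda>X. sqrt (real n) *\<^sub>R (extend_by D T g (empirical n X) - T Q))) (N Q)) (\<lambda>_. 0) sequentially"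
      by (rule U2[OF gm])
  qed (rule U1)
qed

text \<open>Expansions survive an image of the law under a continuous map \<open>h\<close> and composition of the functional with a
  map \<open>\<phi>\<close> that has a quadratic Taylor remainder. The statistic is enlarged by the influence function, because
  the remainder of \<open>\<phi>\<close> is quadratic in the increment of \<open>T\<close>, which the integral of \<open>l\<close> controls.\<close>

lemma local_expansion_delta_method:
  fixes k :: "'z::topological_space \<Rightarrow> 'c::euclidean_space" and T :: "'z measure \<Rightarrow> 'b::euclidean_space"
    and h :: "'a::topological_space \<Rightarrow> 'z" and \<phi> :: "'b \<Rightarrow> 'b2::euclidean_space"
  assumes L: "local_expansion S D T \<epsilon> K (distr P borel h) k l"
    and P: "P \<in> laws" and h: "continuous_on UNIV h"
    and \<epsilon>: "\<epsilon> \<ge> 0" and K: "K \<ge> 0" and C: "C \<ge> 0"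
    and D\<phi>: "linear D\<phi>" "\<And>x. norm (D\<phi> x) \<le> C * norm x" "\<And>x. x \<in> S \<Longrightarrow> D\<phi> x \<in> S2"
    and \<phi>: "\<And>E. norm (\<phi> (T (distr P borel h) + E) - \<phi> (T (distr P borel h)) - D\<phi> E) \<le> C * (norm E)\<^sup>2"
    and T2P: "T2 P = \<phi> (T (distr P borel h))"
    and T2: "\<And>R. R \<in> laws \<Longrightarrow> distr R borel h \<in> D \<Longrightarrow> R \<in> D2 \<and> T2 R = \<phi> (T (distr R borel h))"
  shows "local_expansion S2 D2 T2 \<epsilon> (2 * K + C * K + C * (1 + K * \<epsilon>)\<^sup>2) P (\<lambda>y. (k (h y), l (h y))) (\<lambda>y. D\<phi> (l (h y)))"
proof -
  let ?Q = "distr P borel h"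
  have hm: "h \<in> borel_measurable borel" by (rule borel_measurable_continuous_onI[OF h])
  have kc: "continuous_on UNIV k" and lc: "continuous_on UNIV l" and kK: "\<And>x. norm (k x) \<le> K"
    and lK: "\<And>x. norm (l x) \<le> K" and lS: "\<And>x. l x \<in> S" and l0: "(\<integral>x. l x \<partial>?Q) = 0"
    and exp: "\<And>R. R \<in> laws \<Longrightarrow> norm ((\<integral>x. k x \<partial>R) - (\<integral>x. k x \<partial>?Q)) \<le> \<epsilon> \<Longrightarrow>
        R \<in> D \<and> norm (T R - T ?Q - (\<integral>x. l x \<partial>R)) \<le> K * (norm ((\<integral>x. k x \<partial>R) - (\<integral>x. k x \<partial>?Q)))\<^sup>2"
    using L unfolding local_expansion_def by blast+
  have km: "k \<in> borel_measurable borel" and lm: "l \<in> borel_measurable borel"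
    using kc lc by (auto intro: borel_measurable_continuous_onI)
  have khc: "continuous_on UNIV (\<lambda>y. k (h y))" by (rule continuous_on_compose2[OF kc h]) simp
  have lhc: "continuous_on UNIV (\<lambda>y. l (h y))" by (rule continuous_on_compose2[OF lc h]) simp
  have bD: "bounded_linear D\<phi>" using D\<phi>(1) by (simp add: linear_conv_bounded_linear)
  have push: "distr R borel h \<in> laws" "(\<integral>y. k (h y) \<partial>R) = (\<integral>z. k z \<partial>distr R borel h)"
     "(\<integral>y. l (h y) \<partial>R) = (\<integral>z. l z \<partial>distr R borel h)" "integrable R (\<lambda>y. k (h y))" "integrable R (\<lambda>y. l (h y))"
    if R: "R \<in> laws" for R
  proof -
    have hR: "h \<in> measurable R borel" unfolding laws_measurable[OF R] by (rule hm)
    show "distr R borel h \<in> laws" by (rule laws_distr[OF R hm])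
    show "(\<integral>y. k (h y) \<partial>R) = (\<integral>z. k z \<partial>distr R borel h)" by (rule integral_distr[OF hR km, symmetric])
    show "(\<integral>y. l (h y) \<partial>R) = (\<integral>z. l z \<partial>distr R borel h)" by (rule integral_distr[OF hR lm, symmetric])
    show "integrable R (\<lambda>y. k (h y))"
      by (rule laws_integrable_bounded[OF R borel_measurable_continuous_onI[OF khc] kK])
    show "integrable R (\<lambda>y. l (h y))"
      by (rule laws_integrable_bounded[OF R borel_measurable_continuous_onI[OF lhc] lK])
  qed
  have pair: "(\<integral>y. (k (h y), l (h y)) \<partial>R) = (\<integral>z. k z \<partial>distr R borel h, \<integral>z. l z \<partial>distr R borel h)" if R: "R \<in> laws" for R
  proof -
    have "norm (k (h y), l (h y)) \<le> K + K" for y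
      using norm_Pair_le[of "k (h y)" "l (h y)"] kK[of "h y"] lK[of "h y"] by linarith
    then have "integrable R (\<lambda>y. (k (h y), l (h y)))"
      by (rule laws_integrable_bounded[OF R borel_measurable_continuous_onI[OF continuous_on_Pair[OF khc lhc]]])
    from integral_bounded_linear[OF bounded_linear_fst this] integral_bounded_linear[OF bounded_linear_snd this]
    show ?thesis by (simp add: prod_eq_iff push(2,3)[OF R])
  qed
  have Dl: "(\<integral>y. D\<phi> (l (h y)) \<partial>R) = D\<phi> (\<integral>z. l z \<partial>distr R borel h)" if R: "R \<in> laws" for R
    using integral_bounded_linear[OF bD push(5)[OF R]] by (simp add: push(3)[OF R])
  show ?thesis
    unfolding local_expansion_def
  proof (intro conjI allI ballI impI)
    show "continuous_on UNIV (\<lambda>y. (k (h y), l (h y)))" by (intro continuous_on_Pair khc lhc)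
    show "continuous_on UNIV (\<lambda>y. D\<phi> (l (h y)))"
      by (rule continuous_on_compose2[OF linear_continuous_on[OF bD, of UNIV] lhc]) simp
    have nn: "0 \<le> C * K" "0 \<le> C * (1 + K * \<epsilon>)\<^sup>2" using C K by simp_all
    show "norm (k (h x), l (h x)) \<le> 2 * K + C * K + C * (1 + K * \<epsilon>)\<^sup>2" for x
      using norm_Pair_le[of "k (h x)" "l (h x)"] kK[of "h x"] lK[of "h x"] nn by linarith
    show "norm (D\<phi> (l (h x))) \<le> 2 * K + C * K + C * (1 + K * \<epsilon>)\<^sup>2" for x
      using D\<phi>(2)[of "l (h x)"] mult_left_mono[OF lK[of "h x"] C] nn K by linarith
    show "D\<phi> (l (h x)) \<in> S2" for x by (intro D\<phi>(3) lS)
    show "(\<integral>x. D\<phi> (l (h x)) \<partial>P) = 0" unfolding Dl[OF P] l0 by (rule linear_0[OF D\<phi>(1)])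
    fix R assume R: "R \<in> laws" and small: "norm ((\<integral>y. (k (h y), l (h y)) \<partial>R) - (\<integral>y. (k (h y), l (h y)) \<partial>P)) \<le> \<epsilon>"
    define \<eta> where "\<eta> = norm ((\<integral>y. (k (h y), l (h y)) \<partial>R) - (\<integral>y. (k (h y), l (h y)) \<partial>P))"
    let ?R = "distr R borel h"
    have diff: "(\<integral>y. (k (h y), l (h y)) \<partial>R) - (\<integral>y. (k (h y), l (h y)) \<partial>P)
       = ((\<integral>z. k z \<partial>?R) - (\<integral>z. k z \<partial>?Q), \<integral>z. l z \<partial>?R)"
      unfolding pair[OF R] pair[OF P] l0 by simp
    have \<eta>1: "norm ((\<integral>z. k z \<partial>?R) - (\<integral>z. k z \<partial>?Q)) \<le> \<eta>" and \<eta>2: "norm (\<integral>z. l z \<partial>?R) \<le> \<eta>"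
      unfolding \<eta>_def diff using norm_fst_snd_le[of "((\<integral>z. k z \<partial>?R) - (\<integral>z. k z \<partial>?Q), \<integral>z. l z \<partial>?R)"] by simp_all
    have \<eta>\<epsilon>: "\<eta> \<le> \<epsilon>" "0 \<le> \<eta>" using small by (simp_all add: \<eta>_def)
    have ex: "?R \<in> D" "norm (T ?R - T ?Q - (\<integral>x. l x \<partial>?R)) \<le> K * (norm ((\<integral>x. k x \<partial>?R) - (\<integral>x. k x \<partial>?Q)))\<^sup>2"
      using exp[OF push(1)[OF R]] \<eta>1 \<eta>\<epsilon> by auto
    then show "R \<in> D2" using T2[OF R] by blast
    have T2R: "T2 R = \<phi> (T ?R)" using T2[OF R ex(1)] by blast
    define E where "E = T ?R - T ?Q"
    have e1: "norm (E - (\<integral>x. l x \<partial>?R)) \<le> K * \<eta>\<^sup>2"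
    proof -
      have "K * (norm ((\<integral>x. k x \<partial>?R) - (\<integral>x. k x \<partial>?Q)))\<^sup>2 \<le> K * \<eta>\<^sup>2" by (intro mult_left_mono power_mono \<eta>1 K) simp
      then show ?thesis using ex(2) unfolding E_def by linarith
    qed
    have "norm E \<le> norm (\<integral>x. l x \<partial>?R) + norm (E - (\<integral>x. l x \<partial>?R))"
      using norm_triangle_ineq[of "\<integral>x. l x \<partial>?R" "E - (\<integral>x. l x \<partial>?R)"] by simp
    also have "\<dots> \<le> \<eta> + K * \<eta>\<^sup>2" using \<eta>2 e1 by linarith
    also have "\<dots> \<le> (1 + K * \<epsilon>) * \<eta>"
    proof -
      have "K * (\<eta> * \<eta>) \<le> K * (\<epsilon> * \<eta>)" using \<eta>\<epsilon> K by (intro mult_left_mono mult_right_mono) auto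
      then show ?thesis by (simp add: power2_eq_square algebra_simps)
    qed
    finally have "(norm E)\<^sup>2 \<le> ((1 + K * \<epsilon>) * \<eta>)\<^sup>2" by (intro power_mono) auto
    then have E2: "C * (norm E)\<^sup>2 \<le> C * (1 + K * \<epsilon>)\<^sup>2 * \<eta>\<^sup>2"
      using C by (simp add: power_mult_distrib mult_left_mono mult.assoc)
    have "T2 R - T2 P - (\<integral>x. D\<phi> (l (h x)) \<partial>R) = (\<phi> (T ?Q + E) - \<phi> (T ?Q) - D\<phi> E) + D\<phi> (E - (\<integral>x. l x \<partial>?R))"
      unfolding T2R T2P Dl[OF R] linear_diff[OF D\<phi>(1)] by (simp add: E_def)
    then have "norm (T2 R - T2 P - (\<integral>x. D\<phi> (l (h x)) \<partial>R)) \<le> norm (\<phi> (T ?Q + E) - \<phi> (T ?Q) - D\<phi> E) + norm (D\<phi> (E - (\<integral>x. l x \<partial>?R)))"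
      by (metis norm_triangle_ineq)
    also have "\<dots> \<le> C * (1 + K * \<epsilon>)\<^sup>2 * \<eta>\<^sup>2 + C * (K * \<eta>\<^sup>2)"
      using \<phi>[of E] E2 D\<phi>(2)[of "E - (\<integral>x. l x \<partial>?R)"] mult_left_mono[OF e1 C] by linarith
    also have "\<dots> \<le> (2 * K + C * K + C * (1 + K * \<epsilon>)\<^sup>2) * \<eta>\<^sup>2" using K by (simp add: algebra_simps)
    finally show "norm (T2 R - T2 P - (\<integral>x. D\<phi> (l (h x)) \<partial>R)) \<le> (2 * K + C * K + C * (1 + K * \<epsilon>)\<^sup>2) *
       (norm ((\<integral>y. (k (h y), l (h y)) \<partial>R) - (\<integral>y. (k (h y), l (h y)) \<partial>P)))\<^sup>2" unfolding \<eta>_def .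
  qed
qed


section \<open>Local expansion of the scatter functional\<close>

text \<open>Transforming by \<open>W\<close> with \<open>W A W' = I\<close>, coercivity and the local solution apply at the identity; the result is
  transported back by \<open>V = W\<^sup>-\<^sup>1\<close>. The eigenvalue bound \<open>\<kappa>\<close> keeps the tail condition, with a larger radius, and
  the norms of the transformations under control, so that the constants do not depend on \<open>Q\<close>.\<close>

proposition scatter_local_expansion:
  fixes \<nu> \<delta> M \<kappa> :: real
  assumes nu: "\<nu> > 0" and \<delta>: "\<delta> > 0" and \<kappa>: "\<kappa> \<ge> 0"
  shows "\<exists>\<epsilon>>0. \<exists>K\<ge>0. \<forall>(Q :: (real^'d) measure) A. Q \<in> laws \<and> solves_scatter \<nu> Q A \<and>
     (\<forall>x. x \<bullet> (A *v x) \<le> \<kappa> * (x \<bullet> x) \<and> x \<bullet> x \<le> \<kappa> * (x \<bullet> (A *v x))) \<and>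
     measure Q {y. norm y > M} \<le> (1 - \<delta>) / (\<nu> + real CARD('d)) \<longrightarrow>
     (\<exists>(k :: real^'d \<Rightarrow> (real^'d^'d) \<times> (real^'d^'d^'d^'d)) l.
        local_expansion sym_mats (U_laws (\<nu> + real CARD('d))) (A_fun \<nu>) \<epsilon> K Q k l)"
proof -
  define n where "n = CARD('d)"
  define a where "a = \<nu> + real n"
  have a: "a > 0" using nu by (simp add: a_def)
  \<comment> \<open>Since \<open>|W y|\<^sup>2 = y' A\<^sup>-\<^sup>1 y \<le> \<kappa> |y|\<^sup>2\<close>, the ball of radius \<open>M\<close> is mapped into the ball of radius \<open>M'\<close>.\<close>
  define M' where "M' = sqrt \<kappa> * max M 0"
  have M': "M' \<ge> 0" using \<kappa> by (simp add: M'_def)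
  \<comment> \<open>The coercivity constant, truncated at \<open>1\<close> so that its powers are ordered.\<close>
  define c where "c = min 1 (\<delta> * \<nu> / (\<nu> + M'\<^sup>2))"
  have c: "c > 0" "c \<le> 1" "c \<le> \<delta> * \<nu> / (\<nu> + M'\<^sup>2)"
    using \<delta> nu by (auto simp: c_def add_pos_nonneg)
  define \<epsilon> where "\<epsilon> = c\<^sup>2 / (40 * (a + 1)\<^sup>2)"
  have \<epsilon>: "\<epsilon> > 0" using c a by (simp add: \<epsilon>_def)
  define K0 where "K0 = 40 * (a + 1) ^ 3 / c ^ 3"
  have K0: "K0 \<ge> 0" using c a by (simp add: K0_def)
  \<comment> \<open>Bound for the norm of \<open>e \<mapsto> V e V'\<close>.\<close>
  define d2 where "d2 = (real n)\<^sup>2 * \<kappa>"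
  have d2: "d2 \<ge> 0" using \<kappa> by (simp add: d2_def)
  define Kl where "Kl = d2 * ((a + norm (mat 1 :: real^'d^'d)) / c)"
  define K where "K = max 2 (max Kl (d2 * K0))"
  have K: "K \<ge> 0" "2 \<le> K" "Kl \<le> K" "d2 * K0 \<le> K" by (auto simp: K_def)
  show ?thesis
  proof (rule exI[of _ \<epsilon>], rule conjI[OF \<epsilon>], rule exI[of _ K], rule conjI[OF K(1)], rule allI, rule allI, rule impI)
    fix Q :: "(real^'d) measure" and A :: "real^'d^'d"
    assume H: "Q \<in> laws \<and> solves_scatter \<nu> Q A \<and>
     (\<forall>x. x \<bullet> (A *v x) \<le> \<kappa> * (x \<bullet> x) \<and> x \<bullet> x \<le> \<kappa> * (x \<bullet> (A *v x))) \<and>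
     measure Q {y. norm y > M} \<le> (1 - \<delta>) / (\<nu> + real CARD('d))"
    then have Q: "Q \<in> laws" and sol: "solves_scatter \<nu> Q A"
      and hi: "\<forall>x. x \<bullet> (A *v x) \<le> \<kappa> * (x \<bullet> x)" and lo: "\<forall>x. x \<bullet> x \<le> \<kappa> * (x \<bullet> (A *v x))"
      and tail: "measure Q {y. norm y > M} \<le> (1 - \<delta>) / (\<nu> + real CARD('d))" by blast+
    interpret Q: prob_space Q using Q by (rule laws_prob_space)
    have A: "A \<in> pd_mats" by (rule solves_scatter_pd[OF sol])
    obtain W :: "real^'d^'d" and cc where W: "invertible W" "W ** A ** transpose W = mat 1"
      by (rule simultaneous_diagonalization[OF A pd_mats_sym_mats[OF A]])
    define V where "V = matrix_inv W"
    have V: "invertible V" unfolding V_def by (rule invertible_matrix_inv[OF W(1)])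
    have VV: "V ** transpose V = A"
      using congruence_inverse[OF W(1), of A] by (simp add: W(2) V_def)
    have Wm: "(*v) W \<in> borel_measurable borel" by (rule matrix_vector_borel)
    have pushV: "distr (distr R borel ((*v) W)) borel ((*v) V) = R" if R: "R \<in> laws" for R :: "(real^'d) measure"
    proof -
      have "distr (distr R borel ((*v) W)) borel ((*v) V) = distr R borel (\<lambda>y. V *v (W *v y))"
        by (subst distr_distr) (simp_all add: laws_measurable[OF R] matrix_vector_borel comp_def)
      also have "\<dots> = distr R borel (\<lambda>y. y)"
        using matrix_inv_cancel(2)[OF W(1)] by (simp add: V_def matrix_vector_mul_assoc)
      also have "\<dots> = R" by (rule distr_id2) (simp add: laws_sets[OF R])
      finally show ?thesis .
    qed
    have push_law: "distr R borel ((*v) W) \<in> laws" if "R \<in> laws" for R :: "(real^'d) measure"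
      by (rule laws_distr[OF that Wm])
    have push_int: "(\<integral>y. f (W *v y) \<partial>R) = (\<integral>z. f z \<partial>distr R borel ((*v) W))"
      if "R \<in> laws" "f \<in> borel_measurable borel" for R and f :: "real^'d \<Rightarrow> 'z::{banach,second_countable_topology}"
      by (rule integral_distr[symmetric]) (use that in \<open>simp_all add: laws_measurable[OF that(1)] matrix_vector_borel\<close>)
    define Q' where "Q' = distr Q borel ((*v) W)"
    have Q': "Q' \<in> laws" unfolding Q'_def by (rule push_law[OF Q])
    have sol': "solves_scatter \<nu> Q' (mat 1)"
      using solves_scatter_congruence[OF Q W(1) sol] by (simp add: Q'_def W(2))
    have tail': "measure Q' {z. norm z > M'} \<le> (1 - \<delta>) / (\<nu> + real CARD('d))"
    proof -
      have "measure Q' {z. norm z > M'} = measure Q ((*v) W -` {z. norm z > M'} \<inter> space Q)"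
        unfolding Q'_def
        by (intro measure_distr borel_open open_Collect_less continuous_intros)
          (simp add: laws_measurable[OF Q] matrix_vector_borel)
      also have "\<dots> \<le> measure Q {y. norm y > M}"
      proof (rule Q.finite_measure_mono)
        show "{y. norm y > M} \<in> sets Q"
          unfolding laws_sets[OF Q] by (intro borel_open open_Collect_less continuous_intros)
        show "(*v) W -` {z. norm z > M'} \<inter> space Q \<subseteq> {y. norm y > M}"
        proof
          fix y assume "y \<in> (*v) W -` {z. norm z > M'} \<inter> space Q"
          then have "M' < norm (W *v y)" by simp
          then have "M'\<^sup>2 < (norm (W *v y))\<^sup>2" using M' by (intro power_strict_mono) auto
          also have "(norm (W *v y))\<^sup>2 = y \<bullet> (matrix_inv A *v y)"
            using inverse_form_congruence[OF pd_mats_invertible[OF A] W(1), of y]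
            by (simp add: W(2) power2_norm_eq_inner)
          also have "\<dots> \<le> \<kappa> * (norm y)\<^sup>2"
            using inverse_form_le[OF A lo \<kappa>, of y] by (simp add: power2_norm_eq_inner)
          finally have "\<kappa> * (max M 0)\<^sup>2 < \<kappa> * (norm y)\<^sup>2" using \<kappa> by (simp add: M'_def power_mult_distrib)
          then have "(max M 0)\<^sup>2 < (norm y)\<^sup>2" using \<kappa> by (simp add: mult_less_cancel_left)
          then have "max M 0 < norm y" by (rule power_less_imp_less_base) simp
          then show "y \<in> {y. norm y > M}" by simp
        qed
      qed
      finally show ?thesis using tail by linarith
    qed
    have coercive: "c * (norm e)\<^sup>2 \<le> e \<bullet> (e - deriv_op \<nu> Q' e)" for e
      using derivative_coercive[OF nu Q' sol' M' tail', of e] mult_right_mono[OF c(3), of "(norm e)\<^sup>2"] by simp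
    define L where "L e = e - deriv_op \<nu> Q' e" for e
    have linL: "linear L" unfolding L_def by (intro linear_compose_sub linear_id[unfolded id_def] linear_deriv_op nu Q')
    have injL: "inj L"
    proof (subst linear_injective_0[OF linL], intro allI impI)
      fix e assume "L e = 0"
      then have "c * (norm e)\<^sup>2 \<le> 0" using coercive[of e] by (simp add: L_def)
      then show "e = 0" using c(1) by (simp add: mult_le_0_iff)
    qed
    obtain G where G: "linear G" "\<And>x. L (G x) = x"
      using linear_injective_isomorphism[OF linL injL] by blast
    have G2: "G x - deriv_op \<nu> Q' (G x) = x" for x using G(2)[of x] by (simp add: L_def)
    have normG: "norm (G x) \<le> norm x / c" for x by (rule coercive_inverse_norm[OF c(1) coercive G2])
    have bG: "bounded_linear G" using G(1) by (simp add: linear_conv_bounded_linear)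
    define E where "E e = V ** e ** transpose V" for e
    have linE: "linear E"
      unfolding E_def
      by (rule linearI) (simp_all add: matrix_add_ldistrib matrix_mult_add_right matrix_scalar_ac scalar_matrix_assoc)
    have normE: "norm (E e) \<le> d2 * norm e" for e
      unfolding E_def d2_def n_def by (rule norm_congruence_le[OF VV hi \<kappa>])
    have bE: "bounded_linear E" using linE by (simp add: linear_conv_bounded_linear)
    define m where "m = score \<nu> (mat 1 :: real^'d^'d)"
    have mc: "continuous_on UNIV m" unfolding m_def by (rule continuous_score[OF mat_1_pd nu])
    have im: "integrable R m" if "R \<in> laws" for R unfolding m_def by (rule integrable_score[OF mat_1_pd nu that])
    \<comment> \<open>The influence function: \<open>G\<close> inverts the linearized equation at the identity, and \<open>E\<close> transports back.\<close>
    define l where "l y = E (G (a *\<^sub>R m (W *v y) - mat 1))" for y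
    define k where "k y = score_stat \<nu> (W *v y)" for y
    have GEc: "continuous_on UNIV (\<lambda>x. E (G x))"
      by (intro linear_continuous_on bounded_linear_compose[OF bE bG])
    have Wc: "continuous_on UNIV ((*v) W)" by (intro linear_continuous_on matrix_vector_mul_bounded_linear)
    have l_int: "(\<integral>y. l y \<partial>R) = E (G (a *\<^sub>R (\<integral>z. m z \<partial>distr R borel ((*v) W)) - mat 1))" if R: "R \<in> laws" for R
    proof -
      have R': "distr R borel ((*v) W) \<in> laws" by (rule push_law[OF R])
      interpret R': prob_space "distr R borel ((*v) W)" using R' by (rule laws_prob_space)
      have "(\<integral>y. l y \<partial>R) = (\<integral>z. E (G (a *\<^sub>R m z - mat 1)) \<partial>distr R borel ((*v) W))"
        unfolding l_def
        by (rule push_int[OF R, of "\<lambda>z. E (G (a *\<^sub>R m z - mat 1))"])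
          (intro borel_measurable_continuous_onI continuous_on_compose2[OF GEc] continuous_intros mc subset_UNIV)
      also have "\<dots> = E (G (\<integral>z. a *\<^sub>R m z - mat 1 \<partial>distr R borel ((*v) W)))"
        using im[OF R'] by (intro integral_bounded_linear[OF bounded_linear_compose[OF bE bG]]) simp
      also have "(\<integral>z. a *\<^sub>R m z - mat 1 \<partial>distr R borel ((*v) W)) = a *\<^sub>R (\<integral>z. m z \<partial>distr R borel ((*v) W)) - mat 1"
        using im[OF R'] R'.prob_space by (simp add: Bochner_Integration.integral_diff)
      finally show ?thesis .
    qed
    have k_int: "(\<integral>y. k y \<partial>R) = (\<integral>z. score_stat \<nu> z \<partial>distr R borel ((*v) W))" if R: "R \<in> laws" for R
      unfolding k_def
      by (rule push_int[OF R, of "score_stat \<nu>"]) (intro borel_measurable_continuous_onI continuous_score_stat nu)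
    have one: "a *\<^sub>R (\<integral>z. m z \<partial>Q') = mat 1"
      using sol' unfolding solves_scatter_iff_score[OF mat_1_pd nu Q'] by (simp add: a_def n_def m_def)
    have AQ: "A_fun \<nu> Q = A" by (rule solves_scatter_imp_A_fun[OF Q nu sol])
    have "local_expansion sym_mats (U_laws (\<nu> + real CARD('d))) (A_fun \<nu>) \<epsilon> K Q k l"
      unfolding local_expansion_def
    proof (intro conjI allI ballI impI)
      show "continuous_on UNIV k" unfolding k_def
        by (intro continuous_on_compose2[OF continuous_score_stat[OF nu, of UNIV] Wc] subset_UNIV)
      show "continuous_on UNIV l" unfolding l_def
        by (intro continuous_on_compose2[OF GEc] continuous_intros continuous_on_compose2[OF mc Wc] subset_UNIV)
      show "norm (k x) \<le> K" for x unfolding k_def using norm_score_stat[OF nu, of "W *v x"] K(2) by linarith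
      show "norm (l x) \<le> K" for x
      proof -
        have "norm (a *\<^sub>R m (W *v x)) \<le> a * 1"
          unfolding norm_scaleR m_def using a norm_score_identity[OF nu, of "W *v x"] by (intro mult_mono) auto
        then have "norm (a *\<^sub>R m (W *v x) - mat 1) \<le> a + norm (mat 1 :: real^'d^'d)"
          using norm_triangle_ineq4[of "a *\<^sub>R m (W *v x)" "mat 1"] by linarith
        then have "norm (G (a *\<^sub>R m (W *v x) - mat 1)) \<le> (a + norm (mat 1 :: real^'d^'d)) / c"
          using normG[of "a *\<^sub>R m (W *v x) - mat 1"] c(1) by (meson divide_right_mono less_imp_le order_trans)
        then have "norm (l x) \<le> Kl"
          unfolding l_def Kl_def using normE[of "G (a *\<^sub>R m (W *v x) - mat 1)"] d2 by (meson mult_left_mono order_trans)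
        then show ?thesis using K(3) by linarith
      qed
      show "l x \<in> sym_mats" for x
      proof -
        have s: "a *\<^sub>R m (W *v x) - mat 1 \<in> sym_mats"
          unfolding m_def by (intro subspace_diff[OF sym_mats_subspace] subspace_scale[OF sym_mats_subspace]
             score_sym pd_mats_sym_mats[OF mat_1_pd])
        have "G y = y + deriv_op \<nu> Q' (G y)" for y using G2[of y] by (simp add: algebra_simps)
        then have "G (a *\<^sub>R m (W *v x) - mat 1) \<in> sym_mats"
          using subspace_add[OF sym_mats_subspace s deriv_op_sym] by metis
        then show ?thesis unfolding l_def E_def by (rule congruence_sym_mats)
      qed
      show "(\<integral>x. l x \<partial>Q) = 0"
        unfolding l_int[OF Q] using one linear_0[OF G(1)] linear_0[OF linE] by (simp add: Q'_def)
      fix R :: "(real^'d) measure"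
      assume R: "R \<in> laws" and small: "norm ((\<integral>x. k x \<partial>R) - (\<integral>x. k x \<partial>Q)) \<le> \<epsilon>"
      define R' where "R' = distr R borel ((*v) W)"
      have R': "R' \<in> laws" unfolding R'_def by (rule push_law[OF R])
      define \<eta> where "\<eta> = norm ((\<integral>x. k x \<partial>R) - (\<integral>x. k x \<partial>Q))"
      have \<eta>: "\<eta> = norm ((\<integral>z. score_stat \<nu> z \<partial>R') - (\<integral>z. score_stat \<nu> z \<partial>Q'))"
        unfolding \<eta>_def k_int[OF R] k_int[OF Q] R'_def Q'_def ..
      have sm: "norm ((\<integral>z. score_stat \<nu> z \<partial>R') - (\<integral>z. score_stat \<nu> z \<partial>Q')) * (40 * (\<nu> + real CARD('d) + 1)\<^sup>2 / c\<^sup>2) \<le> 1"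
      proof -
        have "\<eta> * (40 * (a + 1)\<^sup>2 / c\<^sup>2) \<le> \<epsilon> * (40 * (a + 1)\<^sup>2 / c\<^sup>2)"
          using small c a unfolding \<eta>_def by (intro mult_right_mono) auto
        also have "\<dots> = 1" using c a by (simp add: \<epsilon>_def)
        finally show ?thesis by (simp add: \<eta> a_def n_def)
      qed
      obtain e where e: "solves_scatter \<nu> R' (mat 1 + e)"
        "norm (e - G ((\<nu> + real CARD('d)) *\<^sub>R (\<integral>z. score \<nu> (mat 1) z \<partial>R') - mat 1))
          \<le> (40 * (\<nu> + real CARD('d) + 1) ^ 3 / c ^ 3) * (norm ((\<integral>z. score_stat \<nu> z \<partial>R') - (\<integral>z. score_stat \<nu> z \<partial>Q')))\<^sup>2"
        using local_solution_at_identity[OF nu Q' R' sol' c(1,2) coercive G(1) G2 sm] by blast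
      have "solves_scatter \<nu> (distr R' borel ((*v) V)) (V ** (mat 1 + e) ** transpose V)"
        by (rule solves_scatter_congruence[OF R' V e(1)])
      moreover have "distr R' borel ((*v) V) = R" unfolding R'_def by (rule pushV[OF R])
      moreover have "V ** (mat 1 + e) ** transpose V = A + E e"
        by (simp add: E_def matrix_add_ldistrib matrix_mult_add_right VV)
      ultimately have solR: "solves_scatter \<nu> R (A + E e)" by simp
      show "R \<in> U_laws (\<nu> + real CARD('d))" by (rule solves_scatter_imp_U_laws[OF R nu solR])
      have AR: "A_fun \<nu> R = A + E e" by (rule solves_scatter_imp_A_fun[OF R nu solR])
      have "A_fun \<nu> R - A_fun \<nu> Q - (\<integral>x. l x \<partial>R) = E (e - G (a *\<^sub>R (\<integral>z. m z \<partial>R') - mat 1))"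
        unfolding AR AQ l_int[OF R] R'_def[symmetric] by (simp add: linear_diff[OF linE])
      then have "norm (A_fun \<nu> R - A_fun \<nu> Q - (\<integral>x. l x \<partial>R)) \<le> d2 * norm (e - G (a *\<^sub>R (\<integral>z. m z \<partial>R') - mat 1))"
        using normE by simp
      also have "\<dots> \<le> d2 * (K0 * \<eta>\<^sup>2)"
        using e(2) d2 unfolding \<eta> K0_def a_def n_def m_def by (intro mult_left_mono) auto
      also have "\<dots> = (d2 * K0) * \<eta>\<^sup>2" by simp
      also have "\<dots> \<le> K * \<eta>\<^sup>2" using K(4) by (intro mult_right_mono) auto
      finally show "norm (A_fun \<nu> R - A_fun \<nu> Q - (\<integral>x. l x \<partial>R)) \<le> K * (norm ((\<integral>x. k x \<partial>R) - (\<integral>x. k x \<partial>Q)))\<^sup>2"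
        unfolding \<eta>_def .
    qed
    then show "\<exists>(k :: real^'d \<Rightarrow> (real^'d^'d) \<times> (real^'d^'d^'d^'d)) l.
        local_expansion sym_mats (U_laws (\<nu> + real CARD('d))) (A_fun \<nu>) \<epsilon> K Q k l" by blast
  qed
qed


section \<open>Location and scatter as scatter in one more dimension\<close>

definition adjoin :: "real \<Rightarrow> real^'d \<Rightarrow> real^'d option" where
  "adjoin a v = (\<chi> i. case i of None \<Rightarrow> a | Some j \<Rightarrow> v $ j)"

definition coords :: "'a^'d option \<Rightarrow> 'a^'d" where
  "coords x = (\<chi> j. x $ Some j)"

text \<open>The matrix \<open>(\<Sigma> + \<mu> \<mu>', \<mu>; \<mu>', 1)\<close> of second moments of \<open>(Y, 1)\<close> when \<open>Y\<close> has mean \<open>\<mu>\<close> and covariance matrix \<open>\<Sigma>\<close>.\<close>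

definition moment_mat :: "real^'d \<Rightarrow> real^'d^'d \<Rightarrow> real^'d option^'d option" where
  "moment_mat \<mu> \<Sigma> = (\<chi> i. case i of None \<Rightarrow> adjoin 1 \<mu> | Some j \<Rightarrow> adjoin (\<mu> $ j) (\<Sigma> $ j + \<mu> $ j *\<^sub>R \<mu>))"

text \<open>Inverse of \<open>moment_mat\<close> on the matrices whose corner entry is \<open>1\<close>.\<close>

definition loc_scatter_of :: "real^'d option^'d option \<Rightarrow> (real^'d) \<times> (real^'d^'d)" where
  "loc_scatter_of A = (coords (A $ None), \<chi> i j. A $ Some i $ Some j - A $ None $ Some i * A $ None $ Some j)"

lemma adjoin_nth [simp]: "adjoin a v $ None = a" "adjoin a v $ Some j = v $ j"
  by (simp_all add: adjoin_def)

lemma coords_nth [simp]: "coords x $ j = x $ Some j"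
  by (simp add: coords_def)

lemma coords_adjoin [simp]: "coords (adjoin a v) = v"
  by (simp add: vec_eq_iff)

lemma moment_mat_nth [simp]: "moment_mat \<mu> \<Sigma> $ None = adjoin 1 \<mu>"
  "moment_mat \<mu> \<Sigma> $ Some j = adjoin (\<mu> $ j) (\<Sigma> $ j + \<mu> $ j *\<^sub>R \<mu>)"
  by (simp_all add: moment_mat_def)

lemma forall_option: "(\<forall>i. P i) \<longleftrightarrow> P None \<and> (\<forall>j. P (Some j))"
  by (metis option.exhaust)

lemma sum_option: "(\<Sum>i\<in>UNIV. f i) = f None + (\<Sum>j\<in>UNIV. f (Some j))"
  for f :: "'d::finite option \<Rightarrow> 'b::comm_monoid_add"
  unfolding UNIV_option_conv by (subst sum.insert) (auto simp: sum.reindex)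

lemma inner_option: "x \<bullet> y = x $ None * y $ None + coords x \<bullet> coords y"
  for x y :: "real^'d::finite option"
  by (simp add: inner_vec_def sum_option)

lemma loc_scatter_of_moment_mat [simp]: "loc_scatter_of (moment_mat \<mu> \<Sigma>) = (\<mu>, \<Sigma>)"
  by (simp add: loc_scatter_of_def vec_eq_iff)

lemma moment_mat_mult:
  "moment_mat \<mu> \<Sigma> *v x = adjoin (\<mu> \<bullet> coords x + x $ None) (\<Sigma> *v coords x + (\<mu> \<bullet> coords x + x $ None) *\<^sub>R \<mu>)"
proof -
  have "(moment_mat \<mu> \<Sigma> *v x) $ i = adjoin (\<mu> \<bullet> coords x + x $ None) (\<Sigma> *v coords x + (\<mu> \<bullet> coords x + x $ None) *\<^sub>R \<mu>) $ i" for i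
  proof (cases i)
    case None
    then show ?thesis by (simp add: matrix_vector_mul_component inner_option)
  next
    case (Some j)
    then show ?thesis
      by (simp add: matrix_vector_mul_component inner_option inner_add_left algebra_simps)
  qed
  then show ?thesis by (simp add: vec_eq_iff)
qed

lemma moment_mat_quadratic:
  "x \<bullet> (moment_mat \<mu> \<Sigma> *v x) = coords x \<bullet> (\<Sigma> *v coords x) + (\<mu> \<bullet> coords x + x $ None)\<^sup>2"
  by (simp add: moment_mat_mult inner_option inner_add_right power2_eq_square inner_commute[of "coords x" \<mu>] algebra_simps)

lemma moment_mat_sym_mats: "\<Sigma> \<in> sym_mats \<Longrightarrow> moment_mat \<mu> \<Sigma> \<in> sym_mats"
proof -
  assume "\<Sigma> \<in> sym_mats"
  then have "\<Sigma> $ i $ j = \<Sigma> $ j $ i" for i j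
    unfolding sym_mats_def transpose_def vec_eq_iff by simp
  then show ?thesis
    unfolding sym_mats_def by (simp add: transpose_def vec_eq_iff forall_option mult.commute)
qed

lemma moment_mat_pd_mats:
  assumes "\<Sigma> \<in> pd_mats"
  shows "moment_mat \<mu> \<Sigma> \<in> pd_mats"
proof -
  have "0 < x \<bullet> (moment_mat \<mu> \<Sigma> *v x)" if "x \<noteq> 0" for x
  proof (cases "coords x = 0")
    case True
    then have "x $ None \<noteq> 0" using that by (auto simp: vec_eq_iff forall_option)
    then show ?thesis using True by (simp add: moment_mat_quadratic)
  next
    case False
    from pd_mats_posD[OF assms this] show ?thesis
      unfolding moment_mat_quadratic by (intro add_pos_nonneg) auto
  qed
  then show ?thesis
    using moment_mat_sym_mats[OF pd_mats_sym_mats[OF assms]] by (simp add: pd_mats_def)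
qed

text \<open>The form of \<open>\<Sigma>\<close> at \<open>x\<close> is the form of \<open>A\<close> at \<open>(x, - \<mu> \<bullet> x)\<close>.\<close>

lemma moment_mat_loc_scatter_of:
  assumes A: "A \<in> pd_mats" and one: "A $ None $ None = 1" and eq: "loc_scatter_of A = (\<mu>, \<Sigma>)"
  shows "A = moment_mat \<mu> \<Sigma>" "\<Sigma> \<in> pd_mats"
proof -
  have sym: "A $ i $ j = A $ j $ i" for i j
    using pd_mats_symD[OF A] unfolding transpose_def vec_eq_iff by simp
  have mu: "\<mu> = coords (A $ None)" and Sigma: "\<Sigma> = (\<chi> i j. A $ Some i $ Some j - A $ None $ Some i * A $ None $ Some j)"
    using eq by (auto simp: loc_scatter_of_def)
  show AE: "A = moment_mat \<mu> \<Sigma>"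
    by (simp add: mu Sigma vec_eq_iff forall_option one) (simp add: sym[of _ None])
  have "\<Sigma> \<in> sym_mats"
    unfolding sym_mats_def by (simp add: Sigma transpose_def vec_eq_iff) (simp add: sym[of "Some _" "Some _"] mult.commute)
  moreover have "0 < x \<bullet> (\<Sigma> *v x)" if "x \<noteq> 0" for x
  proof -
    define z where "z = adjoin (- (\<mu> \<bullet> x)) x"
    have "z \<noteq> 0" using that by (metis coords_adjoin coords_nth vec_eq_iff z_def zero_index)
    from pd_mats_posD[OF A this] show ?thesis
      by (subst (asm) AE) (simp add: moment_mat_quadratic z_def)
  qed
  ultimately show "\<Sigma> \<in> pd_mats" by (simp add: pd_mats_def)
qed

text \<open>This identity is the reason for the reduction: \<open>\<nu> - 1\<close> plus the inverse form in dimension \<open>d + 1\<close> is \<open>\<nu>\<close> plus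
  the inverse form in dimension \<open>d\<close>.\<close>

lemma moment_mat_inverse_form:
  assumes S: "\<Sigma> \<in> pd_mats"
  shows "adjoin 1 y \<bullet> (matrix_inv (moment_mat \<mu> \<Sigma>) *v adjoin 1 y) = 1 + (y - \<mu>) \<bullet> (matrix_inv \<Sigma> *v (y - \<mu>))"
proof -
  define v where "v = matrix_inv \<Sigma> *v (y - \<mu>)"
  define u where "u = adjoin (1 - \<mu> \<bullet> v) v"
  have "\<Sigma> *v v = y - \<mu>"
    using matrix_inv_cancel(1)[OF pd_mats_invertible[OF S]] by (simp add: v_def matrix_vector_mul_assoc)
  then have "moment_mat \<mu> \<Sigma> *v u = adjoin 1 y"
    by (simp add: moment_mat_mult u_def)
  then have "matrix_inv (moment_mat \<mu> \<Sigma>) *v adjoin 1 y = (matrix_inv (moment_mat \<mu> \<Sigma>) ** moment_mat \<mu> \<Sigma>) *v u"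
    by (metis matrix_vector_mul_assoc)
  also have "\<dots> = u"
    using matrix_inv_cancel(2)[OF pd_mats_invertible[OF moment_mat_pd_mats[OF S]]] by simp
  finally show ?thesis
    unfolding v_def[symmetric] by (simp add: u_def inner_option inner_diff_left)
qed

text \<open>Expansion along a row with a single nonzero entry. Permutations contributing to the determinant fix
  \<open>None\<close> and therefore come from permutations of the remaining indices.\<close>

lemma det_option:
  fixes A :: "real^'d::finite option^'d option"
  assumes "\<And>j. A $ None $ Some j = 0"
  shows "det A = A $ None $ None * det (\<chi> i. coords (A $ Some i))"
proof -
  let ?t = "\<lambda>p. of_int (sign p) * (\<Prod>i\<in>UNIV. A $ i $ p i)"
  let ?P = "{p. p permutes (UNIV :: 'd option set)}" and ?F = "{p. p permutes range (Some :: 'd \<Rightarrow> _)}"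
  let ?Q = "{q. q permutes (UNIV :: 'd set)}"
  let ?h = "map_permutation UNIV (Some :: 'd \<Rightarrow> _)"
  have prod_option: "(\<Prod>i\<in>UNIV. f i) = f None * (\<Prod>j\<in>UNIV. f (Some j))" for f :: "'d option \<Rightarrow> real"
    unfolding UNIV_option_conv by (subst prod.insert) (auto simp: prod.reindex)
  have "det A = (\<Sum>p\<in>?P. ?t p)" by (simp add: det_def)
  also have "\<dots> = (\<Sum>p\<in>?F. ?t p)"
  proof (rule sum.mono_neutral_right)
    show "finite ?P" by (intro finite_permutations) simp
    show "?F \<subseteq> ?P" by (auto intro: permutes_subset)
    show "\<forall>p\<in>?P - ?F. ?t p = 0"
    proof
      fix p assume p: "p \<in> ?P - ?F"
      then have "p None \<noteq> None"
      proof (intro notI)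
        assume "p None = None"
        then have "\<forall>x. x \<notin> range Some \<longrightarrow> p x = x" by (metis UNIV_I option.exhaust rangeI)
        then have "p permutes range Some" using p by (simp add: permutes_def)
        then show False using p by simp
      qed
      then obtain j where "p None = Some j" by auto
      then show "?t p = 0" using assms[of j] by (simp add: prod_option)
    qed
  qed
  also have "\<dots> = (\<Sum>q\<in>?Q. ?t (?h q))"
  proof (rule sum.reindex_bij_witness[of _ ?h "\<lambda>p. the \<circ> p \<circ> Some"])
    fix p :: "'d option \<Rightarrow> 'd option" assume "p \<in> ?F"
    then have p: "p permutes range Some" by simp
    have ex: "p (Some i) = Some (the (p (Some i)))" for i
      using permutes_in_image[OF p, of "Some i"] by auto
    have N: "p None = None" using permutes_not_in[OF p, of None] by auto
    show eq: "?h (the \<circ> p \<circ> Some) = p"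
    proof
      fix x show "?h (the \<circ> p \<circ> Some) x = p x"
      proof (cases x)
        case None
        then show ?thesis using N by (simp add: map_permutation_def restrict_id_def)
      next
        case (Some i)
        then show ?thesis using ex[of i] by (simp add: map_permutation_apply)
      qed
    qed
    have "inj (the \<circ> p \<circ> Some)"
    proof (rule injI)
      fix i j assume "(the \<circ> p \<circ> Some) i = (the \<circ> p \<circ> Some) j"
      then have "p (Some i) = p (Some j)" using ex[of i] ex[of j] by simp
      then show "i = j" using permutes_inj[OF p] by (auto dest: injD)
    qed
    then show "(the \<circ> p \<circ> Some) \<in> ?Q"
      using finite_UNIV_inj_surj[OF finite, of "the \<circ> p \<circ> Some"] by (intro CollectI bij_imp_permutes) (auto simp: bij_def)
    show "?t (?h (the \<circ> p \<circ> Some)) = ?t p" by (simp only: eq)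
  next
    fix q :: "'d \<Rightarrow> 'd" assume "q \<in> ?Q"
    then have q: "q permutes UNIV" by simp
    show "the \<circ> ?h q \<circ> Some = q" by (simp add: fun_eq_iff map_permutation_apply)
    show "?h q \<in> ?F" using map_permutation_permutes[OF _ q, of Some "range Some"] by (simp add: bij_betw_def)
  qed
  also have "\<dots> = (\<Sum>q\<in>?Q. A $ None $ None * (of_int (sign q) * (\<Prod>i\<in>UNIV. (\<chi> i. coords (A $ Some i)) $ i $ q i)))"
  proof (rule sum.cong)
    fix q :: "'d \<Rightarrow> 'd" assume "q \<in> ?Q"
    then have q: "q permutes UNIV" by simp
    have "?h q None = None" by (simp add: map_permutation_def restrict_id_def)
    moreover have "?h q (Some i) = Some (q i)" for i by (simp add: map_permutation_apply)
    moreover have "sign (?h q) = sign q" by (rule sign_map_permutation[OF _ q]) auto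
    ultimately show "?t (?h q) = A $ None $ None * (of_int (sign q) * (\<Prod>i\<in>UNIV. (\<chi> i. coords (A $ Some i)) $ i $ q i))"
      by (simp add: prod_option mult_ac)
  qed simp
  also have "\<dots> = A $ None $ None * det (\<chi> i. coords (A $ Some i))"
    by (simp only: det_def sum_distrib_left)
  finally show ?thesis .
qed

text \<open>The matrix factors as \<open>L (diag \<Sigma> 1) L'\<close> with \<open>L\<close> unipotent.\<close>

lemma det_moment_mat:
  fixes \<Sigma> :: "real^'d^'d"
  shows "det (moment_mat \<mu> \<Sigma>) = det \<Sigma>"
proof -
  define L where "L = (\<chi> i. case i of None \<Rightarrow> adjoin 1 0 | Some j \<Rightarrow> adjoin (\<mu> $ j) (axis j 1))"
  define B where "B = (\<chi> i. case i of None \<Rightarrow> adjoin 1 0 | Some j \<Rightarrow> adjoin 0 (\<Sigma> $ j))"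
  have Ln: "L $ None = adjoin 1 0" "L $ Some j = adjoin (\<mu> $ j) (axis j 1)" for j by (simp_all add: L_def)
  have Bn: "B $ None = adjoin 1 0" "B $ Some j = adjoin 0 (\<Sigma> $ j)" for j by (simp_all add: B_def)
  have "(\<chi> i. axis i 1) = (mat 1 :: real^'d^'d)" by (simp add: vec_eq_iff axis_def mat_def)
  then have dL: "det L = 1" by (subst det_option) (simp_all add: Ln)
  have dB: "det B = det \<Sigma>" by (subst det_option) (simp_all add: Bn)
  have Lx: "L *v x = adjoin (x $ None) (coords x + x $ None *\<^sub>R \<mu>)" for x
    by (simp add: vec_eq_iff forall_option matrix_vector_mul_component inner_option Ln inner_axis' algebra_simps)
  have Bx: "B *v x = adjoin (x $ None) (\<Sigma> *v coords x)" for x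
    by (simp add: vec_eq_iff forall_option matrix_vector_mul_component inner_option Bn)
  have tL: "transpose L *v x = adjoin (\<mu> \<bullet> coords x + x $ None) (coords x)" for x
  proof (rule vector_eq_ldot[THEN iffD1], rule allI)
    fix z
    have "z \<bullet> (transpose L *v x) = (L *v z) \<bullet> x"
      using transpose_adjoint[of z "transpose L" x] by (simp only: transpose_transpose)
    then show "z \<bullet> (transpose L *v x) = z \<bullet> adjoin (\<mu> \<bullet> coords x + x $ None) (coords x)"
      unfolding Lx by (simp add: inner_option inner_add_left algebra_simps)
  qed
  have "moment_mat \<mu> \<Sigma> *v x = (L ** B ** transpose L) *v x" for x
    by (simp only: matrix_vector_mul_assoc[symmetric] tL Bx Lx moment_mat_mult adjoin_nth coords_adjoin)
  then have "moment_mat \<mu> \<Sigma> = L ** B ** transpose L" by (simp add: matrix_eq)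
  then show ?thesis by (simp add: det_mul det_transpose dL dB)
qed

abbreviation augmented_law :: "(real^'d) measure \<Rightarrow> (real^'d option) measure" where
  "augmented_law P \<equiv> distr P borel (adjoin 1)"

lemma continuous_adjoin: "continuous_on S (adjoin a)"
proof -
  have "continuous_on S (\<lambda>v. \<chi> i. case i of None \<Rightarrow> a | Some j \<Rightarrow> v $ j)"
  proof (rule continuous_on_vec_lambda)
    fix i :: "'a option"
    show "continuous_on S (\<lambda>v :: real^'a. case i of None \<Rightarrow> a | Some j \<Rightarrow> v $ j)"
      by (cases i) (auto intro!: continuous_intros)
  qed
  then show ?thesis by (simp add: adjoin_def[abs_def])
qed

lemma adjoin_borel: "adjoin a \<in> borel_measurable borel"
  by (rule borel_measurable_continuous_onI[OF continuous_adjoin])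

lemma augmented_law_laws: "P \<in> laws \<Longrightarrow> augmented_law P \<in> laws"
  by (rule laws_distr[OF _ adjoin_borel])

lemma integral_augmented_law:
  fixes f :: "real^'d::finite option \<Rightarrow> real"
  assumes "P \<in> laws" "f \<in> borel_measurable borel"
  shows "(\<integral>z. f z \<partial>augmented_law P) = (\<integral>y. f (adjoin 1 y) \<partial>P)"

  by (rule integral_distr) (use assms adjoin_borel in \<open>simp_all add: laws_measurable[OF assms(1)]\<close>)

text \<open>Both parameter sums agree, \<open>\<nu> - 1 + (d + 1) = \<nu> + d\<close>, so the factor in \<open>rho\<close> is the same on both sides.\<close>

lemma loc_scatter_obj_eq:
  fixes \<Sigma> :: "real^'d^'d"
  assumes P: "P \<in> laws" and nu: "\<nu> > 1" and S: "\<Sigma> \<in> pd_mats"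
  shows "loc_scatter_obj \<nu> P (\<mu>, \<Sigma>) = scatter_obj (\<nu> - 1) (augmented_law P) (moment_mat \<mu> \<Sigma>)"
proof -
  let ?D = "CARD('d option)"
  have nn: "0 \<le> (y - \<mu>) \<bullet> (matrix_inv \<Sigma> *v (y - \<mu>))" for y
    by (rule pd_mats_nonneg[OF matrix_inv_pd_mats[OF S]])
  have eq: "rho (\<nu> - 1) ?D (adjoin 1 y \<bullet> (matrix_inv (moment_mat \<mu> \<Sigma>) *v adjoin 1 y)) - rho (\<nu> - 1) ?D (adjoin 1 y \<bullet> adjoin 1 y)
    = rho \<nu> CARD('d) ((y - \<mu>) \<bullet> (matrix_inv \<Sigma> *v (y - \<mu>))) - rho \<nu> CARD('d) (y \<bullet> y)" for y
  proof -
    have "adjoin 1 y \<bullet> adjoin 1 y = 1 + y \<bullet> y" by (simp add: inner_option)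
    then show ?thesis
      unfolding moment_mat_inverse_form[OF S]
      using nu nn[of y] by (simp add: rho_diff add_nonneg_nonneg)
  qed
  have "(\<integral>z. (rho (\<nu> - 1) ?D (z \<bullet> (matrix_inv (moment_mat \<mu> \<Sigma>) *v z)) - rho (\<nu> - 1) ?D (z \<bullet> z)) \<partial>augmented_law P)
    = (\<integral>y. (rho \<nu> CARD('d) ((y - \<mu>) \<bullet> (matrix_inv \<Sigma> *v (y - \<mu>))) - rho \<nu> CARD('d) (y \<bullet> y)) \<partial>P)"
  proof -
    have "(\<lambda>z. rho (\<nu> - 1) ?D (z \<bullet> (matrix_inv (moment_mat \<mu> \<Sigma>) *v z)) - rho (\<nu> - 1) ?D (z \<bullet> z)) \<in> borel_measurable borel"
      by (intro borel_measurable_diff rho_borel borel_measurable_inner matrix_vector_borel measurable_ident_sets) simp_all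
    from integral_augmented_law[OF P this] show ?thesis by (simp only: eq)
  qed
  then show ?thesis
    by (simp add: loc_scatter_obj_def scatter_obj_def det_moment_mat)
qed

text \<open>The corner entry is the equation tested with the unit vector of the constant coordinate, where the integrand reduces
  to the weight itself; its mean is known from the trace.\<close>

lemma augmented_scatter_corner:
  fixes A :: "real^'d::finite option^'d option"
  assumes P: "P \<in> laws" and nu: "\<nu> > 0" and sol: "solves_scatter \<nu> (augmented_law P) A"
  shows "A $ None $ None = 1"
proof -
  have A: "A \<in> pd_mats" by (rule solves_scatter_pd[OF sol])
  have cw: "continuous_on UNIV (\<lambda>z. \<nu> + z \<bullet> (matrix_inv A *v z))"
    by (intro continuous_intros linear_continuous_on matrix_vector_mul_bounded_linear)
  have ne: "\<nu> + z \<bullet> (matrix_inv A *v z) \<noteq> 0" for z using weight_pos(1)[OF A nu, of z] by simp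
  have "A $ None $ None = axis None 1 \<bullet> (A *v axis None 1)"
    by (simp add: inner_axis' matrix_vector_mul_component inner_axis)
  also have "\<dots> = (\<nu> + real CARD('d option)) * (\<integral>z. (z $ None)\<^sup>2 / (\<nu> + z \<bullet> (matrix_inv A *v z)) \<partial>augmented_law P)"
    using solves_scatter_eq[OF sol, of "axis None 1"] by (simp only: inner_axis') simp
  also have "(\<integral>z. (z $ None)\<^sup>2 / (\<nu> + z \<bullet> (matrix_inv A *v z)) \<partial>augmented_law P)
     = (\<integral>y. 1 / (\<nu> + adjoin 1 y \<bullet> (matrix_inv A *v adjoin 1 y)) \<partial>P)"
    by (subst integral_augmented_law[OF P])
      (auto intro!: borel_measurable_continuous_onI continuous_on_divide[OF _ cw] continuous_intros simp: ne)
  also have "\<dots> = (\<integral>z. 1 / (\<nu> + z \<bullet> (matrix_inv A *v z)) \<partial>augmented_law P)"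
    by (subst integral_augmented_law[OF P])
      (auto intro!: borel_measurable_continuous_onI continuous_on_divide[OF _ cw] continuous_intros simp: ne)
  finally show ?thesis
    using solves_scatter_mean_weight[OF augmented_law_laws[OF P] nu sol] by simp
qed

lemma augmented_scatter_moment_mat:
  fixes A :: "real^'d::finite option^'d option"
  assumes P: "P \<in> laws" and nu: "\<nu> > 0" and sol: "solves_scatter \<nu> (augmented_law P) A"
    and eq: "loc_scatter_of A = (\<mu>, \<Sigma>)"
  shows "A = moment_mat \<mu> \<Sigma>" "\<Sigma> \<in> pd_mats"
  by (rule moment_mat_loc_scatter_of[OF solves_scatter_pd[OF sol] augmented_scatter_corner[OF P nu sol] eq])+

text \<open>All competitors correspond to matrices of the form \<open>moment_mat\<close>, and the minimizer over the larger set of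
  positive definite matrices is itself of this form.\<close>

proposition mu_Sigma_fun_eq:
  fixes A :: "real^'d::finite option^'d option"
  assumes P: "P \<in> laws" and nu: "\<nu> > 1" and sol: "solves_scatter (\<nu> - 1) (augmented_law P) A"
  shows "mu_Sigma_fun \<nu> P = loc_scatter_of A"
  unfolding mu_Sigma_fun_def
proof (rule the_equality)
  have nu': "\<nu> - 1 > 0" using nu by simp
  obtain \<mu> \<Sigma> where eq: "loc_scatter_of A = (\<mu>, \<Sigma>)" by fastforce
  note AE = augmented_scatter_moment_mat[OF P nu' sol eq]
  note min = solves_scatter_unique_minimizer[OF augmented_law_laws[OF P] nu' sol moment_mat_pd_mats]
  have objA: "loc_scatter_obj \<nu> P (\<mu>, \<Sigma>) = scatter_obj (\<nu> - 1) (augmented_law P) A"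
    unfolding loc_scatter_obj_eq[OF P nu AE(2)] AE(1)[symmetric] ..
  have le: "loc_scatter_obj \<nu> P (\<mu>, \<Sigma>) \<le> loc_scatter_obj \<nu> P (m, S)" if "S \<in> pd_mats" for m S
    unfolding objA loc_scatter_obj_eq[OF P nu that] by (rule min(1)[OF that])
  then show "is_arg_min (loc_scatter_obj \<nu> P) (\<lambda>p. p \<in> UNIV \<times> pd_mats) (loc_scatter_of A)"
    unfolding is_arg_min_def eq using AE(2) by (auto simp: not_less)
  fix p assume p: "is_arg_min (loc_scatter_obj \<nu> P) (\<lambda>p. p \<in> UNIV \<times> pd_mats) p"
  obtain m S where mS: "p = (m, S)" by fastforce
  have S: "S \<in> pd_mats" using p by (simp add: is_arg_min_def mS)
  have "\<not> loc_scatter_obj \<nu> P (\<mu>, \<Sigma>) < loc_scatter_obj \<nu> P (m, S)"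
    using p AE(2) by (auto simp: is_arg_min_def mS)
  then have "moment_mat m S = A"
    unfolding objA loc_scatter_obj_eq[OF P nu S] by (intro min(2)[OF S]) simp
  then show "p = loc_scatter_of A" using mS by auto
qed

text \<open>In homogeneous coordinates an affine subspace is the section at height \<open>1\<close> of a linear subspace of dimension one
  higher.\<close>

lemma aff_dim_augmented:
  fixes L :: "(real^'d) set"
  assumes L: "affine L" "a \<in> L"
  shows "int (dim (span (adjoin 1 ` L))) = aff_dim L + 1"
proof -
  let ?L0 = "(\<lambda>x. x - a) ` L"
  have lin: "linear (adjoin 0 :: real^'d \<Rightarrow> _)" by (rule linearI) (simp_all add: vec_eq_iff forall_option)
  have inj: "inj (adjoin 0 :: real^'d \<Rightarrow> _)" by (rule injI) (metis coords_adjoin)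
  have eq: "adjoin 1 x = adjoin 1 a + adjoin 0 (x - a)" for x by (simp add: vec_eq_iff forall_option)
  have span: "span (adjoin 1 ` L) = span (insert (adjoin 1 a) (adjoin 0 ` ?L0))"
  proof (rule span_eq[THEN iffD2], intro conjI subsetI)
    fix z assume "z \<in> adjoin 1 ` L"
    then obtain x where "x \<in> L" "z = adjoin 1 x" by auto
    then have "x \<in> L" "z = adjoin 1 a + adjoin 0 (x - a)" by (simp_all only: eq[of x])
    then show "z \<in> span (insert (adjoin 1 a) (adjoin 0 ` ?L0))"
      by (simp add: span_add span_base)
  next
    fix z assume "z \<in> insert (adjoin 1 a) (adjoin 0 ` ?L0)"
    then consider "z = adjoin 1 a" | x where "x \<in> L" "z = adjoin 0 (x - a)" by auto
    moreover have "adjoin 0 (x - a) = adjoin 1 x - adjoin 1 a" for x by (simp add: vec_eq_iff forall_option)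
    ultimately consider "z = adjoin 1 a" | x where "x \<in> L" "z = adjoin 1 x - adjoin 1 a" by metis
    then show "z \<in> span (adjoin 1 ` L)"
      by cases (simp_all add: span_diff span_base L(2))
  qed
  have "adjoin 1 a \<notin> span (adjoin 0 ` ?L0)"
  proof
    assume "adjoin 1 a \<in> span (adjoin 0 ` ?L0)"
    then have "adjoin 1 a \<in> adjoin 0 ` span ?L0" by (simp add: linear_span_image[OF lin])
    then have "\<exists>v. adjoin 1 a = adjoin 0 v" by auto
    then show False by (metis adjoin_nth(1) zero_neq_one)
  qed
  then have "dim (span (adjoin 1 ` L)) = dim (adjoin 0 ` ?L0) + 1"
    unfolding span dim_span by (simp add: dim_insert)
  also have "dim (adjoin 0 ` ?L0) = dim ?L0" by (rule dim_image_eq[OF lin]) (use inj in \<open>auto intro: inj_on_subset\<close>)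
  finally show ?thesis using aff_dim_dim_affine_diffs[OF L] by simp
qed

text \<open>Affine subspaces correspond to linear subspaces of one higher dimension, and
  \<open>(d + 1) - (q + 1) = d - q\<close> while \<open>\<nu> - 1 + (d + 1) = \<nu> + d\<close>.\<close>

lemma V_laws_augmented:
  fixes P :: "(real^'d) measure"
  assumes P: "P \<in> laws" and nu: "\<nu> > 1"
  shows "P \<in> V_laws (\<nu> + real CARD('d)) \<longleftrightarrow> augmented_law P \<in> U_laws (\<nu> - 1 + real CARD('d option))"
proof
  interpret P: prob_space P using P by (rule laws_prob_space)
  have mP: "measure (augmented_law P) H = measure P {y. adjoin 1 y \<in> H}" if "subspace H" for H :: "(real^'d option) set"
  proof -
    have "H \<in> sets borel" using closed_subspace[OF that] by (rule borel_closed)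
    then show ?thesis
      using adjoin_borel by (subst measure_distr) (auto simp: laws_measurable[OF P] laws_space[OF P] vimage_def)
  qed
  assume V: "P \<in> V_laws (\<nu> + real CARD('d))"
  have "measure (augmented_law P) H < 1 - (real CARD('d option) - real (dim H)) / (\<nu> - 1 + real CARD('d option))"
    if H: "subspace H" "dim H < CARD('d option)" for H :: "(real^'d option) set"
  proof -
    define L where "L = {y. adjoin 1 y \<in> H}"
    have affL: "affine L"
      unfolding affine_def
    proof (intro ballI allI impI)
      fix x y u v assume xy: "x \<in> L" "y \<in> L" and "u + v = (1::real)"
      then have "adjoin 1 (u *\<^sub>R x + v *\<^sub>R y) = u *\<^sub>R adjoin 1 x + v *\<^sub>R adjoin 1 y"
        by (simp add: vec_eq_iff forall_option)
      then show "u *\<^sub>R x + v *\<^sub>R y \<in> L" using xy H(1) by (auto simp: L_def intro!: subspace_add subspace_scale)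
    qed
    show ?thesis
    proof (cases "L = {}")
      \<comment> \<open>A linear subspace that misses height \<open>1\<close> is a null set of the augmented law.\<close>
      case True
      then show ?thesis
        unfolding mP[OF H(1)] L_def[symmetric] using nu by (simp add: divide_less_eq)
    next
      case False
      then obtain a where a: "a \<in> L" by blast
      have "span (adjoin 1 ` L) \<subseteq> H" using H(1) by (intro span_minimal) (auto simp: L_def)
      then have "dim (span (adjoin 1 ` L)) \<le> dim H" by (rule dim_subset)
      then have le: "aff_dim L + 1 \<le> int (dim H)" using aff_dim_augmented[OF affL a] by linarith
      have "0 \<le> aff_dim L" using a aff_dim_geq[of L] aff_dim_empty[of L] by auto
      then have "measure P L < 1 - (real CARD('d) - real_of_int (aff_dim L)) / (\<nu> + real CARD('d))"
      proof -
        have "aff_dim L < int CARD('d)" using le H(2) by simp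
        with affL \<open>0 \<le> aff_dim L\<close> show ?thesis using V unfolding V_laws_def by blast
      qed
      also have "\<dots> \<le> 1 - (real CARD('d option) - real (dim H)) / (\<nu> - 1 + real CARD('d option))"
      proof -
        have "real CARD('d option) - real (dim H) \<le> real CARD('d) - real_of_int (aff_dim L)" using le by simp
        then show ?thesis using nu by (simp add: divide_right_mono)
      qed
      finally show ?thesis unfolding mP[OF H(1)] L_def[symmetric] .
    qed
  qed
  then show "augmented_law P \<in> U_laws (\<nu> - 1 + real CARD('d option))"
    using augmented_law_laws[OF P] by (simp add: U_laws_def)
next
  interpret P: prob_space P using P by (rule laws_prob_space)
  have mP: "measure (augmented_law P) H = measure P {y. adjoin 1 y \<in> H}" "{y. adjoin 1 y \<in> H} \<in> sets P"
    if "subspace H" for H :: "(real^'d option) set"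
  proof -
    have H: "H \<in> sets borel" using closed_subspace[OF that] by (rule borel_closed)
    then show "measure (augmented_law P) H = measure P {y. adjoin 1 y \<in> H}"
      using adjoin_borel by (subst measure_distr) (auto simp: laws_measurable[OF P] laws_space[OF P] vimage_def)
    show "{y. adjoin 1 y \<in> H} \<in> sets P"
      using measurable_sets[OF adjoin_borel[of 1] H] by (simp add: laws_sets[OF P] vimage_def)
  qed
  assume U: "augmented_law P \<in> U_laws (\<nu> - 1 + real CARD('d option))"
  have "measure P L < 1 - (real CARD('d) - real_of_int (aff_dim L)) / (\<nu> + real CARD('d))"
    if L: "affine L" "0 \<le> aff_dim L" "aff_dim L < int CARD('d)" for L
  proof -
    obtain a where a: "a \<in> L" using L(2) by fastforce
    define H where "H = span (adjoin 1 ` L)"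
    have H: "subspace H" unfolding H_def by (rule subspace_span)
    have dH: "int (dim H) = aff_dim L + 1" unfolding H_def by (rule aff_dim_augmented[OF L(1) a])
    have "measure P L \<le> measure P {y. adjoin 1 y \<in> H}"
      by (rule P.finite_measure_mono[OF _ mP(2)[OF H]]) (auto simp: H_def intro: span_base)
    also have "\<dots> = measure (augmented_law P) H" using mP(1)[OF H] by simp
    also have "\<dots> < 1 - (real CARD('d option) - real (dim H)) / (\<nu> - 1 + real CARD('d option))"
    proof -
      have "dim H < CARD('d option)" using dH L(3) by simp
      with H show ?thesis using U unfolding U_laws_def by blast
    qed
    also have "\<dots> = 1 - (real CARD('d) - real_of_int (aff_dim L)) / (\<nu> + real CARD('d))"
    proof -
      have "real (dim H) = real_of_int (aff_dim L) + 1" using dH by linarith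
      then show ?thesis by simp
    qed
    finally show ?thesis .
  qed
  then show "P \<in> V_laws (\<nu> + real CARD('d))" using P by (simp add: V_laws_def)
qed


section \<open>Local expansion of the location-scatter functional\<close>

text \<open>The corner equation says that the weight \<open>1 / (\<nu> + s)\<close> has mean \<open>1 / (\<nu> + d)\<close>. If \<open>\<mu>\<close> were far away, the
  weight would be small on the ball of radius \<open>M\<close>, and on the tail it is at most \<open>1 / \<nu>\<close>; since
  \<open>1 / \<nu> < 1\<close>, the tail alone cannot make up for this.\<close>

lemma location_bound:
  fixes P :: "(real^'d) measure"
  assumes P: "P \<in> laws" and nu: "\<nu> > 1" and sol: "solves_scatter (\<nu> - 1) (augmented_law P) A"
    and eq: "loc_scatter_of A = (\<mu>, \<Sigma>)" and hi: "\<forall>x. x \<bullet> (\<Sigma> *v x) \<le> \<kappa> * (x \<bullet> x)" and \<kappa>: "\<kappa> > 0"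
    and tail: "measure P {y. norm y > M} \<le> 1 / (\<nu> + real CARD('d))"
  shows "norm \<mu> \<le> max M 0 + sqrt (\<kappa> * ((\<nu> + real CARD('d)) * \<nu> / (\<nu> - 1)))"
proof (rule ccontr)
  define a where "a = \<nu> + real CARD('d)"
  define r where "r = norm \<mu> - max M 0"
  define t where "t = sqrt (\<kappa> * (a * \<nu> / (\<nu> - 1)))"
  have a: "a > 0" using nu by (simp add: a_def)
  have t: "t \<ge> 0" "t\<^sup>2 = \<kappa> * (a * \<nu> / (\<nu> - 1))" using nu a \<kappa> by (simp_all add: t_def)
  assume "\<not> norm \<mu> \<le> max M 0 + sqrt (\<kappa> * ((\<nu> + real CARD('d)) * \<nu> / (\<nu> - 1)))"
  then have r: "t < r" by (simp add: r_def t_def a_def)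
  interpret P: prob_space P using P by (rule laws_prob_space)
  have nu': "\<nu> - 1 > 0" using nu by simp
  have A: "A \<in> pd_mats" by (rule solves_scatter_pd[OF sol])
  note AE = augmented_scatter_moment_mat[OF P nu' sol eq]
  define w where "w z = 1 / (\<nu> - 1 + z \<bullet> (matrix_inv A *v z))" for z
  define B where "B = {y :: real^'d. norm y > M}"
  have B: "B \<in> sets P"
    unfolding B_def laws_sets[OF P] by (intro borel_open open_Collect_less continuous_intros)
  have ne: "\<nu> - 1 + z \<bullet> (matrix_inv A *v z) \<noteq> 0" for z using weight_pos(1)[OF A nu', of z] by simp
  have wc: "continuous_on UNIV w"
    unfolding w_def
    by (intro continuous_on_divide continuous_intros linear_continuous_on matrix_vector_mul_bounded_linear) (simp add: ne)
  have w_bd: "norm (w z) \<le> 1 / (\<nu> - 1)" for z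
    using weight_pos[OF A nu', of z] nu' unfolding w_def by (simp add: frac_le)
  have int: "integrable P (\<lambda>y. w (adjoin 1 y))"
    by (rule laws_integrable_bounded[OF P borel_measurable_continuous_onI w_bd])
      (rule continuous_on_compose2[OF wc continuous_adjoin], simp)
  have one: "a * (\<integral>y. w (adjoin 1 y) \<partial>P) = 1"
    using solves_scatter_mean_weight[OF augmented_law_laws[OF P] nu' sol]
    unfolding w_def[symmetric] integral_augmented_law[OF P borel_measurable_continuous_onI[OF wc]]
    by (simp add: a_def algebra_simps)
  define b where "b = 1 / (\<nu> + r\<^sup>2 / \<kappa>)"
  have pt: "w (adjoin 1 y) \<le> indicator B y / \<nu> + b" for y
  proof -
    have s: "w (adjoin 1 y) = 1 / (\<nu> + (y - \<mu>) \<bullet> (matrix_inv \<Sigma> *v (y - \<mu>)))"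
      unfolding w_def AE(1) moment_mat_inverse_form[OF AE(2)] by simp
    have b: "b \<ge> 0" using nu \<kappa> by (simp add: b_def)
    show ?thesis
    proof (cases "y \<in> B")
      case True
      have "w (adjoin 1 y) \<le> 1 / \<nu>"
        unfolding s using nu pd_mats_nonneg[OF matrix_inv_pd_mats[OF AE(2)], of "y - \<mu>"] by (intro frac_le) auto
      then show ?thesis using True b by simp
    next
      case False
      then have "norm y \<le> max M 0" by (simp add: B_def)
      then have "r \<le> norm (y - \<mu>)" using norm_triangle_ineq2[of \<mu> y] by (simp add: r_def norm_minus_commute)
      then have "r\<^sup>2 \<le> (norm (y - \<mu>))\<^sup>2" using r t by (intro power_mono) auto
      also have "\<dots> \<le> \<kappa> * ((y - \<mu>) \<bullet> (matrix_inv \<Sigma> *v (y - \<mu>)))"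
        unfolding power2_norm_eq_inner by (rule inverse_form_lower[OF AE(2) hi \<kappa>])
      finally have "r\<^sup>2 / \<kappa> \<le> (y - \<mu>) \<bullet> (matrix_inv \<Sigma> *v (y - \<mu>))" using \<kappa> by (simp add: divide_le_eq mult.commute)
      then have "w (adjoin 1 y) \<le> b"
        unfolding s b_def using nu \<kappa> by (intro frac_le) (auto simp: add_pos_nonneg)
      then show ?thesis using False by simp
    qed
  qed
  have "(\<integral>y. w (adjoin 1 y) \<partial>P) \<le> (\<integral>y. indicator B y / \<nu> + b \<partial>P)"
    using B by (intro integral_mono int pt) (auto simp: integrable_indicator_iff P.emeasure_finite less_top[symmetric])
  also have "\<dots> = measure P B / \<nu> + b"
    using B P.prob_space by (subst Bochner_Integration.integral_add) (auto simp: P.emeasure_finite less_top[symmetric] laws_space[OF P])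
  also have "\<dots> \<le> (1 / a) / \<nu> + b" using tail nu by (intro add_right_mono divide_right_mono) (auto simp: a_def B_def)
  finally have "a * (\<integral>y. w (adjoin 1 y) \<partial>P) \<le> a * ((1 / a) / \<nu> + b)" using a by (intro mult_left_mono) auto
  then have "1 \<le> 1 / \<nu> + a * b" unfolding one using a by (simp add: distrib_left)
  then have le: "(\<nu> - 1) / \<nu> \<le> a * b" using nu by (simp add: diff_divide_distrib)
  have "b < (\<nu> - 1) / (a * \<nu>)"
  proof -
    have "t\<^sup>2 < r\<^sup>2" using r t by (intro power_strict_mono) auto
    then have "a * \<nu> / (\<nu> - 1) < r\<^sup>2 / \<kappa>" using \<kappa> unfolding t(2) by (simp add: less_divide_eq mult.commute)
    then have "a * \<nu> / (\<nu> - 1) < \<nu> + r\<^sup>2 / \<kappa>" using nu by simp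
    then have "b < 1 / (a * \<nu> / (\<nu> - 1))"
      unfolding b_def using nu a by (intro divide_strict_left_mono mult_pos_pos) (auto intro: less_trans[rotated])
    then show ?thesis by simp
  qed
  then have "a * b < a * ((\<nu> - 1) / (a * \<nu>))" using a by (rule mult_strict_left_mono)
  then show False using le a by simp
qed

text \<open>In terms of \<open>v = coords x\<close> and \<open>t = \<mu> \<bullet> v + x\<^sub>0\<close>, where \<open>x\<^sub>0\<close> is the adjoined coordinate, the form is
  \<open>v' \<Sigma> v + t\<^sup>2\<close>, and \<open>x \<mapsto> (v, t)\<close> distorts lengths by an amount controlled by \<open>|\<mu>|\<close>.\<close>

lemma moment_mat_forms:
  assumes hi: "\<forall>x. x \<bullet> (\<Sigma> *v x) \<le> \<kappa> * (x \<bullet> x)" and lo: "\<forall>x. x \<bullet> x \<le> \<kappa> * (x \<bullet> (\<Sigma> *v x))"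
    and \<kappa>: "\<kappa> \<ge> 0" and m: "norm \<mu> \<le> m"
  defines "c \<equiv> (1 + 2 * m\<^sup>2) * \<kappa> + (m + 1)\<^sup>2 + 2"
  shows "x \<bullet> (moment_mat \<mu> \<Sigma> *v x) \<le> c * (x \<bullet> x)" "x \<bullet> x \<le> c * (x \<bullet> (moment_mat \<mu> \<Sigma> *v x))"
proof -
  define v where "v = coords x"
  define b where "b = x $ None"
  define t where "t = \<mu> \<bullet> v + b"
  have m0: "m \<ge> 0" using m norm_ge_zero[of \<mu>] by linarith
  have xx: "x \<bullet> x = b\<^sup>2 + v \<bullet> v" by (simp add: inner_option v_def b_def power2_eq_square)
  have form: "x \<bullet> (moment_mat \<mu> \<Sigma> *v x) = v \<bullet> (\<Sigma> *v v) + t\<^sup>2"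
    by (simp add: moment_mat_quadratic v_def b_def t_def)
  have hv: "v \<bullet> (\<Sigma> *v v) \<le> \<kappa> * (v \<bullet> v)" using hi by (rule spec)
  have lv: "v \<bullet> v \<le> \<kappa> * (v \<bullet> (\<Sigma> *v v))" using lo by (rule spec)
  have vx: "v \<bullet> v \<le> x \<bullet> x" "b\<^sup>2 \<le> x \<bullet> x" by (simp_all add: xx)
  have mv: "(\<mu> \<bullet> v)\<^sup>2 \<le> m\<^sup>2 * (v \<bullet> v)"
  proof -
    have "(\<mu> \<bullet> v)\<^sup>2 \<le> (\<mu> \<bullet> \<mu>) * (v \<bullet> v)" by (rule Cauchy_Schwarz_ineq)
    also have "\<dots> \<le> m\<^sup>2 * (v \<bullet> v)"
      using m unfolding power2_norm_eq_inner[symmetric] by (intro mult_right_mono power_mono) auto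
    finally show ?thesis .
  qed
  have "\<bar>t\<bar> \<le> (m + 1) * norm x"
  proof -
    have "\<bar>\<mu> \<bullet> v\<bar> \<le> norm \<mu> * norm v" by (rule Cauchy_Schwarz_ineq2)
    also have "\<dots> \<le> m * norm x" using m m0 vx(1) by (intro mult_mono) (auto simp: norm_le)
    moreover have "\<bar>b\<bar> \<le> norm x" unfolding b_def by (rule component_le_norm_cart)
    ultimately show ?thesis unfolding t_def by (simp add: algebra_simps)
  qed
  then have "t\<^sup>2 \<le> ((m + 1) * norm x)\<^sup>2" by (metis abs_ge_zero power2_abs power_mono)
  then have t: "t\<^sup>2 \<le> (m + 1)\<^sup>2 * (x \<bullet> x)" by (simp add: power_mult_distrib power2_norm_eq_inner)
  have "\<kappa> * (v \<bullet> v) \<le> \<kappa> * (x \<bullet> x)" using vx \<kappa> by (intro mult_left_mono)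
  moreover have "0 \<le> (2 * m\<^sup>2) * \<kappa> * (x \<bullet> x)" "0 \<le> 2 * (x \<bullet> x)" using \<kappa> by simp_all
  ultimately show "x \<bullet> (moment_mat \<mu> \<Sigma> *v x) \<le> c * (x \<bullet> x)"
    unfolding form c_def distrib_right mult_1 using hv t by linarith
  have "b\<^sup>2 \<le> 2 * t\<^sup>2 + 2 * (\<mu> \<bullet> v)\<^sup>2"
    using zero_le_power2[of "t + \<mu> \<bullet> v"] by (simp add: t_def power2_eq_square algebra_simps)
  then have "x \<bullet> x \<le> (1 + 2 * m\<^sup>2) * (v \<bullet> v) + 2 * t\<^sup>2" using mv unfolding xx by (simp add: algebra_simps)
  also have "\<dots> \<le> (1 + 2 * m\<^sup>2) * (\<kappa> * (v \<bullet> (\<Sigma> *v v))) + 2 * t\<^sup>2" using lv by (intro add_right_mono mult_left_mono) auto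
  also have "\<dots> \<le> c * (v \<bullet> (\<Sigma> *v v)) + c * t\<^sup>2"
  proof (rule add_mono)
    have n: "0 \<le> v \<bullet> (\<Sigma> *v v)" if "v \<noteq> 0"
    proof -
      have "0 < v \<bullet> v" using that by simp
      then have "0 < \<kappa> * (v \<bullet> (\<Sigma> *v v))" using lv by linarith
      then show ?thesis using \<kappa> by (simp add: zero_less_mult_iff)
    qed
    then have "0 \<le> v \<bullet> (\<Sigma> *v v)" by (cases "v = 0") auto
    then have "((1 + 2 * m\<^sup>2) * \<kappa>) * (v \<bullet> (\<Sigma> *v v)) \<le> c * (v \<bullet> (\<Sigma> *v v))" by (intro mult_right_mono) (auto simp: c_def)
    then show "(1 + 2 * m\<^sup>2) * (\<kappa> * (v \<bullet> (\<Sigma> *v v))) \<le> c * (v \<bullet> (\<Sigma> *v v))" by (simp only: mult.assoc)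
    show "2 * t\<^sup>2 \<le> c * t\<^sup>2" using \<kappa> by (intro mult_right_mono) (auto simp: c_def)
  qed
  also have "\<dots> = c * (x \<bullet> (moment_mat \<mu> \<Sigma> *v x))" unfolding form by (simp add: distrib_left)
  finally show "x \<bullet> x \<le> c * (x \<bullet> (moment_mat \<mu> \<Sigma> *v x))" .
qed

lemma norm_coords_le: "norm (coords x) \<le> norm x"
  for x :: "'b::real_normed_vector^'d::finite option"
  unfolding norm_vec_def L2_set_def by (rule real_sqrt_le_mono) (simp add: sum_option)

lemma norm_rank_one: "norm (\<chi> i j. u $ i * v $ j) = norm u * norm (v :: real^'m)"
  for u :: "real^'n"
proof -
  have "norm (\<chi> i j. u $ i * v $ j) = L2_set (\<lambda>i. norm (u $ i *\<^sub>R v)) UNIV"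
    by (simp add: norm_vec_def[where 'a = "real^'m"] scaleR_vec_def)
  also have "\<dots> = norm v * norm u"
    by (simp add: norm_vec_def[of u] L2_set_right_distrib mult.commute)
  finally show ?thesis by simp
qed

text \<open>Derivative of \<open>loc_scatter_of\<close> at a matrix with location \<open>\<mu>\<close>.\<close>

definition loc_scatter_deriv :: "real^'d \<Rightarrow> real^'d option^'d option \<Rightarrow> (real^'d) \<times> (real^'d^'d)" where
  "loc_scatter_deriv \<mu> E = (coords (E $ None), \<chi> i j. E $ Some i $ Some j - \<mu> $ i * E $ None $ Some j - E $ None $ Some i * \<mu> $ j)"

lemma linear_loc_scatter_deriv: "linear (loc_scatter_deriv \<mu>)"
  by (rule linearI) (simp_all add: loc_scatter_deriv_def vec_eq_iff algebra_simps)

lemma norm_loc_scatter_deriv: "norm (loc_scatter_deriv \<mu> E) \<le> (2 + 2 * norm \<mu>) * norm E"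
  for \<mu> :: "real^'d"
proof -
  define e where "e = coords (E $ None)"
  have e: "norm e \<le> norm E"
    unfolding e_def using norm_coords_le[of "E $ None"] Finite_Cartesian_Product.norm_nth_le[of E None] by linarith
  define F where "F = coords (\<chi> i. coords (E $ i))"
  have "norm (\<chi> i. coords (E $ i)) \<le> norm E"
    by (rule norm_le_componentwise_cart) (simp add: norm_coords_le)
  then have F: "norm F \<le> norm E" unfolding F_def using norm_coords_le order_trans by blast
  have "loc_scatter_deriv \<mu> E = (e, F - (\<chi> i j. \<mu> $ i * e $ j) - (\<chi> i j. e $ i * \<mu> $ j))"
    by (simp add: loc_scatter_deriv_def e_def F_def vec_eq_iff)
  then have "norm (loc_scatter_deriv \<mu> E) \<le> norm e + norm (F - (\<chi> i j. \<mu> $ i * e $ j) - (\<chi> i j. e $ i * \<mu> $ j))"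
    by (simp only: norm_Pair_le)
  also have "norm (F - (\<chi> i j. \<mu> $ i * e $ j) - (\<chi> i j. e $ i * \<mu> $ j)) \<le> norm F + norm (\<chi> i j. \<mu> $ i * e $ j) + norm (\<chi> i j. e $ i * \<mu> $ j)"
    using norm_triangle_ineq4[of "F - (\<chi> i j. \<mu> $ i * e $ j)" "\<chi> i j. e $ i * \<mu> $ j"]
      norm_triangle_ineq4[of F "\<chi> i j. \<mu> $ i * e $ j"] by linarith
  also have "\<dots> \<le> norm E + norm \<mu> * norm E + norm \<mu> * norm E"
    unfolding norm_rank_one mult.commute[of "norm e"] using F e by (intro add_mono mult_left_mono) auto
  finally show ?thesis using e by (simp add: algebra_simps)
qed

lemma loc_scatter_deriv_sym:
  assumes "E \<in> sym_mats"
  shows "loc_scatter_deriv \<mu> E \<in> UNIV \<times> sym_mats"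
proof -
  have "E $ i $ j = E $ j $ i" for i j
    using assms unfolding sym_mats_def transpose_def vec_eq_iff by simp
  then show ?thesis
    by (simp add: loc_scatter_deriv_def sym_mats_def transpose_def vec_eq_iff algebra_simps)
qed

text \<open>The map is quadratic; its second order term is \<open>- e e'\<close>, with \<open>e\<close> the location part of the increment.\<close>

lemma loc_scatter_of_expansion:
  assumes "fst (loc_scatter_of A) = \<mu>"
  shows "norm (loc_scatter_of (A + E) - loc_scatter_of A - loc_scatter_deriv \<mu> E) \<le> (norm E)\<^sup>2"
proof -
  define e where "e = coords (E $ None)"
  have e: "norm e \<le> norm E"
    unfolding e_def using norm_coords_le[of "E $ None"] Finite_Cartesian_Product.norm_nth_le[of E None] by linarith
  have mu: "\<mu> = coords (A $ None)" using assms by (simp add: loc_scatter_of_def)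
  have "loc_scatter_of (A + E) - loc_scatter_of A - loc_scatter_deriv \<mu> E = (0, - outer e)"
    by (simp add: loc_scatter_of_def loc_scatter_deriv_def mu e_def vec_eq_iff algebra_simps)
  then have "norm (loc_scatter_of (A + E) - loc_scatter_of A - loc_scatter_deriv \<mu> E) = e \<bullet> e"
    by (simp add: norm_Pair norm_outer)
  also have "\<dots> \<le> (norm E)\<^sup>2" unfolding power2_norm_eq_inner[symmetric] using e by (intro power_mono) auto
  finally show ?thesis .
qed

text \<open>The expansion of scatter in dimension \<open>d + 1\<close> is composed with \<open>loc_scatter_of\<close>.\<close>

proposition location_scatter_local_expansion:
  fixes \<nu> \<delta> M \<kappa> m :: real
  assumes nu: "\<nu> > 1" and \<delta>: "\<delta> > 0" and \<kappa>: "\<kappa> \<ge> 0" and m: "m \<ge> 0"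
  shows "\<exists>\<epsilon>>0. \<exists>K\<ge>0. \<forall>(P :: (real^'d) measure) A. P \<in> laws \<and> solves_scatter (\<nu> - 1) (augmented_law P) A \<and>
     norm (fst (loc_scatter_of A)) \<le> m \<and>
     (\<forall>x. x \<bullet> (snd (loc_scatter_of A) *v x) \<le> \<kappa> * (x \<bullet> x) \<and> x \<bullet> x \<le> \<kappa> * (x \<bullet> (snd (loc_scatter_of A) *v x))) \<and>
     measure P {y. norm y > M} \<le> (1 - \<delta>) / (\<nu> + real CARD('d)) \<longrightarrow>
     (\<exists>(k :: real^'d \<Rightarrow> ((real^'d option^'d option) \<times> (real^'d option^'d option^'d option^'d option)) \<times> (real^'d option^'d option)) l.
        local_expansion (UNIV \<times> sym_mats) (V_laws (\<nu> + real CARD('d))) (mu_Sigma_fun \<nu>) \<epsilon> K P k l)"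
proof -
  have nu': "\<nu> - 1 > 0" using nu by simp
  define c where "c = (1 + 2 * m\<^sup>2) * \<kappa> + (m + 1)\<^sup>2 + 2"
  have c: "c \<ge> 0" using \<kappa> by (simp add: c_def)
  \<comment> \<open>The norm of \<open>(y, 1)\<close> in terms of that of \<open>y\<close>.\<close>
  define M' where "M' = sqrt (1 + (max M 0)\<^sup>2)"
  obtain \<epsilon> K where \<epsilon>: "\<epsilon> > 0" and K: "K \<ge> 0" and exp: "\<forall>(Q :: (real^'d option) measure) A. Q \<in> laws \<and> solves_scatter (\<nu> - 1) Q A \<and>
     (\<forall>x. x \<bullet> (A *v x) \<le> c * (x \<bullet> x) \<and> x \<bullet> x \<le> c * (x \<bullet> (A *v x))) \<and>
     measure Q {y. norm y > M'} \<le> (1 - \<delta>) / (\<nu> - 1 + real CARD('d option)) \<longrightarrow>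
     (\<exists>(k :: real^'d option \<Rightarrow> (real^'d option^'d option) \<times> (real^'d option^'d option^'d option^'d option)) l.
        local_expansion sym_mats (U_laws (\<nu> - 1 + real CARD('d option))) (A_fun (\<nu> - 1)) \<epsilon> K Q k l)"
    using scatter_local_expansion[OF nu' \<delta> c, of M', where 'd = "'d option"] by blast
  define C where "C = 2 + 2 * m"
  have C: "C \<ge> 0" using m by (simp add: C_def)
  define K2 where "K2 = 2 * K + C * K + C * (1 + K * \<epsilon>)\<^sup>2"
  have K2: "K2 \<ge> 0" using K C by (simp add: K2_def)
  show ?thesis
  proof (rule exI[of _ \<epsilon>], rule conjI[OF \<epsilon>], rule exI[of _ K2], rule conjI[OF K2], rule allI, rule allI, rule impI)
    fix P :: "(real^'d) measure" and A :: "real^'d option^'d option"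
    assume H: "P \<in> laws \<and> solves_scatter (\<nu> - 1) (augmented_law P) A \<and>
     norm (fst (loc_scatter_of A)) \<le> m \<and>
     (\<forall>x. x \<bullet> (snd (loc_scatter_of A) *v x) \<le> \<kappa> * (x \<bullet> x) \<and> x \<bullet> x \<le> \<kappa> * (x \<bullet> (snd (loc_scatter_of A) *v x))) \<and>
     measure P {y. norm y > M} \<le> (1 - \<delta>) / (\<nu> + real CARD('d))"
    define \<mu> \<Sigma> where "\<mu> = fst (loc_scatter_of A)" and "\<Sigma> = snd (loc_scatter_of A)"
    have eq: "loc_scatter_of A = (\<mu>, \<Sigma>)" by (simp add: \<mu>_def \<Sigma>_def)
    have P: "P \<in> laws" and sol: "solves_scatter (\<nu> - 1) (augmented_law P) A" and mu: "norm \<mu> \<le> m"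
      and hi: "\<forall>x. x \<bullet> (\<Sigma> *v x) \<le> \<kappa> * (x \<bullet> x)" and lo: "\<forall>x. x \<bullet> x \<le> \<kappa> * (x \<bullet> (\<Sigma> *v x))"
      and tail: "measure P {y. norm y > M} \<le> (1 - \<delta>) / (\<nu> + real CARD('d))"
      using H unfolding \<mu>_def \<Sigma>_def by blast+
    interpret P: prob_space P using P by (rule laws_prob_space)
    have AE: "A = moment_mat \<mu> \<Sigma>" by (rule augmented_scatter_moment_mat(1)[OF P nu' sol eq])
    have forms: "\<forall>x. x \<bullet> (A *v x) \<le> c * (x \<bullet> x) \<and> x \<bullet> x \<le> c * (x \<bullet> (A *v x))"
      unfolding AE c_def using moment_mat_forms[OF hi lo \<kappa> mu] by blast
    have tail': "measure (augmented_law P) {z. norm z > M'} \<le> (1 - \<delta>) / (\<nu> - 1 + real CARD('d option))"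
    proof -
      have "measure (augmented_law P) {z. norm z > M'} = measure P (adjoin 1 -` {z. norm z > M'} \<inter> space P)"
        by (intro measure_distr borel_open open_Collect_less continuous_intros)
          (simp add: laws_measurable[OF P] adjoin_borel)
      also have "\<dots> \<le> measure P {y. norm y > M}"
      proof (rule P.finite_measure_mono)
        show "{y. norm y > M} \<in> sets P"
          unfolding laws_sets[OF P] by (intro borel_open open_Collect_less continuous_intros)
        show "adjoin 1 -` {z. norm z > M'} \<inter> space P \<subseteq> {y. norm y > M}"
        proof
          fix y :: "real^'d" assume "y \<in> adjoin 1 -` {z. norm z > M'} \<inter> space P"
          then have "M' < norm (adjoin 1 y)" by simp
          moreover have "norm (adjoin 1 y) = sqrt (1 + (norm y)\<^sup>2)"
            by (simp add: norm_eq_sqrt_inner inner_option)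
          ultimately have "(max M 0)\<^sup>2 < (norm y)\<^sup>2" by (simp add: M'_def)
          then have "max M 0 < norm y" by (rule power_less_imp_less_base) simp
          then show "y \<in> {y. norm y > M}" by simp
        qed
      qed
      finally show ?thesis using tail by simp
    qed
    obtain k :: "real^'d option \<Rightarrow> (real^'d option^'d option) \<times> (real^'d option^'d option^'d option^'d option)" and l
      where L: "local_expansion sym_mats (U_laws (\<nu> - 1 + real CARD('d option))) (A_fun (\<nu> - 1)) \<epsilon> K (augmented_law P) k l"
      using exp augmented_law_laws[OF P] sol forms tail' by blast
    have AP: "A_fun (\<nu> - 1) (augmented_law P) = A" by (rule solves_scatter_imp_A_fun[OF augmented_law_laws[OF P] nu' sol])
    have "local_expansion (UNIV \<times> sym_mats) (V_laws (\<nu> + real CARD('d))) (mu_Sigma_fun \<nu>) \<epsilon> K2 P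
       (\<lambda>y. (k (adjoin 1 y), l (adjoin 1 y))) (\<lambda>y. loc_scatter_deriv \<mu> (l (adjoin 1 y)))"
      unfolding K2_def
    proof (rule local_expansion_delta_method[where \<phi> = loc_scatter_of, OF L P continuous_adjoin less_imp_le[OF \<epsilon>] K C linear_loc_scatter_deriv _ loc_scatter_deriv_sym])
      show "norm (loc_scatter_deriv \<mu> x) \<le> C * norm x" for x
        using norm_loc_scatter_deriv[of \<mu> x] mult_right_mono[of "2 + 2 * norm \<mu>" C "norm x"] mu by (simp add: C_def)
      show "norm (loc_scatter_of (A_fun (\<nu> - 1) (augmented_law P) + E) - loc_scatter_of (A_fun (\<nu> - 1) (augmented_law P)) - loc_scatter_deriv \<mu> E) \<le> C * (norm E)\<^sup>2" for E
        using loc_scatter_of_expansion[of A \<mu> E] mult_right_mono[of 1 C "(norm E)\<^sup>2"] m unfolding AP by (simp add: \<mu>_def C_def)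
      show "mu_Sigma_fun \<nu> P = loc_scatter_of (A_fun (\<nu> - 1) (augmented_law P))"
        unfolding AP by (rule mu_Sigma_fun_eq[OF P nu sol])
      fix R :: "(real^'d) measure"
      assume R: "R \<in> laws" and U: "augmented_law R \<in> U_laws (\<nu> - 1 + real CARD('d option))"
      obtain B :: "real^'d option^'d option" where B: "solves_scatter (\<nu> - 1) (augmented_law R) B"
        using U_laws_imp_solves_scatter[OF U nu'] by blast
      show "R \<in> V_laws (\<nu> + real CARD('d)) \<and> mu_Sigma_fun \<nu> R = loc_scatter_of (A_fun (\<nu> - 1) (augmented_law R))"
        using V_laws_augmented[OF R nu] U mu_Sigma_fun_eq[OF R nu B]
          solves_scatter_imp_A_fun[OF augmented_law_laws[OF R] nu' B] by simp
    qed
    then show "\<exists>(k :: real^'d \<Rightarrow> ((real^'d option^'d option) \<times> (real^'d option^'d option^'d option^'d option)) \<times> (real^'d option^'d option)) l.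
        local_expansion (UNIV \<times> sym_mats) (V_laws (\<nu> + real CARD('d))) (mu_Sigma_fun \<nu>) \<epsilon> K2 P k l" by blast
  qed
qed


section \<open>Uniformity over the classes\<close>

text \<open>The class \<open>\<W>\<close> is described by operator norms; the expansions use the equivalent bounds of the quadratic forms.\<close>

lemma W_set_forms:
  fixes A :: "real^'d^'d"
  assumes A: "A \<in> W_set \<delta>" and \<delta>: "\<delta> > 0"
  shows "\<forall>x. x \<bullet> (A *v x) \<le> (1 / \<delta>) * (x \<bullet> x)" "\<forall>x. x \<bullet> x \<le> (1 / \<delta>) * (x \<bullet> (A *v x))"
proof -
  have pd: "A \<in> pd_mats" and o: "onorm ((*v) A) \<le> 1 / \<delta>" "onorm ((*v) (matrix_inv A)) \<le> 1 / \<delta>"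
    using A by (simp_all add: W_set_def)
  have le: "\<forall>x. x \<bullet> (B *v x) \<le> (1 / \<delta>) * (x \<bullet> x)" if "onorm ((*v) B) \<le> 1 / \<delta>" for B :: "real^'d^'d"
  proof
    fix x
    have "x \<bullet> (B *v x) \<le> norm x * norm (B *v x)" by (rule norm_cauchy_schwarz)
    also have "norm x * norm (B *v x) \<le> norm x * ((1 / \<delta>) * norm x)"
    proof (rule mult_left_mono[OF _ norm_ge_zero])
      show "norm (B *v x) \<le> (1 / \<delta>) * norm x"
      using onorm[OF matrix_vector_mul_bounded_linear, of B x] mult_right_mono[OF that, of "norm x"] by simp
    qed
    finally show "x \<bullet> (B *v x) \<le> (1 / \<delta>) * (x \<bullet> x)"
      by (simp add: power2_norm_eq_inner[symmetric] power2_eq_square mult_ac)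
  qed
  show "\<forall>x. x \<bullet> (A *v x) \<le> (1 / \<delta>) * (x \<bullet> x)" by (rule le[OF o(1)])
  have "matrix_inv (matrix_inv A) = A"
    by (rule matrix_inv_unique[OF matrix_inv_cancel(2)[OF pd_mats_invertible[OF pd]]])
  then show "\<forall>x. x \<bullet> x \<le> (1 / \<delta>) * (x \<bullet> (A *v x))"
    using inverse_form_lower[OF matrix_inv_pd_mats[OF pd] le[OF o(2)]] \<delta> by simp
qed

theorem proposition22:
  fixes \<delta> M :: real
  assumes "\<delta> > 0"
  shows
    "(\<forall>\<nu>. 2 \<le> CARD('d::finite) \<and> 0 < \<nu> \<longrightarrow>
        uniform_convergence_to_normal
          (sym_mats :: (real^'d^'d) set)
          (U_laws (\<nu> + real CARD('d)))
          (A_fun \<nu>)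
          {Q \<in> U_laws (\<nu> + real CARD('d)).
             A_fun \<nu> Q \<in> W_set \<delta> \<and>
             measure Q {y :: real^'d. norm y > M} \<le> (1 - \<delta>) / (\<nu> + real CARD('d))})
     \<and>
     (\<forall>\<nu>. 1 < \<nu> \<longrightarrow>
        uniform_convergence_to_normal
          (UNIV \<times> sym_mats :: ((real^'d) \<times> (real^'d^'d)) set)
          (V_laws (\<nu> + real CARD('d)))
          (mu_Sigma_fun \<nu>)
          {P \<in> V_laws (\<nu> + real CARD('d)).
             snd (mu_Sigma_fun \<nu> P) \<in> W_set \<delta> \<and>
             measure P {y :: real^'d. norm y > M} \<le> (1 - \<delta>) / (\<nu> + real CARD('d))})"
proof (intro conjI allI impI)
  fix \<nu> :: real assume "2 \<le> CARD('d) \<and> 0 < \<nu>"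
  then have nu: "\<nu> > 0" by simp
  let ?U = "U_laws (\<nu> + real CARD('d)) :: (real^'d) measure set"
  let ?C = "{Q \<in> ?U. A_fun \<nu> Q \<in> W_set \<delta> \<and> measure Q {y :: real^'d. norm y > M} \<le> (1 - \<delta>) / (\<nu> + real CARD('d))}"
  have U: "?U \<subseteq> laws" by (auto simp: U_laws_def)
  have \<kappa>: "0 \<le> 1 / \<delta>" using assms by simp
  obtain \<epsilon> K where \<epsilon>: "\<epsilon> > 0" and K: "K \<ge> 0" and exp: "\<forall>(Q :: (real^'d) measure) A. Q \<in> laws \<and> solves_scatter \<nu> Q A \<and>
     (\<forall>x. x \<bullet> (A *v x) \<le> (1 / \<delta>) * (x \<bullet> x) \<and> x \<bullet> x \<le> (1 / \<delta>) * (x \<bullet> (A *v x))) \<and>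
     measure Q {y. norm y > M} \<le> (1 - \<delta>) / (\<nu> + real CARD('d)) \<longrightarrow>
     (\<exists>(k :: real^'d \<Rightarrow> (real^'d^'d) \<times> (real^'d^'d^'d^'d)) l.
        local_expansion sym_mats (U_laws (\<nu> + real CARD('d))) (A_fun \<nu>) \<epsilon> K Q k l)"
    using scatter_local_expansion[OF nu assms \<kappa>, of M, where 'd = 'd] by blast
  show "uniform_convergence_to_normal sym_mats ?U (A_fun \<nu>) ?C"
  proof (rule uniform_convergence_to_normal_if_local_expansion[OF sym_mats_subspace U _ \<epsilon> K, where 'c = "(real^'d^'d) \<times> (real^'d^'d^'d^'d)"])
    show "?C \<subseteq> laws" using U by blast
    fix Q assume Q: "Q \<in> ?C"
    then have QU: "Q \<in> ?U" by blast
    obtain A :: "real^'d^'d" where A: "solves_scatter \<nu> Q A" using U_laws_imp_solves_scatter[OF QU nu] by blast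
    have QL: "Q \<in> laws" using QU U by blast
    have "A_fun \<nu> Q = A" by (rule solves_scatter_imp_A_fun[OF QL nu A])
    then have "A \<in> W_set \<delta>" using Q by blast
    note forms = W_set_forms[OF this assms]
    show "\<exists>(k :: real^'d \<Rightarrow> (real^'d^'d) \<times> (real^'d^'d^'d^'d)) l. local_expansion sym_mats ?U (A_fun \<nu>) \<epsilon> K Q k l"
      using exp QL A forms Q by blast
  next
    fix n and X :: "nat \<Rightarrow> real^'d" assume E: "empirical n X \<in> ?U"
    obtain A :: "real^'d^'d" where A: "solves_scatter \<nu> (empirical n X) A" using U_laws_imp_solves_scatter[OF E nu] by blast
    \<comment> \<open>An empirical measure satisfies the conditions of the expansion with an eigenvalue bound and a radius of its own.\<close>
    obtain c where c: "c \<ge> 1" "\<forall>x. x \<bullet> (A *v x) \<le> c * (x \<bullet> x) \<and> x \<bullet> x \<le> c * (x \<bullet> (A *v x))"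
      by (rule forms_equivalent[OF solves_scatter_pd[OF A]])
    have c0: "c \<ge> 0" using c by simp
    have "measure (empirical n X) {y. norm y > (\<Sum>j<n. norm (X j))} \<le> (1 - 1) / (\<nu> + real CARD('d))"
      by (simp add: empirical_no_tail)
    then show "\<exists>\<epsilon>>0. \<exists>K (k :: real^'d \<Rightarrow> (real^'d^'d) \<times> (real^'d^'d^'d^'d)) l.
        local_expansion sym_mats ?U (A_fun \<nu>) \<epsilon> K (empirical n X) k l"
      using scatter_local_expansion[OF nu zero_less_one c0, of "\<Sum>j<n. norm (X j)", where 'd = 'd] E U A c(2) by blast
  qed
next
  fix \<nu> :: real assume nu: "1 < \<nu>"
  then have nu': "\<nu> - 1 > 0" by simp
  let ?V = "V_laws (\<nu> + real CARD('d)) :: (real^'d) measure set"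
  let ?C = "{P \<in> ?V. snd (mu_Sigma_fun \<nu> P) \<in> W_set \<delta> \<and> measure P {y :: real^'d. norm y > M} \<le> (1 - \<delta>) / (\<nu> + real CARD('d))}"
  have V: "?V \<subseteq> laws" by (auto simp: V_laws_def)
  have S: "subspace (UNIV \<times> sym_mats :: ((real^'d) \<times> (real^'d^'d)) set)"
    by (intro subspace_Times subspace_UNIV sym_mats_subspace)
  have critical: "\<exists>A. solves_scatter (\<nu> - 1) (augmented_law P) A \<and> mu_Sigma_fun \<nu> P = loc_scatter_of A" if "P \<in> ?V" for P
  proof -
    have P: "P \<in> laws" using that V by blast
    have "augmented_law P \<in> U_laws (\<nu> - 1 + real CARD('d option))" using V_laws_augmented[OF P nu] that by blast
    then show ?thesis using U_laws_imp_solves_scatter[OF _ nu'] mu_Sigma_fun_eq[OF P nu] by metis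
  qed
  have \<kappa>: "0 \<le> 1 / \<delta>" "0 < 1 / \<delta>" using assms by simp_all
  define m where "m = max M 0 + sqrt ((1 / \<delta>) * ((\<nu> + real CARD('d)) * \<nu> / (\<nu> - 1)))"
  have m: "m \<ge> 0" using nu assms by (simp add: m_def)
  obtain \<epsilon> K where \<epsilon>: "\<epsilon> > 0" and K: "K \<ge> 0" and exp: "\<forall>(P :: (real^'d) measure) A. P \<in> laws \<and> solves_scatter (\<nu> - 1) (augmented_law P) A \<and>
     norm (fst (loc_scatter_of A)) \<le> m \<and>
     (\<forall>x. x \<bullet> (snd (loc_scatter_of A) *v x) \<le> (1 / \<delta>) * (x \<bullet> x) \<and> x \<bullet> x \<le> (1 / \<delta>) * (x \<bullet> (snd (loc_scatter_of A) *v x))) \<and>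
     measure P {y. norm y > M} \<le> (1 - \<delta>) / (\<nu> + real CARD('d)) \<longrightarrow>
     (\<exists>(k :: real^'d \<Rightarrow> ((real^'d option^'d option) \<times> (real^'d option^'d option^'d option^'d option)) \<times> (real^'d option^'d option)) l.
        local_expansion (UNIV \<times> sym_mats) (V_laws (\<nu> + real CARD('d))) (mu_Sigma_fun \<nu>) \<epsilon> K P k l)"
    using location_scatter_local_expansion[OF nu assms \<kappa>(1) m, of M, where 'd = 'd] by blast
  show "uniform_convergence_to_normal (UNIV \<times> sym_mats) ?V (mu_Sigma_fun \<nu>) ?C"
  proof (rule uniform_convergence_to_normal_if_local_expansion[OF S V _ \<epsilon> K,
      where 'c = "((real^'d option^'d option) \<times> (real^'d option^'d option^'d option^'d option)) \<times> (real^'d option^'d option)"])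
    show "?C \<subseteq> laws" using V by blast
    fix P assume P: "P \<in> ?C"
    then have PV: "P \<in> ?V" and tail: "measure P {y. norm y > M} \<le> (1 - \<delta>) / (\<nu> + real CARD('d))" by blast+
    have PL: "P \<in> laws" using PV V by blast
    obtain A where A: "solves_scatter (\<nu> - 1) (augmented_law P) A" "mu_Sigma_fun \<nu> P = loc_scatter_of A"
      using critical[OF PV] by blast
    have "snd (loc_scatter_of A) \<in> W_set \<delta>" using P A(2) by simp
    note forms = W_set_forms[OF this assms]
    have "measure P {y. norm y > M} \<le> 1 / (\<nu> + real CARD('d))"
      using tail assms nu by (elim order_trans) (simp add: divide_right_mono)
    then have mu: "norm (fst (loc_scatter_of A)) \<le> m"
      unfolding m_def by (rule location_bound[OF PL nu A(1) surjective_pairing forms(1) \<kappa>(2)])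
    show "\<exists>(k :: real^'d \<Rightarrow> ((real^'d option^'d option) \<times> (real^'d option^'d option^'d option^'d option)) \<times> (real^'d option^'d option)) l.
        local_expansion (UNIV \<times> sym_mats) ?V (mu_Sigma_fun \<nu>) \<epsilon> K P k l"
      using exp PL A(1) mu forms tail by blast
  next
    fix n and X :: "nat \<Rightarrow> real^'d" assume E: "empirical n X \<in> ?V"
    have EL: "empirical n X \<in> laws" using E V by blast
    obtain A where A: "solves_scatter (\<nu> - 1) (augmented_law (empirical n X)) A" using critical[OF E] by blast
    have "snd (loc_scatter_of A) \<in> pd_mats"
      by (rule augmented_scatter_moment_mat(2)[OF EL nu' A surjective_pairing])
    then obtain c where c: "c \<ge> 1" "\<forall>x. x \<bullet> (snd (loc_scatter_of A) *v x) \<le> c * (x \<bullet> x) \<and> x \<bullet> x \<le> c * (x \<bullet> (snd (loc_scatter_of A) *v x))"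
      by (rule forms_equivalent)
    have c0: "c \<ge> 0" using c by simp
    have "measure (empirical n X) {y. norm y > (\<Sum>j<n. norm (X j))} \<le> (1 - 1) / (\<nu> + real CARD('d))"
      by (simp add: empirical_no_tail)
    then show "\<exists>\<epsilon>>0. \<exists>K (k :: real^'d \<Rightarrow> ((real^'d option^'d option) \<times> (real^'d option^'d option^'d option^'d option)) \<times> (real^'d option^'d option)) l.
        local_expansion (UNIV \<times> sym_mats) ?V (mu_Sigma_fun \<nu>) \<epsilon> K (empirical n X) k l"
      using location_scatter_local_expansion[OF nu zero_less_one c0 norm_ge_zero, of "fst (loc_scatter_of A)" "\<Sum>j<n. norm (X j)"]
        EL A c(2) by blast
  qed
qed

end
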